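(* Assume [LJ1]–[LJ4], let $\ell>\gamma$ and $u_0^{(1)},u_1^{(1)}>0$. Let $k_n=(k_n^1,k_n^2)$ satisfy (K). Let $\mathcal T=(\mathcal T_n)$, $\mathcal T_n=\{t_n^0,\dots,t_n^{r_n}\}$, be sets of representative atoms such that (T) there exists $(p_n)\subset\mathbb N$ with $\lambda_np_n\to0$ and $\max_i(t_n^{i+1}-t_n^i)\le p_n$; $\{0,\dots,k_n^1\}\cup\{k_n^2,\dots,n\}\subset\mathcal T_n$ for all $n$; and the quantities $b(x,\mathcal T)$ ($x\in[0,1]$), $\hat r(\mathcal T)$, $\hat l(\mathcal T)$ exist in $\mathbb N\cup\{+\infty\}$. Then $\hat H_{1,n}^{\ell,k_n,\mathcal T_n}$ $\Gamma$-converges with respect to the $L^1(0,1)$-topology to the functional $\hat H_1^{\ell,\mathcal T}$ defined by $$\begin{aligned}\hat H_1^{\ell,\mathcal T}(u)=&\,B(u_0^{(1)},\gamma)\big(1-\#(S_u\cap\{0\})\big)+B(u_1^{(1)},\gamma)\big(1-\#(S_u\cap\{1\})\big)\\&+B_{IFJ}\big(\hat r(\mathcal T),b(0,\mathcal T),u_0^{(1)}\big)\#(S_u\cap\{0\})+B_{IFJ}\big(\hat l(\mathcal T),b(1,\mathcal T),u_1^{(1)}\big)\#(S_u\cap\{1\})\\&-\sum_{x\in S_u\cap(0,1)}b(x,\mathcal T)J_0(\gamma)-J_0(\gamma)\end{aligned}$$ if $u\in SBV_c^\ell(0,1)$, and $\hat H_1^{\ell,\mathcal T}(u)=+\infty$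 otherwise on $L^1(0,1)$.
   Context: Potentials: $J_1,J_2:\mathbb R\to(-\infty,+\infty]$; $J_{CB}:=J_1+J_2$; $J_0(z):=J_2(z)+\frac12\inf\{J_1(z_1)+J_1(z_2):z_1+z_2=2z\}$; $J_0^{**}$ is the convex lower semicontinuous envelope of $J_0$. Hypotheses: [LJ1] $\{z:J_0(z)=J_0^{**}(z)\}\cap\{z:J_0\text{ is affine in a neighbourhood of }z\}=\emptyset$. [LJ2] for every $z$ with $J_0(z)=J_0^{**}(z)$, the set $\{(z_1,z_2):z_1+z_2=2z,\ J_0(z)=J_2(z)+\frac12(J_1(z_1)+J_1(z_2))\}$ has exactly one element. [LJ3] $J_1,J_2$ are $C^{1,\alpha}$ on their domains for some $0<\alpha\le1$, $J_0$ is $C^1$ on its domain, $\operatorname{dom}J_1=\operatorname{dom}J_2\supset(0,+\infty)$, $\lim_{z\to+\infty}J_j(z)=0$ ($j=1,2$) and $\lim_{z\to+\infty}J_0(z)=:J_0(+\infty)\in\mathbb R$. [LJ4] there is a convex $\Psi:\mathbb R\to[0,+\infty]$ with $\lim_{z\to-\infty}\Psi(z)/|z|=+\infty$ and constants $c_1,c_2>0$ with $c_1(\Psi(z)-1)\le J_j(z)\le c_2\max\{\Psi(z),|z|\}$ for all $z\in\mathbb R$, $j=1,2$; there are $\delta_1,\delta_2,\gamma>0$ with $\{\delta_j\}=\operatorname{argmin}J_j$ and $\{\gamma\}=\operatorname{argmin}J_0$; $J_j$ is strictly convex on $(-\infty,\delta_j)\cap\operatorname{dom}J_j$; $J_0(\gamma)<J_0(+\infty)$;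 and $J_0(z)=J_0^{**}(z)$ for all $z\le\gamma$. Discrete setting: $\lambda_n=1/n$; $\mathcal A_n(0,1)$ is the set of continuous $u:[0,1]\to\mathbb R$ affine on each $(i\lambda_n,(i+1)\lambda_n)$, $i=0,\dots,n-1$; $u^i:=u(i\lambda_n)$. Boundary conditions (BC): $u^0=0$, $u^1=\lambda_nu_0^{(1)}$, $u^{n-1}=\ell-\lambda_nu_1^{(1)}$, $u^n=\ell$. Quasicontinuum energy: for integers $0<k_n^1<k_n^2<n-2$ and $u\in\mathcal A_n(0,1)$ satisfying (BC), $\hat H_n^{\ell,k_n}(u)=\sum_{i=0}^{n-1}\lambda_nJ_1(\frac{u^{i+1}-u^i}{\lambda_n})+\sum_{i=0}^{k_n^1-1}\lambda_nJ_2(\frac{u^{i+2}-u^i}{2\lambda_n})+\sum_{i=k_n^1}^{k_n^2-2}\frac{\lambda_n}{2}\{J_2(\frac{u^{i+1}-u^i}{\lambda_n})+J_2(\frac{u^{i+2}-u^{i+1}}{\lambda_n})\}+\sum_{i=k_n^2-1}^{n-2}\lambda_nJ_2(\frac{u^{i+2}-u^i}{2\lambda_n})$, and $+\infty$ otherwise. For $\mathcal T_n=\{t_n^0<\dots<t_n^{r_n}\}\subset\{0,\dots,n\}$ with $t_n^0=0,t_n^{r_n}=n$, $\mathcal A_{\mathcal T_n}(0,1)$ is the set of $u$ affine on each $(t_n^i\lambda_n,t_n^{i+1}\lambda_n)$, and $\hat H_n^{\ell,k_n,\mathcal T_n}(u)=\hat H_n^{\ell,k_n}(u)$ if $u\in\mathcal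 A_{\mathcal T_n}(0,1)$, $+\infty$ otherwise. Assumption (K): $k_n^1\to\infty$, $n-k_n^2\to\infty$, $\lambda_nk_n^1\to0$, $\lambda_n(n-k_n^2)\to0$. First order energy: $\hat H_{1,n}^{\ell,k_n,\mathcal T_n}(u):=\big(\hat H_n^{\ell,k_n,\mathcal T_n}(u)-J_0^{**}(\ell)\big)/\lambda_n$. Function spaces: $SBV^\ell(0,1)$ is the set of special functions of bounded variation with $u(0-)=0$, $u(1+)=\ell$ (jumps at $0,1$ allowed); $S_u\subset[0,1]$ the jump set, $[u](t)=u(t+)-u(t-)$. For $\ell>\gamma$, $SBV_c^\ell(0,1)$ is the set of $u\in SBV^\ell(0,1)$ with $0<\#S_u<\infty$, $[u]>0$ on $S_u$ and $u'=\gamma$ a.e. Repatom quantities: for $x\in[0,1]$, $b(x,\mathcal T):=\lim_{n\to\infty}\min\{q_n^2-q_n^1\}$, the minimum taken over pairs of integer sequences $(q_n^1),(q_n^2)$ with $k_n^1<q_n^1<q_n^2<k_n^2$, $q_n^1,q_n^2\in\mathcal T_n$ and $\lambda_nq_n^1\to x$, $\lambda_nq_n^2\to x$ (i.e. the minimal asymptotic distance between two representative atoms of the continuum region converging to $x$). $\hat r(\mathcal T):=\lim_n(r(\mathcal T_n)-k_n^1)$ with $r(\mathcal T_n)=\min\{r\in\mathcal T_n:r>k_n^1\}$; $\hat l(\mathcal T):=\lim_n(k_n^2-l(\mathcal T_n))$ with $l(\mathcal T_n)=\max\{l\in\mathcal T_n:l<k_n^2\}$. Boundary layer energies (with $\mathbb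 N=\{0,1,2,\dots\}$): for $\theta>0$, $B(\theta,\gamma):=\inf_{N\in\mathbb N}\min\{\frac12J_1(v^1-v^0)+\sum_{i\ge0}[J_2(\frac{v^{i+2}-v^i}{2})+\frac12J_1(v^{i+2}-v^{i+1})+\frac12J_1(v^{i+1}-v^i)-J_0(\gamma)]:v:\mathbb N\to\mathbb R,\ v^0=0,\ v^1=\theta,\ v^{i+1}-v^i=\gamma\ \forall i\ge N\}$; $B_b(\theta):=\inf_{k\in\mathbb N}\min\{\frac12J_1(v^1-v^0)+\sum_{i=0}^{k-1}[J_2(\frac{v^{i+2}-v^i}{2})+\frac12J_1(v^{i+2}-v^{i+1})+\frac12J_1(v^{i+1}-v^i)-J_0(\gamma)]:v^{k+1}=0,\ v^{k+1}-v^k=\theta\}$; $B(\gamma):=\inf_{N\in\mathbb N}\min\{\frac12J_1(v^1-v^0)+\sum_{i\ge0}[J_2(\frac{v^{i+2}-v^i}{2})+\frac12J_1(v^{i+2}-v^{i+1})+\frac12J_1(v^{i+1}-v^i)-J_0(\gamma)]:v:\mathbb N\to\mathbb R,\ v^0=0,\ v^{i+1}-v^i=\gamma\ \forall i\ge N\}$; for $m\in\mathbb N$, $B_{IF}(m):=\inf_{k\in\mathbb N}\min\{\frac12J_1(v^1-v^0)+\sum_{i=0}^{k-1}[J_2(\frac{v^{i+2}-v^i}{2})+\frac12J_1(v^{i+2}-v^{i+1})+\frac12J_1(v^{i+1}-v^i)-J_0(\gamma)]+\frac{2m+1}{2}(J_{CB}(v^{k+1}-v^k)-J_0(\gamma)):v:\mathbb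 N\to\mathbb R,\ v^0=0\}$, and $B_{IF}(+\infty):=B(\gamma)$; $B_{BJ}(\theta):=\frac12J_1(\theta)+B_b(\theta)+B(\gamma)-2J_0(\gamma)$; $B_{IJ}:=2B(\gamma)-2J_0(\gamma)$; for $n\in\{1,2,\dots\}\cup\{+\infty\}$, $B_{AIF}(n):=B_{IF}(n-1)+B(\gamma)-2J_0(\gamma)$ (with $+\infty-1=+\infty$); for $n,k\in\{1,2,\dots\}\cup\{+\infty\}$, $\tilde B_{IFJ}(n,k):=\min\{B_{AIF}(n),\,B(\gamma)-(\frac12+n)J_0(\gamma),\,-kJ_0(\gamma)\}$ and $B_{IFJ}(n,k,\theta):=\min\{\tilde B_{IFJ}(n,k)+B(\theta,\gamma),\,B_{BJ}(\theta)\}$. *)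

theory Defs
  imports "HOL-Analysis.Analysis"
begin

section \<open>Potentials\<close>

text \<open>Potentials are extended-real valued functions (values in (-infinity,+infinity]).\<close>

definition dom_pot :: "(real \<Rightarrow> ereal) \<Rightarrow> real set" where
  "dom_pot J = {z. J z < \<infinity>}"

definition J_CB :: "(real \<Rightarrow> ereal) \<Rightarrow> (real \<Rightarrow> ereal) \<Rightarrow> real \<Rightarrow> ereal" where
  "J_CB J1 J2 z = J1 z + J2 z"

definition J0 :: "(real \<Rightarrow> ereal) \<Rightarrow> (real \<Rightarrow> ereal) \<Rightarrow> real \<Rightarrow> ereal" where
  "J0 J1 J2 z = J2 z + ereal (1/2) * Inf {J1 z1 + J1 z2 | z1 z2. z1 + z2 = 2 * z}"

text \<open>Legendre--Fenchel conjugate and biconjugate (the convex lsc envelope f^{**}).\<close>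

definition conj_fun :: "(real \<Rightarrow> ereal) \<Rightarrow> real \<Rightarrow> ereal" where
  "conj_fun f p = Sup {ereal (p * z) - f z | z. True}"

definition biconj :: "(real \<Rightarrow> ereal) \<Rightarrow> real \<Rightarrow> ereal" where
  "biconj f z = Sup {ereal (p * z) - conj_fun f p | p. True}"

definition affine_near :: "(real \<Rightarrow> ereal) \<Rightarrow> real \<Rightarrow> bool" where
  "affine_near f z \<longleftrightarrow> (\<exists>e>0. \<exists>a c. \<forall>y. \<bar>y - z\<bar> < e \<longrightarrow> f y = ereal (a * y + c))"

text \<open>C^{1,alpha} on the domain: differentiable (relative to the domain) with a derivative
  that is alpha-Hoelder continuous on every compact subset of the domain.\<close>

definition C1alpha_on_dom :: "(real \<Rightarrow> ereal) \<Rightarrow> real \<Rightarrow> bool" where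
  "C1alpha_on_dom J \<alpha> \<longleftrightarrow> (\<exists>D. (\<forall>x\<in>dom_pot J.
        ((\<lambda>z. real_of_ereal (J z)) has_real_derivative D x) (at x within dom_pot J)) \<and>
      (\<forall>K. compact K \<and> K \<subseteq> dom_pot J \<longrightarrow>
        (\<exists>C. \<forall>x\<in>K. \<forall>y\<in>K. \<bar>D x - D y\<bar> \<le> C * \<bar>x - y\<bar> powr \<alpha>)))"

definition C1_on_dom :: "(real \<Rightarrow> ereal) \<Rightarrow> bool" where
  "C1_on_dom J \<longleftrightarrow> (\<exists>D. (\<forall>x\<in>dom_pot J.
        ((\<lambda>z. real_of_ereal (J z)) has_real_derivative D x) (at x within dom_pot J)) \<and>
      continuous_on (dom_pot J) D)"

definition convex_ereal_fun :: "(real \<Rightarrow> ereal) \<Rightarrow> bool" where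
  "convex_ereal_fun g \<longleftrightarrow> (\<forall>x y t. 0 \<le> t \<and> t \<le> 1 \<longrightarrow>
      g ((1 - t) * x + t * y) \<le> ereal (1 - t) * g x + ereal t * g y)"

definition strictly_convex_on_pot :: "real set \<Rightarrow> (real \<Rightarrow> ereal) \<Rightarrow> bool" where
  "strictly_convex_on_pot A g \<longleftrightarrow> (\<forall>x\<in>A. \<forall>y\<in>A. \<forall>t. x \<noteq> y \<and> 0 < t \<and> t < 1 \<longrightarrow>
      g ((1 - t) * x + t * y) < ereal (1 - t) * g x + ereal t * g y)"

section \<open>Hypotheses [LJ1]--[LJ4]\<close>

definition LJ1 :: "(real \<Rightarrow> ereal) \<Rightarrow> (real \<Rightarrow> ereal) \<Rightarrow> bool" where
  "LJ1 J1 J2 \<longleftrightarrow> {z. J0 J1 J2 z = biconj (J0 J1 J2) z} \<inter> {z. affine_near (J0 J1 J2) z} = {}"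

definition LJ2 :: "(real \<Rightarrow> ereal) \<Rightarrow> (real \<Rightarrow> ereal) \<Rightarrow> bool" where
  "LJ2 J1 J2 \<longleftrightarrow> (\<forall>z. J0 J1 J2 z = biconj (J0 J1 J2) z \<and> J0 J1 J2 z < \<infinity> \<longrightarrow>
      card {(z1, z2). z1 + z2 = 2 * z \<and>
        J0 J1 J2 z = J2 z + ereal (1/2) * (J1 z1 + J1 z2)} = 1)"

definition LJ3 :: "(real \<Rightarrow> ereal) \<Rightarrow> (real \<Rightarrow> ereal) \<Rightarrow> real \<Rightarrow> real \<Rightarrow> bool" where
  "LJ3 J1 J2 \<alpha> J0inf \<longleftrightarrow> 0 < \<alpha> \<and> \<alpha> \<le> 1 \<and>
     C1alpha_on_dom J1 \<alpha> \<and> C1alpha_on_dom J2 \<alpha> \<and> C1_on_dom (J0 J1 J2) \<and>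
     dom_pot J1 = dom_pot J2 \<and> {0<..} \<subseteq> dom_pot J1 \<and>
     (J1 \<longlongrightarrow> 0) at_top \<and> (J2 \<longlongrightarrow> 0) at_top \<and>
     (J0 J1 J2 \<longlongrightarrow> ereal J0inf) at_top"

definition LJ4 :: "(real \<Rightarrow> ereal) \<Rightarrow> (real \<Rightarrow> ereal) \<Rightarrow> real \<Rightarrow> real \<Rightarrow> bool" where
  "LJ4 J1 J2 \<gamma> J0inf \<longleftrightarrow>
     (\<exists>\<Psi> :: real \<Rightarrow> ereal. convex_ereal_fun \<Psi> \<and> (\<forall>z. 0 \<le> \<Psi> z) \<and>
        ((\<lambda>z. \<Psi> z / ereal \<bar>z\<bar>) \<longlongrightarrow> \<infinity>) at_bot \<and>
        (\<exists>c1 c2. c1 > 0 \<and> c2 > 0 \<and> (\<forall>z. \<forall>J \<in> {J1, J2}.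
            ereal c1 * (\<Psi> z - 1) \<le> J z \<and> J z \<le> ereal c2 * max (\<Psi> z) (ereal \<bar>z\<bar>)))) \<and>
     (\<exists>\<delta>1 \<delta>2. \<delta>1 > 0 \<and> \<delta>2 > 0 \<and>
        {z. \<forall>y. J1 z \<le> J1 y} = {\<delta>1} \<and> {z. \<forall>y. J2 z \<le> J2 y} = {\<delta>2} \<and>
        strictly_convex_on_pot ({..<\<delta>1} \<inter> dom_pot J1) J1 \<and>
        strictly_convex_on_pot ({..<\<delta>2} \<inter> dom_pot J2) J2) \<and>
     \<gamma> > 0 \<and> {z. \<forall>y. J0 J1 J2 z \<le> J0 J1 J2 y} = {\<gamma>} \<and>
     J0 J1 J2 \<gamma> < ereal J0inf \<and>
     (\<forall>z\<le>\<gamma>. J0 J1 J2 z = biconj (J0 J1 J2) z)"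

section \<open>Discrete quasicontinuum energies\<close>

definition consecutive :: "nat set \<Rightarrow> nat \<Rightarrow> nat \<Rightarrow> bool" where
  "consecutive T a b \<longleftrightarrow> a \<in> T \<and> b \<in> T \<and> a < b \<and> (\<forall>c\<in>T. \<not> (a < c \<and> c < b))"

text \<open>Membership in A_{T_n}(0,1): continuous on [0,1], affine on each (t^i/n, t^{i+1}/n).\<close>

definition in_A_T :: "nat \<Rightarrow> nat set \<Rightarrow> (real \<Rightarrow> real) \<Rightarrow> bool" where
  "in_A_T n T u \<longleftrightarrow> continuous_on {0..1} u \<and>
     (\<forall>a b. consecutive T a b \<longrightarrow>
        (\<exists>p q. \<forall>x\<in>{real a / real n<..<real b / real n}. u x = p * x + q))"

definition BC :: "nat \<Rightarrow> real \<Rightarrow> real \<Rightarrow> real \<Rightarrow> (real \<Rightarrow> real) \<Rightarrow> bool" where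
  "BC n l u0 u1 u \<longleftrightarrow> u 0 = 0 \<and> u (1 / real n) = u0 / real n \<and>
     u ((real n - 1) / real n) = l - u1 / real n \<and> u 1 = l"

text \<open>The quasicontinuum energy expressed through the nodal values w i = u(i lambda_n).\<close>

definition qc_energy :: "(real \<Rightarrow> ereal) \<Rightarrow> (real \<Rightarrow> ereal) \<Rightarrow> nat \<Rightarrow> nat \<Rightarrow> nat \<Rightarrow> (nat \<Rightarrow> real) \<Rightarrow> ereal" where
  "qc_energy J1 J2 n k1 k2 w = (let lam = 1 / real n in
      (\<Sum>i<n. ereal lam * J1 ((w (i+1) - w i) / lam))
    + (\<Sum>i<k1. ereal lam * J2 ((w (i+2) - w i) / (2 * lam)))
    + (\<Sum>i\<in>{k1..k2-2}. ereal (lam / 2) *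
          (J2 ((w (i+1) - w i) / lam) + J2 ((w (i+2) - w (i+1)) / lam)))
    + (\<Sum>i\<in>{k2-1..n-2}. ereal lam * J2 ((w (i+2) - w i) / (2 * lam))))"

text \<open>First order energy as a functional on L^1(0,1) (i.e. invariant under a.e. modification):
  its value at u is the energy of the (unique) admissible continuous representative of u,
  and +infinity if there is none.\<close>

definition H1n :: "(real \<Rightarrow> ereal) \<Rightarrow> (real \<Rightarrow> ereal) \<Rightarrow> real \<Rightarrow> real \<Rightarrow> real \<Rightarrow>
    nat \<Rightarrow> nat \<Rightarrow> nat \<Rightarrow> nat set \<Rightarrow> (real \<Rightarrow> real) \<Rightarrow> ereal" where
  "H1n J1 J2 l u0 u1 n k1 k2 T u = Inf {ereal (real n) *
        (qc_energy J1 J2 n k1 k2 (\<lambda>i. v (real i / real n)) - biconj (J0 J1 J2) l) | v.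
      in_A_T n T v \<and> BC n l u0 u1 v \<and> (AE x in lborel. x \<in> {0..1} \<longrightarrow> u x = v x)}"

section \<open>Gamma-convergence in L^1(0,1)\<close>

definition L1_conv :: "(nat \<Rightarrow> real \<Rightarrow> real) \<Rightarrow> (real \<Rightarrow> real) \<Rightarrow> bool" where
  "L1_conv us u \<longleftrightarrow> (\<forall>n. us n absolutely_integrable_on {0..1}) \<and> u absolutely_integrable_on {0..1} \<and>
     ((\<lambda>n. integral {0..1} (\<lambda>x. \<bar>us n x - u x\<bar>)) \<longlonglongrightarrow> 0)"

definition Gamma_conv_L1 :: "(nat \<Rightarrow> (real \<Rightarrow> real) \<Rightarrow> ereal) \<Rightarrow> ((real \<Rightarrow> real) \<Rightarrow> ereal) \<Rightarrow> bool" where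
  "Gamma_conv_L1 F G \<longleftrightarrow> (\<forall>u. u absolutely_integrable_on {0..1} \<longrightarrow>
      (\<forall>us. L1_conv us u \<longrightarrow> G u \<le> liminf (\<lambda>n. F n (us n))) \<and>
      (\<exists>us. L1_conv us u \<and> limsup (\<lambda>n. F n (us n)) \<le> G u))"

section \<open>Boundary layer energies\<close>

definition bl_term :: "(real \<Rightarrow> ereal) \<Rightarrow> (real \<Rightarrow> ereal) \<Rightarrow> real \<Rightarrow> (nat \<Rightarrow> real) \<Rightarrow> nat \<Rightarrow> ereal" where
  "bl_term J1 J2 \<gamma> v i = J2 ((v (i+2) - v i) / 2) + ereal (1/2) * J1 (v (i+2) - v (i+1))
      + ereal (1/2) * J1 (v (i+1) - v i) - J0 J1 J2 \<gamma>"

text \<open>The infinite sum over i >= 0, as the limit of the partial sums.\<close>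

definition bl_series :: "(real \<Rightarrow> ereal) \<Rightarrow> (real \<Rightarrow> ereal) \<Rightarrow> real \<Rightarrow> (nat \<Rightarrow> real) \<Rightarrow> ereal" where
  "bl_series J1 J2 \<gamma> v = lim (\<lambda>M. \<Sum>i<M. bl_term J1 J2 \<gamma> v i)"

definition B_theta :: "(real \<Rightarrow> ereal) \<Rightarrow> (real \<Rightarrow> ereal) \<Rightarrow> real \<Rightarrow> real \<Rightarrow> ereal" where
  "B_theta J1 J2 \<gamma> \<theta> = Inf {ereal (1/2) * J1 (v 1 - v 0) + bl_series J1 J2 \<gamma> v | v N.
      v 0 = 0 \<and> v 1 = \<theta> \<and> (\<forall>i\<ge>N. v (i+1) - v i = \<gamma>)}"

definition B_b :: "(real \<Rightarrow> ereal) \<Rightarrow> (real \<Rightarrow> ereal) \<Rightarrow> real \<Rightarrow> real \<Rightarrow> ereal" where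
  "B_b J1 J2 \<gamma> \<theta> = Inf {ereal (1/2) * J1 (v 1 - v 0) + (\<Sum>i<k. bl_term J1 J2 \<gamma> v i) | v k.
      v (k+1) = 0 \<and> v (k+1) - v k = \<theta>}"

definition B_gamma :: "(real \<Rightarrow> ereal) \<Rightarrow> (real \<Rightarrow> ereal) \<Rightarrow> real \<Rightarrow> ereal" where
  "B_gamma J1 J2 \<gamma> = Inf {ereal (1/2) * J1 (v 1 - v 0) + bl_series J1 J2 \<gamma> v | v N.
      v 0 = 0 \<and> (\<forall>i\<ge>N. v (i+1) - v i = \<gamma>)}"

definition B_IF_nat :: "(real \<Rightarrow> ereal) \<Rightarrow> (real \<Rightarrow> ereal) \<Rightarrow> real \<Rightarrow> nat \<Rightarrow> ereal" where
  "B_IF_nat J1 J2 \<gamma> m = Inf {ereal (1/2) * J1 (v 1 - v 0) + (\<Sum>i<k. bl_term J1 J2 \<gamma> v i)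
       + ereal ((2 * real m + 1) / 2) * (J_CB J1 J2 (v (k+1) - v k) - J0 J1 J2 \<gamma>) | v k.
      v 0 = 0}"

definition B_IF :: "(real \<Rightarrow> ereal) \<Rightarrow> (real \<Rightarrow> ereal) \<Rightarrow> real \<Rightarrow> enat \<Rightarrow> ereal" where
  "B_IF J1 J2 \<gamma> m = (case m of enat k \<Rightarrow> B_IF_nat J1 J2 \<gamma> k | \<infinity> \<Rightarrow> B_gamma J1 J2 \<gamma>)"

definition B_BJ :: "(real \<Rightarrow> ereal) \<Rightarrow> (real \<Rightarrow> ereal) \<Rightarrow> real \<Rightarrow> real \<Rightarrow> ereal" where
  "B_BJ J1 J2 \<gamma> \<theta> = ereal (1/2) * J1 \<theta> + B_b J1 J2 \<gamma> \<theta> + B_gamma J1 J2 \<gamma>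
      - ereal 2 * J0 J1 J2 \<gamma>"

definition B_AIF :: "(real \<Rightarrow> ereal) \<Rightarrow> (real \<Rightarrow> ereal) \<Rightarrow> real \<Rightarrow> enat \<Rightarrow> ereal" where
  "B_AIF J1 J2 \<gamma> n = B_IF J1 J2 \<gamma> (n - 1) + B_gamma J1 J2 \<gamma> - ereal 2 * J0 J1 J2 \<gamma>"

definition B_IFJ_tilde :: "(real \<Rightarrow> ereal) \<Rightarrow> (real \<Rightarrow> ereal) \<Rightarrow> real \<Rightarrow> enat \<Rightarrow> enat \<Rightarrow> ereal" where
  "B_IFJ_tilde J1 J2 \<gamma> n k = min (B_AIF J1 J2 \<gamma> n)
      (min (B_gamma J1 J2 \<gamma> - (ereal (1/2) + ereal_of_enat n) * J0 J1 J2 \<gamma>)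
           (- (ereal_of_enat k * J0 J1 J2 \<gamma>)))"

definition B_IFJ :: "(real \<Rightarrow> ereal) \<Rightarrow> (real \<Rightarrow> ereal) \<Rightarrow> real \<Rightarrow> enat \<Rightarrow> enat \<Rightarrow> real \<Rightarrow> ereal" where
  "B_IFJ J1 J2 \<gamma> n k \<theta> = min (B_IFJ_tilde J1 J2 \<gamma> n k + B_theta J1 J2 \<gamma> \<theta>) (B_BJ J1 J2 \<gamma> \<theta>)"

section \<open>Repatom quantities\<close>

text \<open>Admissible pairs of sequences of representative atoms of the continuum region
  converging to x (conditions required for all sufficiently large n).\<close>

definition adm_pair :: "(nat \<Rightarrow> nat) \<Rightarrow> (nat \<Rightarrow> nat) \<Rightarrow> (nat \<Rightarrow> nat set) \<Rightarrow> real \<Rightarrow>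
    (nat \<Rightarrow> nat) \<Rightarrow> (nat \<Rightarrow> nat) \<Rightarrow> bool" where
  "adm_pair k1 k2 T x q1 q2 \<longleftrightarrow>
     (\<forall>\<^sub>F n in sequentially. k1 n < q1 n \<and> q1 n < q2 n \<and> q2 n < k2 n \<and> q1 n \<in> T n \<and> q2 n \<in> T n) \<and>
     ((\<lambda>n. real (q1 n) / real n) \<longlonglongrightarrow> x) \<and> ((\<lambda>n. real (q2 n) / real n) \<longlonglongrightarrow> x)"

text \<open>b(x,T) exists and equals b: b is the minimum over admissible pairs of the limit of
  q2 - q1 (every admissible pair has asymptotic distance at least b, and b is attained as a limit).\<close>

definition is_b :: "(nat \<Rightarrow> nat) \<Rightarrow> (nat \<Rightarrow> nat) \<Rightarrow> (nat \<Rightarrow> nat set) \<Rightarrow> real \<Rightarrow> enat \<Rightarrow> bool" where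
  "is_b k1 k2 T x b \<longleftrightarrow>
     (\<forall>q1 q2. adm_pair k1 k2 T x q1 q2 \<longrightarrow>
        ereal_of_enat b \<le> liminf (\<lambda>n. ereal (real (q2 n - q1 n)))) \<and>
     (\<exists>q1 q2. adm_pair k1 k2 T x q1 q2 \<and>
        ((\<lambda>n. ereal (real (q2 n - q1 n))) \<longlonglongrightarrow> ereal_of_enat b))"

definition r_T :: "nat set \<Rightarrow> nat \<Rightarrow> nat" where
  "r_T Tn k1 = Min {r \<in> Tn. r > k1}"

definition l_T :: "nat set \<Rightarrow> nat \<Rightarrow> nat" where
  "l_T Tn k2 = Max {l \<in> Tn. l < k2}"

section \<open>The limit functional\<close>

text \<open>SBV_c^l(0,1) (with u(0-)=0, u(1+)=l): finitely many (nonempty) positive jumps in [0,1],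
  absolutely continuous part of slope gamma. The canonical representative on (0,1) is
  t \<mapsto> gamma t + sum of the jumps located in [0,t).\<close>

definition sbvc_fun :: "real \<Rightarrow> real set \<Rightarrow> (real \<Rightarrow> real) \<Rightarrow> real \<Rightarrow> real" where
  "sbvc_fun \<gamma> S a t = \<gamma> * t + (\<Sum>s\<in>{s\<in>S. s < t}. a s)"

definition sbvc_rep :: "real \<Rightarrow> real \<Rightarrow> real set \<Rightarrow> (real \<Rightarrow> real) \<Rightarrow> bool" where
  "sbvc_rep l \<gamma> S a \<longleftrightarrow> finite S \<and> S \<noteq> {} \<and> S \<subseteq> {0..1} \<and> (\<forall>s\<in>S. a s > 0) \<and>
     \<gamma> + (\<Sum>s\<in>S. a s) = l"

definition H1_value :: "(real \<Rightarrow> ereal) \<Rightarrow> (real \<Rightarrow> ereal) \<Rightarrow> real \<Rightarrow> real \<Rightarrow> real \<Rightarrow>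
    (real \<Rightarrow> enat) \<Rightarrow> enat \<Rightarrow> enat \<Rightarrow> real set \<Rightarrow> ereal" where
  "H1_value J1 J2 \<gamma> u0 u1 b rhat lhat S =
       (if 0 \<in> S then B_IFJ J1 J2 \<gamma> rhat (b 0) u0 else B_theta J1 J2 \<gamma> u0)
     + (if 1 \<in> S then B_IFJ J1 J2 \<gamma> lhat (b 1) u1 else B_theta J1 J2 \<gamma> u1)
     - (\<Sum>x\<in>S \<inter> {0<..<1}. ereal_of_enat (b x) * J0 J1 J2 \<gamma>)
     - J0 J1 J2 \<gamma>"

definition H1_lim :: "(real \<Rightarrow> ereal) \<Rightarrow> (real \<Rightarrow> ereal) \<Rightarrow> real \<Rightarrow> real \<Rightarrow> real \<Rightarrow> real \<Rightarrow>
    (real \<Rightarrow> enat) \<Rightarrow> enat \<Rightarrow> enat \<Rightarrow> (real \<Rightarrow> real) \<Rightarrow> ereal" where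
  "H1_lim J1 J2 \<gamma> l u0 u1 b rhat lhat u = Inf {H1_value J1 J2 \<gamma> u0 u1 b rhat lhat S | S a.
      sbvc_rep l \<gamma> S a \<and> (AE x in lborel. x \<in> {0..1} \<longrightarrow> u x = sbvc_fun \<gamma> S a x)}"

end

theory Submission
  imports Defs
begin

text \<open>Let \<open>m = J\<^sub>0(\<gamma>)\<close>, which is the value of the convex envelope at \<open>l\<close>. Written in the bond
  slopes of \<open>u\<close>, the rescaled energy minus its boundary terms is a sum of nonnegative cell energies:
  \<open>F s t = J\<^sub>2((s+t)/2) + (J\<^sub>1 s + J\<^sub>1 t)/2 - m\<close> for neighbouring bonds in the atomistic regions, and
  \<open>G s = J\<^sub>1 s + J\<^sub>2 s - m\<close> per bond in the continuum region, where a whole element of \<open>k\<close> bonds carries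
  one slope and costs \<open>k * G s\<close>. Both vanish only at \<open>\<gamma>\<close>, so under an energy bound all but boundedly
  many slopes are close to \<open>\<gamma>\<close>, and the limit has derivative \<open>\<gamma>\<close> and finitely many upward jumps, each
  generated by bonds whose slopes tend to infinity. Since \<open>G s \<rightarrow> -m\<close> at infinity, a jump inside
  the continuum region costs \<open>-m\<close> times the length of the shortest element available there. A steep
  bond in an atomistic region decouples the chain, and the pieces on its two sides compete in the
  boundary layer problems; this gives the lower bound. For the upper bound one glues nearly optimal
  layers, constant slope \<open>\<gamma>\<close>, and one steep element per jump whose slope is adjusted by a bounded amount
  to meet the boundary condition.\<close>

text \<open>The envelope equals \<open>m\<close> to the right of \<gamma> because \<open>J0\<close>
  has a finite limit at plus infinity, so no affine function of positive slope lies below it. The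
  delicate passage from the hypotheses to estimates is the quantitative well of \<open>F\<close> at
  \<gamma>: without lower semicontinuity, uniqueness of the minimising pair does not give it by
  compactness alone. In the atomistic regions neighbouring bonds interact. The chain is cut there at
  a bond of slope almost \<gamma>, which exists by pigeonhole since these regions contain ever more
  bonds; whether a steep bond lies before or after this cut separates two of the alternatives in
  \<open>B_IFJ\<close>. In the continuum region \<open>G\<close> couples nothing, and the chain may
  be cut anywhere. The right end is a left end after the reflection \<open>i -> n - 1 - i\<close>,
  since \<open>F\<close> is symmetric. The counts \<open>rhat\<close>, \<open>lhat\<close> and
  \<open>b x\<close> may be infinite; then finitely many steep bonds already cost more than any
  prescribed bound. All estimates are made for one real number strictly below or above the limit
  value, which splits into one such number for each end and each interior jump.\<close>

lemma strict_convex_of_midpoint: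
  fixes f :: "real \<Rightarrow> real"
  assumes "x < y" and cont: "continuous_on {x..y} f"
    and mid: "\<And>z e. x \<le> z - e \<Longrightarrow> z + e \<le> y \<Longrightarrow> 0 < e \<Longrightarrow> 2 * f z < f (z - e) + f (z + e)"
    and t: "0 < t" "t < 1"
  shows "f ((1 - t) * x + t * y) < (1 - t) * f x + t * f y"
proof (rule ccontr)
  define sl where "sl = (f y - f x) / (y - x)"
  define g where "g z = f z - f x - sl * (z - x)" for z
  define p where "p = (1 - t) * x + t * y"
  assume neg: "\<not> ?thesis"
  have sl: "sl * (y - x) = f y - f x" using assms(1) by (simp add: sl_def)
  have gx: "g x = 0" "g y = 0" by (simp_all add: g_def sl)
  have px: "p - x = t * (y - x)" "y - p = (1 - t) * (y - x)"
    by (simp_all add: p_def algebra_simps)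
  have pin: "x < p" "p < y"
    using px t \<open>x < y\<close> by (metis diff_gt_0_iff_gt zero_less_mult_iff)+
  have "sl * (p - x) = t * (f y - f x)"
    unfolding px sl[symmetric] by simp
  then have gp: "g p \<ge> 0"
    using neg unfolding g_def p_def[symmetric] by (simp add: algebra_simps)
  have cg: "continuous_on {x..y} g"
    unfolding g_def by (intro continuous_intros cont)
  obtain z0 where z0: "z0 \<in> {x..y}" "\<And>z. z \<in> {x..y} \<Longrightarrow> g z \<le> g z0"
    using continuous_attains_sup[OF compact_Icc _ cg] \<open>x < y\<close> by fastforce
  \<comment> \<open>The maximiser found may be an endpoint, where \<open>g\<close> vanishes. Since
    \<open>g p\<close> is nonnegative, \<open>p\<close> is then a maximiser too, and an interior
    one.\<close>
  obtain z1 where z1: "x < z1" "z1 < y" "\<And>z. z \<in> {x..y} \<Longrightarrow> g z \<le> g z1"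
  proof (cases "z0 = x \<or> z0 = y")
    case True
    then have "g z0 = 0" using gx by auto
    then show ?thesis using that[of p] pin gp z0(2) by fastforce
  next
    case False
    then show ?thesis using that[of z0] z0 by auto
  qed
  define e where "e = min (z1 - x) (y - z1)"
  have e: "e > 0" "x \<le> z1 - e" "z1 + e \<le> y" using z1 by (auto simp: e_def)
  have "g (z1 - e) + g (z1 + e) \<le> 2 * g z1"
    using z1(3)[of "z1 - e"] z1(3)[of "z1 + e"] e by (smt (verit) atLeastAtMost_iff)
  then have "f (z1 - e) + f (z1 + e) \<le> 2 * f z1"
    by (simp add: g_def algebra_simps)
  with mid[OF e(2,3,1)] show False by simp
qed

text \<open>The real-valued content of the hypotheses; apart from the value of the envelope at
  \<open>l\<close>, the convergence proof uses nothing else about the potentials.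
  \<open>pair_well\<close> is uniqueness of the minimising pair in quantitative form, and
  \<open>coercive\<close> keeps slopes bounded from below. Nothing bounds them from above: slopes
  that tend to infinity become jumps.\<close>

locale lj_potentials =
  fixes J1 J2 :: "real \<Rightarrow> ereal" and D :: "real set" and \<gamma> m :: real and j1 j2 :: "real \<Rightarrow> real"
  assumes J1_in: "\<And>z. z \<in> D \<Longrightarrow> J1 z = ereal (j1 z)"
    and J2_in: "\<And>z. z \<in> D \<Longrightarrow> J2 z = ereal (j2 z)"
    and J1_out: "\<And>z. z \<notin> D \<Longrightarrow> J1 z = \<infinity>"
    and J2_out: "\<And>z. z \<notin> D \<Longrightarrow> J2 z = \<infinity>"
    and J0_gamma: "J0 J1 J2 \<gamma> = ereal m"
    and pos_in: "\<And>z. 0 < z \<Longrightarrow> z \<in> D"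
    and mid_in: "\<And>s t. s \<in> D \<Longrightarrow> t \<in> D \<Longrightarrow> (s + t) / 2 \<in> D"
    and gamma_pos: "0 < \<gamma>"
    and m_neg: "m < 0"
    and pair_ge: "\<And>s t. s \<in> D \<Longrightarrow> t \<in> D \<Longrightarrow> m \<le> j2 ((s + t) / 2) + j1 s / 2 + j1 t / 2"
    and pair_gamma: "j1 \<gamma> + j2 \<gamma> = m"
    and pair_well: "\<And>\<delta>. 0 < \<delta> \<Longrightarrow> \<exists>\<eta>>0. \<forall>s\<in>D. \<forall>t\<in>D.
          j2 ((s + t) / 2) + j1 s / 2 + j1 t / 2 - m < \<eta> \<longrightarrow> \<bar>s - \<gamma>\<bar> < \<delta>"
    and cont_gamma: "isCont j1 \<gamma>" "isCont j2 \<gamma>"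
    and lim_top: "(j1 \<longlongrightarrow> 0) at_top" "(j2 \<longlongrightarrow> 0) at_top"
    and coercive: "\<And>c. \<exists>K. \<forall>s\<in>D. j1 s \<le> c \<longrightarrow> - K \<le> s"
    and lower_bound: "\<exists>c. \<forall>s\<in>D. - c \<le> j1 s \<and> - c \<le> j2 s"

section \<open>From the hypotheses on the potentials to real-valued estimates\<close>

lemma biconj_le_max:
  assumes "x \<le> z" "z \<le> y"
  shows "biconj f z \<le> max (biconj f x) (biconj f y)"
  unfolding biconj_def[of f z]
proof (rule Sup_least, clarify)
  fix p
  have "p * z \<le> p * x \<or> p * z \<le> p * y"
    using assms by (cases "p \<ge> 0") (auto intro: mult_left_mono mult_left_mono_neg)
  then have "ereal (p * z) - conj_fun f p \<le> ereal (p * x) - conj_fun f p \<or>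
      ereal (p * z) - conj_fun f p \<le> ereal (p * y) - conj_fun f p"
    by (auto intro: ereal_minus_mono)
  moreover have "ereal (p * x) - conj_fun f p \<le> biconj f x" "ereal (p * y) - conj_fun f p \<le> biconj f y"
    unfolding biconj_def by (auto intro: Sup_upper)
  ultimately show "ereal (p * z) - conj_fun f p \<le> max (biconj f x) (biconj f y)"
    by (meson max.coboundedI1 max.coboundedI2 order_trans)
qed

text \<open>A finite limit at plus infinity makes the conjugate infinite at every positive slope.
  Only nonincreasing affine minorants remain, and to the right of \<gamma> these are at most their
  value at \<gamma>, hence at most \<open>m\<close>. The constant \<open>m\<close> is itself a
  minorant.\<close>

lemma biconj_beyond_argmin:
  assumes min: "\<And>z. f \<gamma> \<le> f z" and fin: "f \<gamma> = ereal m"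
    and lim: "(f \<longlongrightarrow> ereal L) at_top" and "\<gamma> \<le> l"
  shows "biconj f l = ereal m"
proof (rule antisym)
  have conj_inf: "conj_fun f p = \<infinity>" if "p > 0" for p
  proof -
    have ev: "eventually (\<lambda>z. f z < ereal (L + 1)) at_top"
      using lim by (rule order_tendstoD) simp
    have "ereal B \<le> conj_fun f p" for B
    proof -
      have "eventually (\<lambda>z::real. z \<ge> (B + L + 1) / p) at_top" by (rule eventually_ge_at_top)
      with ev have "eventually (\<lambda>z. f z < ereal (L + 1) \<and> z \<ge> (B + L + 1) / p) at_top"
        by eventually_elim auto
      then obtain z where z: "f z < ereal (L + 1)" "z \<ge> (B + L + 1) / p"
        using eventually_happens by fastforce
      have "B + L + 1 \<le> p * z" using z(2) that by (simp add: field_simps)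
      then have "ereal B \<le> ereal (p * z) - ereal (L + 1)" by simp
      also have "\<dots> \<le> ereal (p * z) - f z" using z(1) by (intro ereal_minus_mono) auto
      also have "\<dots> \<le> conj_fun f p" unfolding conj_fun_def by (auto intro: Sup_upper)
      finally show ?thesis .
    qed
    then show ?thesis by (metis ereal_top)
  qed
  show "biconj f l \<le> ereal m"
    unfolding biconj_def
  proof (rule Sup_least, clarify)
    fix p
    show "ereal (p * l) - conj_fun f p \<le> ereal m"
    proof (cases "p > 0")
      case True
      then show ?thesis by (simp add: conj_inf)
    next
      case False
      have "ereal (p * \<gamma>) - f \<gamma> \<le> conj_fun f p"
        unfolding conj_fun_def by (auto intro: Sup_upper)
      then have "ereal (p * l) - conj_fun f p \<le> ereal (p * l) - (ereal (p * \<gamma>) - f \<gamma>)"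
        by (intro ereal_minus_mono) auto
      also have "\<dots> = ereal (p * (l - \<gamma>) + m)" by (simp add: fin algebra_simps)
      also have "\<dots> \<le> ereal m" using False \<open>\<gamma> \<le> l\<close> by (auto simp: mult_nonpos_nonneg)
      finally show ?thesis .
    qed
  qed
  have "conj_fun f 0 \<le> ereal (- m)"
    unfolding conj_fun_def
  proof (rule Sup_least, clarify)
    fix z
    have "ereal (0 * z) - f z \<le> ereal (0 * z) - f \<gamma>" by (intro ereal_minus_mono min) simp
    then show "ereal (0 * z) - f z \<le> ereal (- m)" by (simp add: fin)
  qed
  then have "ereal (0 * l) - ereal (- m) \<le> ereal (0 * l) - conj_fun f 0"
    by (intro ereal_minus_mono) auto
  also have "\<dots> \<le> biconj f l" unfolding biconj_def by (blast intro: Sup_upper)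
  finally show "ereal m \<le> biconj f l" by simp
qed

text \<open>The potentials are not assumed lower semicontinuous. A minimising sequence of the pair
  energy could therefore escape to a finite endpoint \<open>a\<close> outside the domain; the strict midpoint
  convexity of \<open>j1\<close> up to \<open>\<gamma>\<close> (uniqueness in [LJ2]) together with criticality of \<open>\<gamma>\<close>
  excludes this.\<close>

lemma no_escape_to_endpoint:
  fixes j1 j2 :: "real \<Rightarrow> real" and s t :: "nat \<Rightarrow> real"
  assumes ge: "\<And>x y. x \<in> D \<Longrightarrow> y \<in> D \<Longrightarrow> m \<le> j2 ((x + y) / 2) + j1 x / 2 + j1 y / 2"
    and eqm: "j1 \<gamma> + j2 \<gamma> = m"
    and mid: "\<And>z e. 0 < e \<Longrightarrow> z \<le> \<gamma> \<Longrightarrow> z - e \<in> D \<Longrightarrow> z + e \<in> D \<Longrightarrow> 2 * j1 z < j1 (z - e) + j1 (z + e)"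
    and up: "\<And>x. a < x \<Longrightarrow> x \<in> D"
    and cont1: "\<And>x. a < x \<Longrightarrow> isCont j1 x" and cont2: "\<And>x. a < x \<Longrightarrow> isCont j2 x"
    and d1: "(j1 has_real_derivative d1) (at \<gamma>)" and d2: "(j2 has_real_derivative d2) (at \<gamma>)"
    and ag: "a < \<gamma>"
    and sD: "\<And>n. s n \<in> D" and tD: "\<And>n. t n \<in> D" and sa: "\<And>n. a < s n"
    and slim: "s \<longlonglongrightarrow> a" and tlim: "t \<longlonglongrightarrow> 2 * \<gamma> - a"
    and Elim: "(\<lambda>n. j2 ((s n + t n) / 2) + j1 (s n) / 2 + j1 (t n) / 2) \<longlonglongrightarrow> m"
  shows False
proof -
  have "\<gamma> - a > 0" using ag by simp
  define g where "g = \<gamma> - a"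
  have g: "g > 0" using ag by (simp add: g_def)
  \<comment> \<open>The value \<open>j1\<close> would need at the missing point \<open>a\<close> for
    the pair \<open>(a, 2\<gamma> - a)\<close> to have energy exactly \<open>m\<close>. The sequence
    \<open>j1 (s n)\<close> converges to it.\<close>
  define al where "al = 2 * j1 \<gamma> - j1 (2 * \<gamma> - a)"
  define \<phi> where "\<phi> h = j1 (a + h) - al" for h
  have zlim: "(\<lambda>n. (s n + t n) / 2) \<longlonglongrightarrow> \<gamma>"
    using tendsto_divide[OF tendsto_add[OF slim tlim] tendsto_const, of 2] by simp
  have j2z: "(\<lambda>n. j2 ((s n + t n) / 2)) \<longlonglongrightarrow> j2 \<gamma>"
    by (rule isCont_tendsto_compose[OF cont2 zlim]) (use ag in simp)
  have j1t: "(\<lambda>n. j1 (t n)) \<longlonglongrightarrow> j1 (2 * \<gamma> - a)"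
    by (rule isCont_tendsto_compose[OF cont1 tlim]) (use ag in simp)
  have "(\<lambda>n. 2 * ((j2 ((s n + t n) / 2) + j1 (s n) / 2 + j1 (t n) / 2)
          - j2 ((s n + t n) / 2) - j1 (t n) / 2)) \<longlonglongrightarrow> 2 * (m - j2 \<gamma> - j1 (2 * \<gamma> - a) / 2)"
    by (intro tendsto_intros Elim j2z j1t) auto
  then have j1s: "(\<lambda>n. j1 (s n)) \<longlonglongrightarrow> al"
    unfolding al_def eqm[symmetric] by (simp add: algebra_simps)
  \<comment> \<open>Moving only the escaping coordinate, the competitors
    \<open>(s n + h, t n)\<close> stay in the domain and have energy at least \<open>m\<close>. In
    the limit this bounds the growth of \<open>j1\<close> at \<open>a\<close> from below by that of
    \<open>j2\<close> at \<gamma>.\<close>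
  have I1: "- 2 * (j2 (\<gamma> + h / 2) - j2 \<gamma>) \<le> \<phi> h" if "h > 0" for h
  proof -
    have l1: "(\<lambda>n. j1 (s n + h)) \<longlonglongrightarrow> j1 (a + h)"
      by (rule isCont_tendsto_compose[OF cont1]) (use that slim in \<open>auto intro!: tendsto_intros\<close>)
    have "(\<lambda>n. (s n + t n) / 2 + h / 2) \<longlonglongrightarrow> \<gamma> + h / 2" by (intro tendsto_intros zlim)
    then have l2: "(\<lambda>n. j2 ((s n + h + t n) / 2)) \<longlonglongrightarrow> j2 (\<gamma> + h / 2)"
      by (intro isCont_tendsto_compose[OF cont2]) (use that ag in \<open>auto simp: add_divide_distrib algebra_simps\<close>)
    have "(\<lambda>n. j2 ((s n + h + t n) / 2) + j1 (s n + h) / 2 + j1 (t n) / 2) \<longlonglongrightarrow>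
        j2 (\<gamma> + h / 2) + j1 (a + h) / 2 + j1 (2 * \<gamma> - a) / 2"
      by (intro tendsto_intros l1 l2 j1t) auto
    then have "m \<le> j2 (\<gamma> + h / 2) + j1 (a + h) / 2 + j1 (2 * \<gamma> - a) / 2"
    proof (rule tendsto_lowerbound)
      have "s n + h \<in> D" for n using sa[of n] that by (intro up) simp
      then show "\<forall>\<^sub>F n in sequentially. m \<le> j2 ((s n + h + t n) / 2) + j1 (s n + h) / 2 + j1 (t n) / 2"
        using ge[OF _ tD] by simp
    qed simp
    then show ?thesis unfolding \<phi>_def al_def using eqm by (simp add: algebra_simps)
  qed
  have conv: "j1 ((1 - u) * x + u * y) < (1 - u) * j1 x + u * j1 y"
    if "a < x" "x < y" "y \<le> \<gamma>" "0 < u" "u < 1" for x y u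
  proof (rule strict_convex_of_midpoint[OF that(2) _ _ that(4,5)])
    show "continuous_on {x..y} j1"
      using cont1 that by (intro continuous_at_imp_continuous_on) auto
    show "2 * j1 z < j1 (z - e) + j1 (z + e)" if "x \<le> z - e" "z + e \<le> y" "0 < e" for z e
      by (rule mid) (use that \<open>a < x\<close> \<open>y \<le> \<gamma>\<close> in \<open>auto intro!: up\<close>)
  qed
  \<comment> \<open>Convexity extended to the missing endpoint, with \<open>al\<close> as the value
    there, by passing to the limit along \<open>s n\<close>.\<close>
  have conv0: "\<phi> (u * h) \<le> u * \<phi> h" if "0 < h" "h \<le> g" "0 < u" "u < 1" for h u
  proof -
    have ev: "eventually (\<lambda>n. s n < a + h) sequentially"
      using slim by (rule order_tendstoD) (use that in simp)
    have "(\<lambda>n. (1 - u) * s n + u * (a + h)) \<longlonglongrightarrow> (1 - u) * a + u * (a + h)"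
      by (intro tendsto_intros slim)
    also have "(1 - u) * a + u * (a + h) = a + u * h" by (simp add: algebra_simps)
    finally have l1: "(\<lambda>n. j1 ((1 - u) * s n + u * (a + h))) \<longlonglongrightarrow> j1 (a + u * h)"
      by (intro isCont_tendsto_compose[OF cont1]) (use that in auto)
    have l2: "(\<lambda>n. (1 - u) * j1 (s n) + u * j1 (a + h)) \<longlonglongrightarrow> (1 - u) * al + u * j1 (a + h)"
      by (intro tendsto_intros j1s)
    have "j1 (a + u * h) \<le> (1 - u) * al + u * j1 (a + h)"
    proof (rule tendsto_le[OF _ l2 l1])
      show "\<forall>\<^sub>F n in sequentially. j1 ((1 - u) * s n + u * (a + h)) \<le> (1 - u) * j1 (s n) + u * j1 (a + h)"
        using ev
      proof eventually_elim
        case (elim n)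
        show ?case using conv[of "s n" "a + h" u] sa[of n] elim that by (simp add: g_def)
      qed
    qed simp
    then show ?thesis by (simp add: \<phi>_def algebra_simps)
  qed
  have G_min: "m \<le> j1 x + j2 x" if "x \<in> D" for x using ge[OF that that] by simp
  \<comment> \<open>Criticality of \<gamma>: on the diagonal the pair energy is
    \<open>j1 + j2\<close>, minimal at \<gamma>. This turns the bound by \<open>j2\<close> into one
    by the slope \<open>d1\<close> of \<open>j1\<close>.\<close>
  have "d1 + d2 = 0"
  proof (rule DERIV_local_min)
    show "((\<lambda>x. j1 x + j2 x) has_real_derivative d1 + d2) (at \<gamma>)" by (intro derivative_intros d1 d2)
    show "0 < \<gamma> - a" using ag by simp
    show "\<forall>y. \<bar>\<gamma> - y\<bar> < \<gamma> - a \<longrightarrow> j1 \<gamma> + j2 \<gamma> \<le> j1 y + j2 y"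
      using G_min up eqm by auto
  qed
  have ev_small: "eventually (\<lambda>h. 0 < h \<and> h < g / 4) (at_right (0::real))"
    using g eventually_at_right_less[of "0::real"] order_tendstoD(2)[OF tendsto_ident_at, of 0 "g/4" "{0<..}"]
    by (simp add: eventually_conj_iff)
  have A: "d1 * (g / 2) \<le> \<phi> (g / 2)"
  proof -
    have "((\<lambda>y. (j2 (\<gamma> + y) - j2 \<gamma>) / y) \<longlongrightarrow> d2) (at 0)" using d2 by (simp add: DERIV_def)
    then have 1: "((\<lambda>y. (j2 (\<gamma> + y) - j2 \<gamma>) / y) \<longlongrightarrow> d2) (at_right 0)"
      by (rule filterlim_mono) (auto simp: at_within_le_at)
    have "filterlim (\<lambda>h::real. h / 2) (at_right 0) (at_right 0)"
      unfolding filterlim_at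
      by (auto intro!: tendsto_eq_intros eventually_mono[OF eventually_at_right_less])
    from filterlim_compose[OF 1 this]
    have "((\<lambda>h. - 1 * ((j2 (\<gamma> + h / 2) - j2 \<gamma>) / (h / 2))) \<longlongrightarrow> - 1 * d2) (at_right 0)"
      by (intro tendsto_intros)
    moreover have "eventually (\<lambda>h. - 1 * ((j2 (\<gamma> + h / 2) - j2 \<gamma>) / (h / 2)) \<le> \<phi> (g / 2) / (g / 2)) (at_right 0)"
      using ev_small
    proof eventually_elim
      case (elim h)
      have "- 1 * ((j2 (\<gamma> + h / 2) - j2 \<gamma>) / (h / 2)) = (- 2 * (j2 (\<gamma> + h / 2) - j2 \<gamma>)) / h" by simp
      also have "\<dots> \<le> \<phi> h / h" using I1[of h] elim by (intro divide_right_mono) auto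
      also have "\<dots> \<le> \<phi> (g / 2) / (g / 2)"
        using conv0[of "g/2" "h / (g/2)"] elim g by (simp add: field_simps)
      finally show ?case .
    qed
    ultimately have "- 1 * d2 \<le> \<phi> (g / 2) / (g / 2)"
      by (rule tendsto_upperbound) simp
    then show ?thesis using \<open>d1 + d2 = 0\<close> g by (simp add: field_simps add_eq_0_iff)
  qed
  have C: "\<phi> g - \<phi> (3/4 * g) \<le> d1 * (g / 4)"
  proof -
    have "((\<lambda>y. (j1 (\<gamma> + y) - j1 \<gamma>) / y) \<longlongrightarrow> d1) (at 0)" using d1 by (simp add: DERIV_def)
    then have 1: "((\<lambda>y. (j1 (\<gamma> + y) - j1 \<gamma>) / y) \<longlongrightarrow> d1) (at_left 0)"
      by (rule filterlim_mono) (auto simp: at_within_le_at)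
    have "filterlim (\<lambda>h::real. - h) (at_left 0) (at_right 0)"
      unfolding filterlim_at
      by (auto intro!: tendsto_eq_intros eventually_mono[OF eventually_at_right_less])
    from filterlim_compose[OF 1 this]
    have 2: "((\<lambda>h. (j1 (\<gamma> + - h) - j1 \<gamma>) / (- h)) \<longlongrightarrow> d1) (at_right 0)" .
    have "eventually (\<lambda>h. (\<phi> g - \<phi> (3/4 * g)) / (g / 4) \<le> (j1 (\<gamma> + - h) - j1 \<gamma>) / (- h)) (at_right 0)"
      using ev_small
    proof eventually_elim
      case (elim h)
      define u where "u = 1 - h / (g / 4)"
      have u: "0 < u" "u < 1" using elim g by (auto simp: u_def field_simps)
      have pt: "(1 - u) * (a + 3/4 * g) + u * \<gamma> = \<gamma> - h"
      proof -
        have "(1 - u) * (a + 3/4 * g) + u * \<gamma> = \<gamma> - (1 - u) * (\<gamma> - a - 3/4 * g)"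
          by (simp add: algebra_simps)
        also have "\<gamma> - a - 3/4 * g = g / 4" using g_def by linarith
        finally have "(1 - u) * (a + 3/4 * g) + u * \<gamma> = \<gamma> - (1 - u) * (g / 4)" .
        then show ?thesis using g by (simp add: u_def)
      qed
      have "j1 (\<gamma> - h) < (1 - u) * j1 (a + 3/4 * g) + u * j1 \<gamma>"
      proof -
        have "a < a + 3/4 * g" "a + 3/4 * g < \<gamma>" using g g_def by linarith+
        from conv[OF this order_refl u] show ?thesis by (simp only: pt)
      qed
      then have "(1 - u) * (j1 \<gamma> - j1 (a + 3/4 * g)) \<le> j1 \<gamma> - j1 (\<gamma> - h)" by (simp add: algebra_simps)
      moreover have "\<phi> g - \<phi> (3/4 * g) = j1 \<gamma> - j1 (a + 3/4 * g)" by (simp add: \<phi>_def g_def)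
      ultimately have "h / (g / 4) * (\<phi> g - \<phi> (3/4 * g)) \<le> j1 \<gamma> - j1 (\<gamma> - h)" by (simp add: u_def)
      then have "(\<phi> g - \<phi> (3/4 * g)) / (g / 4) \<le> (j1 \<gamma> - j1 (\<gamma> - h)) / h"
      proof -
        have "X / (g / 4) \<le> Y / h" if "h / (g / 4) * X \<le> Y" for X Y
          using that elim g by (simp add: field_simps)
        then show "h / (g / 4) * (\<phi> g - \<phi> (3/4 * g)) \<le> j1 \<gamma> - j1 (\<gamma> - h) \<Longrightarrow> ?thesis" .
      qed
      also have "\<dots> = (j1 (\<gamma> + - h) - j1 \<gamma>) / (- h)" by (simp add: minus_divide_left)
      finally show ?case .
    qed
    with 2 have "(\<phi> g - \<phi> (3/4 * g)) / (g / 4) \<le> d1" by (intro tendsto_lowerbound) auto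
    then show ?thesis using g by (simp add: field_simps)
  qed
  have M1: "\<phi> (g / 2) \<le> 2/3 * \<phi> (3/4 * g)" using conv0[of "3/4*g" "2/3"] g by simp
  have M2: "2 * \<phi> (3/4 * g) < \<phi> (g / 2) + \<phi> g"
  proof -
    have eq: "(1 - 1/2) * (a + g/2) + 1/2 * \<gamma> = a + 3/4 * g" using g_def by (simp add: field_simps)
    have "a < a + g/2" "a + g/2 < \<gamma>" using g g_def by linarith+
    from conv[OF this order_refl, of "1/2"]
    have "j1 (a + 3/4 * g) < (1 - 1/2) * j1 (a + g/2) + 1/2 * j1 \<gamma>" by (simp only: eq)
    then show ?thesis by (simp add: \<phi>_def g_def algebra_simps)
  qed
  \<comment> \<open>By \<open>A\<close> the chord of \<open>\<phi>\<close> over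
    \<open>[0, g/2]\<close> has slope at least \<open>d1\<close>, by \<open>C\<close> the one over
    \<open>[3g/4, g]\<close> has slope at most \<open>d1\<close>. Convexity (\<open>M1\<close>) and
    strict convexity (\<open>M2\<close>) make the second slope strictly larger than the
    first.\<close>
  show False using A C M1 M2 by (simp add: algebra_simps)
qed


text \<open>The set of minimising pairs is invariant under exchange of the coordinates. If it is a
  singleton, its element lies on the diagonal.\<close>

lemma strictly_convex_midpoint_of_LJ2:
  assumes "LJ2 J1 J2" "J0 J1 J2 z = biconj (J0 J1 J2) z" "J0 J1 J2 z < \<infinity>"
  shows "J0 J1 J2 z = J2 z + J1 z"
    and "z1 + z2 = 2 * z \<Longrightarrow> J0 J1 J2 z = J2 z + ereal (1/2) * (J1 z1 + J1 z2) \<Longrightarrow> z1 = z"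
proof -
  let ?M = "{(z1, z2). z1 + z2 = 2 * z \<and> J0 J1 J2 z = J2 z + ereal (1/2) * (J1 z1 + J1 z2)}"
  have "card ?M = 1" using assms unfolding LJ2_def by blast
  then obtain p where p: "?M = {p}" by (rule card_1_singletonE)
  obtain x y where xy: "p = (x, y)" by (cases p)
  have "(x, y) \<in> ?M" using p xy by simp
  then have x: "x + y = 2 * z" "J0 J1 J2 z = J2 z + ereal (1/2) * (J1 x + J1 y)" by auto
  then have "(y, x) \<in> ?M" by (simp add: add.commute)
  then have "(y, x) = (x, y)" unfolding p xy by (rule singletonD)
  then have "y = x" by (rule Pair_inject)
  then have xz: "x = z" "y = z" using x(1) by linarith+
  have "ereal (1/2) * (J1 z + J1 z) = J1 z" by (cases "J1 z") auto
  then show "J0 J1 J2 z = J2 z + J1 z" using x xz by simp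
  show "z1 = z" if "z1 + z2 = 2 * z" "J0 J1 J2 z = J2 z + ereal (1/2) * (J1 z1 + J1 z2)"
  proof -
    have "(z1, z2) \<in> ?M" using that by simp
    then have "(z1, z2) = (x, y)" unfolding p xy by (rule singletonD)
    then show ?thesis using xz by simp
  qed
qed

text \<open>All items but \<open>pair_well\<close> are read off. If \<open>pair_well\<close> fails,
  pairs with energy tending to \<open>m\<close> keep their first slope away from \<gamma>. They are
  bounded, their midpoints converge to \<gamma>, and the limit pair either minimises, against
  uniqueness, or has left the domain, which \<open>no_escape_to_endpoint\<close> excludes.\<close>

lemma lj_potentials_of_LJ:
  fixes J1 J2 :: "real \<Rightarrow> ereal"
  assumes J1p: "\<forall>z. J1 z \<noteq> -\<infinity>" and J2p: "\<forall>z. J2 z \<noteq> -\<infinity>"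
    and LJ2: "LJ2 J1 J2" and LJ3: "LJ3 J1 J2 \<alpha> J0inf" and LJ4: "LJ4 J1 J2 \<gamma> J0inf"
  shows "lj_potentials J1 J2 (dom_pot J1) \<gamma> (real_of_ereal (J0 J1 J2 \<gamma>))
    (\<lambda>z. real_of_ereal (J1 z)) (\<lambda>z. real_of_ereal (J2 z))"
    and "\<gamma> \<le> l \<Longrightarrow> biconj (J0 J1 J2) l = J0 J1 J2 \<gamma>"
proof -
  define D where "D = dom_pot J1"
  define j1 where "j1 z = real_of_ereal (J1 z)" for z
  define j2 where "j2 z = real_of_ereal (J2 z)" for z
  define E where "E = J0 J1 J2"
  define m where "m = real_of_ereal (E \<gamma>)"
  have dom2: "dom_pot J2 = D" using LJ3 by (simp add: LJ3_def D_def)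
  have J1D: "J1 z = ereal (j1 z)" if "z \<in> D" for z
    using that J1p by (cases "J1 z") (auto simp: D_def dom_pot_def j1_def)
  have J2D: "J2 z = ereal (j2 z)" if "z \<in> D" for z
    using that J2p dom2 by (cases "J2 z") (auto simp: dom_pot_def j2_def)
  have J1n: "J1 z = \<infinity>" if "z \<notin> D" for z using that by (auto simp: D_def dom_pot_def)
  have J2n: "J2 z = \<infinity>" if "z \<notin> D" for z using that dom2 by (auto simp: dom_pot_def)
  have pos: "z \<in> D" if "0 < z" for z using LJ3 that by (auto simp: LJ3_def D_def)
  obtain \<Psi> c1 c2 where \<Psi>: "convex_ereal_fun \<Psi>" "\<And>z. 0 \<le> \<Psi> z"
      "((\<lambda>z. \<Psi> z / ereal \<bar>z\<bar>) \<longlongrightarrow> \<infinity>) at_bot" and c: "c1 > 0" "c2 > 0"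
      and bds: "\<forall>z. \<forall>J \<in> {J1, J2}. ereal c1 * (\<Psi> z - 1) \<le> J z \<and> J z \<le> ereal c2 * max (\<Psi> z) (ereal \<bar>z\<bar>)"
    using conjunct1[OF LJ4[unfolded LJ4_def]] by (elim exE conjE) (rule that; simp)
  have c_lower: "ereal c1 * (\<Psi> z - 1) \<le> J1 z" "ereal c1 * (\<Psi> z - 1) \<le> J2 z"
    and c_upper: "J1 z \<le> ereal c2 * max (\<Psi> z) (ereal \<bar>z\<bar>)" for z
    using bds by auto
  \<comment> \<open>The growth bounds identify the domain of the potentials with that of the convex
    function \<open>\<Psi>\<close>. It is therefore convex, and since it contains the positive
    half-line it is an upper set (\<open>between\<close>).\<close>
  have D_iff: "z \<in> D \<longleftrightarrow> \<Psi> z < \<infinity>" for z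
  proof
    assume "z \<in> D"
    then show "\<Psi> z < \<infinity>" using c_lower(1)[of z] J1D[of z] c(1) by (cases "\<Psi> z") auto
  next
    assume "\<Psi> z < \<infinity>"
    then obtain r where r: "\<Psi> z = ereal r" using \<Psi>(2)[of z] by (cases "\<Psi> z") auto
    have "J1 z \<le> ereal (c2 * max r \<bar>z\<bar>)" using c_upper[of z] r by (auto simp: max_def split: if_splits)
    then have "J1 z \<noteq> \<infinity>" by auto
    then show "z \<in> D" using J1n[of z] by blast
  qed
  have conv: "(1 - u) * x + u * y \<in> D" if "x \<in> D" "y \<in> D" "0 \<le> u" "u \<le> 1" for x y u
  proof -
    have fin: "\<exists>r. \<Psi> x = ereal r" if "x \<in> D" for x
      using that D_iff[of x] \<Psi>(2)[of x] by (cases "\<Psi> x") auto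
    obtain r1 r2 where r: "\<Psi> x = ereal r1" "\<Psi> y = ereal r2" using fin[OF \<open>x \<in> D\<close>] fin[OF \<open>y \<in> D\<close>] by blast
    have "\<Psi> ((1 - u) * x + u * y) \<le> ereal (1 - u) * \<Psi> x + ereal u * \<Psi> y"
      using \<Psi>(1) that unfolding convex_ereal_fun_def by blast
    also have "\<dots> < \<infinity>" by (simp add: r)
    finally show ?thesis unfolding D_iff .
  qed
  have between: "z \<in> D" if "x \<in> D" "x \<le> z" for x z
  proof -
    define y where "y = \<bar>z\<bar> + 1"
    have y: "y \<in> D" "z < y" "y > 0" using pos by (auto simp: y_def)
    define u where "u = (z - x) / (y - x)"
    have "0 \<le> u" "u \<le> 1" using that y by (auto simp: u_def)
    moreover have "(1 - u) * x + u * y = z"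
    proof -
      have "u * (y - x) = z - x" using that y by (simp add: u_def)
      then show ?thesis by (simp add: algebra_simps)
    qed
    ultimately show ?thesis using conv[OF that(1) y(1)] by metis
  qed
  have mid: "(s + t) / 2 \<in> D" if "s \<in> D" "t \<in> D" for s t
    using conv[OF that, of "1/2"] by (simp add: add_divide_distrib)
  have lb: "- c1 \<le> j1 s" "- c1 \<le> j2 s" if "s \<in> D" for s
  proof -
    have "ereal (- c1) \<le> ereal c1 * (\<Psi> s - 1)"
      using D_iff[of s] that \<Psi>(2)[of s] c(1) by (cases "\<Psi> s") (auto simp: algebra_simps one_ereal_def)
    then show "- c1 \<le> j1 s" "- c1 \<le> j2 s"
      using order_trans[OF _ c_lower(1)[of s]] order_trans[OF _ c_lower(2)[of s]] J1D[OF that] J2D[OF that] by fastforce+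
  qed
  have coer: "\<exists>K. \<forall>s\<in>D. j1 s \<le> b \<longrightarrow> - K \<le> s" for b
  proof -
    have "eventually (\<lambda>z. \<Psi> z / ereal \<bar>z\<bar> > 1) at_bot"
      using \<Psi>(3) by (rule order_tendstoD) simp
    then obtain K0 where K0: "\<And>z. z \<le> K0 \<Longrightarrow> \<Psi> z / ereal \<bar>z\<bar> > 1"
      unfolding eventually_at_bot_linorder by auto
    \<comment> \<open>Left of \<open>K0\<close> one has \<open>\<Psi> s > - s\<close>, hence
      \<open>j1 s > c1 * (- s - 1)\<close>. The term \<open>b / c1 + 2\<close> makes this exceed
      \<open>b\<close> below \<open>- K\<close>.\<close>
    define K where "K = max (max 1 (- K0)) (b / c1 + 2)"
    have "- K \<le> s" if "s \<in> D" "j1 s \<le> b" for s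
    proof (rule ccontr)
      assume "\<not> ?thesis"
      then have s: "s < - K" by simp
      then have s0: "s \<le> K0" "s < 0" "- s > b / c1 + 2" by (auto simp: K_def)
      obtain r where r: "\<Psi> s = ereal r" using D_iff[of s] \<open>s \<in> D\<close> \<Psi>(2)[of s] by (cases "\<Psi> s") auto
      have "r / \<bar>s\<bar> > 1" using K0[OF s0(1)] r s0 by (simp add: one_ereal_def)
      then have "r > - s" using s0 by (simp add: field_simps)
      moreover have "c1 * (r - 1) \<le> j1 s" using c_lower(1)[of s] r J1D[OF that(1)] by (simp add: one_ereal_def)
      ultimately have "c1 * (- s - 1) \<le> b" using c(1) that(2)
        by (smt (verit) mult_left_mono)
      then show False using s0(3) c(1) by (simp add: field_simps)
    qed
    then show ?thesis by blast
  qed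
  have J0_le: "E z \<le> J2 z + ereal (1/2) * (J1 s + J1 t)" if "s + t = 2 * z" for s t z
    unfolding E_def J0_def
    by (intro add_left_mono ereal_mult_left_mono Inf_lower) (use that in auto)
  have E_le: "E ((s + t) / 2) \<le> ereal (j2 ((s + t) / 2) + j1 s / 2 + j1 t / 2)" if "s \<in> D" "t \<in> D" for s t
    using J0_le[of s t "(s + t) / 2"] J2D[OF mid[OF that]] J1D[OF that(1)] J1D[OF that(2)] by (simp add: add.assoc add_divide_distrib)
  have E_fin: "E z < \<infinity>" if "z \<in> D" for z
    using E_le[OF that that] by auto
  have argmin: "{z. \<forall>y. E z \<le> E y} = {\<gamma>}" and gpos: "\<gamma> > 0" and glim: "E \<gamma> < ereal J0inf"
    and contact: "\<And>z. z \<le> \<gamma> \<Longrightarrow> E z = biconj E z"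
    using conjunct2[OF LJ4[unfolded LJ4_def]] unfolding E_def by auto
  have gmin: "E \<gamma> \<le> E y" for y using argmin by auto
  have gD: "\<gamma> \<in> D" using gpos pos by auto
  have Eg: "E \<gamma> = J2 \<gamma> + J1 \<gamma>"
    using strictly_convex_midpoint_of_LJ2(1)[OF LJ2, of \<gamma>] contact E_fin[OF gD] by (simp add: E_def)
  then have Egm: "E \<gamma> = ereal m" and eqm: "j1 \<gamma> + j2 \<gamma> = m"
    by (simp_all add: J1D J2D gD m_def)
  have ge: "m \<le> j2 ((s + t) / 2) + j1 s / 2 + j1 t / 2" if "s \<in> D" "t \<in> D" for s t
    using order_trans[OF gmin E_le[OF that]] Egm by simp
  have Elim: "(E \<longlongrightarrow> ereal J0inf) at_top" using LJ3 by (simp add: LJ3_def E_def)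
  have biconj_l: "biconj E l = E \<gamma>" if "\<gamma> \<le> l"
    using biconj_beyond_argmin[OF gmin Egm Elim that] Egm by simp
  have Jlim: "(j1 \<longlongrightarrow> 0) at_top" "(j2 \<longlongrightarrow> 0) at_top"
  proof -
    have "(J1 \<longlongrightarrow> ereal 0) at_top" "(J2 \<longlongrightarrow> ereal 0) at_top" using LJ3 by (auto simp: LJ3_def zero_ereal_def)
    then show "(j1 \<longlongrightarrow> 0) at_top" "(j2 \<longlongrightarrow> 0) at_top" unfolding j1_def j2_def by (auto dest: lim_real_of_ereal)
  qed
  have "m < 0"
  proof -
    have "((\<lambda>z. ereal (j2 z + j1 z)) \<longlongrightarrow> ereal (0 + 0)) at_top"
      by (intro tendsto_intros Jlim)
    moreover have "\<forall>\<^sub>F z in at_top. E z \<le> ereal (j2 z + j1 z)"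
      using eventually_gt_at_top[of 0]
    proof eventually_elim
      case (elim z)
      then show ?case using E_le[of z z] pos[of z] by (simp add: add.assoc)
    qed
    ultimately have "ereal J0inf \<le> ereal (0 + 0)" using Elim by (intro tendsto_le) auto
    then show ?thesis using glim Egm by simp
  qed
  have C1: "C1alpha_on_dom J1 \<alpha>" "C1alpha_on_dom J2 \<alpha>" "C1_on_dom E"
    using LJ3 by (simp_all add: LJ3_def E_def)
  obtain D1 where D1: "\<forall>x\<in>D. (j1 has_real_derivative D1 x) (at x within D)"
    using C1(1)[unfolded C1alpha_on_dom_def, folded D_def j1_def[abs_def]] by (elim exE conjE) (rule that)
  obtain D2 where D2: "\<forall>x\<in>D. (j2 has_real_derivative D2 x) (at x within D)"
    using C1(2)[unfolded C1alpha_on_dom_def dom2, folded j2_def[abs_def]] by (elim exE conjE) (rule that)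
  obtain D0 where D0: "\<forall>x\<in>dom_pot E. ((\<lambda>z. real_of_ereal (E z)) has_real_derivative D0 x) (at x within dom_pot E)"
    using C1(3)[unfolded C1_on_dom_def] by (elim exE conjE) (rule that)
  have cont1: "continuous (at x within D) j1" and cont2: "continuous (at x within D) j2" if "x \<in> D" for x
    using DERIV_continuous[OF bspec[OF D1 that]] DERIV_continuous[OF bspec[OF D2 that]] by simp_all
  have at_in: "at x within D = at x" if "a \<in> D \<or> (\<forall>y>a. y \<in> D)" "a < x" for a x
    by (rule at_within_open_subset[of _ "{a<..}"]) (use that between[of a] in auto)
  have strict: "2 * j1 z < j1 (z - e) + j1 (z + e)"
    if "0 < e" "z \<le> \<gamma>" "z - e \<in> D" "z + e \<in> D" for z e
  proof -
    have zD: "z \<in> D" using between[OF that(3)] that(1) by simp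
    note un = strictly_convex_midpoint_of_LJ2[OF LJ2, of z, folded E_def, OF contact[OF that(2)] E_fin[OF zD]]
    note Ez = un(1)
    have "E z \<le> J2 z + ereal (1/2) * (J1 (z - e) + J1 (z + e))" by (rule J0_le) simp
    moreover have "E z \<noteq> J2 z + ereal (1/2) * (J1 (z - e) + J1 (z + e))"
      using un(2)[of "z - e" "z + e"] that(1) by auto
    ultimately have "E z < J2 z + ereal (1/2) * (J1 (z - e) + J1 (z + e))" by simp
    then show ?thesis using Ez that zD by (simp add: J1D J2D)
  qed
  have well: "\<exists>\<eta>>0. \<forall>s\<in>D. \<forall>t\<in>D. j2 ((s + t) / 2) + j1 s / 2 + j1 t / 2 - m < \<eta> \<longrightarrow> \<bar>s - \<gamma>\<bar> < \<delta>"
    if "\<delta> > 0" for \<delta>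
  proof (rule ccontr)
    assume neg: "\<not> ?thesis"
    define H where "H s t = j2 ((s + t) / 2) + j1 s / 2 + j1 t / 2" for s t
    \<comment> \<open>Half the gap between \<open>J0\<close> at infinity and its minimum. Energies
      below \<open>m + \<eta>0\<close> keep the midpoint below some \<open>Z\<close>; as coercivity
      keeps both slopes above \<open>- K\<close>, both lie in \<open>[-K, 2Z + K]\<close>.\<close>
    define \<eta>0 where "\<eta>0 = (J0inf - m) / 2"
    have \<eta>0: "\<eta>0 > 0" using glim Egm by (simp add: \<eta>0_def)
    have "eventually (\<lambda>z. E z > ereal (m + \<eta>0)) at_top"
      using Elim by (rule order_tendstoD) (use \<eta>0 in \<open>simp add: \<eta>0_def field_simps\<close>)
    then obtain Z where Z: "\<And>z. z \<ge> Z \<Longrightarrow> E z > ereal (m + \<eta>0)"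
      unfolding eventually_at_top_linorder by auto
    have "\<exists>p. fst p \<in> D \<and> snd p \<in> D \<and> H (fst p) (snd p) - m < min \<eta>0 (1 / real (Suc n)) \<and> \<not> \<bar>fst p - \<gamma>\<bar> < \<delta>" for n
    proof -
      have "min \<eta>0 (1 / real (Suc n)) > 0" using \<eta>0 by simp
      then show ?thesis using neg unfolding H_def by (metis fst_conv snd_conv)
    qed
    then obtain p where p: "\<And>n. fst (p n) \<in> D" "\<And>n. snd (p n) \<in> D"
      "\<And>n. H (fst (p n)) (snd (p n)) - m < min \<eta>0 (1 / real (Suc n))" "\<And>n::nat. \<not> \<bar>fst (p n) - \<gamma>\<bar> < \<delta>"
      by metis
    obtain K where K: "\<And>s. s \<in> D \<Longrightarrow> j1 s \<le> 2 * (m + \<eta>0 + c1 + c1) \<Longrightarrow> - K \<le> s" using coer by blast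
    have H_sum: "H s t = j2 ((s + t) / 2) + j1 s / 2 + j1 t / 2" for s t by (simp add: H_def)
    have lbK: "- K \<le> s \<and> - K \<le> t \<and> (s + t) / 2 < Z" if "s \<in> D" "t \<in> D" "H s t - m < \<eta>0" for s t
    proof -
      have "- c1 \<le> j2 ((s + t) / 2)" "- c1 \<le> j1 s" "- c1 \<le> j1 t" using lb mid that by auto
      then have "- K \<le> s" "- K \<le> t" using that c(1) by (auto intro!: K simp: H_def)
      moreover have "(s + t) / 2 < Z"
      proof (rule ccontr)
        assume "\<not> (s + t) / 2 < Z"
        then have "ereal (m + \<eta>0) < ereal (H s t)" using Z E_le[OF that(1,2)] unfolding H_def by (meson less_le_trans not_le)
        then show False using that(3) by simp
      qed
      ultimately show ?thesis by simp
    qed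
    have "p n \<in> {-K..2*Z+K} \<times> {-K..2*Z+K}" for n
      using lbK[OF p(1)[of n] p(2)[of n]] p(3)[of n] by (cases "p n") auto
    moreover have "compact ({-K..2*Z+K} \<times> {-K..2*Z+K})" by (intro compact_Times compact_Icc)
    ultimately obtain q r where q: "strict_mono r" "(p \<circ> r) \<longlonglongrightarrow> q"
      unfolding compact_eq_seq_compact_metric seq_compact_def by metis
    define s where "s n = fst (p (r n))" for n
    define t where "t n = snd (p (r n))" for n
    have sD: "s n \<in> D" and tD: "t n \<in> D" for n using p by (auto simp: s_def t_def)
    have slim: "s \<longlonglongrightarrow> fst q" and tlim: "t \<longlonglongrightarrow> snd q"
      using tendsto_fst[OF q(2)] tendsto_snd[OF q(2)] by (simp_all add: s_def[abs_def] t_def[abs_def] o_def)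
    define z where "z n = (s n + t n) / 2" for n
    define zz where "zz = (fst q + snd q) / 2"
    have zlim: "z \<longlonglongrightarrow> zz" unfolding z_def zz_def by (intro tendsto_intros slim tlim) simp
    have zD: "z n \<in> D" for n unfolding z_def by (intro mid sD tD)
    have Hlim: "(\<lambda>n. H (s n) (t n)) \<longlonglongrightarrow> m"
    proof (rule tendsto_sandwich[where f = "\<lambda>_. m" and h = "\<lambda>n. m + 1 / real (Suc (r n))"])
      have "(\<lambda>n. m + 1 / real (Suc n)) \<longlonglongrightarrow> m + 0" by (intro tendsto_intros LIMSEQ_Suc[OF lim_1_over_n])
      from LIMSEQ_subseq_LIMSEQ[OF this q(1)] show "(\<lambda>n. m + 1 / real (Suc (r n))) \<longlonglongrightarrow> m" by (simp add: o_def)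
      show "\<forall>\<^sub>F n in sequentially. H (s n) (t n) \<le> m + 1 / real (Suc (r n))"
        using p(3) by (intro always_eventually) (smt (verit) s_def t_def)
      show "\<forall>\<^sub>F n in sequentially. m \<le> H (s n) (t n)"
        using ge sD tD by (simp add: H_def)
    qed simp
    have Ez: "E (z n) \<le> ereal (H (s n) (t n))" for n
      unfolding z_def H_def using E_le sD tD by blast
    have Hlim': "(\<lambda>n. ereal (H (s n) (t n))) \<longlonglongrightarrow> ereal m" using Hlim by simp
    have min_unique: "x = \<gamma>" if "E x \<le> ereal m" for x
    proof -
      have "\<forall>y. E x \<le> E y" using gmin Egm that by (metis order_trans)
      then show ?thesis using argmin by blast
    qed
    \<comment> \<open>Lower semicontinuity of \<open>E\<close> is replaced by two arguments. Left of
      \<gamma> the function \<open>E\<close> is its convex envelope, so small values at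
      \<open>z n\<close> and at \<gamma> force a small value in between, at a second minimiser.
      Right of \<gamma> it is continuous.\<close>
    have zz: "zz = \<gamma>"
    proof (cases zz \<gamma> rule: linorder_cases)
      case less
      define w where "w = (zz + \<gamma>) / 2"
      have w: "zz < w" "w < \<gamma>" using less by (auto simp: w_def)
      have "E w \<le> ereal m"
      proof (rule tendsto_lowerbound[OF Hlim'])
        show "\<forall>\<^sub>F n in sequentially. E w \<le> ereal (H (s n) (t n))"
          using order_tendstoD(2)[OF zlim w(1)]
        proof eventually_elim
          case (elim n)
          have "E w \<le> max (E (z n)) (E \<gamma>)"
            using biconj_le_max[of "z n" w \<gamma> E] elim w by (simp flip: contact)
          also have "\<dots> = E (z n)" using gmin by (rule max_absorb1)
          also have "\<dots> \<le> ereal (H (s n) (t n))" by (rule Ez)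
          finally show ?case . 
        qed
      qed simp
      then show ?thesis using min_unique w by blast
    next
      case greater
      have zzD: "zz \<in> D" using greater gpos pos by auto
      have sub: "D \<subseteq> dom_pot E" using E_fin by (auto simp: dom_pot_def)
      have "continuous (at zz within dom_pot E) (\<lambda>z. real_of_ereal (E z))"
        using DERIV_continuous[OF bspec[OF D0 subsetD[OF sub zzD]]] .
      then have c0: "continuous (at zz within D) (\<lambda>z. real_of_ereal (E z))"
        using sub continuous_within_subset by blast
      have 1: "(\<lambda>n. real_of_ereal (E (z n))) \<longlonglongrightarrow> real_of_ereal (E zz)"
        using c0 zlim zD unfolding continuous_within_sequentially by (auto simp: o_def)
      have Er: "E x = ereal (real_of_ereal (E x))" if "x \<in> D" for x
        using E_fin[OF that] gmin[of x] Egm by (cases "E x") auto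
      have "real_of_ereal (E zz) \<le> m"
        by (rule LIMSEQ_le[OF 1 Hlim]) (metis Ez Er zD ereal_less_eq(3))
      then show ?thesis using min_unique[of zz] Er[OF zzD] by (metis ereal_less_eq(3))
    qed simp
    have sq: "fst q \<noteq> \<gamma>"
    proof
      assume "fst q = \<gamma>"
      then have "eventually (\<lambda>n. dist (s n) \<gamma> < \<delta>) sequentially" using slim that by (auto simp: tendsto_iff)
      then obtain n where "dist (s n) \<gamma> < \<delta>" using eventually_happens by fastforce
      then show False using p(4) by (simp add: s_def dist_real_def)
    qed
    \<comment> \<open>A limit point \<open>a\<close> outside \<open>D\<close> must be the left end
      of \<open>D\<close>: the domain is an upper set, so every term of the sequence exceeds
      \<open>a\<close> and every point beyond \<open>a\<close> lies in \<open>D\<close>.\<close>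
    have edge: False
      if "s' \<longlonglongrightarrow> a" "t' \<longlonglongrightarrow> 2 * \<gamma> - a" "a \<notin> D" "\<And>n. s' n \<in> D" "\<And>n. t' n \<in> D"
        "(\<lambda>n. H (s' n) (t' n)) \<longlonglongrightarrow> m" for s' t' a
    proof -
      have a0: "a \<le> 0" using that(3) pos[of a] by (meson not_le)
      have up: "x \<in> D" if "a < x" for x
      proof -
        have "eventually (\<lambda>n. s' n < x) sequentially" using order_tendstoD(2)[OF \<open>s' \<longlonglongrightarrow> a\<close> that] .
        then obtain n where "s' n < x" using eventually_happens by fastforce
        then show ?thesis using between[OF \<open>\<And>n. s' n \<in> D\<close>[of n]] by simp
      qed
      have sa: "a < s' n" for n using between[OF that(4)[of n], of a] that(3) by (meson not_le)
      have at: "at x within D = at x" if "a < x" for x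
        using at_in[OF disjI2 that] up by blast
      show False
      proof (rule no_escape_to_endpoint[of D m j2 j1 \<gamma> a "D1 \<gamma>" "D2 \<gamma>" s' t'])
        show "isCont j1 x" if "a < x" for x using cont1[OF up[OF that]] at[OF that] by simp
        show "isCont j2 x" if "a < x" for x using cont2[OF up[OF that]] at[OF that] by simp
        show "(j1 has_real_derivative D1 \<gamma>) (at \<gamma>)" "(j2 has_real_derivative D2 \<gamma>) (at \<gamma>)"
          using bspec[OF D1 gD] bspec[OF D2 gD] at[of \<gamma>] a0 gpos by auto
      qed (use ge eqm strict up a0 gpos that sa in \<open>auto simp: H_def\<close>)
    qed
    have sum2: "fst q + snd q = 2 * \<gamma>" using zz by (simp add: zz_def)
    show False
    proof (cases "fst q \<in> D \<and> snd q \<in> D")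
      case False
      then consider "fst q \<notin> D" | "snd q \<notin> D" by blast
      then show False
      proof cases
        case 1
        have "2 * \<gamma> - fst q = snd q" using sum2 by simp
        then show False using edge[OF slim _ 1, of t] tlim sD tD Hlim by simp
      next
        case 2
        have "(\<lambda>n. H (t n) (s n)) = (\<lambda>n. H (s n) (t n))" by (auto simp: H_def add.commute)
        moreover have "2 * \<gamma> - snd q = fst q" using sum2 by simp
        ultimately show False
          using edge[OF tlim _ 2, of s] slim sD tD Hlim by simp
      qed
    next
      case True
      have "(\<lambda>n. j1 (s n)) \<longlonglongrightarrow> j1 (fst q)" "(\<lambda>n. j1 (t n)) \<longlonglongrightarrow> j1 (snd q)" "(\<lambda>n. j2 (z n)) \<longlonglongrightarrow> j2 zz"
        using cont1[of "fst q"] cont1[of "snd q"] cont2[of zz] True mid slim tlim zlim sD tD zD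
        unfolding continuous_within_sequentially by (auto simp: o_def zz_def)
      then have "(\<lambda>n. j2 (z n) + j1 (s n) / 2 + j1 (t n) / 2) \<longlonglongrightarrow> j2 \<gamma> + j1 (fst q) / 2 + j1 (snd q) / 2"
        unfolding zz by (intro tendsto_intros) auto
      then have eq: "j2 \<gamma> + j1 (fst q) / 2 + j1 (snd q) / 2 = m"
        using Hlim unfolding H_def z_def by (rule LIMSEQ_unique)
      have "fst q = \<gamma>"
      proof (rule strictly_convex_midpoint_of_LJ2(2)[OF LJ2])
        show "J0 J1 J2 \<gamma> = biconj (J0 J1 J2) \<gamma>" using contact by (simp add: E_def)
        show "J0 J1 J2 \<gamma> < \<infinity>" using Egm by (simp add: E_def)
        show "J0 J1 J2 \<gamma> = J2 \<gamma> + ereal (1/2) * (J1 (fst q) + J1 (snd q))"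
          using Egm eq True by (simp add: E_def J1D J2D gD algebra_simps add_divide_distrib)
      qed (rule sum2)
      then show False using sq by simp
    qed
  qed
  show "lj_potentials J1 J2 (dom_pot J1) \<gamma> (real_of_ereal (J0 J1 J2 \<gamma>))
    (\<lambda>z. real_of_ereal (J1 z)) (\<lambda>z. real_of_ereal (J2 z))"
    unfolding D_def[symmetric] E_def[symmetric] j1_def[symmetric] j2_def[symmetric] m_def[symmetric]
  proof (unfold_locales, fold E_def)
    have "at \<gamma> within D = at \<gamma>" using at_in[of 0 \<gamma>] pos gpos by auto
    then show "isCont j1 \<gamma>" "isCont j2 \<gamma>" using cont1[OF gD] cont2[OF gD] by auto
    show "\<exists>c. \<forall>s\<in>D. - c \<le> j1 s \<and> - c \<le> j2 s" using lb by blast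
  qed (use J1D J2D J1n J2n Egm pos mid gpos \<open>m < 0\<close> ge eqm well Jlim coer in auto)
  show "\<gamma> \<le> l \<Longrightarrow> biconj (J0 J1 J2) l = J0 J1 J2 \<gamma>" using biconj_l by (simp add: E_def)
qed

section \<open>Cell energies, chains of interactions, and layer energies\<close>

context lj_potentials
begin

definition F :: "real \<Rightarrow> real \<Rightarrow> real" where
  "F s t = j2 ((s + t) / 2) + j1 s / 2 + j1 t / 2 - m"

definition G :: "real \<Rightarrow> real" where
  "G s = j1 s + j2 s - m"

text \<open>The sum counts interactions, not bonds: the slopes \<open>s a\<close> up to and
  including \<open>s b\<close> take part, and two consecutive paths share the bond at which they
  meet.\<close>

definition path :: "(nat \<Rightarrow> real) \<Rightarrow> nat \<Rightarrow> nat \<Rightarrow> real" where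
  "path s a b = (\<Sum>i\<in>{a..<b}. F (s i) (s (Suc i)))"

lemma F_nonneg: "s \<in> D \<Longrightarrow> t \<in> D \<Longrightarrow> 0 \<le> F s t"
  using pair_ge[of s t] by (simp add: F_def)

lemma F_commute: "F s t = F t s"
  by (simp add: F_def add.commute add.left_commute)

lemma F_diag: "F s s = G s"
  by (simp add: F_def G_def)

lemma G_nonneg: "s \<in> D \<Longrightarrow> 0 \<le> G s"
  using F_nonneg[of s s] by (simp add: F_diag)

lemma G_gamma [simp]: "G \<gamma> = 0" and F_gamma [simp]: "F \<gamma> \<gamma> = 0"
  using pair_gamma by (simp_all add: F_diag G_def)

lemma gamma_in: "\<gamma> \<in> D" using gamma_pos pos_in by blast

lemma F_well:
  assumes "0 < \<delta>"
  obtains \<eta> where "0 < \<eta>" "\<And>s t. s \<in> D \<Longrightarrow> t \<in> D \<Longrightarrow> F s t < \<eta> \<Longrightarrow> \<bar>s - \<gamma>\<bar> < \<delta>"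
    "\<And>s. s \<in> D \<Longrightarrow> G s < \<eta> \<Longrightarrow> \<bar>s - \<gamma>\<bar> < \<delta>"
proof -
  obtain \<eta> where \<eta>: "0 < \<eta>" "\<forall>s\<in>D. \<forall>t\<in>D. F s t < \<eta> \<longrightarrow> \<bar>s - \<gamma>\<bar> < \<delta>"
    using pair_well[OF assms] unfolding F_def by blast
  show thesis
    by (rule that[OF \<eta>(1)]) (use \<eta>(2) in \<open>auto simp flip: F_diag\<close>)
qed

lemma F_small:
  assumes "0 < \<epsilon>"
  obtains \<delta> where "0 < \<delta>" "\<And>s. \<bar>s - \<gamma>\<bar> < \<delta> \<Longrightarrow> F s \<gamma> < \<epsilon>"
proof -
  have "isCont (\<lambda>s. F s \<gamma>) \<gamma>"
  proof -
    have "isCont (\<lambda>s. j2 ((s + \<gamma>) / 2)) \<gamma>"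
      by (rule isCont_o2[where f = "\<lambda>s. (s + \<gamma>) / 2"]) (auto intro!: continuous_intros cont_gamma)
    then show ?thesis unfolding F_def by (intro continuous_intros cont_gamma) auto
  qed
  then have "((\<lambda>s. F s \<gamma>) \<longlongrightarrow> 0) (at \<gamma>)" by (simp add: isCont_def)
  then have "eventually (\<lambda>s. F s \<gamma> < \<epsilon>) (at \<gamma>)" by (rule order_tendstoD(2)) (rule assms)
  then obtain d where d: "d > 0" "\<And>s. s \<noteq> \<gamma> \<Longrightarrow> dist s \<gamma> < d \<Longrightarrow> F s \<gamma> < \<epsilon>"
    unfolding eventually_at by auto
  show thesis
  proof (rule that[OF d(1)])
    show "F s \<gamma> < \<epsilon>" if "\<bar>s - \<gamma>\<bar> < d" for s
      using d(2)[of s] that assms by (cases "s = \<gamma>") (auto simp: dist_real_def)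
  qed
qed

lemma lower_const:
  obtains c where "0 \<le> c" "\<And>s. s \<in> D \<Longrightarrow> - c \<le> j1 s" "\<And>s. s \<in> D \<Longrightarrow> - c \<le> j2 s"
proof -
  obtain c where c: "\<forall>s\<in>D. - c \<le> j1 s \<and> - c \<le> j2 s" using lower_bound by blast
  show thesis by (rule that[of "\<bar>c\<bar>"]) (use c in \<open>fastforce+\<close>)
qed

lemma slope_ge_of_energy:
  obtains K where "\<And>s t. s \<in> D \<Longrightarrow> t \<in> D \<Longrightarrow> F s t \<le> C \<Longrightarrow> - K \<le> s"
proof -
  obtain c where c: "0 \<le> c" "\<And>s. s \<in> D \<Longrightarrow> - c \<le> j1 s" "\<And>s. s \<in> D \<Longrightarrow> - c \<le> j2 s"
    using lower_const by blast
  \<comment> \<open>From \<open>F s t \<le> C\<close> one gets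
    \<open>j1 s \<le> 2 * (C + m) - 2 * j2 ((s + t) / 2) - j1 t\<close>, and the last two terms are
    at most \<open>3 * c\<close>.\<close>
  obtain K where K: "\<forall>s\<in>D. j1 s \<le> 2 * (C + m) + 3 * c \<longrightarrow> - K \<le> s" using coercive by blast
  show thesis
  proof (rule that)
    fix s t assume st: "s \<in> D" "t \<in> D" "F s t \<le> C"
    have "j1 s \<le> 2 * (C + m) + 3 * c"
      using st(3) c(2)[OF st(2)] c(3)[OF mid_in[OF st(1,2)]] by (simp add: F_def)
    then show "- K \<le> s" using K st by blast
  qed
qed

text \<open>A steep bond \<open>h\<close> interacts with its neighbour only through the surface term
  \<open>j1 s / 2\<close>. Uniformity in \<open>s\<close> needs just \<open>- K \<le> s\<close>, for
  then \<open>h \<ge> 2 * a + K\<close> forces the average beyond \<open>a\<close>, where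
  \<open>j2\<close> is small. The free threshold \<open>N\<close> lets the user separate steep bonds
  from prescribed slopes.\<close>

lemma jump_lower:
  assumes "0 < \<epsilon>"
  obtains M where "\<And>s h. - K \<le> s \<Longrightarrow> M \<le> h \<Longrightarrow> j1 s / 2 - m - \<epsilon> \<le> F s h" "\<And>h. M \<le> h \<Longrightarrow> - m - \<epsilon> \<le> G h"
    "N \<le> M"
proof -
  have "eventually (\<lambda>z. j1 z > - \<epsilon> / 2) at_top" "eventually (\<lambda>z. j2 z > - \<epsilon> / 2) at_top"
    using lim_top by (auto intro!: order_tendstoD[where y = 0] simp: assms)
  then obtain a where a: "\<And>z. z \<ge> a \<Longrightarrow> j1 z > - \<epsilon> / 2 \<and> j2 z > - \<epsilon> / 2"
    by (auto simp: eventually_at_top_linorder) (metis max.bounded_iff)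
  show thesis
  proof (rule that[where M = "max N (max a (2 * a + K))"])
    show "j1 s / 2 - m - \<epsilon> \<le> F s h" if "- K \<le> s" "max N (max a (2 * a + K)) \<le> h" for s h
      using a[of h] a[of "(s + h) / 2"] that assms by (simp add: F_def)
    show "- m - \<epsilon> \<le> G h" if "max N (max a (2 * a + K)) \<le> h" for h
      using a[of h] that assms by (simp add: G_def)
  qed simp
qed

lemma jump_upper:
  assumes "0 < \<epsilon>"
  obtains H where "0 < H" "\<And>h. H \<le> h \<Longrightarrow> F s h \<le> j1 s / 2 - m + \<epsilon>" "\<And>h. H \<le> h \<Longrightarrow> G h \<le> - m + \<epsilon>"
proof -
  have "eventually (\<lambda>z. j1 z < \<epsilon> / 2) at_top" "eventually (\<lambda>z. j2 z < \<epsilon> / 2) at_top"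
    using order_tendstoD(2)[OF lim_top(1), of "\<epsilon> / 2"] order_tendstoD(2)[OF lim_top(2), of "\<epsilon> / 2"] assms by simp_all
  then obtain a where a: "\<And>z. z \<ge> a \<Longrightarrow> j1 z < \<epsilon> / 2 \<and> j2 z < \<epsilon> / 2"
    by (auto simp: eventually_at_top_linorder) (metis max.bounded_iff)
  show thesis
  proof (rule that[where H = "max 1 (max a (2 * a - s))"])
    show "F s h \<le> j1 s / 2 - m + \<epsilon>" if "max 1 (max a (2 * a - s)) \<le> h" for h
      using a[of h] a[of "(s + h) / 2"] that assms by (simp add: F_def)
    show "G h \<le> - m + \<epsilon>" if "max 1 (max a (2 * a - s)) \<le> h" for h
      using a[of h] that by (simp add: G_def)
  qed simp
qed

lemma path_split: "a \<le> b \<Longrightarrow> b \<le> c \<Longrightarrow> path s a c = path s a b + path s b c"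
  by (simp add: path_def sum.atLeastLessThan_concat)

lemma path_empty [simp]: "path s a a = 0"
  by (simp add: path_def)

lemma path_step: "path s a (Suc a) = F (s a) (s (Suc a))"
  by (simp add: path_def)

lemma path_shift: "(\<And>i. i \<le> n \<Longrightarrow> s (a + i) = t i) \<Longrightarrow> path s a (a + n) = path t 0 n"
proof -
  assume st: "\<And>i. i \<le> n \<Longrightarrow> s (a + i) = t i"
  have "path s a (a + n) = (\<Sum>i\<in>{0..<n}. F (s (a + i)) (s (Suc (a + i))))"
    unfolding path_def using sum.shift_bounds_nat_ivl[of "\<lambda>i. F (s i) (s (Suc i))" 0 a n]
    by (simp add: add.commute)
  also have "\<dots> = path t 0 n"
    unfolding path_def by (intro sum.cong refl) (metis Suc_leI add_Suc_right atLeastLessThan_iff less_imp_le st)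
  finally show ?thesis .
qed

text \<open>Symmetry of \<open>F\<close>. This is what allows the right end of the chain, and layers
  written outward from a crack, to be treated as left ends.\<close>

lemma path_rev: "(\<And>i. i \<le> n \<Longrightarrow> s (a + i) = t (n - i)) \<Longrightarrow> path s a (a + n) = path t 0 n"
proof -
  assume st: "\<And>i. i \<le> n \<Longrightarrow> s (a + i) = t (n - i)"
  have "path s a (a + n) = path (\<lambda>i. t (n - i)) 0 n"
    by (rule path_shift) (rule st)
  also have "\<dots> = (\<Sum>i\<in>{..<n}. F (t (Suc (n - Suc i))) (t (n - Suc i)))"
    unfolding path_def atLeast0LessThan by (intro sum.cong refl) (simp add: Suc_diff_Suc)
  also have "\<dots> = (\<Sum>i\<in>{..<n}. F (t i) (t (Suc i)))"
    using sum.nat_diff_reindex[of "\<lambda>i. F (t i) (t (Suc i))" n] by (simp add: F_commute)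
  finally show ?thesis by (simp add: path_def atLeast0LessThan)
qed

lemma path_gamma_tail: "(\<And>i. N \<le> i \<Longrightarrow> t i = \<gamma>) \<Longrightarrow> N \<le> n \<Longrightarrow> path t 0 n = path t 0 N"
proof -
  assume t: "\<And>i. N \<le> i \<Longrightarrow> t i = \<gamma>" and n: "N \<le> n"
  have "path t N n = 0" unfolding path_def by (rule sum.neutral) (auto simp: t)
  then show ?thesis using path_split[of 0 N n t] n by simp
qed

lemma path_nonneg: "(\<And>i. a \<le> i \<Longrightarrow> i \<le> b \<Longrightarrow> s i \<in> D) \<Longrightarrow> 0 \<le> path s a b"
  unfolding path_def by (rule sum_nonneg) (auto intro!: F_nonneg)

subsection \<open>Boundary layer energies in terms of slopes\<close>

definition nodes :: "(nat \<Rightarrow> real) \<Rightarrow> nat \<Rightarrow> real" where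
  "nodes t i = (\<Sum>j<i. t j)"

lemma nodes_0 [simp]: "nodes t 0 = 0" by (simp add: nodes_def)

lemma nodes_step: "nodes t (Suc i) - nodes t i = t i" by (simp add: nodes_def)

lemma bl_term_real:
  assumes "v (i+1) - v i = t i" "v (i+2) - v (i+1) = t (Suc i)" "t i \<in> D" "t (Suc i) \<in> D"
  shows "bl_term J1 J2 \<gamma> v i = ereal (F (t i) (t (Suc i)))"
proof -
  have "v (i+2) - v i = t i + t (Suc i)" using assms(1,2) by linarith
  then show ?thesis unfolding bl_term_def using assms J0_gamma mid_in[OF assms(3,4)]
    by (simp add: J1_in J2_in F_def algebra_simps)
qed

lemma bl_term_infty:
  assumes "v (i+1) - v i \<notin> D \<or> v (i+2) - v (i+1) \<notin> D"
  shows "bl_term J1 J2 \<gamma> v i = \<infinity>"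
proof -
  have "J1 z \<noteq> -\<infinity>" "J2 z \<noteq> -\<infinity>" for z
    by (cases "z \<in> D"; simp add: J1_in J2_in J1_out J2_out)+
  then show ?thesis unfolding bl_term_def using assms J0_gamma
    by (cases "J2 ((v (i+2) - v i) / 2)"; cases "J1 (v (i+2) - v (i+1))"; cases "J1 (v (i+1) - v i)")
       (auto simp: J1_out)
qed

lemma bl_sum_real:
  assumes "\<And>i. i \<le> k \<Longrightarrow> v (i+1) - v i = t i" "\<And>i. i \<le> k \<Longrightarrow> t i \<in> D"
  shows "(\<Sum>i<k. bl_term J1 J2 \<gamma> v i) = ereal (path t 0 k)"
proof -
  have "bl_term J1 J2 \<gamma> v i = ereal (F (t i) (t (Suc i)))" if "i < k" for i
    using assms[of i] assms[of "Suc i"] that by (intro bl_term_real) auto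
  then show ?thesis by (simp add: path_def atLeast0LessThan)
qed

lemma bl_term_not_MInf: "bl_term J1 J2 \<gamma> v i \<noteq> -\<infinity>"
proof (cases "v (i+1) - v i \<in> D \<and> v (i+2) - v (i+1) \<in> D")
  case True
  then show ?thesis
    using bl_term_real[of v i "\<lambda>j. if j = i then v (i+1) - v i else v (i+2) - v (i+1)"] by simp
next
  case False
  then show ?thesis using bl_term_infty[of v i] by auto
qed

lemma bl_sum_finite_imp:
  assumes "(\<Sum>i<k. bl_term J1 J2 \<gamma> v i) < \<infinity>" "i < k"
  shows "v (i+1) - v i \<in> D" "v (i+2) - v (i+1) \<in> D"
proof -
  have "bl_term J1 J2 \<gamma> v i \<noteq> \<infinity>"
    using assms sum_Pinfty[of "bl_term J1 J2 \<gamma> v" "{..<k}"] by auto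
  then show "v (i+1) - v i \<in> D" "v (i+2) - v (i+1) \<in> D"
    using bl_term_infty[of v i] by blast+
qed

lemma bl_sum_not_MInf: "(\<Sum>i<k. bl_term J1 J2 \<gamma> v i) \<noteq> -\<infinity>"
  by (induction k) (use bl_term_not_MInf[of v] in auto)

text \<open>Past \<open>N\<close> all slopes equal \<gamma> and each term is
  \<open>F \<gamma> \<gamma> = 0\<close>, so the partial sums are stationary and the limit in the
  definition of the series exists.\<close>

lemma bl_series_eventually:
  assumes "\<forall>i\<ge>N. v (i+1) - v i = \<gamma>"
  shows "bl_series J1 J2 \<gamma> v = (\<Sum>i<N. bl_term J1 J2 \<gamma> v i)"
proof -
  have z: "bl_term J1 J2 \<gamma> v i = 0" if "N \<le> i" for i
  proof -
    have "i + 1 + 1 = i + 2" by simp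
    then have "v (i+1) - v i = \<gamma>" "v (i+2) - v (i+1) = \<gamma>"
      using assms[rule_format, of i] assms[rule_format, of "i+1"] that by (simp_all only: trans_le_add1)
    then have "bl_term J1 J2 \<gamma> v i = ereal (F \<gamma> \<gamma>)"
      using bl_term_real[where t = "\<lambda>_. \<gamma>"] gamma_in by blast
    then show ?thesis by simp
  qed
  have "(\<Sum>i<M. bl_term J1 J2 \<gamma> v i) = (\<Sum>i<N. bl_term J1 J2 \<gamma> v i)" if "N \<le> M" for M
    
    using z by (intro sum.mono_neutral_right) (use that in \<open>simp_all add: lessThan_subset_iff\<close>)
  then have "(\<lambda>M. \<Sum>i<M. bl_term J1 J2 \<gamma> v i) \<longlonglongrightarrow> (\<Sum>i<N. bl_term J1 J2 \<gamma> v i)"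
    by (intro tendsto_eventually) (unfold eventually_at_top_linorder, blast)
  then show ?thesis unfolding bl_series_def by (rule limI)
qed

lemma half_J1_not_MInf: "ereal (1/2) * J1 z \<noteq> -\<infinity>"
  by (cases "z \<in> D") (simp_all add: J1_in J1_out)

lemma half_J1_finite_imp: "ereal (1/2) * J1 z < \<infinity> \<Longrightarrow> z \<in> D"
  by (cases "z \<in> D") (simp_all add: J1_out)

lemma Inf_less_ex: "Inf X < (a::ereal) \<Longrightarrow> \<exists>x\<in>X. x < a"
  by (simp add: Inf_less_iff)

text \<open>No term is minus infinity, so a finite total forces every slope into \<open>D\<close>.
  The first slope is obtained from the \<open>J1\<close> term, which also covers
  \<open>k = 0\<close>.\<close>

lemma layer_element_real:
  assumes lt: "ereal (1/2) * J1 (v 1 - v 0) + (\<Sum>i<k. bl_term J1 J2 \<gamma> v i) < ereal A"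
  shows "\<And>i. i \<le> k \<Longrightarrow> v (i+1) - v i \<in> D"
    and "j1 (v 1 - v 0) / 2 + path (\<lambda>i. v (i+1) - v i) 0 k < A"
proof -
  have fin: "ereal (1/2) * J1 (v 1 - v 0) < \<infinity>" "(\<Sum>i<k. bl_term J1 J2 \<gamma> v i) < \<infinity>"
    using lt half_J1_not_MInf[of "v 1 - v 0"] bl_sum_not_MInf[of v k]
    by (cases "ereal (1/2) * J1 (v 1 - v 0)"; cases "\<Sum>i<k. bl_term J1 J2 \<gamma> v i"; simp)+
  have D0: "v 1 - v 0 \<in> D" using half_J1_finite_imp[OF fin(1)] .
  show Di: "v (i+1) - v i \<in> D" if "i \<le> k" for i
  proof (cases i)
    case 0
    then show ?thesis using D0 by simp
  next
    case (Suc j)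
    then show ?thesis using bl_sum_finite_imp(2)[OF fin(2), of j] that by simp
  qed
  show "j1 (v 1 - v 0) / 2 + path (\<lambda>i. v (i+1) - v i) 0 k < A"
    using lt bl_sum_real[of k v "\<lambda>i. v (i+1) - v i"] Di D0 by (simp add: J1_in)
qed

text \<open>Stop the chain after bond \<open>P\<close> and continue with slope \<gamma>; the only
  additional cost is the interaction \<open>F (t P) \<gamma>\<close>. The same competitor serves
  \<open>B_gamma\<close>, whose first slope is free.\<close>

lemma B_theta_le:
  assumes "t 0 = \<theta>" "\<And>i. i \<le> P \<Longrightarrow> t i \<in> D" "F (t P) \<gamma> \<le> \<epsilon>"
  shows "B_theta J1 J2 \<gamma> \<theta> \<le> ereal (j1 \<theta> / 2 + path t 0 P + \<epsilon>)"
    and "B_gamma J1 J2 \<gamma> \<le> ereal (j1 \<theta> / 2 + path t 0 P + \<epsilon>)"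
proof -
  define t' where "t' i = (if i \<le> P then t i else \<gamma>)" for i
  define v where "v = nodes t'"
  have v: "v (i+1) - v i = t' i" for i by (simp add: v_def nodes_step)
  have tail: "\<forall>i\<ge>Suc P. v (i+1) - v i = \<gamma>" unfolding v by (simp add: t'_def)
  have D': "t' i \<in> D" for i using assms(2) gamma_in by (simp add: t'_def)
  have v1: "v 0 = 0" "v 1 = \<theta>" using v[of 0] assms(1) by (simp_all add: v_def t'_def)
  have "path t' 0 (Suc P) = path t' 0 P + F (t' P) (t' (Suc P))"
    using path_split[of 0 P "Suc P" t'] by (simp add: path_step)
  also have "path t' 0 P = path t 0 P" using path_shift[of P t' 0 t] by (simp add: t'_def)
  finally have p: "path t' 0 (Suc P) = path t 0 P + F (t P) \<gamma>" by (simp add: t'_def[of P] t'_def[of "Suc P"])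
  have "bl_series J1 J2 \<gamma> v = ereal (path t' 0 (Suc P))"
    using bl_series_eventually[of "Suc P" v] tail bl_sum_real[of "Suc P" v t'] v D' by simp
  then have e: "ereal (1/2) * J1 (v 1 - v 0) + bl_series J1 J2 \<gamma> v = ereal (j1 \<theta> / 2 + path t 0 P + F (t P) \<gamma>)"
    using v1 D'[of 0] assms(1) by (simp add: J1_in p t'_def)
  have "B_theta J1 J2 \<gamma> \<theta> \<le> ereal (1/2) * J1 (v 1 - v 0) + bl_series J1 J2 \<gamma> v"
    unfolding B_theta_def by (rule Inf_lower) (use v1 tail in blast)
  then show "B_theta J1 J2 \<gamma> \<theta> \<le> ereal (j1 \<theta> / 2 + path t 0 P + \<epsilon>)"
    unfolding e using assms(3) by (simp add: order_trans[OF _ iffD2[OF ereal_less_eq(3)]])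
  have "B_gamma J1 J2 \<gamma> \<le> ereal (1/2) * J1 (v 1 - v 0) + bl_series J1 J2 \<gamma> v"
    unfolding B_gamma_def by (rule Inf_lower) (use v1 tail in blast)
  then show "B_gamma J1 J2 \<gamma> \<le> ereal (j1 \<theta> / 2 + path t 0 P + \<epsilon>)"
    unfolding e using assms(3) by (simp add: order_trans[OF _ iffD2[OF ereal_less_eq(3)]])
qed

text \<open>In \<open>B_b\<close> the prescribed slope belongs to the last bond. Here bonds are
  numbered from the boundary inward, so the competitor is the reversed chain, shifted to vanish at
  node \<open>k + 1\<close>.\<close>

lemma B_b_le:
  assumes "t 0 = \<theta>" "\<And>i. i \<le> k \<Longrightarrow> t i \<in> D"
  shows "B_b J1 J2 \<gamma> \<theta> \<le> ereal (j1 (t k) / 2 + path t 0 k)"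
proof -
  define t' where "t' i = t (k - i)" for i
  define v where "v i = nodes t' i - nodes t' (k + 1)" for i
  have v: "v (i+1) - v i = t' i" for i by (simp add: v_def nodes_step)
  have "path t' 0 (0 + k) = path t 0 k" by (rule path_rev) (simp add: t'_def)
  then have e: "ereal (1/2) * J1 (v 1 - v 0) + (\<Sum>i<k. bl_term J1 J2 \<gamma> v i) = ereal (j1 (t k) / 2 + path t 0 k)"
    using bl_sum_real[of k v t'] v v[of 0] assms(2) by (simp add: t'_def J1_in)
  have "v (k+1) = 0 \<and> v (k+1) - v k = \<theta>" using v[of k] assms(1) by (simp add: v_def t'_def)
  then have "B_b J1 J2 \<gamma> \<theta> \<le> ereal (1/2) * J1 (v 1 - v 0) + (\<Sum>i<k. bl_term J1 J2 \<gamma> v i)"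
    unfolding B_b_def by (intro Inf_lower) blast
  then show ?thesis unfolding e .
qed

text \<open>The weight \<open>q + 1/2\<close> belongs to an element of \<open>q + 1\<close> bonds
  that starts at the interface: its first bond counts \<open>G / 2\<close>, the other
  \<open>q\<close> bonds count fully.\<close>

lemma B_IF_nat_le:
  assumes "\<And>i. i \<le> k \<Longrightarrow> t i \<in> D"
  shows "B_IF_nat J1 J2 \<gamma> q \<le> ereal (j1 (t 0) / 2 + path t 0 k + (real q + 1/2) * G (t k))"
proof -
  define v where "v = nodes t"
  have v: "v (i+1) - v i = t i" for i by (simp add: v_def nodes_step)
  have e: "ereal (1/2) * J1 (v 1 - v 0) + (\<Sum>i<k. bl_term J1 J2 \<gamma> v i)
       + ereal ((2 * real q + 1) / 2) * (J_CB J1 J2 (v (k+1) - v k) - J0 J1 J2 \<gamma>)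
     = ereal (j1 (t 0) / 2 + path t 0 k + (real q + 1/2) * G (t k))"
    using bl_sum_real[of k v t] v v[of 0] v[of k] assms J0_gamma
    by (simp add: J_CB_def J1_in J2_in G_def add_divide_distrib)
  have "v 0 = 0" by (simp add: v_def)
  then have "B_IF_nat J1 J2 \<gamma> q \<le> ereal (1/2) * J1 (v 1 - v 0) + (\<Sum>i<k. bl_term J1 J2 \<gamma> v i)
       + ereal ((2 * real q + 1) / 2) * (J_CB J1 J2 (v (k+1) - v k) - J0 J1 J2 \<gamma>)"
    unfolding B_IF_nat_def by (intro Inf_lower) blast
  then show ?thesis unfolding e .
qed

lemma B_theta_ex:
  assumes "B_theta J1 J2 \<gamma> \<theta> < ereal A"
  obtains t N where "t 0 = \<theta>" "\<And>i. t i \<in> D" "\<And>i. N \<le> i \<Longrightarrow> t i = \<gamma>" "j1 \<theta> / 2 + path t 0 N < A"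
proof -
  obtain v N where v: "v 0 = 0" "v 1 = \<theta>" "\<forall>i\<ge>N. v (i+1) - v i = \<gamma>"
    "ereal (1/2) * J1 (v 1 - v 0) + bl_series J1 J2 \<gamma> v < ereal A"
    using Inf_less_ex[OF assms[unfolded B_theta_def]] by blast
  note le = layer_element_real[OF v(4)[unfolded bl_series_eventually[OF v(3)]]]
  show thesis
  proof (rule that[of "\<lambda>i. v (i+1) - v i" N])
    show "v (i+1) - v i \<in> D" for i using le(1)[of i] v(3) gamma_in by (cases "i \<le> N") auto
  qed (use v le(2) in auto)
qed

lemma B_gamma_ex:
  assumes "B_gamma J1 J2 \<gamma> < ereal A"
  obtains t N where "\<And>i. t i \<in> D" "\<And>i. N \<le> i \<Longrightarrow> t i = \<gamma>" "j1 (t 0) / 2 + path t 0 N < A"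
proof -
  obtain v N where v: "v 0 = 0" "\<forall>i\<ge>N. v (i+1) - v i = \<gamma>"
    "ereal (1/2) * J1 (v 1 - v 0) + bl_series J1 J2 \<gamma> v < ereal A"
    using Inf_less_ex[OF assms[unfolded B_gamma_def]] by blast
  note le = layer_element_real[OF v(3)[unfolded bl_series_eventually[OF v(2)]]]
  show thesis
  proof (rule that[of "\<lambda>i. v (i+1) - v i" N])
    show "v (i+1) - v i \<in> D" for i using le(1)[of i] v(2) gamma_in by (cases "i \<le> N") auto
  qed (use v le(2) in auto)
qed

lemma B_b_ex:
  assumes "B_b J1 J2 \<gamma> \<theta> < ereal A"
  obtains t k where "t 0 = \<theta>" "\<And>i. t i \<in> D" "j1 (t k) / 2 + path t 0 k < A"
proof -
  obtain v k where v: "v (k+1) = 0" "v (k+1) - v k = \<theta>"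
    "ereal (1/2) * J1 (v 1 - v 0) + (\<Sum>i<k. bl_term J1 J2 \<gamma> v i) < ereal A"
    using Inf_less_ex[OF assms[unfolded B_b_def]] by blast
  note le = layer_element_real[OF v(3)]
  \<comment> \<open>For \<open>i > k\<close> truncated subtraction returns the slope
    \<open>v 1 - v 0\<close>, so all values of \<open>t\<close> lie in \<open>D\<close>.\<close>
  define t where "t i = v (k - i + 1) - v (k - i)" for i
  have "path t 0 (0 + k) = path (\<lambda>i. v (i+1) - v i) 0 k" by (rule path_rev) (simp add: t_def)
  then show thesis
    using that[of t k] v le by (simp add: t_def)
qed

lemma B_IF_nat_ex:
  assumes "B_IF_nat J1 J2 \<gamma> q < ereal A"
  obtains t k where "\<And>i. t i \<in> D" "j1 (t 0) / 2 + path t 0 k + (real q + 1/2) * G (t k) < A"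
proof -
  obtain v k where v: "v 0 = 0"
    "ereal (1/2) * J1 (v 1 - v 0) + (\<Sum>i<k. bl_term J1 J2 \<gamma> v i)
       + ereal ((2 * real q + 1) / 2) * (J_CB J1 J2 (v (k+1) - v k) - J0 J1 J2 \<gamma>) < ereal A"
    using Inf_less_ex[OF assms[unfolded B_IF_nat_def]] by blast
  define X where "X = ereal (1/2) * J1 (v 1 - v 0) + (\<Sum>i<k. bl_term J1 J2 \<gamma> v i)"
  define Y where "Y = J_CB J1 J2 (v (k+1) - v k) - J0 J1 J2 \<gamma>"
  have X: "X \<noteq> -\<infinity>" unfolding X_def using half_J1_not_MInf bl_sum_not_MInf by simp
  have Y: "Y = (if v (k+1) - v k \<in> D then ereal (G (v (k+1) - v k)) else \<infinity>)"
    by (simp add: Y_def J_CB_def J1_in J2_in J1_out J2_out J0_gamma G_def)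
  have vk: "v (k+1) - v k \<in> D"
  proof (rule ccontr)
    assume "v (k+1) - v k \<notin> D"
    then have "ereal ((2 * real q + 1) / 2) * Y = \<infinity>" by (simp add: Y)
    then show False using v(2) X unfolding X_def[symmetric] Y_def[symmetric] by simp
  qed
  then have "X + ereal ((real q + 1/2) * G (v (k+1) - v k)) < ereal A"
    using v(2) unfolding X_def[symmetric] Y_def[symmetric] by (simp add: Y add_divide_distrib)
  then have XA: "X < ereal (A - (real q + 1/2) * G (v (k+1) - v k))"
    using X by (cases X) auto
  note le = layer_element_real[OF XA[unfolded X_def]]
  \<comment> \<open>Beyond bond \<open>k\<close> nothing is known about \<open>v\<close>; the
    default \<gamma> keeps every value in \<open>D\<close>.\<close>
  define t where "t i = (if i \<le> k then v (i+1) - v i else \<gamma>)" for i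
  have "path t 0 k = path (\<lambda>i. v (i+1) - v i) 0 k" using path_shift[of k t 0 "\<lambda>i. v (i+1) - v i"] by (simp add: t_def)
  then show thesis
    using that[of t k] le gamma_in by (simp add: t_def)
qed

end

section \<open>Finite layer energies and lower bounds at one end of the chain\<close>

lemma ereal_ge_of_less: "(\<And>A. X < ereal A \<Longrightarrow> c \<le> A) \<Longrightarrow> ereal c \<le> X"
  by (metis ereal_dense2 ereal_less_eq(3) leD not_le_imp_less)

lemma ereal_real_of_bounds: "ereal a \<le> X \<Longrightarrow> X \<le> ereal b \<Longrightarrow> X = ereal (real_of_ereal X)"
  by (cases X) auto

lemma less_plus_ereal_iff: "ereal A < X + ereal r \<longleftrightarrow> ereal (A - r) < X"
  by (cases X) (auto simp: algebra_simps)

lemma plus_ereal_less_iff: "X + ereal r < ereal A \<longleftrightarrow> X < ereal (A - r)"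
  by (cases X) (auto simp: algebra_simps)

context lj_potentials
begin

abbreviation "b_gamma \<equiv> real_of_ereal (B_gamma J1 J2 \<gamma>)"
abbreviation "b_theta \<theta> \<equiv> real_of_ereal (B_theta J1 J2 \<gamma> \<theta>)"
abbreviation "b_b \<theta> \<equiv> real_of_ereal (B_b J1 J2 \<gamma> \<theta>)"
abbreviation "b_IF q \<equiv> real_of_ereal (B_IF_nat J1 J2 \<gamma> q)"

text \<open>Interactions are nonnegative and the half surface term is bounded below; a single bond
  of slope \<theta> followed by slope \<gamma> bounds the infimum from above. Finiteness lets the
  sums that define the jump costs be computed in the reals.\<close>

lemma B_theta_real: assumes "0 < \<theta>" shows "B_theta J1 J2 \<gamma> \<theta> = ereal (b_theta \<theta>)"
proof -
  obtain c where c: "0 \<le> c" "\<And>s. s \<in> D \<Longrightarrow> - c \<le> j1 s" "\<And>s. s \<in> D \<Longrightarrow> - c \<le> j2 s"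
    using lower_const by blast
  have "ereal (- c) \<le> B_theta J1 J2 \<gamma> \<theta>"
  proof (rule ereal_ge_of_less)
    fix A assume "B_theta J1 J2 \<gamma> \<theta> < ereal A"
    then obtain t N where t: "t 0 = \<theta>" "\<And>i. t i \<in> D" "\<And>i. N \<le> i \<Longrightarrow> t i = \<gamma>"
      "j1 \<theta> / 2 + path t 0 N < A" by (rule B_theta_ex) (rule that)
    have "0 \<le> path t 0 N" by (rule path_nonneg) (rule t)
    then show "- c \<le> A" using t(4) c(1) c(2)[OF pos_in[OF assms]] by simp
  qed
  moreover have "B_theta J1 J2 \<gamma> \<theta> \<le> ereal (j1 \<theta> / 2 + path (\<lambda>_. \<theta>) 0 0 + F \<theta> \<gamma>)"
    by (rule B_theta_le(1)) (use pos_in[OF assms] in auto)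
  ultimately show ?thesis by (rule ereal_real_of_bounds)
qed

lemma B_gamma_real: "B_gamma J1 J2 \<gamma> = ereal b_gamma"
proof -
  obtain c where c: "0 \<le> c" "\<And>s. s \<in> D \<Longrightarrow> - c \<le> j1 s" "\<And>s. s \<in> D \<Longrightarrow> - c \<le> j2 s"
    using lower_const by blast
  have "ereal (- c) \<le> B_gamma J1 J2 \<gamma>"
  proof (rule ereal_ge_of_less)
    fix A assume "B_gamma J1 J2 \<gamma> < ereal A"
    then obtain t N where t: "\<And>i. t i \<in> D" "\<And>i. N \<le> i \<Longrightarrow> t i = \<gamma>"
      "j1 (t 0) / 2 + path t 0 N < A" by (rule B_gamma_ex) (rule that)
    have "0 \<le> path t 0 N" by (rule path_nonneg) (rule t)
    then show "- c \<le> A" using t(3) c(1) c(2)[OF t(1)[of 0]] by simp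
  qed
  moreover have "B_gamma J1 J2 \<gamma> \<le> ereal (j1 \<gamma> / 2 + path (\<lambda>_. \<gamma>) 0 0 + 0)"
    by (rule B_theta_le(2)) (use gamma_in in auto)
  ultimately show ?thesis by (rule ereal_real_of_bounds)
qed

lemma B_b_real: assumes "0 < \<theta>" shows "B_b J1 J2 \<gamma> \<theta> = ereal (b_b \<theta>)"
proof -
  obtain c where c: "0 \<le> c" "\<And>s. s \<in> D \<Longrightarrow> - c \<le> j1 s" "\<And>s. s \<in> D \<Longrightarrow> - c \<le> j2 s"
    using lower_const by blast
  have "ereal (- c) \<le> B_b J1 J2 \<gamma> \<theta>"
  proof (rule ereal_ge_of_less)
    fix A assume "B_b J1 J2 \<gamma> \<theta> < ereal A"
    then obtain t k where t: "t 0 = \<theta>" "\<And>i. t i \<in> D" "j1 (t k) / 2 + path t 0 k < A" by (rule B_b_ex) (rule that)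
    have "0 \<le> path t 0 k" by (rule path_nonneg) (rule t)
    then show "- c \<le> A" using t(3) c(1) c(2)[OF t(2)[of k]] by simp
  qed
  moreover have "B_b J1 J2 \<gamma> \<theta> \<le> ereal (j1 \<theta> / 2 + path (\<lambda>_. \<theta>) 0 0)"
    by (rule B_b_le) (use pos_in[OF assms] in auto)
  ultimately show ?thesis by (rule ereal_real_of_bounds)
qed

lemma B_IF_nat_real: "B_IF_nat J1 J2 \<gamma> q = ereal (b_IF q)"
proof -
  obtain c where c: "0 \<le> c" "\<And>s. s \<in> D \<Longrightarrow> - c \<le> j1 s" "\<And>s. s \<in> D \<Longrightarrow> - c \<le> j2 s"
    using lower_const by blast
  have "ereal (- c) \<le> B_IF_nat J1 J2 \<gamma> q"
  proof (rule ereal_ge_of_less)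
    fix A assume "B_IF_nat J1 J2 \<gamma> q < ereal A"
    then obtain t k where t: "\<And>i. t i \<in> D" "j1 (t 0) / 2 + path t 0 k + (real q + 1/2) * G (t k) < A"
      by (rule B_IF_nat_ex) (rule that)
    have "0 \<le> path t 0 k" by (rule path_nonneg) (rule t)
    moreover have "0 \<le> (real q + 1/2) * G (t k)" using G_nonneg[OF t(1)] by simp
    ultimately show "- c \<le> A" using t(2) c(1) c(2)[OF t(1)[of 0]] by simp
  qed
  moreover have "B_IF_nat J1 J2 \<gamma> q \<le> ereal (j1 \<gamma> / 2 + path (\<lambda>_. \<gamma>) 0 0 + (real q + 1/2) * G \<gamma>)"
    by (rule B_IF_nat_le) (use gamma_in in auto)
  ultimately show ?thesis by (rule ereal_real_of_bounds)
qed

definition b_IFr :: "enat \<Rightarrow> real" where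
  "b_IFr rhat = (case rhat of enat q \<Rightarrow> b_IF (q - 1) | \<infinity> \<Rightarrow> b_gamma)"

lemma B_AIF_real: "rhat \<noteq> 0 \<Longrightarrow> B_AIF J1 J2 \<gamma> rhat = ereal (b_IFr rhat + b_gamma - 2 * m)"
proof (cases rhat)
  case (enat q)
  then have "B_AIF J1 J2 \<gamma> rhat = B_IF_nat J1 J2 \<gamma> (q - 1) + B_gamma J1 J2 \<gamma> - ereal 2 * J0 J1 J2 \<gamma>"
    by (simp add: B_AIF_def B_IF_def one_enat_def)
  also have "\<dots> = ereal (b_IF (q - 1)) + ereal b_gamma - ereal 2 * ereal m"
    by (simp only: B_IF_nat_real[symmetric] B_gamma_real[symmetric] J0_gamma)
  finally show ?thesis by (simp add: b_IFr_def enat)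
next
  case infinity
  then have "B_AIF J1 J2 \<gamma> rhat = B_gamma J1 J2 \<gamma> + B_gamma J1 J2 \<gamma> - ereal 2 * J0 J1 J2 \<gamma>"
    by (simp add: B_AIF_def B_IF_def)
  also have "\<dots> = ereal b_gamma + ereal b_gamma - ereal 2 * ereal m"
    by (simp only: B_gamma_real[symmetric] J0_gamma)
  finally show ?thesis by (simp add: b_IFr_def infinity)
qed

lemma B_BJ_real: "0 < \<theta> \<Longrightarrow> B_BJ J1 J2 \<gamma> \<theta> = ereal (j1 \<theta> / 2 + b_b \<theta> + b_gamma - 2 * m)"
proof -
  assume "0 < \<theta>"
  have "B_BJ J1 J2 \<gamma> \<theta> = ereal (1/2) * ereal (j1 \<theta>) + ereal (b_b \<theta>) + ereal b_gamma - ereal 2 * ereal m"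
    unfolding B_BJ_def
    by (simp only: B_b_real[OF \<open>0 < \<theta>\<close>, symmetric] B_gamma_real[symmetric] J0_gamma J1_in[OF pos_in[OF \<open>0 < \<theta>\<close>]])
  then show ?thesis by simp
qed

text \<open>As \<open>m\<close> is negative, an infinite count gives minus infinity. After the sign
  change in the limit energy, a jump where no element of bounded length is available costs plus
  infinity.\<close>

lemma enat_mult_m: "ereal_of_enat k * J0 J1 J2 \<gamma> = (case k of enat q \<Rightarrow> ereal (real q * m) | \<infinity> \<Rightarrow> -\<infinity>)"
  using m_neg by (cases k) (simp_all add: J0_gamma)

lemma half_enat_mult_m: "(ereal (1/2) + ereal_of_enat k) * J0 J1 J2 \<gamma>
    = (case k of enat q \<Rightarrow> ereal ((1/2 + real q) * m) | \<infinity> \<Rightarrow> -\<infinity>)"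
  using m_neg by (cases k) (simp_all add: J0_gamma)

lemma tilde_terms:
  assumes "rhat \<noteq> 0"
  shows "B_IFJ_tilde J1 J2 \<gamma> rhat b = min (ereal (b_IFr rhat + b_gamma - 2 * m))
      (min (case rhat of enat q \<Rightarrow> ereal (b_gamma - (1/2 + real q) * m) | \<infinity> \<Rightarrow> \<infinity>)
           (case b of enat q \<Rightarrow> ereal (- (real q * m)) | \<infinity> \<Rightarrow> \<infinity>))"
proof -
  have "B_gamma J1 J2 \<gamma> - (ereal (1/2) + ereal_of_enat rhat) * J0 J1 J2 \<gamma> =
      (case rhat of enat q \<Rightarrow> ereal (b_gamma - (1/2 + real q) * m) | \<infinity> \<Rightarrow> \<infinity>)"
    unfolding half_enat_mult_m by (subst B_gamma_real) (auto split: enat.split)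
  moreover have "- (ereal_of_enat b * J0 J1 J2 \<gamma>) = (case b of enat q \<Rightarrow> ereal (- (real q * m)) | \<infinity> \<Rightarrow> \<infinity>)"
    unfolding enat_mult_m by (auto split: enat.split)
  ultimately show ?thesis unfolding B_IFJ_tilde_def B_AIF_real[OF assms] by simp
qed

text \<open>Four places for a crack near an end: in the atomistic region inside the boundary layer
  (first bound), in that region between a bond of slope almost \<gamma> and the interface (second),
  in the first continuum element (third), or in a later element (fourth). The last two exist only
  for finite counts.\<close>

lemma less_B_IFJ:
  assumes "0 < \<theta>" "rhat \<noteq> 0" "ereal A < B_IFJ J1 J2 \<gamma> rhat b \<theta>"
  shows "A < j1 \<theta> / 2 + b_b \<theta> + b_gamma - 2 * m"
    and "A < b_IFr rhat + b_gamma - 2 * m + b_theta \<theta>"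
    and "rhat = enat q \<Longrightarrow> A < b_gamma - (1/2 + real q) * m + b_theta \<theta>"
    and "b = enat k \<Longrightarrow> A < - (real k * m) + b_theta \<theta>"
proof -
  have *: "ereal A < B_IFJ_tilde J1 J2 \<gamma> rhat b + ereal (b_theta \<theta>)" "ereal A < B_BJ J1 J2 \<gamma> \<theta>"
    using assms(3) B_theta_real[OF assms(1)] unfolding B_IFJ_def by simp_all
  show "A < j1 \<theta> / 2 + b_b \<theta> + b_gamma - 2 * m" using *(2) B_BJ_real[OF assms(1)] by simp
  note t = *(1)[unfolded less_plus_ereal_iff tilde_terms[OF assms(2)]]
  show "A < b_IFr rhat + b_gamma - 2 * m + b_theta \<theta>" using t by simp
  show "A < b_gamma - (1/2 + real q) * m + b_theta \<theta>" if "rhat = enat q" using t that by simp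
  show "A < - (real k * m) + b_theta \<theta>" if "b = enat k" using t that by simp
qed

lemma B_IFJ_less:
  assumes "0 < \<theta>" "rhat \<noteq> 0" "B_IFJ J1 J2 \<gamma> rhat b \<theta> < ereal A"
  obtains (BJ) "j1 \<theta> / 2 + b_b \<theta> + b_gamma - 2 * m < A"
    | (AIF) "b_IFr rhat + b_gamma - 2 * m + b_theta \<theta> < A"
    | (IF) q where "rhat = enat q" "b_gamma - (1/2 + real q) * m + b_theta \<theta> < A"
    | (CB) k where "b = enat k" "- (real k * m) + b_theta \<theta> < A"
proof -
  have *: "B_IFJ_tilde J1 J2 \<gamma> rhat b + ereal (b_theta \<theta>) < ereal A \<or> B_BJ J1 J2 \<gamma> \<theta> < ereal A"
    using assms(3) B_theta_real[OF assms(1)] unfolding B_IFJ_def by (simp add: min_less_iff_disj)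
  show thesis
  proof (cases "B_BJ J1 J2 \<gamma> \<theta> < ereal A")
    case True
    then show ?thesis using BJ B_BJ_real[OF assms(1)] by simp
  next
    case False
    then have t: "min (ereal (b_IFr rhat + b_gamma - 2 * m))
      (min (case rhat of enat q \<Rightarrow> ereal (b_gamma - (1/2 + real q) * m) | \<infinity> \<Rightarrow> \<infinity>)
           (case b of enat q \<Rightarrow> ereal (- (real q * m)) | \<infinity> \<Rightarrow> \<infinity>)) < ereal (A - b_theta \<theta>)"
      using * unfolding plus_ereal_less_iff tilde_terms[OF assms(2)] by simp
    then show ?thesis
      unfolding min_less_iff_disj
      using AIF IF CB by (auto split: enat.splits simp: algebra_simps)
  qed
qed

text \<open>Energy of the first \<open>W\<close> bonds when bonds up to \<open>k\<close> interact
  through \<open>F\<close> and later ones are in the continuum region. Bond \<open>k\<close> belongs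
  to both regions; it enters the last interaction of the path and carries half of its
  \<open>G\<close>. The summand at bond 0 is the half of \<open>J1\<close> that no cell
  absorbs.\<close>

definition left_energy :: "(nat \<Rightarrow> real) \<Rightarrow> nat \<Rightarrow> nat \<Rightarrow> real" where
  "left_energy s k W = j1 (s 0) / 2 + path s 0 k + G (s k) / 2 + (\<Sum>i\<in>{k<..<W}. G (s i))"

text \<open>Pigeonhole: if each of \<open>k\<close> interactions costs at least
  \<open>\<eta>\<close>, the path costs \<open>k * \<eta>\<close>, beyond \<open>C\<close> for large
  \<open>k\<close>. The second conclusion is the same for a long element of one slope
  \<open>z\<close>, whose cost is a large multiple of \<open>G z\<close>. The slack 1 in the choice
  of \<open>k0\<close> absorbs the half bond at the interface.\<close>

lemma good_index:
  assumes "0 < e"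
  obtains k0 where "\<And>k s. k0 \<le> k \<Longrightarrow> (\<And>i. i \<le> k \<Longrightarrow> s i \<in> D) \<Longrightarrow> path s 0 k \<le> C \<Longrightarrow>
      \<exists>P<k. F (s P) \<gamma> \<le> e \<and> \<bar>s P - \<gamma>\<bar> < 1"
    and "\<And>x z. z \<in> D \<Longrightarrow> real k0 - 1/2 \<le> x \<Longrightarrow> x * G z \<le> C \<Longrightarrow> F z \<gamma> \<le> e"
proof -
  obtain \<delta> where \<delta>: "0 < \<delta>" "\<And>s. \<bar>s - \<gamma>\<bar> < \<delta> \<Longrightarrow> F s \<gamma> < e" using F_small[OF assms] by blast
  have "0 < min \<delta> 1" using \<delta> by simp
  then obtain \<eta> where \<eta>: "0 < \<eta>" "\<And>s t. s \<in> D \<Longrightarrow> t \<in> D \<Longrightarrow> F s t < \<eta> \<Longrightarrow> \<bar>s - \<gamma>\<bar> < min \<delta> 1"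
    "\<And>s. s \<in> D \<Longrightarrow> G s < \<eta> \<Longrightarrow> \<bar>s - \<gamma>\<bar> < min \<delta> 1" using F_well by blast
  obtain k0 :: nat where k0: "real k0 > \<bar>C\<bar> / \<eta> + 1" using reals_Archimedean2 by blast
  show thesis
  proof (rule that[of k0])
    fix k and s :: "nat \<Rightarrow> real"
    assume k: "k0 \<le> k" "\<And>i. i \<le> k \<Longrightarrow> s i \<in> D" "path s 0 k \<le> C"
    have "\<exists>P<k. F (s P) (s (Suc P)) < \<eta>"
    proof (rule ccontr)
      assume "\<not> ?thesis"
      then have "(\<Sum>i\<in>{0..<k}. \<eta>) \<le> path s 0 k" unfolding path_def by (intro sum_mono) force
      then have "real k * \<eta> \<le> C" using k(3) by simp
      moreover have "real k * \<eta> > \<bar>C\<bar>"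
      proof -
        have "\<bar>C\<bar> / \<eta> < real k" using k0 k(1) by linarith
        then show ?thesis using \<eta>(1) by (simp add: field_simps)
      qed
      ultimately show False by simp
    qed
    then obtain P where P: "P < k" "F (s P) (s (Suc P)) < \<eta>" by blast
    then have "\<bar>s P - \<gamma>\<bar> < min \<delta> 1" using \<eta>(2)[of "s P" "s (Suc P)"] k(2)[of P] k(2)[of "Suc P"] by simp
    then show "\<exists>P<k. F (s P) \<gamma> \<le> e \<and> \<bar>s P - \<gamma>\<bar> < 1" using P(1) \<delta>(2) by force
  next
    fix x z :: real assume z: "z \<in> D" "real k0 - 1/2 \<le> x" "x * G z \<le> C"
    have "G z < \<eta>"
    proof (rule ccontr)
      assume "\<not> G z < \<eta>"
      have x: "\<bar>C\<bar> / \<eta> < x" using z(2) k0 by linarith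
      have x0: "x > 0" using x \<eta>(1) by (smt (verit) divide_nonneg_pos)
      have "\<bar>C\<bar> < x * \<eta>" using x \<eta>(1) by (simp add: field_simps)
      also have "\<dots> \<le> x * G z" using \<open>\<not> G z < \<eta>\<close> x0 by (intro mult_left_mono) auto
      finally show False using z(3) by simp
    qed
    then show "F z \<gamma> \<le> e" using \<eta>(3)[OF z(1)] \<delta>(2)[of z] by auto
  qed
qed

lemma small_slack:
  fixes x y c :: real
  assumes "x < y" "0 \<le> c"
  obtains e0 where "0 < e0" "\<And>e. 0 < e \<Longrightarrow> e \<le> e0 \<Longrightarrow> x + c * e < y"
proof (rule that[of "(y - x) / (c + 1)"])
  show "0 < (y - x) / (c + 1)" using assms by simp
  show "x + c * e < y" if "0 < e" "e \<le> (y - x) / (c + 1)" for e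
    using that assms by (simp add: field_simps) 
qed

lemma left_energy_bounds:
  assumes "k < W" "\<And>i. i < W \<Longrightarrow> s i \<in> D"
  shows "0 \<le> path s 0 k" "0 \<le> G (s k)" "0 \<le> (\<Sum>i\<in>{k<..<W}. G (s i))"
proof -
  show "0 \<le> path s 0 k" by (rule path_nonneg) (use assms in simp)
  show "0 \<le> G (s k)" using assms G_nonneg by simp
  show "0 \<le> (\<Sum>i\<in>{k<..<W}. G (s i))" by (rule sum_nonneg) (use assms G_nonneg in simp)
qed

text \<open>Cut at a bond \<open>P\<close> of slope almost \<gamma> and continue with slope
  \<gamma>. What lies beyond \<open>P\<close> is nonnegative and is dropped.\<close>

lemma left_lower_nojump:
  assumes "0 < \<theta>" "ereal A < B_theta J1 J2 \<gamma> \<theta>"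
  obtains k0 where "\<And>k W s. k0 \<le> k \<Longrightarrow> k < W \<Longrightarrow> s 0 = \<theta> \<Longrightarrow> (\<And>i. i < W \<Longrightarrow> s i \<in> D) \<Longrightarrow>
      A \<le> left_energy s k W"
proof -
  have A: "A < b_theta \<theta>" using assms(2) by (subst (asm) B_theta_real[OF assms(1)]) simp
  define e where "e = b_theta \<theta> - A"
  have e: "e > 0" using A by (simp add: e_def)
  obtain c where c: "0 \<le> c" "\<And>s. s \<in> D \<Longrightarrow> - c \<le> j1 s" "\<And>s. s \<in> D \<Longrightarrow> - c \<le> j2 s"
    using lower_const by blast
  obtain k0 where k0: "\<And>k s. k0 \<le> k \<Longrightarrow> (\<And>i. i \<le> k \<Longrightarrow> s i \<in> D) \<Longrightarrow> path s 0 k \<le> A + c \<Longrightarrow>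
      \<exists>P<k. F (s P) \<gamma> \<le> e \<and> \<bar>s P - \<gamma>\<bar> < 1" using good_index[OF e, of "A + c"] by metis
  show thesis
  proof (rule that[of k0], rule ccontr)
    fix k W and s :: "nat \<Rightarrow> real"
    assume h: "k0 \<le> k" "k < W" "s 0 = \<theta>" "\<And>i. i < W \<Longrightarrow> s i \<in> D" and neg: "\<not> A \<le> left_energy s k W"
    note nn = left_energy_bounds[of k W s, OF h(2) h(4)]
    have "path s 0 k \<le> A + c" using neg nn c(1) c(2)[OF h(4), of 0] h(2) by (simp add: left_energy_def)
    then obtain P where P: "P < k" "F (s P) \<gamma> \<le> e" using k0[OF h(1), of s] h by force
    have "B_theta J1 J2 \<gamma> \<theta> \<le> ereal (j1 \<theta> / 2 + path s 0 P + e)"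
      by (rule B_theta_le(1)) (use h P in auto)
    then have 1: "b_theta \<theta> \<le> j1 \<theta> / 2 + path s 0 P + e" by (subst (asm) B_theta_real[OF assms(1)]) simp
    have "0 \<le> path s P k" by (rule path_nonneg) (use h in simp)
    then have "path s 0 P \<le> path s 0 k" using path_split[of 0 P k s] P(1) by simp
    then show False using 1 neg nn h(3) by (simp add: left_energy_def e_def)
  qed
qed

text \<open>One bound for finite and infinite counts. A finite count is its own \<open>Q\<close>.
  For an infinite one \<open>Q\<close> is so large that \<open>Q\<close> steep bonds exceed
  \<open>A\<close> even with an error up to \<open>- m / 2\<close> on each. The summand 8 leaves
  room for the bounded number of other errors.\<close>

lemma first_element_count:
  obtains Q :: nat and e0 :: real where "rhat = enat Q \<or> rhat = \<infinity>" "0 < e0"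
    "\<And>e. (\<And>q. rhat = enat q \<Longrightarrow> A < X - real q * m) \<Longrightarrow> 0 < e \<Longrightarrow> e \<le> e0 \<Longrightarrow> A + (real Q + 8) * e < X - real Q * m"
proof (cases rhat)
  case (enat q)
  show thesis
  proof (cases "A < X - real q * m")
    case True
    obtain e0 where "0 < e0" "\<And>e. 0 < e \<Longrightarrow> e \<le> e0 \<Longrightarrow> A + (real q + 8) * e < X - real q * m"
      using small_slack[OF True, of "real q + 8"] by (metis add_nonneg_nonneg of_nat_0_le_iff zero_le_numeral)
    then show ?thesis using that[of q e0] enat by blast
  next
    case False
    then show ?thesis using that[of q 1] enat by auto
  qed
next
  case infinity
  \<comment> \<open>Half of the cost \<open>- Q * m\<close> pays for \<open>A - X + 8 * e\<close>,
    the other half for the \<open>Q\<close> errors \<open>e \<le> - m / 2\<close>.\<close>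
  obtain Q :: nat where Q: "real Q > (A - X + 8 * (- m / 2)) / (- m / 2)" using reals_Archimedean2 by blast
  have "A + (real Q + 8) * e < X - real Q * m" if "0 < e" "e \<le> - m / 2" for e
  proof -
    have "A - X + 8 * (- m / 2) < real Q * (- m / 2)" using Q m_neg by (simp add: field_simps)
    moreover have "(real Q + 8) * e \<le> (real Q + 8) * (- m / 2)" using that by (intro mult_left_mono) auto
    ultimately show ?thesis by (simp add: algebra_simps)
  qed
  then show ?thesis using that[of Q "- m / 2"] infinity m_neg by simp
qed

text \<open>A bond \<open>P\<close> of slope almost \<gamma> exists in the atomistic region, and the
  position of the steep bond \<open>j\<close> relative to \<open>P\<close>, \<open>k\<close> and
  \<open>r\<close> selects one alternative of the minimum in \<open>B_IFJ\<close>. The thresholds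
  \<open>M\<close> and \<open>k0\<close> are chosen before the chain. The condition with
  \<open>min (enat k0) b\<close> expresses that the steep element is as long as the count requires,
  or merely long if the count is infinite.\<close>

lemma left_lower_jump:
  assumes \<theta>: "0 < \<theta>" and rhat: "rhat \<noteq> 0" and A: "ereal A < B_IFJ J1 J2 \<gamma> rhat b \<theta>"
  obtains M :: real and k0 :: nat
    where "\<And>k r q1 q2 W s j. k0 \<le> k \<Longrightarrow> k < r \<Longrightarrow> r \<le> W \<Longrightarrow>
      rhat = enat (r - k) \<or> rhat = \<infinity> \<and> k0 \<le> r - k \<Longrightarrow> s 0 = \<theta> \<Longrightarrow> (\<And>i. i < W \<Longrightarrow> s i \<in> D) \<Longrightarrow>
      (\<And>i. k \<le> i \<Longrightarrow> i < r \<Longrightarrow> s i = s k) \<Longrightarrow> j < W \<Longrightarrow> M \<le> s j \<Longrightarrow>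
      (r \<le> j \<Longrightarrow> r \<le> q1 \<and> q1 \<le> j \<and> j < q2 \<and> q2 \<le> W \<and> (\<forall>i\<in>{q1..<q2}. s i = s j) \<and>
          min (enat k0) b \<le> enat (q2 - q1)) \<Longrightarrow>
      A \<le> left_energy s k W"
proof -
  note less = less_B_IFJ[OF \<theta> rhat A]
  obtain c where c: "0 \<le> c" "\<And>s. s \<in> D \<Longrightarrow> - c \<le> j1 s" "\<And>s. s \<in> D \<Longrightarrow> - c \<le> j2 s"
    using lower_const by blast
  define C where "C = A + c"
  obtain K where K: "\<And>s t. s \<in> D \<Longrightarrow> t \<in> D \<Longrightarrow> F s t \<le> C \<Longrightarrow> - K \<le> s"
    using slope_ge_of_energy by blast
  obtain e1 where e1: "0 < e1" "\<And>e. 0 < e \<Longrightarrow> e \<le> e1 \<Longrightarrow> A + 8 * e < j1 \<theta> / 2 + b_b \<theta> + b_gamma - 2 * m"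
    using small_slack[OF less(1), of 8] by auto
  obtain e2 where e2: "0 < e2" "\<And>e. 0 < e \<Longrightarrow> e \<le> e2 \<Longrightarrow> A + 8 * e < b_IFr rhat + b_gamma - 2 * m + b_theta \<theta>"
    using small_slack[OF less(2), of 8] by auto
  obtain Q :: nat and e3 where e3: "rhat = enat Q \<or> rhat = \<infinity>" "0 < e3"
    and "\<And>e. (\<And>q. rhat = enat q \<Longrightarrow> A < (b_gamma - m / 2 + b_theta \<theta>) - real q * m) \<Longrightarrow> 0 < e \<Longrightarrow> e \<le> e3 \<Longrightarrow>
      A + (real Q + 8) * e < (b_gamma - m / 2 + b_theta \<theta>) - real Q * m"
    using first_element_count[of rhat A "b_gamma - m / 2 + b_theta \<theta>"] by blast
  then have e3': "\<And>e. 0 < e \<Longrightarrow> e \<le> e3 \<Longrightarrow> A + (real Q + 8) * e < (b_gamma - m / 2 + b_theta \<theta>) - real Q * m"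
    using less(3) by (force simp: algebra_simps)
  obtain B :: nat and e4 where e4: "b = enat B \<or> b = \<infinity>" "0 < e4"
    and "\<And>e. (\<And>q. b = enat q \<Longrightarrow> A < b_theta \<theta> - real q * m) \<Longrightarrow> 0 < e \<Longrightarrow> e \<le> e4 \<Longrightarrow>
      A + (real B + 8) * e < b_theta \<theta> - real B * m"
    using first_element_count[of b A "b_theta \<theta>"] by blast
  then have e4': "\<And>e. 0 < e \<Longrightarrow> e \<le> e4 \<Longrightarrow> A + (real B + 8) * e < b_theta \<theta> - real B * m"
    using less(4) by (force simp: algebra_simps)
  \<comment> \<open>One error size for all four alternatives. The bound by \<open>- m / 2\<close>
    keeps \<open>- m - e\<close> nonnegative, so longer steep elements never cost less.\<close>
  define e where "e = min (min e1 e2) (min (min e3 e4) (- m / 2))"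
  have e: "0 < e" "e \<le> e1" "e \<le> e2" "e \<le> e3" "e \<le> e4" "e \<le> - m / 2"
    using e1 e2 e3 e4 m_neg by (auto simp: e_def)
  have me: "0 \<le> - m - e" using e m_neg by simp
  \<comment> \<open>The threshold above \<open>\<theta> + \<gamma> + 1\<close> separates the steep
    bond from bond 0, whose slope is \<theta>, and from \<open>P\<close>, whose slope is within 1 of
    \<gamma>.\<close>
  obtain M where M: "\<And>s h. - K \<le> s \<Longrightarrow> M \<le> h \<Longrightarrow> j1 s / 2 - m - e \<le> F s h" "\<And>h. M \<le> h \<Longrightarrow> - m - e \<le> G h"
    "\<theta> + \<gamma> + 1 \<le> M" using jump_lower[OF e(1)] by blast
  obtain k1 where k1: "\<And>k s. k1 \<le> k \<Longrightarrow> (\<And>i. i \<le> k \<Longrightarrow> s i \<in> D) \<Longrightarrow> path s 0 k \<le> C \<Longrightarrow>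
      \<exists>P<k. F (s P) \<gamma> \<le> e \<and> \<bar>s P - \<gamma>\<bar> < 1"
    "\<And>x z. z \<in> D \<Longrightarrow> real k1 - 1/2 \<le> x \<Longrightarrow> x * G z \<le> C \<Longrightarrow> F z \<gamma> \<le> e"
    using good_index[OF e(1), of C] by blast
  \<comment> \<open>At least 1, so that bond \<open>k\<close> has a predecessor; at least
    \<open>Q\<close> and \<open>B\<close>, so that elements belonging to infinite counts contain
    that many bonds.\<close>
  define k0 where "k0 = max (max k1 1) (max Q B)"
  show thesis
  proof (rule that[of k0 M], rule ccontr)
    fix k r q1 q2 W j and s :: "nat \<Rightarrow> real"
    assume h: "k0 \<le> k" "k < r" "r \<le> W" "rhat = enat (r - k) \<or> rhat = \<infinity> \<and> k0 \<le> r - k" "s 0 = \<theta>"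
      "\<And>i. i < W \<Longrightarrow> s i \<in> D" "\<And>i. k \<le> i \<Longrightarrow> i < r \<Longrightarrow> s i = s k" "j < W" "M \<le> s j"
      and elt: "r \<le> j \<Longrightarrow> r \<le> q1 \<and> q1 \<le> j \<and> j < q2 \<and> q2 \<le> W \<and> (\<forall>i\<in>{q1..<q2}. s i = s j) \<and>
          min (enat k0) b \<le> enat (q2 - q1)"
      and neg: "\<not> A \<le> left_energy s k W"
    have kW: "k < W" using h by simp
    note nn = left_energy_bounds[of k W s, OF kW h(6)]
    have sD: "s i \<in> D" if "i < W" for i using h(6) that .
    have lt: "j1 \<theta> / 2 + path s 0 k + G (s k) / 2 + (\<Sum>i\<in>{k<..<W}. G (s i)) < A"
      using neg h(5) by (simp add: left_energy_def)
    have j1\<theta>: "- c \<le> j1 \<theta>" using c(2) pos_in \<theta> by simp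
    have pC: "path s 0 k \<le> C" using lt nn c(1) j1\<theta> by (simp add: C_def)
    have FC: "F (s i) (s (Suc i)) \<le> C" if "i < k" for i
    proof -
      have "F (s i) (s (Suc i)) \<le> path s 0 k"
        unfolding path_def by (rule member_le_sum) (use that kW in \<open>auto intro!: F_nonneg sD\<close>)
      then show ?thesis using pC by simp
    qed
    have sK: "- K \<le> s i" if "i \<le> k" for i
    proof (cases "i < k")
      case True
      then show ?thesis using K[OF _ _ FC[OF True]] sD kW by simp
    next
      case False
      then have i: "i = Suc (k - 1)" "k - 1 < k" using that h(1) by (auto simp: k0_def)
      show ?thesis using K[of "s i" "s (k - 1)"] FC[OF i(2)] sD kW i by (simp add: F_commute)
    qed
    obtain P where P: "P < k" "F (s P) \<gamma> \<le> e" "\<bar>s P - \<gamma>\<bar> < 1"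
      using k1(1)[of k s] h(1) sD kW pC by (force simp: k0_def)
    have "B_theta J1 J2 \<gamma> \<theta> \<le> ereal (j1 \<theta> / 2 + path s 0 P + e)"
      by (rule B_theta_le(1)) (use h P in auto)
    then have bth: "b_theta \<theta> \<le> j1 \<theta> / 2 + path s 0 P + e" by (subst (asm) B_theta_real[OF \<theta>]) simp
    have bg_fwd: "b_gamma \<le> j1 (s x) / 2 + path s x y + e" if "x \<le> y" "y < W" "F (s y) \<gamma> \<le> e" for x y
    proof -
      have "path s x (x + (y - x)) = path (\<lambda>i. s (x + i)) 0 (y - x)" by (rule path_shift) simp
      moreover have "B_gamma J1 J2 \<gamma> \<le> ereal (j1 (s x) / 2 + path (\<lambda>i. s (x + i)) 0 (y - x) + e)"
        by (rule B_theta_le(2)) (use that sD in auto)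
      ultimately show ?thesis using that(1) by (subst (asm) B_gamma_real) simp
    qed
    have bg_bwd: "b_gamma \<le> j1 (s y) / 2 + path s x y + e" if "x \<le> y" "y < W" "F (s x) \<gamma> \<le> e" for x y
    proof -
      have "path s x (x + (y - x)) = path (\<lambda>i. s (y - i)) 0 (y - x)"
        by (rule path_rev) (use that in simp)
      moreover have "B_gamma J1 J2 \<gamma> \<le> ereal (j1 (s y) / 2 + path (\<lambda>i. s (y - i)) 0 (y - x) + e)"
        by (rule B_theta_le(2)) (use that sD in auto)
      ultimately show ?thesis using that(1) by (subst (asm) B_gamma_real) simp
    qed
    have pnn: "0 \<le> path s x y" if "y \<le> k" for x y by (rule path_nonneg) (use sD kW that in simp)
    \<comment> \<open>The bonds of the first continuum element after bond \<open>k\<close> repeat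
      its slope.\<close>
    have first: "real (r - k - 1) * G (s k) \<le> (\<Sum>i\<in>{k<..<W}. G (s i))"
    proof -
      have "(\<Sum>i\<in>{k<..<r}. G (s i)) = (\<Sum>i\<in>{k<..<r}. G (s k))" by (intro sum.cong refl arg_cong[where f = G] h(7)) auto
      also have "\<dots> = real (r - k - 1) * G (s k)" by simp
      finally have "real (r - k - 1) * G (s k) = (\<Sum>i\<in>{k<..<r}. G (s i))" ..
      also have "\<dots> \<le> (\<Sum>i\<in>{k<..<W}. G (s i))"
        by (rule sum_mono2) (use h(3) in \<open>auto intro!: G_nonneg sD\<close>)
      finally show ?thesis .
    qed
    have rk: "real (r - k - 1) = real (r - k) - 1" using h(2) by (simp add: of_nat_diff)
    \<comment> \<open>A steep bond inside the atomistic region decouples the chain: both its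
      interactions cost \<open>- m\<close> and leave to the neighbours their half surface
      terms.\<close>
    have jump2: "j1 (s (j - 1)) / 2 + j1 (s (j + 1)) / 2 - 2 * m - 2 * e \<le> path s (j - 1) (j + 1)" if "j < k" "1 \<le> j"
    proof -
      have "path s (j - 1) (j + 1) = F (s (j - 1)) (s j) + F (s j) (s (j + 1))"
        using path_split[of "j - 1" j "j + 1" s] path_step[of s "j - 1"] path_step[of s j] that by simp
      moreover have "j1 (s (j - 1)) / 2 - m - e \<le> F (s (j - 1)) (s j)" using M(1)[OF sK h(9)] that by simp
      moreover have "j1 (s (j + 1)) / 2 - m - e \<le> F (s j) (s (j + 1))"
        using M(1)[OF sK h(9), of "j + 1"] that by (simp add: F_commute)
      ultimately show ?thesis by simp
    qed
    have j1: "1 \<le> j" using h(5,9) M(3) gamma_pos by (cases j) auto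
    have jP: "j \<noteq> P" using P(3) h(9) M(3) \<theta> by auto
    consider "j < P" | "P < j" "j < k" | "k \<le> j" "j < r" | "r \<le> j" using jP by linarith
    then show False
    proof cases
      \<comment> \<open>Crack before \<open>P\<close>: the piece up to bond \<open>j - 1\<close>
        competes in \<open>B_b\<close>, the piece from bond \<open>j + 1\<close> to \<open>P\<close>
        in \<open>B_gamma\<close>.\<close>
      case 1
      have "B_b J1 J2 \<gamma> \<theta> \<le> ereal (j1 (s (j - 1)) / 2 + path s 0 (j - 1))"
        by (rule B_b_le) (use h 1 P in auto)
      then have "b_b \<theta> \<le> j1 (s (j - 1)) / 2 + path s 0 (j - 1)" by (subst (asm) B_b_real[OF \<theta>]) simp
      moreover have "b_gamma \<le> j1 (s (j + 1)) / 2 + path s (j + 1) P + e"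
        by (rule bg_fwd) (use 1 P kW in auto)
      moreover have "path s 0 k = path s 0 (j - 1) + path s (j - 1) (j + 1) + path s (j + 1) P + path s P k"
        using path_split[of 0 "j - 1" k s] path_split[of "j - 1" "j + 1" k s] path_split[of "j + 1" P k s] 1 P j1
        by simp
      ultimately show False
        using jump2 1 P j1 pnn[of k P] lt nn e1(2)[OF e(1,2)] e(1) by simp
    next
      \<comment> \<open>Crack between \<open>P\<close> and the interface: bonds up to
        \<open>P\<close> compete in \<open>B_theta\<close>, those from \<open>P\<close> to
        \<open>j - 1\<close>, read backwards, in \<open>B_gamma\<close>, and those after
        \<open>j\<close> in the interface layer.\<close>
      case 2
      have bw: "b_gamma \<le> j1 (s (j - 1)) / 2 + path s P (j - 1) + e"
        by (rule bg_bwd) (use 2 P kW in auto)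
      have sp: "path s 0 k = path s 0 P + path s P (j - 1) + path s (j - 1) (j + 1) + path s (j + 1) k"
        using path_split[of 0 P k s] path_split[of P "j - 1" k s] path_split[of "j - 1" "j + 1" k s] 2 P j1
        by simp
      have "b_IFr rhat \<le> j1 (s (j + 1)) / 2 + path s (j + 1) k + (G (s k) / 2 + real (r - k - 1) * G (s k)) + e"
      proof (cases "rhat = \<infinity>")
        case True
        \<comment> \<open>For an infinite count the first element is so long that bounded energy
          forces its slope close to \<gamma>; the interface layer is then an ordinary free
          layer.\<close>
        have k0r: "k0 \<le> r - k" using h(4) True by auto
        have "F (s k) \<gamma> \<le> e"
        proof (rule k1(2))
          show "s k \<in> D" using sD kW .
          show "real k1 - 1/2 \<le> real (r - k) - 1/2" using k0r by (simp add: k0_def)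
          have "(real (r - k) - 1/2) * G (s k) = G (s k) / 2 + real (r - k - 1) * G (s k)"
            unfolding rk by (simp add: algebra_simps)
          then show "(real (r - k) - 1/2) * G (s k) \<le> C"
            using first lt nn j1\<theta> c(1) by (simp add: C_def)
        qed
        then have "b_gamma \<le> j1 (s (j + 1)) / 2 + path s (j + 1) k + e"
          by (intro bg_fwd) (use 2 kW in auto)
        moreover have "0 \<le> G (s k) / 2 + real (r - k - 1) * G (s k)" using nn(2) by simp
        ultimately show ?thesis unfolding True by (simp add: b_IFr_def)
      next
        case False
        then have rh: "rhat = enat (r - k)" using h(4) by auto
        have "path s (j + 1) (j + 1 + (k - (j + 1))) = path (\<lambda>i. s (j + 1 + i)) 0 (k - (j + 1))" by (rule path_shift) simp
        moreover have "B_IF_nat J1 J2 \<gamma> (r - k - 1) \<le> ereal (j1 (s (j + 1 + 0)) / 2 + path (\<lambda>i. s (j + 1 + i)) 0 (k - (j + 1))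
            + (real (r - k - 1) + 1/2) * G (s (j + 1 + (k - (j + 1)))))"
          by (rule B_IF_nat_le) (use 2 kW sD in auto)
        ultimately show ?thesis using 2 rh e(1) by (subst (asm) B_IF_nat_real) (simp add: b_IFr_def algebra_simps)
      qed
      then show False
        using bw sp jump2 2 j1 bth first lt e2(2)[OF e(1,3)] e(1) by simp
    next
      \<comment> \<open>Crack in the first element. The interaction across the interface pays
        \<open>- m\<close>, the element pays \<open>Q - 1/2\<close> times that amount; together
        these give the factor \<open>1/2 + Q\<close> of the interface alternative.\<close>
      case 3
      then have sk: "M \<le> s k" using h(7)[of j] h(9) by simp
      have kp: "P \<le> k - 1" "Suc (k - 1) = k" using P(1) by auto
      have bw: "b_gamma \<le> j1 (s (k - 1)) / 2 + path s P (k - 1) + e"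
        by (rule bg_bwd) (use P kW in auto)
      have "path s 0 k = path s 0 P + path s P (k - 1) + F (s (k - 1)) (s k)"
        using path_split[of 0 P k s] path_split[of P "k - 1" k s] path_step[of s "k - 1"] kp P(1) by simp
      moreover have "j1 (s (k - 1)) / 2 - m - e \<le> F (s (k - 1)) (s k)" using M(1)[OF sK sk] by simp
      moreover have "(real Q - 1/2) * (- m - e) \<le> G (s k) / 2 + real (r - k - 1) * G (s k)"
      proof -
        have Qr: "Q \<le> r - k" using e3(1) h(4) by (auto simp: k0_def)
        have "(real Q - 1/2) * (- m - e) \<le> (real (r - k) - 1/2) * (- m - e)"
          using Qr me by (intro mult_right_mono) auto
        also have "\<dots> \<le> (real (r - k) - 1/2) * G (s k)"
          using M(2)[OF sk] h(2) by (intro mult_left_mono) auto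
        finally show ?thesis unfolding rk by (simp add: algebra_simps)
      qed
      ultimately have "b_theta \<theta> + b_gamma - m + (real Q - 1/2) * (- m - e) - 3 * e < A"
        using bw bth first lt by simp
      moreover have "(real Q - 1/2) * (- m - e) = - (real Q * m) - real Q * e + m / 2 + e / 2"
        "(real Q + 8) * e = real Q * e + 8 * e" by (simp_all add: field_simps)
      ultimately show False using e3'[OF e(1,4)] e(1) by linarith
    next
      \<comment> \<open>Crack in a later element: the layer at the boundary is intact, and the whole
        steep element pays.\<close>
      case 4
      note el = elt[OF 4]
      have "real B * (- m - e) \<le> (\<Sum>i\<in>{q1..<q2}. G (s i))"
      proof -
        have "B \<le> q2 - q1" using e4(1) el by (auto simp: k0_def min_def split: if_splits)
        then have "real B * (- m - e) \<le> real (q2 - q1) * (- m - e)" using me by (intro mult_right_mono) auto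
        also have "\<dots> = (\<Sum>i\<in>{q1..<q2}. - m - e)" by simp
        also have "\<dots> \<le> (\<Sum>i\<in>{q1..<q2}. G (s i))"
        proof (rule sum_mono)
          fix i assume "i \<in> {q1..<q2}"
          then have "s i = s j" using el by blast
          then show "- m - e \<le> G (s i)" using M(2)[OF h(9)] by (simp only:)
        qed
        finally show ?thesis .
      qed
      also have "\<dots> \<le> (\<Sum>i\<in>{k<..<W}. G (s i))"
      proof (rule sum_mono2)
        show "{q1..<q2} \<subseteq> {k<..<W}" using el h(2) by (auto simp del: ball_simps)
      qed (auto intro!: G_nonneg sD)
      finally have "b_theta \<theta> + real B * (- m - e) - e < A"
        using bth lt nn pnn[of k P] path_split[of 0 P k s] P(1) by simp
      then show False using e4'[OF e(1,5)] e(1) by (simp add: algebra_simps)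
    qed
  qed
qed

text \<open>Away from the ends there is no layer: only the number of steep bonds matters, with the
  same cut-off for infinite counts.\<close>

lemma interior_lower_jump:
  assumes A: "\<And>k. b = enat k \<Longrightarrow> A < - (real k * m)"
  obtains M :: real and k0 :: nat
    where "\<And>q1 q2 s h. (\<And>i. i \<in> {q1..<q2} \<Longrightarrow> s i = h) \<Longrightarrow> M \<le> h \<Longrightarrow> min (enat k0) b \<le> enat (q2 - q1) \<Longrightarrow>
      A \<le> (\<Sum>i\<in>{q1..<q2}. G (s i))"
proof -
  obtain B :: nat and e0 where e0: "b = enat B \<or> b = \<infinity>" "0 < e0"
    and "\<And>e. (\<And>q. b = enat q \<Longrightarrow> A < 0 - real q * m) \<Longrightarrow> 0 < e \<Longrightarrow> e \<le> e0 \<Longrightarrow>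
      A + (real B + 8) * e < 0 - real B * m"
    using first_element_count[of b A 0] by blast
  then have e0': "\<And>e. 0 < e \<Longrightarrow> e \<le> e0 \<Longrightarrow> A + (real B + 8) * e < - real B * m"
    using A by force
  define e where "e = min e0 (- m / 2)"
  have e: "0 < e" "e \<le> e0" "0 \<le> - m - e" using e0 m_neg by (auto simp: e_def)
  obtain M where M: "\<And>h. M \<le> h \<Longrightarrow> - m - e \<le> G h" using jump_lower[OF e(1)] by metis
  show thesis
  proof (rule that[of M B])
    fix q1 q2 and s :: "nat \<Rightarrow> real" and h
    assume h: "\<And>i. i \<in> {q1..<q2} \<Longrightarrow> s i = h" "M \<le> h" "min (enat B) b \<le> enat (q2 - q1)"
    have "B \<le> q2 - q1" using e0(1) h(3) by (auto simp: min_def split: if_splits)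
    then have "real B * (- m - e) \<le> real (q2 - q1) * (- m - e)" using e by (intro mult_right_mono) auto
    also have "\<dots> = (\<Sum>i\<in>{q1..<q2}. - m - e)" by simp
    also have "\<dots> \<le> (\<Sum>i\<in>{q1..<q2}. G (s i))" using h(1) M[OF h(2)] by (intro sum_mono) auto
    finally show "A \<le> (\<Sum>i\<in>{q1..<q2}. G (s i))" using e0'[OF e(1,2)] e(1) by (simp add: algebra_simps)
  qed
qed

end

section \<open>Nearly optimal slopes at one end of the chain\<close>

context lj_potentials
begin

definition bump :: "nat \<Rightarrow> nat \<Rightarrow> real \<Rightarrow> (nat \<Rightarrow> real) \<Rightarrow> nat \<Rightarrow> real" where
  "bump p cnt h e i = (if p \<le> i \<and> i < p + cnt then h else e i)"

text \<open>A profile \<open>e\<close> at one end before the crack is opened: the \<open>cnt\<close>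
  bonds from \<open>p\<close> on have slope \<gamma> and are to be raised by \<open>bump\<close>.
  The last clause lists the possible places: an atomistic bond, the whole first element, or the
  whole element \<open>[q1, q2)\<close>. The bound \<open>C\<close> on the total deviation from
  \<gamma> does not depend on the chain length in the applications, so the layer moves nodes only by
  order \<open>1 / n\<close>.\<close>

definition left_block :: "real \<Rightarrow> nat \<Rightarrow> nat \<Rightarrow> nat \<Rightarrow> nat \<Rightarrow> nat \<Rightarrow> real \<Rightarrow> (nat \<Rightarrow> real) \<Rightarrow> nat \<Rightarrow> bool" where
  "left_block \<theta> k r q1 q2 cnt C e p \<longleftrightarrow> e 0 = \<theta> \<and> (\<forall>i. e i \<in> D) \<and> 1 \<le> p \<and> p + cnt \<le> q2 \<and>
     (\<forall>i\<ge>r. e i = \<gamma>) \<and> (\<forall>i\<in>{k..<r}. e i = e k) \<and> (\<Sum>i<q2. \<bar>e i - \<gamma>\<bar>) \<le> C \<and>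
     (\<forall>i\<in>{p..<p+cnt}. e i = \<gamma>) \<and>
     (cnt = 1 \<and> p < k \<or> p = k \<and> cnt = r - k \<or> p = q1 \<and> cnt = q2 - q1)"

lemma sum_abs_support:
  fixes e :: "nat \<Rightarrow> real"
  assumes "\<And>i. e i \<noteq> g \<Longrightarrow> i \<in> S" "finite S" "card S \<le> c" "\<And>i. \<bar>e i - g\<bar> \<le> X"
  shows "(\<Sum>i<q. \<bar>e i - g\<bar>) \<le> real c * X"
proof -
  have X: "0 \<le> X" using assms(4)[of 0] by simp
  have "(\<Sum>i<q. \<bar>e i - g\<bar>) = (\<Sum>i\<in>{..<q} \<inter> S. \<bar>e i - g\<bar>)"
    by (rule sum.mono_neutral_right) (use assms(1) in auto)
  also have "\<dots> \<le> real (card ({..<q} \<inter> S)) * X"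
    using sum_bounded_above[of "{..<q} \<inter> S" "\<lambda>i. \<bar>e i - g\<bar>" X] assms(4) by simp
  also have "\<dots> \<le> real c * X"
    using card_mono[OF assms(2), of "{..<q} \<inter> S"] assms(3) X by (intro mult_right_mono) auto
  finally show ?thesis .
qed

lemma abs_bound_tail:
  fixes t :: "nat \<Rightarrow> real"
  assumes "\<And>i. N \<le> i \<Longrightarrow> t i = g"
  shows "\<bar>t i - g\<bar> \<le> (\<Sum>i<N. \<bar>t i - g\<bar>)"
proof (cases "i < N")
  case True
  then show ?thesis by (intro member_le_sum) auto
next
  case False
  then show ?thesis using assms by (simp add: sum_nonneg)
qed

lemma left_energy_gamma_tail:
  assumes "\<And>i. k \<le> i \<Longrightarrow> s i = \<gamma>"
  shows "left_energy s k W = j1 (s 0) / 2 + path s 0 k"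
proof -
  have "(\<Sum>i\<in>{k<..<W}. G (s i)) = 0" by (rule sum.neutral) (use assms in auto)
  then show ?thesis using assms[of k] by (simp add: left_energy_def)
qed

lemma left_energy_step:
  assumes "k < r" "r \<le> W" "\<And>i. k \<le> i \<Longrightarrow> i < r \<Longrightarrow> s i = z" "\<And>i. r \<le> i \<Longrightarrow> s i = \<gamma>"
  shows "left_energy s k W = j1 (s 0) / 2 + path s 0 k + (real (r - k) - 1/2) * G z"
proof -
  have "(\<Sum>i\<in>{k<..<W}. G (s i)) = (\<Sum>i\<in>{k<..<r}. G (s i))"
    by (rule sum.mono_neutral_right) (use assms in auto)
  also have "\<dots> = (\<Sum>i\<in>{k<..<r}. G z)" by (rule sum.cong) (use assms(3) in auto)
  also have "\<dots> = (real (r - k) - 1) * G z" using assms(1) by (simp add: of_nat_diff)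
  finally show ?thesis using assms(3)[of k] assms(1) by (simp add: left_energy_def algebra_simps)
qed

lemma path_jump:
  assumes "1 \<le> p" "p < k"
  shows "path s 0 k = path s 0 (p - 1) + F (s (p - 1)) (s p) + F (s p) (s (p + 1)) + path s (p + 1) k"
  using path_split[of 0 "p - 1" k s] path_split[of "p - 1" p k s] path_split[of p "p + 1" k s]
    path_step[of s "p - 1"] path_step[of s p] assms by simp

text \<open>A layer at the boundary and a layer read backwards from bond \<open>p\<close> are joined
  by bonds of slope \<gamma>, which cost nothing, so the two energies simply add.\<close>

lemma path_theta_gamma:
  assumes "\<And>i. N1 \<le> i \<Longrightarrow> t i = \<gamma>" "\<And>i. N2 \<le> i \<Longrightarrow> g i = \<gamma>" "N1 + N2 \<le> p"
    and s: "\<And>i. i \<le> p \<Longrightarrow> s i = (if i < N1 then t i else g (p - i))"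
  shows "path s 0 p = path t 0 N1 + path g 0 N2"
proof -
  have "path s 0 (0 + N1) = path t 0 N1"
  proof (rule path_shift)
    fix i assume "i \<le> N1"
    then show "s (0 + i) = t i" using assms(1)[of i] assms(2)[of "p - i"] assms(3) s[of i] by (cases "i = N1") auto
  qed
  moreover have "path s N1 (N1 + (p - N1)) = path g 0 (p - N1)"
    by (rule path_rev) (use assms s in auto)
  moreover have "path g 0 (p - N1) = path g 0 N2"
    by (rule path_gamma_tail) (use assms in auto)
  ultimately show ?thesis using path_split[of 0 N1 p s] assms(3) by simp
qed

lemma left_upper_nojump:
  assumes "0 < \<theta>" "B_theta J1 J2 \<gamma> \<theta> < ereal A"
  obtains e N where "e 0 = \<theta>" "\<And>i. e i \<in> D" "\<And>i. N \<le> i \<Longrightarrow> e i = \<gamma>"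
    "\<And>k W. N \<le> k \<Longrightarrow> left_energy e k W \<le> A"
proof -
  obtain t N where t: "t 0 = \<theta>" "\<And>i. t i \<in> D" "\<And>i. N \<le> i \<Longrightarrow> t i = \<gamma>" "j1 \<theta> / 2 + path t 0 N < A"
    using assms(2) by (rule B_theta_ex) (rule that)
  show thesis
  proof (rule that[of t N])
    show "left_energy t k W \<le> A" if "N \<le> k" for k W
      using left_energy_gamma_tail[of k t W] path_gamma_tail[of N t k] t that by simp
  qed (use t in auto)
qed

text \<open>One formula covers both kinds of count: for an infinite one
  \<open>t k = \<gamma>\<close>, so the term with \<open>G (t k)\<close> vanishes whatever
  \<open>n\<close> is.\<close>

lemma b_IFr_ex:
  assumes "b_IFr rhat < A" "rhat \<noteq> 0"
  obtains t k where "\<And>i. t i \<in> D"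
    "\<And>n. rhat = enat n \<or> rhat = \<infinity> \<Longrightarrow> j1 (t 0) / 2 + path t 0 k + (real n - 1/2) * G (t k) < A"
    "rhat = \<infinity> \<Longrightarrow> t k = \<gamma>"
proof (cases rhat)
  case (enat q)
  have q: "real (q - 1) + 1/2 = real q - 1/2" using assms(2) enat by (cases q) (auto simp: zero_enat_def)
  have "B_IF_nat J1 J2 \<gamma> (q - 1) < ereal A"
    using assms(1) enat by (subst B_IF_nat_real) (simp add: b_IFr_def)
  then obtain t k where "\<And>i. t i \<in> D" "j1 (t 0) / 2 + path t 0 k + (real (q - 1) + 1/2) * G (t k) < A"
    by (rule B_IF_nat_ex) (rule that)
  then show ?thesis using that[of t k] enat unfolding q by auto
next
  case infinity
  have "B_gamma J1 J2 \<gamma> < ereal A"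
    using assms(1) infinity by (subst B_gamma_real) (simp add: b_IFr_def)
  then obtain t N where "\<And>i. t i \<in> D" "\<And>i. N \<le> i \<Longrightarrow> t i = \<gamma>" "j1 (t 0) / 2 + path t 0 N < A"
    by (rule B_gamma_ex) (rule that)
  then show ?thesis using that[of t N] infinity by auto
qed

text \<open>Each alternative of the minimum is realised by gluing the near minimisers of its layers
  around the steep bonds. Only the placement of the layers depends on \<open>k\<close>,
  \<open>r\<close>, \<open>q1\<close>, \<open>q2\<close>; their shapes, the number of steep bonds
  and the bounds \<open>C\<close>, \<open>H\<close> do not.\<close>

lemma left_upper_jump:
  assumes \<theta>: "0 < \<theta>" and rhat: "rhat \<noteq> 0" and A: "B_IFJ J1 J2 \<gamma> rhat b \<theta> < ereal A"
  obtains cnt k0 :: nat and C H :: real where "0 < cnt"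
    "\<And>k r q1 q2. k0 \<le> k \<Longrightarrow> k < r \<Longrightarrow> r \<le> q1 \<Longrightarrow> q1 < q2 \<Longrightarrow> rhat = enat (r - k) \<or> rhat = \<infinity> \<Longrightarrow>
       b = enat (q2 - q1) \<or> b = \<infinity> \<Longrightarrow>
       \<exists>e p. left_block \<theta> k r q1 q2 cnt C e p \<and> (\<forall>h\<ge>H. left_energy (bump p cnt h e) k q2 \<le> A)"
proof (cases rule: B_IFJ_less[OF \<theta> rhat A])
  case 1
  \<comment> \<open>Four errors: one for each of the two layers and one for each interaction of the
    steep bond.\<close>
  define x where "x = (A - (j1 \<theta> / 2 + b_b \<theta> + b_gamma - 2 * m)) / 4"
  have x: "0 < x" and xA: "4 * x = A - (j1 \<theta> / 2 + b_b \<theta> + b_gamma - 2 * m)" using 1 by (simp_all add: x_def)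
  have "B_b J1 J2 \<gamma> \<theta> < ereal (b_b \<theta> + x)" by (subst B_b_real[OF \<theta>]) (use x in simp)
  then obtain tb kb where tb: "tb 0 = \<theta>" "\<And>i. tb i \<in> D" "j1 (tb kb) / 2 + path tb 0 kb < b_b \<theta> + x"
    by (rule B_b_ex) (rule that)
  have "B_gamma J1 J2 \<gamma> < ereal (b_gamma + x)" by (subst B_gamma_real) (use x in simp)
  then obtain tg Ng where tg: "\<And>i. tg i \<in> D" "\<And>i. Ng \<le> i \<Longrightarrow> tg i = \<gamma>" "j1 (tg 0) / 2 + path tg 0 Ng < b_gamma + x"
    by (rule B_gamma_ex) (rule that)
  obtain H1 where H1: "\<And>h. H1 \<le> h \<Longrightarrow> F (tb kb) h \<le> j1 (tb kb) / 2 - m + x" using jump_upper[OF x] by metis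
  obtain H2 where H2: "\<And>h. H2 \<le> h \<Longrightarrow> F (tg 0) h \<le> j1 (tg 0) / 2 - m + x" using jump_upper[OF x] by metis
  \<comment> \<open>The boundary layer, the bond \<open>kb + 1\<close> to be raised, then the layer
    that leads back to slope \<gamma>.\<close>
  define e where "e i = (if i \<le> kb then tb i else if i = kb + 1 then \<gamma> else tg (i - kb - 2))" for i
  define C where "C = (\<Sum>i<kb + 2 + Ng. \<bar>e i - \<gamma>\<bar>)"
  have eg: "e i = \<gamma>" if "kb + 2 + Ng \<le> i" for i using that tg(2) by (auto simp: e_def)
  show thesis
  proof (rule that[of 1 "kb + 2 + Ng" C "max H1 H2"])
    fix k r q1 q2 :: nat
    assume h: "kb + 2 + Ng \<le> k" "k < r" "r \<le> q1" "q1 < q2"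
    have "left_block \<theta> k r q1 q2 1 C e (kb + 1)"
    proof -
      have "(\<Sum>i<q2. \<bar>e i - \<gamma>\<bar>) = C" unfolding C_def
        by (rule sum.mono_neutral_right) (use h eg in auto)
      moreover have "e i \<in> D" for i using tb tg gamma_in by (simp add: e_def)
      ultimately show ?thesis unfolding left_block_def using h eg tb(1) by (auto simp: e_def)
    qed
    moreover have "left_energy (bump (kb + 1) 1 z e) k q2 \<le> A" if z: "z \<ge> max H1 H2" for z
    proof -
      define s where "s = bump (kb + 1) 1 z e"
      have s: "i \<le> kb \<Longrightarrow> s i = tb i" "s (kb + 1) = z" "s (kb + 2 + i) = tg i" for i
        by (auto simp: s_def bump_def e_def)
      have "left_energy s k q2 = j1 (s 0) / 2 + path s 0 k"
        by (rule left_energy_gamma_tail) (use h eg in \<open>auto simp: s_def bump_def\<close>)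
      also have "path s 0 k = path s 0 kb + F (tb kb) z + F z (tg 0) + path s (kb + 2) k"
        using path_jump[of "kb + 1" k s] h s s(3)[of 0] by simp
      also have "path s 0 kb = path tb 0 kb" using path_shift[of kb s 0 tb] s by simp
      also have "path s (kb + 2) k = path tg 0 Ng"
      proof -
        have "path s (kb + 2) (kb + 2 + (k - (kb + 2))) = path tg 0 (k - (kb + 2))"
          by (rule path_shift) (rule s)
        also have "kb + 2 + (k - (kb + 2)) = k" using h(1) by simp
        also have "path tg 0 (k - (kb + 2)) = path tg 0 Ng"
          by (rule path_gamma_tail) (use h tg in auto)
        finally show ?thesis .
      qed
      finally show ?thesis
        using H1[of z] H2[of z] z tb(3) tg(3) s(1)[of 0] tb(1) xA F_commute[of z "tg 0"] x
        unfolding s_def[symmetric] by simp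
    qed
    ultimately show "\<exists>e p. left_block \<theta> k r q1 q2 1 C e p \<and> (\<forall>h\<ge>max H1 H2. left_energy (bump p 1 h e) k q2 \<le> A)"
      by blast
  qed simp
next
  case 2
  define x where "x = (A - (b_IFr rhat + b_gamma - 2 * m + b_theta \<theta>)) / 5"
  have x: "0 < x" and xA: "5 * x = A - (b_IFr rhat + b_gamma - 2 * m + b_theta \<theta>)" using 2 by (simp_all add: x_def)
  have "B_theta J1 J2 \<gamma> \<theta> < ereal (b_theta \<theta> + x)" by (subst B_theta_real[OF \<theta>]) (use x in simp)
  then obtain tt Nt where tt: "tt 0 = \<theta>" "\<And>i. tt i \<in> D" "\<And>i. Nt \<le> i \<Longrightarrow> tt i = \<gamma>" "j1 \<theta> / 2 + path tt 0 Nt < b_theta \<theta> + x"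
    by (rule B_theta_ex) (rule that)
  have "B_gamma J1 J2 \<gamma> < ereal (b_gamma + x)" by (subst B_gamma_real) (use x in simp)
  then obtain tg Ng where tg: "\<And>i. tg i \<in> D" "\<And>i. Ng \<le> i \<Longrightarrow> tg i = \<gamma>" "j1 (tg 0) / 2 + path tg 0 Ng < b_gamma + x"
    by (rule B_gamma_ex) (rule that)
  have "b_IFr rhat < b_IFr rhat + x" using x by simp
  then obtain tI kI where tI: "\<And>i. tI i \<in> D"
    "\<And>n. rhat = enat n \<or> rhat = \<infinity> \<Longrightarrow> j1 (tI 0) / 2 + path tI 0 kI + (real n - 1/2) * G (tI kI) < b_IFr rhat + x"
    "rhat = \<infinity> \<Longrightarrow> tI kI = \<gamma>"
    using rhat by (rule b_IFr_ex) (rule that)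
  obtain H1 where H1: "\<And>h. H1 \<le> h \<Longrightarrow> F (tI 0) h \<le> j1 (tI 0) / 2 - m + x" using jump_upper[OF x] by metis
  obtain H2 where H2: "\<And>h. H2 \<le> h \<Longrightarrow> F (tg 0) h \<le> j1 (tg 0) / 2 - m + x" using jump_upper[OF x] by metis
  define X where "X = (\<Sum>i<Nt. \<bar>tt i - \<gamma>\<bar>) + (\<Sum>i<Ng. \<bar>tg i - \<gamma>\<bar>) + (\<Sum>i<Suc kI. \<bar>tI i - \<gamma>\<bar>)"
  \<comment> \<open>The first element carries the slope \<open>tI kI\<close> on all its bonds, which
    adds their number to the support of the deviation. For an infinite count this slope is \<gamma>
    and adds nothing.\<close>
  define cI where "cI = (case rhat of enat q \<Rightarrow> q | \<infinity> \<Rightarrow> 0)"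
  define C where "C = real (Nt + Ng + kI + cI) * X"
  show thesis
  proof (rule that[of 1 "Suc Nt + Ng + Suc kI + 2" C "max H1 H2"])
    fix k r q1 q2 :: nat
    assume h: "Suc Nt + Ng + Suc kI + 2 \<le> k" "k < r" "r \<le> q1" "q1 < q2" "rhat = enat (r - k) \<or> rhat = \<infinity>"
    \<comment> \<open>The crack sits \<open>kI + 1\<close> bonds before the interface, so that
      \<open>tI\<close> fills exactly the bonds \<open>p + 1\<close> to \<open>k\<close>.\<close>
    define p where "p = k - kI - 1"
    have p: "Nt + Ng + 2 \<le> p" "p + 1 + kI = k" using h(1) by (auto simp: p_def)
    \<comment> \<open>Boundary layer, bonds of slope \<gamma>, a layer ending at the crack (hence
      reversed), the crack, the interface layer. The minimum with \<open>kI\<close> prolongs the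
      last slope of \<open>tI\<close> over the whole first element.\<close>
    define e where "e i = (if i < Nt then tt i else if i < p then tg (p - 1 - i) else if i = p then \<gamma>
        else if i < r then tI (min (i - p - 1) kI) else \<gamma>)" for i
    have "left_block \<theta> k r q1 q2 1 C e p"
    proof -
      have "(\<Sum>i<q2. \<bar>e i - \<gamma>\<bar>) \<le> C" unfolding C_def
      proof (rule sum_abs_support)
        let ?S = "{..<Nt} \<union> {p - Ng..<p} \<union> {p + 1..<k} \<union> (if rhat = \<infinity> then {} else {k..<r})"
        show "finite ?S" by simp
        have "card ?S \<le> card {..<Nt} + card {p - Ng..<p} + card {p + 1..<k} + card (if rhat = \<infinity> then {} else {k..<r})"
          by (meson card_Un_le add_le_mono1 order_trans)
        also have "\<dots> \<le> Nt + Ng + kI + cI" using p h(5) by (auto simp: cI_def)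
        finally show "card ?S \<le> Nt + Ng + kI + cI" .
        show "i \<in> ?S" if "e i \<noteq> \<gamma>" for i
        proof (rule ccontr)
          assume n: "i \<notin> ?S"
          then consider "Nt \<le> i" "i < p - Ng" | "i = p" | "k \<le> i" "i < r" "rhat = \<infinity>" | "r \<le> i"
            using p h(2) by (auto split: if_splits) linarith+
          then have "e i = \<gamma>"
          proof cases
            case 3
            then have "min (i - p - 1) kI = kI" using p by simp
            then show ?thesis using 3 p tI(3) by (simp add: e_def)
          qed (use p h tg(2) in \<open>auto simp: e_def\<close>)
          then show False using that by simp
        qed
        show "\<bar>e i - \<gamma>\<bar> \<le> X" for i
        proof -
          define S1 where "S1 = (\<Sum>i<Nt. \<bar>tt i - \<gamma>\<bar>)"
          define S2 where "S2 = (\<Sum>i<Ng. \<bar>tg i - \<gamma>\<bar>)"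
          define S3 where "S3 = (\<Sum>i<Suc kI. \<bar>tI i - \<gamma>\<bar>)"
          have "\<bar>tt i - \<gamma>\<bar> \<le> S1" "\<bar>tg (p - 1 - i) - \<gamma>\<bar> \<le> S2"
            unfolding S1_def S2_def using abs_bound_tail tt(3) tg(2) by blast+
          moreover have "\<bar>tI (min (i - p - 1) kI) - \<gamma>\<bar> \<le> S3" unfolding S3_def
            by (rule member_le_sum[where f = "\<lambda>i. \<bar>tI i - \<gamma>\<bar>"]) auto
          moreover have "0 \<le> S1" "0 \<le> S2" "0 \<le> S3"
            unfolding S1_def S2_def S3_def by (rule sum_nonneg; simp)+
          ultimately show ?thesis
            unfolding X_def S1_def[symmetric] S2_def[symmetric] S3_def[symmetric] e_def by simp
        qed
      qed
      moreover have "e i \<in> D" for i using tt tg tI gamma_in by (simp add: e_def)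
      moreover have "e 0 = \<theta>"
      proof (cases "Nt = 0")
        case True
        then show ?thesis using tt(1) tt(3)[of 0] tg(2)[of "p - 1"] p by (simp add: e_def)
      qed (simp add: e_def tt)
      moreover have "e i = e k" if "i \<in> {k..<r}" for i using that p h by (auto simp: e_def)
      ultimately show ?thesis unfolding left_block_def using h p by (auto simp: e_def)
    qed
    moreover have "left_energy (bump p 1 z e) k q2 \<le> A" if z: "z \<ge> max H1 H2" for z
    proof -
      define s where "s = bump p 1 z e"
      have s1: "s i = (if i < Nt then tt i else tg (p - 1 - i))" if "i \<le> p - 1" for i
        using that p by (auto simp: s_def bump_def e_def)
      have s2: "s p = z" by (simp add: s_def bump_def)
      have s3: "s (p + 1 + i) = tI i" if "i \<le> kI" for i using that p h by (auto simp: s_def bump_def e_def)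
      have "left_energy s k q2 = j1 (s 0) / 2 + path s 0 k + (real (r - k) - 1/2) * G (tI kI)"
        by (rule left_energy_step) (use h p in \<open>auto simp: s_def bump_def e_def\<close>)
      also have "s 0 = \<theta>"
      proof (cases "Nt = 0")
        case True
        then show ?thesis using s1[of 0] tt(1) tt(3)[of 0] tg(2)[of "p - 1"] p by simp
      qed (use s1[of 0] tt in simp)
      also have "path s 0 k = path s 0 (p - 1) + F (tg 0) z + F z (tI 0) + path s (p + 1) k"
      proof -
        have "\<not> p - 1 < Nt" using p by linarith
        then have "s (p - 1) = tg 0" using s1[of "p - 1"] by simp
        then show ?thesis using path_jump[of p k s] p s2 s3[of 0] by simp
      qed
      also have "path s 0 (p - 1) = path tt 0 Nt + path tg 0 Ng"
        by (rule path_theta_gamma) (use tt tg p s1 in auto)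
      also have "path s (p + 1) k = path tI 0 kI"
        using path_shift[of kI s "p + 1" tI] s3 p by simp
      finally show ?thesis
        using H1[of z] H2[of z] z tt(4) tg(3) tI(2)[OF h(5)] xA F_commute[of z "tI 0"] x
        unfolding s_def[symmetric] by simp
    qed
    ultimately show "\<exists>e p. left_block \<theta> k r q1 q2 1 C e p \<and> (\<forall>h\<ge>max H1 H2. left_energy (bump p 1 h e) k q2 \<le> A)"
      by blast
  qed simp
next
  case (3 q)
  \<comment> \<open>The two layers, the interaction across the interface and the
    \<open>q - 1/2\<close> weighted bonds of the first element each use one error \<open>x\<close>,
    which is less than \<open>q + 4\<close> in all.\<close>
  define x where "x = (A - (b_gamma - (1/2 + real q) * m + b_theta \<theta>)) / (real q + 4)"
  have x: "0 < x" using 3 by (simp add: x_def)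
  have xA: "(real q + 4) * x = A - (b_gamma - (1/2 + real q) * m + b_theta \<theta>)" by (simp add: x_def)
  have q: "0 < q" using rhat 3 by (cases q) (auto simp: zero_enat_def)
  have "B_theta J1 J2 \<gamma> \<theta> < ereal (b_theta \<theta> + x)" by (subst B_theta_real[OF \<theta>]) (use x in simp)
  then obtain tt Nt where tt: "tt 0 = \<theta>" "\<And>i. tt i \<in> D" "\<And>i. Nt \<le> i \<Longrightarrow> tt i = \<gamma>" "j1 \<theta> / 2 + path tt 0 Nt < b_theta \<theta> + x"
    by (rule B_theta_ex) (rule that)
  have "B_gamma J1 J2 \<gamma> < ereal (b_gamma + x)" by (subst B_gamma_real) (use x in simp)
  then obtain tg Ng where tg: "\<And>i. tg i \<in> D" "\<And>i. Ng \<le> i \<Longrightarrow> tg i = \<gamma>" "j1 (tg 0) / 2 + path tg 0 Ng < b_gamma + x"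
    by (rule B_gamma_ex) (rule that)
  obtain H where H: "\<And>h. H \<le> h \<Longrightarrow> F (tg 0) h \<le> j1 (tg 0) / 2 - m + x" "\<And>h. H \<le> h \<Longrightarrow> G h \<le> - m + x"
    using jump_upper[OF x] by metis
  define X where "X = (\<Sum>i<Nt. \<bar>tt i - \<gamma>\<bar>) + (\<Sum>i<Ng. \<bar>tg i - \<gamma>\<bar>)"
  define C where "C = real (Nt + Ng) * X"
  show thesis
  proof (rule that[of q "Nt + Ng + 2" C H])
    fix k r q1 q2 :: nat
    assume h: "Nt + Ng + 2 \<le> k" "k < r" "r \<le> q1" "q1 < q2" "rhat = enat (r - k) \<or> rhat = \<infinity>"
    have rq: "r - k = q" using h(5) 3 by simp
    define e where "e i = (if i < Nt then tt i else if i < k then tg (k - 1 - i) else \<gamma>)" for i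
    have e0: "e 0 = \<theta>"
    proof (cases "Nt = 0")
      case True
      then show ?thesis using tt(1) tt(3)[of 0] tg(2)[of "k - 1"] h by (simp add: e_def)
    qed (simp add: e_def tt)
    have "left_block \<theta> k r q1 q2 q C e k"
    proof -
      have "(\<Sum>i<q2. \<bar>e i - \<gamma>\<bar>) \<le> C" unfolding C_def
      proof (rule sum_abs_support)
        let ?S = "{..<Nt} \<union> {k - Ng..<k}"
        show "finite ?S" by simp
        show "card ?S \<le> Nt + Ng" using card_Un_le[of "{..<Nt}" "{k - Ng..<k}"] h(1) by simp
        show "i \<in> ?S" if "e i \<noteq> \<gamma>" for i
        proof (rule ccontr)
          assume "i \<notin> ?S"
          then have "\<not> i < Nt" "i < k \<Longrightarrow> Ng \<le> k - 1 - i" by auto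
          then have "e i = \<gamma>" using tg(2)[of "k - 1 - i"] by (simp add: e_def)
          then show False using that by simp
        qed
        show "\<bar>e i - \<gamma>\<bar> \<le> X" for i
        proof -
          define S1 where "S1 = (\<Sum>i<Nt. \<bar>tt i - \<gamma>\<bar>)"
          define S2 where "S2 = (\<Sum>i<Ng. \<bar>tg i - \<gamma>\<bar>)"
          have "\<bar>tt i - \<gamma>\<bar> \<le> S1" "\<bar>tg (k - 1 - i) - \<gamma>\<bar> \<le> S2"
            unfolding S1_def S2_def using abs_bound_tail tt(3) tg(2) by blast+
          moreover have "0 \<le> S1" "0 \<le> S2"
            unfolding S1_def S2_def by (rule sum_nonneg; simp)+
          ultimately show ?thesis
            unfolding X_def S1_def[symmetric] S2_def[symmetric] e_def by simp
        qed
      qed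
      moreover have "e i \<in> D" for i using tt tg gamma_in by (simp add: e_def)
      ultimately show ?thesis unfolding left_block_def using h e0 rq by (auto simp: e_def)
    qed
    moreover have "left_energy (bump k q z e) k q2 \<le> A" if z: "z \<ge> H" for z
    proof -
      define s where "s = bump k q z e"
      have s1: "s i = (if i < Nt then tt i else tg (k - 1 - i))" if "i \<le> k - 1" for i
        using that h(1) by (auto simp: s_def bump_def e_def)
      have s2: "s k = z" using q by (simp add: s_def bump_def)
      have "left_energy s k q2 = j1 (s 0) / 2 + path s 0 k + (real (r - k) - 1/2) * G z"
        by (rule left_energy_step) (use h rq in \<open>auto simp: s_def bump_def e_def\<close>)
      also have "s 0 = \<theta>" using e0 h(1) by (simp add: s_def bump_def)
      also have "path s 0 k = path s 0 (k - 1) + F (tg 0) z"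
      proof -
        have "\<not> k - 1 < Nt" using h(1) by linarith
        then have "s (k - 1) = tg 0" using s1[of "k - 1"] by simp
        then show ?thesis using path_split[of 0 "k - 1" k s] path_step[of s "k - 1"] h(1) s2 by simp
      qed
      also have "path s 0 (k - 1) = path tt 0 Nt + path tg 0 Ng"
        by (rule path_theta_gamma) (use tt tg h(1) s1 in auto)
      finally have "left_energy s k q2 = j1 \<theta> / 2 + (path tt 0 Nt + path tg 0 Ng + F (tg 0) z) + (real q - 1/2) * G z"
        using rq by simp
      moreover have "(real q - 1/2) * G z \<le> (real q - 1/2) * (- m + x)"
        using H(2)[OF z] q by (intro mult_left_mono) auto
      moreover have "(real q - 1/2) * (- m + x) = real q * x - real q * m + m / 2 - x / 2"
        by (simp add: field_simps)
      moreover have "real q * x + 4 * x = A - (b_gamma - m / 2 - real q * m + b_theta \<theta>)"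
        using xA by (simp add: algebra_simps)
      ultimately show ?thesis
        using H(1)[OF z] tt(4) tg(3) x unfolding s_def[symmetric] by simp
    qed
    ultimately show "\<exists>e p. left_block \<theta> k r q1 q2 q C e p \<and> (\<forall>h\<ge>H. left_energy (bump p q h e) k q2 \<le> A)"
      by blast
  qed (rule q)
next
  case (4 q)
  define x where "x = (A - (- (real q * m) + b_theta \<theta>)) / (real q + 2)"
  have x: "0 < x" using 4 by (simp add: x_def)
  have xA: "(real q + 2) * x = A - (- (real q * m) + b_theta \<theta>)" by (simp add: x_def)
  have "B_theta J1 J2 \<gamma> \<theta> < ereal (b_theta \<theta> + x)" by (subst B_theta_real[OF \<theta>]) (use x in simp)
  then obtain tt Nt where tt: "tt 0 = \<theta>" "\<And>i. tt i \<in> D" "\<And>i. Nt \<le> i \<Longrightarrow> tt i = \<gamma>" "j1 \<theta> / 2 + path tt 0 Nt < b_theta \<theta> + x"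
    by (rule B_theta_ex) (rule that)
  obtain H where H: "\<And>h. H \<le> h \<Longrightarrow> G h \<le> - m + x"
    using jump_upper[OF x] by metis
  define C where "C = (\<Sum>i<Nt. \<bar>tt i - \<gamma>\<bar>)"
  show thesis
  \<comment> \<open>Positivity of the count is due before any element is given. Once
    \<open>q1 < q2\<close> is available, \<open>q = q2 - q1\<close> is positive and the maximum is
    \<open>q\<close>.\<close>
  proof (rule that[of "max 1 q" "Nt + 1" C H])
    fix k r q1 q2 :: nat
    assume h: "Nt + 1 \<le> k" "k < r" "r \<le> q1" "q1 < q2" and "b = enat (q2 - q1) \<or> b = \<infinity>"
    then have rq: "q2 - q1 = q" "max 1 q = q" using 4 by auto
    have "left_block \<theta> k r q1 q2 q C tt q1"
    proof -
      have "(\<Sum>i<q2. \<bar>tt i - \<gamma>\<bar>) = C" unfolding C_def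
        by (rule sum.mono_neutral_right) (use h tt in auto)
      then show ?thesis unfolding left_block_def using h tt rq by auto
    qed
    moreover have "left_energy (bump q1 q z tt) k q2 \<le> A" if z: "z \<ge> H" for z
    proof -
      define s where "s = bump q1 q z tt"
      have s1: "s i = tt i" if "i < q1" for i using that by (simp add: s_def bump_def)
      have "(\<Sum>i\<in>{k<..<q2}. G (s i)) = (\<Sum>i\<in>{q1..<q2}. G (s i))"
        by (rule sum.mono_neutral_right) (use h tt s1 in auto)
      also have "\<dots> = (\<Sum>i\<in>{q1..<q2}. G z)" by (rule sum.cong) (use rq in \<open>auto simp: s_def bump_def\<close>)
      also have "\<dots> = real q * G z" using rq by simp
      also have "\<dots> \<le> real q * (- m + x)" using H[OF z] by (intro mult_left_mono) auto
      finally have G: "(\<Sum>i\<in>{k<..<q2}. G (s i)) \<le> real q * (- m + x)" .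
      have "path s 0 k = path tt 0 k" using path_shift[of k s 0 tt] s1 h by simp
      also have "\<dots> = path tt 0 Nt" by (rule path_gamma_tail) (use tt h in auto)
      finally have "left_energy s k q2 \<le> j1 \<theta> / 2 + path tt 0 Nt + real q * (- m + x)"
        using G s1[of 0] s1[of k] tt h by (simp add: left_energy_def)
      then show ?thesis using tt(4) xA x unfolding s_def[symmetric] by (simp add: algebra_simps)
    qed
    ultimately show "\<exists>e p. left_block \<theta> k r q1 q2 (max 1 q) C e p \<and> (\<forall>h\<ge>H. left_energy (bump p (max 1 q) h e) k q2 \<le> A)"
      unfolding rq(2) by blast
  qed simp
qed

end

section \<open>The quasicontinuum energy in terms of slopes\<close>

definition slopes :: "nat \<Rightarrow> (real \<Rightarrow> real) \<Rightarrow> nat \<Rightarrow> real" where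
  "slopes n v i = real n * (v (real (i + 1) / real n) - v (real i / real n))"

lemma sum_ereal_not_MInf: "(\<And>i. i \<in> A \<Longrightarrow> f i \<noteq> (-\<infinity>::ereal)) \<Longrightarrow> sum f A \<noteq> -\<infinity>"
  by (induction A rule: infinite_finite_induct) auto

lemma sum_half_telescope:
  fixes f :: "nat \<Rightarrow> real"
  assumes "a < b"
  shows "(\<Sum>i\<in>{a..<b}. (f i + f (Suc i)) / 2) = f a / 2 + (\<Sum>i\<in>{a<..<b}. f i) + f b / 2"
  using assms
proof (induction b rule: less_induct)
  case (less b)
  show ?case
  proof (cases "b = Suc a")
    case True
    then have "{a<..<b} = {}" by auto
    then show ?thesis using True by (simp add: add_divide_distrib)
  next
    case False
    then obtain c where c: "b = Suc c" "a < c" using less.prems by (cases b) auto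
    have "{a<..<b} = insert c {a<..<c}" using c by auto
    then show ?thesis using less.IH[of c] c by (simp add: add_divide_distrib)
  qed
qed

context lj_potentials
begin

text \<open>All continuum bonds are assigned to the left window. The reflected right window ends
  right after its interface bond \<open>n - b\<close>, which is bond \<open>b - 1\<close> of the
  chain, and so has an empty continuum part.\<close>

definition qc_E :: "nat \<Rightarrow> nat \<Rightarrow> nat \<Rightarrow> (nat \<Rightarrow> real) \<Rightarrow> real" where
  "qc_E n a b s = left_energy s a (b - 1) + left_energy (\<lambda>i. s (n - 1 - i)) (n - b) (Suc (n - b)) - m"

text \<open>Each \<open>J1\<close> is shared in halves by the two adjacent cells, and the two
  outermost halves are left over as surface terms. Averaging neighbouring \<open>J2\<close> in the
  continuum region gives each inner bond a full \<open>G\<close> and the two interface bonds half of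
  it.\<close>

lemma qc_E_expand:
  assumes ab: "0 < a" "a + 1 < b" "b + 2 < n"
  shows "(\<Sum>i<n. j1 (s i)) + (\<Sum>i<a. j2 ((s i + s (Suc i)) / 2))
    + (\<Sum>i\<in>{a..b-2}. (j2 (s i) + j2 (s (Suc i))) / 2) + (\<Sum>i\<in>{b-1..n-2}. j2 ((s i + s (Suc i)) / 2))
    - real n * m = qc_E n a b s"
proof -
  have iv: "{a..b-2} = {a..<b-1}" "{b-1..n-2} = {b-1..<n-1}" using ab by auto
  have "(\<Sum>i<n. j1 (s i)) = j1 (s 0) / 2 + j1 (s (n - 1)) / 2 + (\<Sum>i\<in>{0..<n-1}. (j1 (s i) + j1 (s (Suc i))) / 2)"
  proof -
    have "{..<n} = insert 0 (insert (n - 1) {0<..<n-1})" using ab by auto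
    then show ?thesis using sum_half_telescope[of 0 "n - 1" "\<lambda>i. j1 (s i)"] ab by simp
  qed
  also have "(\<Sum>i\<in>{0..<n-1}. (j1 (s i) + j1 (s (Suc i))) / 2) = (\<Sum>i\<in>{0..<a}. (j1 (s i) + j1 (s (Suc i))) / 2)
      + (\<Sum>i\<in>{a..<b-1}. (j1 (s i) + j1 (s (Suc i))) / 2) + (\<Sum>i\<in>{b-1..<n-1}. (j1 (s i) + j1 (s (Suc i))) / 2)"
  proof -
    have le: "0 \<le> a" "a \<le> b - 1" "b - 1 \<le> n - 1" "a \<le> n - 1" using ab by auto
    show ?thesis
      by (simp only: sum.atLeastLessThan_concat[OF le(1,2)]
          sum.atLeastLessThan_concat[OF order_trans[OF le(1,2)] le(3)])
  qed
  finally have S1: "(\<Sum>i<n. j1 (s i)) = j1 (s 0) / 2 + j1 (s (n - 1)) / 2 + ((\<Sum>i\<in>{0..<a}. (j1 (s i) + j1 (s (Suc i))) / 2)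
      + (\<Sum>i\<in>{a..<b-1}. (j1 (s i) + j1 (s (Suc i))) / 2) + (\<Sum>i\<in>{b-1..<n-1}. (j1 (s i) + j1 (s (Suc i))) / 2))" .
  have Fs: "(\<Sum>i\<in>{x..<y}. (j1 (s i) + j1 (s (Suc i))) / 2) + (\<Sum>i\<in>{x..<y}. j2 ((s i + s (Suc i)) / 2))
      = path s x y + real (y - x) * m" for x y
    unfolding path_def F_def by (simp add: sum.distrib sum_subtractf add_divide_distrib sum_divide_distrib)
  have Gs: "(\<Sum>i\<in>{a..<b-1}. (j1 (s i) + j1 (s (Suc i))) / 2) + (\<Sum>i\<in>{a..<b-1}. (j2 (s i) + j2 (s (Suc i))) / 2)
      = G (s a) / 2 + (\<Sum>i\<in>{a<..<b-1}. G (s i)) + G (s (b - 1)) / 2 + real (b - 1 - a) * m"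
  proof -
    have "(\<Sum>i\<in>{a..<b-1}. (G (s i) + G (s (Suc i))) / 2) = G (s a) / 2 + (\<Sum>i\<in>{a<..<b-1}. G (s i)) + G (s (b - 1)) / 2"
      using sum_half_telescope[of a "b - 1" "\<lambda>i. G (s i)"] ab by simp
    moreover have "(\<Sum>i\<in>{a..<b-1}. (G (s i) + G (s (Suc i))) / 2) =
        (\<Sum>i\<in>{a..<b-1}. (j1 (s i) + j1 (s (Suc i))) / 2 + (j2 (s i) + j2 (s (Suc i))) / 2 - m)"
      by (rule sum.cong) (simp_all add: G_def field_simps)
    ultimately show ?thesis by (simp add: sum.distrib sum_subtractf)
  qed
  have "path s (b - 1) (b - 1 + (n - b)) = path (\<lambda>i. s (n - 1 - i)) 0 (n - b)"
    by (rule path_rev) (use ab in auto)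
  moreover have "b - 1 + (n - b) = n - 1" using ab by simp
  ultimately have pr: "path s (b - 1) (n - 1) = path (\<lambda>i. s (n - 1 - i)) 0 (n - b)" by simp
  have emp: "{n - b<..<Suc (n - b)} = {}" by auto
  have nb: "n - Suc (n - b) = b - 1" using ab by simp
  \<comment> \<open>A chain of \<open>n\<close> bonds has \<open>n - 1\<close> cells. The one
    \<open>m\<close> without a cell is the summand \<open>- m\<close> of \<open>qc_E\<close>, and
    finally the \<open>- J0 \<gamma>\<close> of the limit.\<close>
  have "real (a - 0) + real (b - 1 - a) + real (n - 1 - (b - 1)) + 1 = real n" using ab by simp
  then have rn: "real n * m = real (a - 0) * m + real (b - 1 - a) * m + real (n - 1 - (b - 1)) * m + m"
    by (metis distrib_right mult_1)
  show ?thesis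
    unfolding S1 iv qc_E_def left_energy_def emp rn
    using Fs[of 0 a] Gs Fs[of "b - 1" "n - 1"] pr nb by (simp add: atLeast0LessThan)
qed

lemma J_not_MInf: "J1 z \<noteq> -\<infinity>" "J2 z \<noteq> -\<infinity>"
  by (cases "z \<in> D"; simp add: J1_in J2_in J1_out J2_out)+

lemma qc_energy_slopes:
  assumes n: "0 < n"
  shows "qc_energy J1 J2 n a b (\<lambda>i. v (real i / real n)) =
     (\<Sum>i<n. ereal (1 / real n) * J1 (slopes n v i)) + (\<Sum>i<a. ereal (1 / real n) * J2 ((slopes n v i + slopes n v (Suc i)) / 2))
    + (\<Sum>i\<in>{a..b-2}. ereal (1 / real n / 2) * (J2 (slopes n v i) + J2 (slopes n v (Suc i))))
    + (\<Sum>i\<in>{b-1..n-2}. ereal (1 / real n) * J2 ((slopes n v i + slopes n v (Suc i)) / 2))"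
proof -
  have 1: "(v (real (i+1) / real n) - v (real i / real n)) / (1 / real n) = slopes n v i" for i
    by (simp add: slopes_def)
  have 2: "(v (real (i+2) / real n) - v (real (i+1) / real n)) / (1 / real n) = slopes n v (Suc i)" for i
    by (simp add: slopes_def)
  have 3: "(v (real (i+2) / real n) - v (real i / real n)) / (2 * (1 / real n)) = (slopes n v i + slopes n v (Suc i)) / 2" for i
    by (simp add: slopes_def algebra_simps add_divide_distrib diff_divide_distrib)
  show ?thesis unfolding qc_energy_def Let_def 1 2 3 ..
qed

lemma qc_energy_real:
  assumes ab: "0 < a" "a + 1 < b" "b + 2 < n" and s: "\<And>i. i < n \<Longrightarrow> slopes n v i \<in> D"
  shows "ereal (real n) * (qc_energy J1 J2 n a b (\<lambda>i. v (real i / real n)) - ereal m) = ereal (qc_E n a b (slopes n v))"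
proof -
  define s where "s = slopes n v"
  have n: "0 < n" using ab by simp
  have sD: "s i \<in> D" if "i < n" for i using assms(4) that by (simp add: s_def)
  have e1: "(\<Sum>i<n. ereal (1 / real n) * J1 (s i)) = ereal (1 / real n * (\<Sum>i<n. j1 (s i)))"
    using sD by (simp add: J1_in sum_distrib_left)
  have e2: "(\<Sum>i<a. ereal (1 / real n) * J2 ((s i + s (Suc i)) / 2)) = ereal (1 / real n * (\<Sum>i<a. j2 ((s i + s (Suc i)) / 2)))"
  proof -
    have "(\<Sum>i<a. ereal (1 / real n) * J2 ((s i + s (Suc i)) / 2)) = (\<Sum>i<a. ereal (1 / real n * j2 ((s i + s (Suc i)) / 2)))"
      by (rule sum.cong) (use ab sD mid_in in \<open>simp_all add: J2_in\<close>)
    then show ?thesis by (simp add: sum_distrib_left)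
  qed
  have e3: "(\<Sum>i\<in>{a..b-2}. ereal (1 / real n / 2) * (J2 (s i) + J2 (s (Suc i))))
      = ereal (1 / real n * (\<Sum>i\<in>{a..b-2}. (j2 (s i) + j2 (s (Suc i))) / 2))"
  proof -
    have "(\<Sum>i\<in>{a..b-2}. ereal (1 / real n / 2) * (J2 (s i) + J2 (s (Suc i))))
      = (\<Sum>i\<in>{a..b-2}. ereal (1 / real n * ((j2 (s i) + j2 (s (Suc i))) / 2)))"
    proof (rule sum.cong[OF refl])
      fix i assume "i \<in> {a..b-2}"
      then have "i < n" "Suc i < n" using ab by auto
      then show "ereal (1 / real n / 2) * (J2 (s i) + J2 (s (Suc i))) = ereal (1 / real n * ((j2 (s i) + j2 (s (Suc i))) / 2))"
        using J2_in[OF sD] by simp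
    qed
    then show ?thesis by (simp add: sum_distrib_left)
  qed
  have e4: "(\<Sum>i\<in>{b-1..n-2}. ereal (1 / real n) * J2 ((s i + s (Suc i)) / 2))
      = ereal (1 / real n * (\<Sum>i\<in>{b-1..n-2}. j2 ((s i + s (Suc i)) / 2)))"
  proof -
    have "(\<Sum>i\<in>{b-1..n-2}. ereal (1 / real n) * J2 ((s i + s (Suc i)) / 2))
      = (\<Sum>i\<in>{b-1..n-2}. ereal (1 / real n * j2 ((s i + s (Suc i)) / 2)))"
    proof (rule sum.cong[OF refl])
      fix i assume "i \<in> {b-1..n-2}"
      then have "i < n" "Suc i < n" using ab by auto
      then show "ereal (1 / real n) * J2 ((s i + s (Suc i)) / 2) = ereal (1 / real n * j2 ((s i + s (Suc i)) / 2))"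
        using J2_in[OF mid_in[OF sD sD]] by simp
    qed
    then show ?thesis by (simp add: sum_distrib_left)
  qed
  show ?thesis
    unfolding qc_energy_slopes[OF n] s_def[symmetric] e1 e2 e3 e4 qc_E_expand[OF ab, symmetric]
    using n by (simp add: algebra_simps add_divide_distrib)
qed

text \<open>Every bond has its own \<open>J1\<close> term and no term is minus infinity, so one
  slope outside the domain already makes the energy infinite.\<close>

lemma qc_energy_finite_imp:
  assumes n: "0 < n" and fin: "ereal (real n) * (qc_energy J1 J2 n a b (\<lambda>i. v (real i / real n)) - ereal m) < \<infinity>"
    and i: "i < n"
  shows "slopes n v i \<in> D"
proof (rule ccontr)
  assume "slopes n v i \<notin> D"
  then have "ereal (1 / real n) * J1 (slopes n v i) = \<infinity>" using n by (simp add: J1_out)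
  then have S1: "(\<Sum>i<n. ereal (1 / real n) * J1 (slopes n v i)) = \<infinity>"
    using i by (subst sum_Pinfty) blast
  have nm: "ereal (1 / real n) * J2 z \<noteq> -\<infinity>" for z
    using n by (cases "z \<in> D") (simp_all add: J2_in J2_out)
  have "J2 z + J2 z' \<noteq> -\<infinity>" for z z' using J_not_MInf by simp
  then have nm2: "ereal (1 / real n / 2) * (J2 z + J2 z') \<noteq> -\<infinity>" for z z'
    using n by (cases "J2 z + J2 z'") auto
  have "qc_energy J1 J2 n a b (\<lambda>i. v (real i / real n)) = \<infinity>"
    unfolding qc_energy_slopes[OF n] S1 using sum_ereal_not_MInf nm nm2 by simp
  then show False using fin n by simp
qed

end

subsection \<open>Piecewise affine functions and their slopes\<close>

lemma consecutive_cover: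
  assumes "T \<subseteq> {0..n}" "0 \<in> T" "n \<in> T" "i < n"
  obtains a b where "consecutive T a b" "a \<le> i" "i < b" "b \<le> n"
proof -
  have fin: "finite T" using assms(1) finite_subset by blast
  define a where "a = Max {t \<in> T. t \<le> i}"
  define b where "b = Min {t \<in> T. i < t}"
  have a: "a \<in> {t \<in> T. t \<le> i}" unfolding a_def by (rule Max_in) (use fin assms in auto)
  have b: "b \<in> {t \<in> T. i < t}" unfolding b_def by (rule Min_in) (use fin assms in auto)
  have "c \<le> a" if "c \<in> T" "c \<le> i" for c unfolding a_def using fin that by (intro Max_ge) auto
  moreover have "b \<le> c" if "c \<in> T" "i < c" for c unfolding b_def using fin that by (intro Min_le) auto
  ultimately have "consecutive T a b"
    unfolding consecutive_def using a b by (metis (mono_tags, lifting) le_less_trans mem_Collect_eq not_less)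
  then show thesis using that a b assms(1) by auto
qed

definition elem_const :: "nat set \<Rightarrow> (nat \<Rightarrow> real) \<Rightarrow> bool" where
  "elem_const T s \<longleftrightarrow> (\<forall>a b. consecutive T a b \<longrightarrow> (\<forall>i\<in>{a..<b}. s i = s a))"

definition bond_affine :: "nat \<Rightarrow> (real \<Rightarrow> real) \<Rightarrow> bool" where
  "bond_affine n v \<longleftrightarrow> (\<forall>i<n. \<exists>p q. \<forall>x\<in>{real i / real n..real (i+1) / real n}. v x = p * x + q)"

lemma affine_closed_interval:
  fixes v :: "real \<Rightarrow> real"
  assumes "continuous_on {0..1} v" "0 \<le> x" "x < y" "y \<le> 1" "\<forall>z\<in>{x<..<y}. v z = p * z + q" "z \<in> {x..y}"
  shows "v z = p * z + q"
proof -
  have "continuous_on (closure {x<..<y}) (\<lambda>z. v z - (p * z + q))"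
    using assms by (intro continuous_intros continuous_on_subset[OF assms(1)]) (auto simp: closure_greaterThanLessThan)
  then have "v z - (p * z + q) = 0"
    by (rule continuous_constant_on_closure) (use assms in \<open>auto simp: closure_greaterThanLessThan\<close>)
  then show ?thesis by simp
qed

lemma in_A_T_affine:
  assumes A: "in_A_T n T v" and T: "T \<subseteq> {0..n}" "0 \<in> T" "n \<in> T" and n: "0 < n"
  shows "bond_affine n v" "elem_const T (slopes n v)"
proof -
  have el: "\<exists>p q. \<forall>z\<in>{real a / real n..real b / real n}. v z = p * z + q" if c: "consecutive T a b" for a b
  proof -
    have ab: "a < b" "b \<le> n" using c T by (auto simp: consecutive_def)
    obtain p q where pq: "\<forall>x\<in>{real a / real n<..<real b / real n}. v x = p * x + q"
      using A c unfolding in_A_T_def by blast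
    have "continuous_on {0..1} v" using A by (simp add: in_A_T_def)
    moreover have "0 \<le> real a / real n" "real a / real n < real b / real n" "real b / real n \<le> 1"
      using ab n by (simp_all add: divide_strict_right_mono)
    ultimately have "\<forall>z\<in>{real a / real n..real b / real n}. v z = p * z + q"
      by (intro ballI) (rule affine_closed_interval[OF _ _ _ _ pq])
    then show ?thesis by blast
  qed
  have sub: "{real i / real n..real (i+1) / real n} \<subseteq> {real a / real n..real b / real n}" if "a \<le> i" "i < b" for a b i
  proof -
    have "real a / real n \<le> real i / real n" "real (i+1) / real n \<le> real b / real n"
      using that by (intro divide_right_mono; simp)+
    then show ?thesis by (simp add: atLeastatMost_subset_iff)
  qed
  show "bond_affine n v"
    unfolding bond_affine_def
  proof (intro allI impI)
    fix i assume "i < n"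
    then obtain a b where ab: "consecutive T a b" "a \<le> i" "i < b" using consecutive_cover[OF T] by metis
    show "\<exists>p q. \<forall>x\<in>{real i / real n..real (i+1) / real n}. v x = p * x + q"
      using el[OF ab(1)] sub[OF ab(2,3)] by blast
  qed
  show "elem_const T (slopes n v)"
    unfolding elem_const_def
  proof (intro allI impI ballI)
    fix a b i assume ab: "consecutive T a b" and i: "i \<in> {a..<b}"
    obtain p q where pq: "\<forall>z\<in>{real a / real n..real b / real n}. v z = p * z + q" using el[OF ab] by blast
    have "slopes n v j = p" if "a \<le> j" "j < b" for j
    proof -
      have "real j / real n \<in> {real j / real n..real (j+1) / real n}" "real (j+1) / real n \<in> {real j / real n..real (j+1) / real n}"
        using n by (simp_all add: divide_right_mono)
      then have "v (real j / real n) = p * (real j / real n) + q" "v (real (j+1) / real n) = p * (real (j+1) / real n) + q"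
        using bspec[OF pq subsetD[OF sub[OF that]]] by simp_all
      then show ?thesis unfolding slopes_def using n by (simp add: field_simps)
    qed
    then show "slopes n v i = slopes n v a" using i by simp
  qed
qed

lemma slopes_sum:
  assumes "0 < n"
  shows "(\<Sum>j<i. slopes n v j) = real n * (v (real i / real n) - v 0)"
  by (induction i) (simp_all add: slopes_def algebra_simps)

text \<open>The primitive of the step function with slope \<open>s j\<close> on bond
  \<open>j\<close>. Each clamp measures how much of bond \<open>j\<close> lies left of
  \<open>x\<close>, which gives continuity without case distinctions.\<close>

definition interp :: "nat \<Rightarrow> (nat \<Rightarrow> real) \<Rightarrow> real \<Rightarrow> real" where
  "interp n s x = (\<Sum>j<n. s j * max 0 (min (1 / real n) (x - real j / real n)))"

lemma interp_continuous: "continuous_on A (interp n s)"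
  unfolding interp_def by (intro continuous_intros)

text \<open>The clamps of adjacent bonds merge into the clamp of their union. Hence a slope that is
  constant on an element gives a function affine there.\<close>

lemma clamp_telescope:
  assumes "a \<le> b"
  shows "(\<Sum>j\<in>{a..<b}. max 0 (min (1 / real n) (x - real j / real n))) =
    max 0 (min (real (b - a) / real n) (x - real a / real n))"
  using assms
proof (induction b)
  case (Suc b)
  show ?case
  proof (cases "a = Suc b")
    case False
    then have ab: "a \<le> b" using Suc.prems by simp
    have a: "max 0 (min L y) + max 0 (min h (y - L)) = max 0 (min (L + h) y)" if "0 \<le> L" "0 \<le> h" for L h y :: real
      using that by (auto simp: max_def min_def)
    have "max 0 (min (real (b - a) / real n) (x - real a / real n)) + max 0 (min (1 / real n) (x - real b / real n))
        = max 0 (min (real (Suc b - a) / real n) (x - real a / real n))"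
    proof -
      have "real (Suc b - a) / real n = real (b - a) / real n + 1 / real n"
        using ab by (simp add: Suc_diff_le add_divide_distrib)
      moreover have "x - real b / real n = x - real a / real n - real (b - a) / real n"
        using ab by (simp add: of_nat_diff diff_divide_distrib)
      ultimately show ?thesis
        using a[of "real (b - a) / real n" "1 / real n" "x - real a / real n"] by (simp only:) simp
    qed
    then show ?thesis using Suc.IH[OF ab] ab by simp
  qed simp
qed simp

lemma interp_node:
  assumes "0 < n" "i \<le> n"
  shows "interp n s (real i / real n) = (\<Sum>j<i. s j) / real n"
proof -
  have "interp n s (real i / real n) = (\<Sum>j<n. if j < i then s j / real n else 0)"
    unfolding interp_def
  proof (rule sum.cong[OF refl])
    fix j
    have "j < i \<Longrightarrow> 1 / real n \<le> real i / real n - real j / real n"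
      using assms(1) by (simp add: diff_divide_distrib[symmetric] divide_right_mono)
    moreover have "\<not> j < i \<Longrightarrow> real i / real n - real j / real n \<le> 0"
      using assms(1) by (simp add: divide_right_mono)
    ultimately show "s j * max 0 (min (1 / real n) (real i / real n - real j / real n)) = (if j < i then s j / real n else 0)"
      by (cases "j < i") simp_all
  qed
  also have "\<dots> = (\<Sum>j<i. s j / real n)"
    by (rule sum.mono_neutral_cong_right) (use assms in auto)
  finally show ?thesis by (simp add: sum_divide_distrib)
qed

lemma interp_in_A_T:
  assumes T: "T \<subseteq> {0..n}" and n: "0 < n" and s: "elem_const T s"
  shows "in_A_T n T (interp n s)"
  unfolding in_A_T_def
proof (intro conjI allI impI interp_continuous)
  fix a b assume ab: "consecutive T a b"
  then have ab': "a < b" "b \<le> n" using T by (auto simp: consecutive_def)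
  have "interp n s x = s a * x + ((\<Sum>j<a. s j) / real n - s a * (real a / real n))"
    if x: "x \<in> {real a / real n<..<real b / real n}" for x
  proof -
    let ?c = "\<lambda>j. max 0 (min (1 / real n) (x - real j / real n))"
    have "interp n s x = (\<Sum>j\<in>{0..<a}. s j * ?c j) + (\<Sum>j\<in>{a..<b}. s j * ?c j) + (\<Sum>j\<in>{b..<n}. s j * ?c j)"
      unfolding interp_def using ab' sum.atLeastLessThan_concat[of 0 a n "\<lambda>j. s j * ?c j"]
        sum.atLeastLessThan_concat[of a b n "\<lambda>j. s j * ?c j"] by (simp add: atLeast0LessThan)
    also have "(\<Sum>j\<in>{0..<a}. s j * ?c j) = (\<Sum>j\<in>{0..<a}. s j / real n)"
    proof (rule sum.cong[OF refl])
      fix j assume j: "j \<in> {0..<a}"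
      then have "real (j + 1) / real n \<le> real a / real n" using n by (intro divide_right_mono) auto
      then have "1 / real n \<le> x - real j / real n" using x by (simp add: add_divide_distrib)
      then show "s j * ?c j = s j / real n" using n by simp
    qed
    also have "(\<Sum>j\<in>{a..<b}. s j * ?c j) = (\<Sum>j\<in>{a..<b}. s a * ?c j)"
    proof (rule sum.cong[OF refl])
      fix j assume "j \<in> {a..<b}"
      then have "s j = s a" using s ab unfolding elem_const_def by blast
      then show "s j * ?c j = s a * ?c j" by simp
    qed
    also have "\<dots> = s a * (x - real a / real n)"
    proof -
      have "real (b - a) / real n = real b / real n - real a / real n" using ab' by (simp add: of_nat_diff diff_divide_distrib)
      then have "max 0 (min (real (b - a) / real n) (x - real a / real n)) = x - real a / real n"
        using x by simp
      then show ?thesis using clamp_telescope[of a b n x] ab' by (simp add: sum_distrib_left[symmetric])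
    qed
    also have "(\<Sum>j\<in>{b..<n}. s j * ?c j) = 0"
    proof (rule sum.neutral, rule ballI)
      fix j assume "j \<in> {b..<n}"
      then have "real b / real n \<le> real j / real n" using n by (intro divide_right_mono) auto
      then have "min (1 / real n) (x - real j / real n) \<le> 0" using x by (intro min.coboundedI2) simp
      then show "s j * ?c j = 0" by simp
    qed
    finally show ?thesis by (simp add: sum_divide_distrib algebra_simps atLeast0LessThan)
  qed
  then show "\<exists>p q. \<forall>x\<in>{real a / real n<..<real b / real n}. interp n s x = p * x + q" by blast
qed

lemma slopes_interp:
  assumes "i < n"
  shows "slopes n (interp n s) i = s i"
  using assms interp_node[of n i s] interp_node[of n "Suc i" s] by (simp add: slopes_def field_simps)

subsection \<open>Limits of piecewise affine functions with finitely many steep bonds\<close>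

definition step_sum :: "'j set \<Rightarrow> ('j \<Rightarrow> real) \<Rightarrow> ('j \<Rightarrow> real) \<Rightarrow> real \<Rightarrow> real" where
  "step_sum J A x t = (\<Sum>j\<in>{j\<in>J. x j < t}. A j)"

lemma affine_between:
  fixes v :: "real \<Rightarrow> real"
  assumes "\<forall>z\<in>{x..y}. v z = p * z + q" "z \<in> {x..y}"
  shows "\<bar>v z - L\<bar> \<le> \<bar>v x - L\<bar> + \<bar>v y - L\<bar>"
proof -
  have v: "v x = p * x + q" "v y = p * y + q" "v z = p * z + q" using assms by auto
  show ?thesis
  proof (cases "p \<ge> 0")
    case True
    then have "v x \<le> v z" "v z \<le> v y" unfolding v using assms(2) by (auto intro: mult_left_mono)
    then show ?thesis by linarith
  next
    case False
    then have "v z \<le> v x" "v y \<le> v z" unfolding v using assms(2) by (auto intro: mult_left_mono_neg)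
    then show ?thesis by linarith
  qed
qed

text \<open>At a point \<open>t\<close> that is no limit of jump positions, both nodes around
  \<open>t\<close> eventually have the same jumps to their left, so the nodal values there have a
  common limit. The value at \<open>t\<close> lies between them.\<close>

lemma interp_limit:
  fixes N :: "nat \<Rightarrow> nat" and v :: "nat \<Rightarrow> real \<Rightarrow> real" and pos :: "nat \<Rightarrow> 'j \<Rightarrow> nat"
  assumes N: "filterlim N at_top sequentially" and J: "finite J"
    and aff: "\<And>k. bond_affine (N k) (v k)"
    and node: "\<And>k i. i \<le> N k \<Longrightarrow>
      \<bar>v k (real i / real (N k)) - g * (real i / real (N k)) - (\<Sum>j\<in>{j\<in>J. pos k j < i}. A k j)\<bar> \<le> err k"
    and err: "err \<longlonglongrightarrow> 0"
    and pos: "\<And>j. j \<in> J \<Longrightarrow> (\<lambda>k. real (pos k j) / real (N k)) \<longlonglongrightarrow> x j"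
    and A: "\<And>j. j \<in> J \<Longrightarrow> (\<lambda>k. A k j) \<longlonglongrightarrow> a j"
    and t: "0 < t" "t < 1" "t \<notin> x ` J"
  shows "(\<lambda>k. v k t) \<longlonglongrightarrow> g * t + step_sum J a x t"
proof -
  define i where "i k = nat \<lfloor>real (N k) * t\<rfloor>" for k
  define L where "L = g * t + step_sum J a x t"
  have Npos: "eventually (\<lambda>k. 0 < N k) sequentially"
    using eventually_compose_filterlim[OF eventually_gt_at_top[of 0] N] .
  have ifl: "real (i k) \<le> real (N k) * t" "real (N k) * t < real (i k) + 1" for k
  proof -
    have "0 \<le> \<lfloor>real (N k) * t\<rfloor>" using t by simp
    then have "real (i k) = of_int \<lfloor>real (N k) * t\<rfloor>" by (simp add: i_def)
    then show "real (i k) \<le> real (N k) * t" "real (N k) * t < real (i k) + 1" by linarith+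
  qed
  have iN: "i k < N k" if "0 < N k" for k
  proof -
    have "real (N k) * t < real (N k)" using t that by simp
    then show ?thesis using ifl(1)[of k] by linarith
  qed
  have Ninv: "(\<lambda>k. 1 / real (N k)) \<longlonglongrightarrow> 0"
    using filterlim_compose[OF lim_1_over_n N] by simp
  have bnd: "\<bar>real (i k) / real (N k) - t\<bar> \<le> 1 / real (N k) \<and> \<bar>real (i k + 1) / real (N k) - t\<bar> \<le> 1 / real (N k)"
    if "0 < N k" for k
  proof -
    have "real (i k) / real (N k) \<le> t" using ifl(1)[of k] that by (simp add: pos_divide_le_eq mult.commute)
    moreover have "t \<le> real (i k + 1) / real (N k)" using ifl(2)[of k] that by (simp add: pos_le_divide_eq mult.commute)
    moreover have "real (i k + 1) / real (N k) = real (i k) / real (N k) + 1 / real (N k)" by (simp add: add_divide_distrib)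
    ultimately show ?thesis by linarith
  qed
  have lim_i: "(\<lambda>k. real (i k + d) / real (N k)) \<longlonglongrightarrow> t" if "d \<in> {0, 1}" for d
  proof (rule Lim_transform)
    show "(\<lambda>_. t) \<longlonglongrightarrow> t" by simp
    show "(\<lambda>k. real (i k + d) / real (N k) - t) \<longlonglongrightarrow> 0"
      by (rule Lim_null_comparison[OF _ Ninv]) (use Npos bnd that in \<open>auto elim!: eventually_mono simp: abs_minus_commute add.commute\<close>)
  qed
  \<comment> \<open>Equality of \<open>x j\<close> and \<open>t\<close> is excluded, so the strict
    order of the limits decides on which side of both nodes each jump lies.\<close>
  have sel: "eventually (\<lambda>k. \<forall>j\<in>J. (pos k j < i k + d) = (x j < t)) sequentially" if d: "d \<in> {0, 1}" for d
  proof (rule eventually_ball_finite[OF J], rule ballI)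
    fix j assume j: "j \<in> J"
    have ne: "x j \<noteq> t" using t(3) j by blast
    have dl: "(\<lambda>k. real (pos k j) / real (N k) - real (i k + d) / real (N k)) \<longlonglongrightarrow> x j - t"
      by (intro tendsto_diff pos[OF j] lim_i[OF d])
    show "eventually (\<lambda>k. (pos k j < i k + d) = (x j < t)) sequentially"
    proof (cases "x j < t")
      case True
      then have "eventually (\<lambda>k. real (pos k j) / real (N k) - real (i k + d) / real (N k) < 0) sequentially"
        using order_tendstoD(2)[OF dl, of 0] by simp
      with Npos show ?thesis
        by eventually_elim (use True in \<open>simp add: divide_less_cancel\<close>)
    next
      case False
      then have "eventually (\<lambda>k. 0 < real (pos k j) / real (N k) - real (i k + d) / real (N k)) sequentially"
        using order_tendstoD(1)[OF dl, of 0] ne by simp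
      with Npos show ?thesis
        by eventually_elim (use False in \<open>simp add: divide_less_cancel\<close>)
    qed
  qed
  have nodelim: "(\<lambda>k. v k (real (i k + d) / real (N k))) \<longlonglongrightarrow> L" if d: "d \<in> {0, 1}" for d
  proof (rule Lim_transform)
    have "(\<lambda>k. \<Sum>j\<in>{j\<in>J. x j < t}. A k j) \<longlonglongrightarrow> step_sum J a x t"
      unfolding step_sum_def by (intro tendsto_sum) (use A in auto)
    then show l: "(\<lambda>k. g * (real (i k + d) / real (N k)) + (\<Sum>j\<in>{j\<in>J. x j < t}. A k j)) \<longlonglongrightarrow> L"
      unfolding L_def by (intro tendsto_intros lim_i[OF d])
    show "(\<lambda>k. v k (real (i k + d) / real (N k)) - (g * (real (i k + d) / real (N k))
        + (\<Sum>j\<in>{j\<in>J. x j < t}. A k j))) \<longlonglongrightarrow> 0"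
    proof (rule Lim_null_comparison[OF _ err])
      show "eventually (\<lambda>k. norm (v k (real (i k + d) / real (N k)) - (g * (real (i k + d) / real (N k))
        + (\<Sum>j\<in>{j\<in>J. x j < t}. A k j))) \<le> err k) sequentially"
        using Npos sel[OF d]
      proof eventually_elim
        case (elim k)
        have "{j\<in>J. pos k j < i k + d} = {j\<in>J. x j < t}" using elim(2) by blast
        then show ?case using node[of "i k + d" k] iN[OF elim(1)] d by (auto simp: algebra_simps)
      qed
    qed
  qed
  show ?thesis unfolding L_def[symmetric]
  proof (rule LIM_zero_cancel, rule Lim_null_comparison)
    have "(\<lambda>k. \<bar>v k (real (i k + 0) / real (N k)) - L\<bar> + \<bar>v k (real (i k + 1) / real (N k)) - L\<bar>) \<longlonglongrightarrow> \<bar>L - L\<bar> + \<bar>L - L\<bar>"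
      by (intro tendsto_intros nodelim) auto
    then show "(\<lambda>k. \<bar>v k (real (i k) / real (N k)) - L\<bar> + \<bar>v k (real (i k + 1) / real (N k)) - L\<bar>) \<longlonglongrightarrow> 0" by simp
    show "eventually (\<lambda>k. norm (v k t - L) \<le> \<bar>v k (real (i k) / real (N k)) - L\<bar> + \<bar>v k (real (i k + 1) / real (N k)) - L\<bar>) sequentially"
      using Npos
    proof eventually_elim
      case (elim k)
      obtain p q where pq: "\<forall>z\<in>{real (i k) / real (N k)..real (i k + 1) / real (N k)}. v k z = p * z + q"
        using aff[of k] iN[OF elim] unfolding bond_affine_def by blast
      have "t \<in> {real (i k) / real (N k)..real (i k + 1) / real (N k)}"
        using ifl[of k] elim by (auto simp: field_simps)
      then show ?case using affine_between[OF pq, of t L] by simp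
    qed
  qed
qed

lemma finite_family_subseq:
  fixes X :: "nat \<Rightarrow> nat \<Rightarrow> real"
  assumes "\<And>j. j < (n::nat) \<Longrightarrow> bounded (range (\<lambda>k. X k j))"
  shows "\<exists>r. strict_mono r \<and> (\<forall>j<n. convergent (\<lambda>k. X (r k) j))"
  using assms
proof (induction n)
  case 0
  show ?case by (rule exI[of _ id]) (simp add: strict_mono_def)
next
  case (Suc n)
  then obtain r where r: "strict_mono r" "\<forall>j<n. convergent (\<lambda>k. X (r k) j)" by force
  have "bounded (range (\<lambda>k. X (r k) n))"
    by (rule bounded_subset[OF Suc.prems[of n]]) auto
  then obtain L r' where r': "strict_mono r'" "((\<lambda>k. X (r k) n) \<circ> r') \<longlonglongrightarrow> L"
    using bounded_imp_convergent_subsequence by blast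
  have "convergent (\<lambda>k. X ((r \<circ> r') k) j)" if "j < Suc n" for j
  proof (cases "j = n")
    case True
    then show ?thesis using r'(2) by (auto simp: convergent_def o_def)
  next
    case False
    then have "convergent ((\<lambda>k. X (r k) j) \<circ> r')" using r r'(1) that by (intro convergent_subseq_convergent) auto
    then show ?thesis by (simp add: o_def)
  qed
  then show ?case using r(1) r'(1) strict_mono_o by blast
qed

text \<open>The bonds of slope at least \<open>g + 1\<close> are boundedly many; their positions and
  amplitudes lie in bounded sets and converge along a subsequence. All other bonds together deviate
  from slope \<open>g\<close> by an amount that vanishes after division by \<open>N k\<close>, and
  this is \<open>err\<close>.\<close>

lemma steep_bonds_compactness:
  fixes s :: "nat \<Rightarrow> nat \<Rightarrow> real" and N :: "nat \<Rightarrow> nat"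
  assumes N: "filterlim N at_top sequentially" and Npos: "\<And>k. 0 < N k"
    and K: "\<And>k i. i < N k \<Longrightarrow> - K \<le> s k i"
    and cnt: "\<And>\<delta>. 0 < \<delta> \<Longrightarrow> \<exists>c. \<forall>k. card {i. i < N k \<and> \<delta> \<le> \<bar>s k i - g\<bar>} \<le> c"
    and total: "\<And>k. (\<Sum>i<N k. s k i) = real (N k) * l"
  obtains r :: "nat \<Rightarrow> nat" and c :: nat and pos :: "nat \<Rightarrow> nat \<Rightarrow> nat" and A :: "nat \<Rightarrow> nat \<Rightarrow> real"
    and err :: "nat \<Rightarrow> real" and x a :: "nat \<Rightarrow> real"
  where "strict_mono r" "err \<longlonglongrightarrow> 0"
    "\<And>k i. i \<le> N (r k) \<Longrightarrow> \<bar>(\<Sum>j<i. s (r k) j) / real (N (r k)) - g * (real i / real (N (r k)))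
        - (\<Sum>j\<in>{j\<in>{..<c}. pos k j < i}. A k j)\<bar> \<le> err k"
    "\<And>j. j < c \<Longrightarrow> (\<lambda>k. real (pos k j) / real (N (r k))) \<longlonglongrightarrow> x j"
    "\<And>j. j < c \<Longrightarrow> (\<lambda>k. A k j) \<longlonglongrightarrow> a j"
    "\<And>k j. pos k j < N (r k)" "\<And>k j. 0 \<le> A k j"
    "\<And>k j. 0 < A k j \<Longrightarrow> s (r k) (pos k j) = g + real (N (r k)) * A k j"
proof -
  define bad where "bad k = {i. i < N k \<and> g + 1 \<le> s k i}" for k
  have fin: "finite (bad k)" for k by (simp add: bad_def)
  obtain c where "\<And>k. card {i. i < N k \<and> 1 \<le> \<bar>s k i - g\<bar>} \<le> c" using cnt[of 1] by auto
  moreover have "card (bad k) \<le> card {i. i < N k \<and> 1 \<le> \<bar>s k i - g\<bar>}" for k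
    by (rule card_mono) (auto simp: bad_def)
  ultimately have c: "card (bad k) \<le> c" for k using le_trans by blast
  define L where "L k = sorted_list_of_set (bad k)" for k
  have L: "set (L k) = bad k" "distinct (L k)" "length (L k) = card (bad k)" for k using fin by (simp_all add: L_def)
  \<comment> \<open>The list of steep bonds is padded to the fixed length \<open>c\<close> by
    entries of position 0 and amplitude 0, which contribute nothing.\<close>
  define pos where "pos k j = (if j < length (L k) then L k ! j else 0)" for k j
  define A where "A k j = (if j < length (L k) then (s k (L k ! j) - g) / real (N k) else 0)" for k j
  define err where "err k = (\<Sum>i\<in>{..<N k} - bad k. \<bar>s k i - g\<bar>) / real (N k)" for k
  have Lbad: "L k ! j \<in> bad k" if "j < length (L k)" for k j using L that by (metis nth_mem)
  have pos_lt: "pos k j < N k" for k j using Lbad[of j k] Npos by (auto simp: pos_def bad_def)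
  have A_nn: "0 \<le> A k j" for k j using Lbad[of j k] by (auto simp: A_def bad_def)
  have A_s: "s k (pos k j) = g + real (N k) * A k j" if "0 < A k j" for k j
    using that Npos[of k] by (auto simp: A_def pos_def split: if_splits)
  have A_sum: "(\<Sum>j\<in>{j\<in>{..<c}. pos k j < i}. A k j) = (\<Sum>p\<in>bad k \<inter> {..<i}. (s k p - g) / real (N k))" for k i
  proof -
    have "(\<Sum>j\<in>{j\<in>{..<c}. pos k j < i}. A k j) = (\<Sum>j\<in>{j. j < length (L k) \<and> L k ! j < i}. (s k (L k ! j) - g) / real (N k))"
      by (rule sum.mono_neutral_cong_right) (use c[of k] L(3)[of k] in \<open>auto simp: A_def pos_def\<close>)
    also have "\<dots> = (\<Sum>p\<in>(\<lambda>j. L k ! j) ` {j. j < length (L k) \<and> L k ! j < i}. (s k p - g) / real (N k))"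
      by (rule sum.reindex[unfolded o_def, symmetric]) (use L(2)[of k] in \<open>auto simp: inj_on_def nth_eq_iff_index_eq\<close>)
    also have "(\<lambda>j. L k ! j) ` {j. j < length (L k) \<and> L k ! j < i} = bad k \<inter> {..<i}"
      unfolding L(1)[symmetric] by (auto simp: in_set_conv_nth)
    finally show ?thesis .
  qed
  have node: "\<bar>(\<Sum>j<i. s k j) / real (N k) - g * (real i / real (N k)) - (\<Sum>j\<in>{j\<in>{..<c}. pos k j < i}. A k j)\<bar> \<le> err k"
    if "i \<le> N k" for k i
  proof -
    have "(\<Sum>j<i. s k j) / real (N k) - g * (real i / real (N k)) = (\<Sum>j<i. (s k j - g) / real (N k))"
      by (simp add: sum_subtractf diff_divide_distrib sum_divide_distrib)
    also have "\<dots> = (\<Sum>p\<in>bad k \<inter> {..<i}. (s k p - g) / real (N k)) + (\<Sum>p\<in>{..<i} - bad k. (s k p - g) / real (N k))"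
      by (subst sum.union_disjoint[symmetric]) (auto intro!: sum.cong)
    finally have "(\<Sum>j<i. s k j) / real (N k) - g * (real i / real (N k)) - (\<Sum>j\<in>{j\<in>{..<c}. pos k j < i}. A k j)
        = (\<Sum>p\<in>{..<i} - bad k. (s k p - g) / real (N k))" unfolding A_sum by simp
    also have "\<bar>\<dots>\<bar> \<le> (\<Sum>p\<in>{..<i} - bad k. \<bar>(s k p - g) / real (N k)\<bar>)" by (rule sum_abs)
    also have "\<dots> \<le> (\<Sum>p\<in>{..<N k} - bad k. \<bar>(s k p - g) / real (N k)\<bar>)" by (rule sum_mono2) (use that in auto)
    finally show ?thesis by (simp add: err_def sum_divide_distrib)
  qed
  have err0: "err \<longlonglongrightarrow> 0"
  proof (rule LIMSEQ_I)
    fix e :: real assume e: "0 < e"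
    obtain c' where c': "\<And>k. card {i. i < N k \<and> e / 2 \<le> \<bar>s k i - g\<bar>} \<le> c'" using cnt[of "e / 2"] e by auto
    \<comment> \<open>Bonds that are not steep have slopes between \<open>- K\<close> and
      \<open>g + 1\<close>, so \<open>X\<close> bounds their deviation. Only boundedly many of them
      deviate by more than \<open>e / 2\<close>.\<close>
    define X where "X = 1 + \<bar>K\<bar> + \<bar>g\<bar>"
    have "eventually (\<lambda>k. real (N k) > 2 * real c' * X / e) sequentially"
      using filterlim_compose[OF filterlim_real_sequentially N] by (auto simp: filterlim_at_top_dense)
    then obtain k0 where k0: "\<And>k. k0 \<le> k \<Longrightarrow> real (N k) > 2 * real c' * X / e" by (auto simp: eventually_at_top_linorder)
    have "norm (err k - 0) < e" if "k0 \<le> k" for k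
    proof -
      have "(\<Sum>i\<in>{..<N k} - bad k. \<bar>s k i - g\<bar>) \<le> (\<Sum>i\<in>{..<N k} - bad k. e / 2 + (if e / 2 \<le> \<bar>s k i - g\<bar> then X else 0))"
      proof (rule sum_mono)
        fix i assume "i \<in> {..<N k} - bad k"
        then have "- K \<le> s k i" "s k i < g + 1" using K[of i k] by (auto simp: bad_def)
        then show "\<bar>s k i - g\<bar> \<le> e / 2 + (if e / 2 \<le> \<bar>s k i - g\<bar> then X else 0)" using e by (auto simp: X_def)
      qed
      also have "\<dots> \<le> (\<Sum>i\<in>{..<N k}. e / 2 + (if e / 2 \<le> \<bar>s k i - g\<bar> then X else 0))"
        by (rule sum_mono2) (use e in \<open>auto simp: X_def\<close>)
      also have "\<dots> = real (N k) * (e / 2) + (\<Sum>i\<in>{i\<in>{..<N k}. e / 2 \<le> \<bar>s k i - g\<bar>}. X)"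
        unfolding sum.distrib by (subst sum.inter_filter) simp_all
      also have "\<dots> \<le> real (N k) * (e / 2) + real c' * X"
      proof -
        have "real (card {i\<in>{..<N k}. e / 2 \<le> \<bar>s k i - g\<bar>}) \<le> real c'" using c'[of k] by simp
        moreover have "0 \<le> X" by (simp add: X_def)
        ultimately show ?thesis by (simp add: mult_right_mono)
      qed
      also have "\<dots> < real (N k) * (e / 2) + real (N k) * (e / 2)" using k0[OF that] e by (simp add: field_simps)
      finally have "err k < e" using Npos[of k] by (simp add: err_def field_simps)
      moreover have "0 \<le> err k" by (auto simp: err_def intro!: divide_nonneg_nonneg sum_nonneg)
      ultimately show ?thesis by simp
    qed
    then show "\<exists>k0. \<forall>k\<ge>k0. norm (err k - 0) < e" by blast
  qed
  obtain E where E: "\<And>k. \<bar>err k\<bar> \<le> E" using convergent_imp_Bseq[OF convergentI[OF err0]] unfolding Bseq_def by auto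
  \<comment> \<open>At the last node the amplitudes sum to \<open>l - g\<close> up to
    \<open>err\<close>; since they are nonnegative, each one is bounded.\<close>
  have Abd: "A k j \<le> \<bar>l - g\<bar> + E" if "j < c" for k j
  proof -
    have "\<bar>(l - g) - (\<Sum>j\<in>{j\<in>{..<c}. pos k j < N k}. A k j)\<bar> \<le> err k"
      using node[of "N k" k] Npos[of k] total[of k] by simp
    moreover have "A k j \<le> (\<Sum>j\<in>{j\<in>{..<c}. pos k j < N k}. A k j)"
      by (rule member_le_sum) (use that pos_lt A_nn in auto)
    ultimately show ?thesis using E[of k] by linarith
  qed
  \<comment> \<open>Positions and amplitudes are packed into one family of \<open>2 * c\<close>
    bounded sequences, so that a single subsequence serves all of them.\<close>
  define X where "X k j = (if j < c then real (pos k j) / real (N k) else A k (j - c))" for k j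
  have "bounded (range (\<lambda>k. X k j))" if "j < 2 * c" for j
  proof -
    have "\<bar>X k j\<bar> \<le> 1 + \<bar>l - g\<bar> + \<bar>E\<bar>" for k
    proof (cases "j < c")
      case True
      have "real (pos k j) / real (N k) \<le> 1" using pos_lt[of k j] by simp
      then show ?thesis using True by (simp add: X_def)
    next
      case False
      then have "j - c < c" using that by simp
      then have "A k (j - c) \<le> \<bar>l - g\<bar> + E" by (rule Abd)
      then show ?thesis using False A_nn[of k "j - c"] by (simp add: X_def)
    qed
    then show ?thesis unfolding bounded_iff by (intro exI[of _ "1 + \<bar>l - g\<bar> + \<bar>E\<bar>"]) auto
  qed
  then obtain r where r: "strict_mono r" "\<forall>j<2*c. convergent (\<lambda>k. X (r k) j)"
    using finite_family_subseq[of "2 * c" X] by blast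
  show thesis
  proof (rule that[where r = r and err = "err \<circ> r" and c = c and pos = "\<lambda>k. pos (r k)" and A = "\<lambda>k. A (r k)"
        and x = "\<lambda>j. lim (\<lambda>k. X (r k) j)" and a = "\<lambda>j. lim (\<lambda>k. X (r k) (c + j))"])
    show "(err \<circ> r) \<longlonglongrightarrow> 0" using LIMSEQ_subseq_LIMSEQ[OF err0 r(1)] .
    show "(\<lambda>k. real (pos (r k) j) / real (N (r k))) \<longlonglongrightarrow> lim (\<lambda>k. X (r k) j)" if "j < c" for j
      using r(2)[rule_format, of j] that by (simp add: convergent_LIMSEQ_iff X_def)
    show "(\<lambda>k. A (r k) j) \<longlonglongrightarrow> lim (\<lambda>k. X (r k) (c + j))" if "j < c" for j
      using r(2)[rule_format, of "c + j"] that by (simp add: convergent_LIMSEQ_iff X_def)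
  qed (use r node pos_lt A_nn A_s in auto)
qed

section \<open>Convergent counts, splitting of extended sums, consequences of an energy
  bound\<close>

lemma eventually_enat_of_tendsto:
  assumes "(\<lambda>n. ereal (real (f n))) \<longlonglongrightarrow> ereal_of_enat e"
  shows "eventually (\<lambda>n. e = enat (f n) \<or> e = \<infinity> \<and> K \<le> f n) sequentially"
proof (cases e)
  case (enat a)
  then have "(\<lambda>n. real (f n)) \<longlonglongrightarrow> real a" using assms by simp
  then have "eventually (\<lambda>n. dist (real (f n)) (real a) < 1) sequentially" by (simp add: tendsto_iff)
  then show ?thesis
    by eventually_elim (use enat in \<open>auto simp: dist_real_def\<close>)
next
  case infinity
  then have "(\<lambda>n. ereal (real (f n))) \<longlonglongrightarrow> \<infinity>" using assms by simp
  then have "eventually (\<lambda>n. ereal (real K) < ereal (real (f n))) sequentially" by (rule order_tendstoD) simp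
  then show ?thesis by eventually_elim (use infinity in auto)
qed

text \<open>A choice made along a subsequence is completed to a full sequence by a fixed one. This
  is needed because the minimal distances \<open>b x\<close> are defined by full sequences.\<close>

lemma eventually_merge:
  fixes r :: "nat \<Rightarrow> nat"
  assumes r: "strict_mono r" and q: "eventually (\<lambda>k. P (r k) (q k)) sequentially"
    and p: "eventually (\<lambda>n. P n (p n)) sequentially"
  shows "eventually (\<lambda>n. P n (if n \<in> range r then q (inv_into UNIV r n) else p n)) sequentially"
proof -
  obtain k0 where k0: "\<And>k. k0 \<le> k \<Longrightarrow> P (r k) (q k)" using q by (auto simp: eventually_at_top_linorder)
  obtain n0 where n0: "\<And>n. n0 \<le> n \<Longrightarrow> P n (p n)" using p by (auto simp: eventually_at_top_linorder)
  have inj: "inj r" using r by (simp add: strict_mono_imp_inj_on)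
  have "P n (if n \<in> range r then q (inv_into UNIV r n) else p n)" if "max n0 (r k0) \<le> n" for n
  proof (cases "n \<in> range r")
    case True
    then obtain k where k: "n = r k" by blast
    then have "k0 \<le> k" using that r by (simp add: strict_mono_less_eq)
    then show ?thesis using k0 k inj by simp
  next
    case False
    then show ?thesis using n0 that by simp
  qed
  then show ?thesis unfolding eventually_at_top_linorder by blast
qed

text \<open>A strict bound on a sum is distributed over the summands, so that the ends and the
  interior jumps can be estimated separately. A summand plus infinity can take any share.\<close>

lemma ereal_less_add_split:
  assumes "ereal A < X + Y" "X \<noteq> -\<infinity>" "Y \<noteq> -\<infinity>"
  obtains x y where "ereal x < X" "ereal y < Y" "A < x + y"
proof (cases X)
  case (real x)
  show thesis
  proof (cases Y)
    fix y assume y: "Y = ereal y"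
    define d where "d = (x + y - A) / 3"
    have "d > 0" using assms real y by (simp add: d_def)
    then show thesis using that[of "x - d" "y - d"] real y by (simp add: d_def field_simps)
  next
    assume "Y = \<infinity>"
    then show thesis using that[of "x - 1" "A - x + 2"] real by simp
  qed (use assms in simp)
next
  case PInf
  then obtain y where "ereal y < Y" using assms(3) by (metis ereal_dense2 ereal_less_eq(2) less_le)
  then show thesis using that[of "A - y + 1" y] PInf by simp
qed (use assms in simp)

lemma ereal_less_sum_split:
  assumes "finite I" "ereal A < sum f I" "\<And>i. i \<in> I \<Longrightarrow> f i \<noteq> -\<infinity>"
  shows "\<exists>a. (\<forall>i\<in>I. ereal (a i) < f i) \<and> A < (\<Sum>i\<in>I. a i)"
  using assms
proof (induction I arbitrary: A rule: finite_induct)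
  case empty
  then show ?case by simp
next
  case (insert i I)
  have nm: "sum f I \<noteq> -\<infinity>" using insert.prems(2) insert.hyps by (intro sum_ereal_not_MInf) auto
  obtain x y where xy: "ereal x < f i" "ereal y < sum f I" "A < x + y"
    using ereal_less_add_split[of A "f i" "sum f I"] insert.prems insert.hyps nm by auto
  obtain a where a: "\<forall>i\<in>I. ereal (a i) < f i" "y < (\<Sum>i\<in>I. a i)"
    using insert.IH[OF xy(2)] insert.prems(2) by auto
  have "(\<Sum>j\<in>insert i I. (a(i := x)) j) = x + (\<Sum>j\<in>I. a j)"
    using insert.hyps by (simp add: sum.insert) (rule sum.cong, auto)
  then show ?case using xy a by (intro exI[of _ "a(i := x)"]) auto
qed

lemma uminus_sum_ereal:
  "finite I \<Longrightarrow> (\<And>i. i \<in> I \<Longrightarrow> f i \<noteq> (\<infinity>::ereal)) \<Longrightarrow> - sum f I = (\<Sum>i\<in>I. - f i)"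
proof (induction I rule: finite_induct)
  case (insert i I)
  have "sum f I \<noteq> \<infinity>" using insert.prems insert.hyps by (subst sum_Pinfty) auto
  then show ?case using insert by (cases "f i"; cases "sum f I") (auto simp flip: insert.IH)
qed simp

lemma card_large_terms:
  fixes f :: "nat \<Rightarrow> real"
  assumes "finite I" "\<And>i. i \<in> I \<Longrightarrow> 0 \<le> f i" "sum f I \<le> C" "0 < \<eta>"
  shows "card {i\<in>I. \<eta> \<le> f i} \<le> nat \<lceil>C / \<eta>\<rceil>"
proof -
  have "real (card {i\<in>I. \<eta> \<le> f i}) * \<eta> = (\<Sum>i\<in>{i\<in>I. \<eta> \<le> f i}. \<eta>)" by simp
  also have "\<dots> \<le> (\<Sum>i\<in>{i\<in>I. \<eta> \<le> f i}. f i)" by (rule sum_mono) auto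
  also have "\<dots> \<le> sum f I" by (rule sum_mono2) (use assms in auto)
  finally have "real (card {i\<in>I. \<eta> \<le> f i}) \<le> C / \<eta>" using assms by (simp add: pos_le_divide_eq)
  then show ?thesis by (metis le_ceiling_iff nat_int nat_mono of_int_of_nat_eq of_nat_ceiling of_nat_le_iff order_trans)
qed

context lj_potentials
begin

text \<open>The continuum energy is a sum over single bonds, so the chain can be cut there at any
  place without an interaction across the cut.\<close>

lemma qc_E_windows:
  assumes "0 < n" "a < W" "W \<le> n - W'" "n - b < W'" "W' \<le> n" "b \<le> n"
  shows "qc_E n a b s = left_energy s a W + left_energy (\<lambda>i. s (n - 1 - i)) (n - b) W'
     + (\<Sum>i\<in>{W..<n-W'}. G (s i)) - m"
proof -
  have "{a<..<b-1} = {a<..<W} \<union> ({W..<n-W'} \<union> {n-W'..<b-1})" using assms by auto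
  then have 1: "(\<Sum>i\<in>{a<..<b-1}. G (s i)) = (\<Sum>i\<in>{a<..<W}. G (s i)) + ((\<Sum>i\<in>{W..<n-W'}. G (s i)) + (\<Sum>i\<in>{n-W'..<b-1}. G (s i)))"
    using assms by (simp only:) (subst sum.union_disjoint; auto)+
  have 2: "(\<Sum>i\<in>{n-W'..<b-1}. G (s i)) = (\<Sum>i\<in>{n-b<..<W'}. G (s (n - 1 - i)))"
    by (rule sum.reindex_bij_witness[of _ "\<lambda>i. n - 1 - i" "\<lambda>i. n - 1 - i"]) (use assms in auto)
  have 3: "{n - b<..<Suc (n - b)} = {}" by auto
  show ?thesis unfolding qc_E_def left_energy_def 1 2 3 by simp
qed

text \<open>After the boundary terms are bounded below, all remaining parts are nonnegative, so each
  of them is bounded. Coercivity then bounds the slopes from below, and the well bounds the number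
  of slopes away from \<gamma>, separately in the three regions.\<close>

lemma energy_bound_consequences:
  obtains K where "\<And>n a b s. 0 < a \<Longrightarrow> a + 1 < b \<Longrightarrow> b + 2 < n \<Longrightarrow> (\<And>i. i < n \<Longrightarrow> s i \<in> D) \<Longrightarrow>
      qc_E n a b s \<le> c \<Longrightarrow> (\<forall>i<n. - K \<le> s i)"
    "\<And>\<delta>. 0 < \<delta> \<Longrightarrow> \<exists>c'. \<forall>n a b s. 0 < a \<longrightarrow> a + 1 < b \<longrightarrow> b + 2 < n \<longrightarrow> (\<forall>i<n. s i \<in> D) \<longrightarrow>
      qc_E n a b s \<le> c \<longrightarrow> card {i. i < n \<and> \<delta> \<le> \<bar>s i - \<gamma>\<bar>} \<le> c'"
proof -
  obtain c0 where c0: "0 \<le> c0" "\<And>s. s \<in> D \<Longrightarrow> - c0 \<le> j1 s" "\<And>s. s \<in> D \<Longrightarrow> - c0 \<le> j2 s"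
    using lower_const by blast
  \<comment> \<open>The two half surface terms are each at least \<open>- c0 / 2\<close>, and the
    summand \<open>- m\<close> of \<open>qc_E\<close> is moved to the right.\<close>
  define C where "C = c + m + c0"
  have parts: "path s 0 a \<le> C \<and> G (s a) \<le> 2 * C \<and> (\<Sum>i\<in>{a<..<b-1}. G (s i)) \<le> C \<and> G (s (b - 1)) \<le> 2 * C \<and>
      path (\<lambda>i. s (n - 1 - i)) 0 (n - b) \<le> C"
    if h: "0 < a" "a + 1 < b" "b + 2 < n" "\<And>i. i < n \<Longrightarrow> s i \<in> D" "qc_E n a b s \<le> c" for n a b :: nat and s
  proof -
    define s' where "s' i = s (n - 1 - i)" for i
    have s'D: "s' i \<in> D" if "i < n" for i using h(3,4) that by (simp add: s'_def)
    have e: "s' (n - b) = s (b - 1)" using h by (simp add: s'_def)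
    have emp: "{n - b<..<Suc (n - b)} = {}" by auto
    have "j1 (s 0) / 2 + path s 0 a + G (s a) / 2 + (\<Sum>i\<in>{a<..<b-1}. G (s i)) +
        (j1 (s' 0) / 2 + path s' 0 (n - b) + G (s (b - 1)) / 2) - m \<le> c"
      using h(5) unfolding qc_E_def left_energy_def emp s'_def[symmetric] e by simp
    moreover have "- c0 \<le> j1 (s 0)" "- c0 \<le> j1 (s' 0)" using c0(2) h(4)[of 0] s'D[of 0] h by auto
    moreover have "0 \<le> path s 0 a" "0 \<le> path s' 0 (n - b)" by (rule path_nonneg; use h s'D in auto)+
    moreover have "0 \<le> G (s a)" "0 \<le> G (s (b - 1))" using h G_nonneg by auto
    moreover have "0 \<le> (\<Sum>i\<in>{a<..<b-1}. G (s i))" by (rule sum_nonneg) (use h G_nonneg in auto)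
    ultimately show ?thesis unfolding s'_def[symmetric] C_def by auto
  qed
  obtain K where K: "\<And>s t. s \<in> D \<Longrightarrow> t \<in> D \<Longrightarrow> F s t \<le> 2 * \<bar>C\<bar> \<Longrightarrow> - K \<le> s" using slope_ge_of_energy by blast
  show thesis
  proof (rule that[of K])
    fix n a b :: nat and s :: "nat \<Rightarrow> real"
    assume h: "0 < a" "a + 1 < b" "b + 2 < n" "\<And>i. i < n \<Longrightarrow> s i \<in> D" "qc_E n a b s \<le> c"
    note p = parts[OF h]
    show "\<forall>i<n. - K \<le> s i"
    proof (intro allI impI)
      fix i assume i: "i < n"
      consider "i < a" | "i = a" | "a < i" "i < b - 1" | "i = b - 1" | "b \<le> i" by linarith
      then show "- K \<le> s i"
      proof cases
        case 1
        have "F (s i) (s (Suc i)) \<le> path s 0 a"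
          unfolding path_def by (rule member_le_sum) (use 1 h in \<open>auto intro!: F_nonneg h(4)\<close>)
        then show ?thesis using p 1 h by (intro K[of _ "s (Suc i)"]) auto
      next
        case 2
        then show ?thesis using p h i by (intro K[of _ "s i"]) (auto simp: F_diag)
      next
        case 3
        have "G (s i) \<le> (\<Sum>i\<in>{a<..<b-1}. G (s i))"
          by (rule member_le_sum) (use 3 h in \<open>auto intro!: G_nonneg h(4)\<close>)
        then show ?thesis using p h i by (intro K[of _ "s i"]) (auto simp: F_diag)
      next
        case 4
        then show ?thesis using p h i by (intro K[of _ "s i"]) (auto simp: F_diag)
      next
        case 5
        define j where "j = n - 1 - i"
        have j: "j < n - b" "n - 1 - j = i" "n - 1 - Suc j = i - 1" using 5 i h by (auto simp: j_def)
        have "F (s (n - 1 - j)) (s (n - 1 - Suc j)) \<le> path (\<lambda>i. s (n - 1 - i)) 0 (n - b)"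
          unfolding path_def
          by (rule member_le_sum[where f = "\<lambda>j. F (s (n - 1 - j)) (s (n - 1 - Suc j))"])
             (use j h in \<open>auto intro!: F_nonneg h(4)\<close>)
        then show ?thesis unfolding j using p h i by (intro K[of _ "s (i - 1)"]) auto
      qed
    qed
  next
    fix \<delta> :: real assume "0 < \<delta>"
    then obtain \<eta> where \<eta>: "0 < \<eta>" "\<And>s t. s \<in> D \<Longrightarrow> t \<in> D \<Longrightarrow> F s t < \<eta> \<Longrightarrow> \<bar>s - \<gamma>\<bar> < \<delta>"
      "\<And>s. s \<in> D \<Longrightarrow> G s < \<eta> \<Longrightarrow> \<bar>s - \<gamma>\<bar> < \<delta>" using F_well by blast
    define c1 where "c1 = nat \<lceil>C / \<eta>\<rceil>"
    have "card {i. i < n \<and> \<delta> \<le> \<bar>s i - \<gamma>\<bar>} \<le> c1 + 2 + c1 + c1"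
      if h: "0 < a" "a + 1 < b" "b + 2 < n" "\<And>i. i < n \<Longrightarrow> s i \<in> D" "qc_E n a b s \<le> c" for n a b :: nat and s
    proof -
      note p = parts[OF h]
      define s' where "s' i = s (n - 1 - i)" for i
      define A1 where "A1 = {i\<in>{0..<a}. \<eta> \<le> F (s i) (s (Suc i))}"
      define A2 where "A2 = {i\<in>{a<..<b-1}. \<eta> \<le> G (s i)}"
      define A3 where "A3 = {i\<in>{0..<n-b}. \<eta> \<le> F (s' i) (s' (Suc i))}"
      have c: "card A1 \<le> c1" "card A2 \<le> c1" "card A3 \<le> c1"
        unfolding A1_def A2_def A3_def c1_def
        by (rule card_large_terms; use p h \<eta>(1) in \<open>auto simp: path_def s'_def intro!: F_nonneg G_nonneg h(4)\<close>)+
      have "{i. i < n \<and> \<delta> \<le> \<bar>s i - \<gamma>\<bar>} \<subseteq> A1 \<union> {a, b - 1} \<union> A2 \<union> (\<lambda>i. n - 1 - i) ` A3"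
      proof
        fix i assume "i \<in> {i. i < n \<and> \<delta> \<le> \<bar>s i - \<gamma>\<bar>}"
        then have i: "i < n" "\<not> \<bar>s i - \<gamma>\<bar> < \<delta>" by auto
        consider "i < a" | "i = a" | "a < i" "i < b - 1" | "i = b - 1" | "b \<le> i" by linarith
        then show "i \<in> A1 \<union> {a, b - 1} \<union> A2 \<union> (\<lambda>i. n - 1 - i) ` A3"
        proof cases
          case 1
          then have "\<eta> \<le> F (s i) (s (Suc i))" using \<eta>(2)[of "s i" "s (Suc i)"] i h by (metis Suc_lessI add_lessD1 not_less less_trans)
          then show ?thesis using 1 by (simp add: A1_def)
        next
          case 3
          then show ?thesis using \<eta>(3)[of "s i"] i h by (auto simp: A2_def not_less[symmetric])
        next
          case 5
          define j where "j = n - 1 - i"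
          have j: "j < n - b" "n - 1 - j = i" "n - 1 - Suc j = i - 1" using 5 i h by (auto simp: j_def)
          have "s' j \<in> D" "s' (Suc j) \<in> D" using h(4) i by (auto simp: s'_def j)
          moreover have "s' j = s i" unfolding s'_def j(2) ..
          ultimately have "\<eta> \<le> F (s' j) (s' (Suc j))" using \<eta>(2)[of "s' j" "s' (Suc j)"] i(2) by force
          then have "j \<in> A3" using j by (simp add: A3_def)
          then show ?thesis using j(2) by (metis UnI2 imageI)
        qed auto
      qed
      then have "card {i. i < n \<and> \<delta> \<le> \<bar>s i - \<gamma>\<bar>} \<le> card (A1 \<union> {a, b - 1} \<union> A2 \<union> (\<lambda>i. n - 1 - i) ` A3)"
        by (rule card_mono[rotated]) (simp add: A1_def A2_def A3_def)
      also have "\<dots> \<le> card A1 + card {a, b - 1} + card A2 + card ((\<lambda>i. n - 1 - i) ` A3)"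
        by (meson card_Un_le add_le_mono1 order_trans)
      also have "\<dots> \<le> c1 + 2 + c1 + c1"
      proof -
        have "card {a, b - 1} \<le> 2" by (simp add: card_insert_if)
        moreover have "card ((\<lambda>i. n - 1 - i) ` A3) \<le> card A3" by (rule card_image_le) (simp add: A3_def)
        ultimately show ?thesis using c by linarith
      qed
      finally show ?thesis .
    qed
    then show "\<exists>c'. \<forall>n a b s. 0 < a \<longrightarrow> a + 1 < b \<longrightarrow> b + 2 < n \<longrightarrow> (\<forall>i<n. s i \<in> D) \<longrightarrow>
      qc_E n a b s \<le> c \<longrightarrow> card {i. i < n \<and> \<delta> \<le> \<bar>s i - \<gamma>\<bar>} \<le> c'" by blast
  qed
qed

end

section \<open>Representative atoms and their minimal distances\<close>

locale qc_setting = lj_potentials +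
  fixes l u0 u1 :: real and k1 k2 :: "nat \<Rightarrow> nat" and T :: "nat \<Rightarrow> nat set" and b :: "real \<Rightarrow> enat"
    and rhat lhat :: enat
  assumes biconj_l: "biconj (J0 J1 J2) l = ereal m"
    and l_gt: "l > \<gamma>"
    and u0_pos: "u0 > 0" and u1_pos: "u1 > 0"
    and K_int: "\<forall>\<^sub>F n in sequentially. 0 < k1 n \<and> k1 n < k2 n \<and> k2 n + 2 < n"
    and K1: "filterlim k1 at_top sequentially"
    and K2: "filterlim (\<lambda>n. n - k2 n) at_top sequentially"
    and K3: "(\<lambda>n. real (k1 n) / real n) \<longlonglongrightarrow> 0"
    and K4: "(\<lambda>n. real (n - k2 n) / real n) \<longlonglongrightarrow> 0"
    and T_sub: "\<forall>n. T n \<subseteq> {0..n} \<and> 0 \<in> T n \<and> n \<in> T n"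
    and T_gap: "\<exists>p :: nat \<Rightarrow> nat. ((\<lambda>n. real (p n) / real n) \<longlonglongrightarrow> 0) \<and>
                  (\<forall>n a c. consecutive (T n) a c \<longrightarrow> c - a \<le> p n)"
    and T_atom: "\<forall>n. {0..k1 n} \<union> {k2 n..n} \<subseteq> T n"
    and b_ex: "\<forall>x\<in>{0..1}. is_b k1 k2 T x (b x)"
    and rhat_ex: "(\<lambda>n. ereal (real (r_T (T n) (k1 n) - k1 n))) \<longlonglongrightarrow> ereal_of_enat rhat"
    and lhat_ex: "(\<lambda>n. ereal (real (k2 n - l_T (T n) (k2 n)))) \<longlonglongrightarrow> ereal_of_enat lhat"
begin

definition rT :: "nat \<Rightarrow> nat" where "rT n = r_T (T n) (k1 n)"
definition lT :: "nat \<Rightarrow> nat" where "lT n = l_T (T n) (k2 n)"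

lemma finite_T: "finite (T n)" using T_sub finite_subset by blast

lemma rT_props:
  assumes "k1 n < k2 n" "k2 n < n"
  shows "consecutive (T n) (k1 n) (rT n)" "k1 n < rT n" "rT n \<le> n"
proof -
  have "rT n \<in> {r \<in> T n. k1 n < r}" unfolding rT_def r_T_def
    by (rule Min_in) (use finite_T T_sub assms in auto)
  moreover have "rT n \<le> c" if "c \<in> T n" "k1 n < c" for c
    unfolding rT_def r_T_def using finite_T that by (intro Min_le) auto
  moreover have "k1 n \<in> T n" using T_atom[rule_format, of n] by auto
  ultimately show "consecutive (T n) (k1 n) (rT n)" "k1 n < rT n" "rT n \<le> n"
    using T_sub unfolding consecutive_def by (force+)
qed

lemma lT_props:
  assumes "k1 n < k2 n" "k2 n < n"
  shows "consecutive (T n) (lT n) (k2 n)" "lT n < k2 n"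
proof -
  have "k1 n \<in> T n" "k2 n \<in> T n" using T_atom[rule_format, of n] assms by auto
  have "lT n \<in> {l \<in> T n. l < k2 n}" unfolding lT_def l_T_def
    by (rule Max_in) (use finite_T \<open>k1 n \<in> T n\<close> assms in auto)
  moreover have "c \<le> lT n" if "c \<in> T n" "c < k2 n" for c
    unfolding lT_def l_T_def using finite_T that by (intro Max_ge) auto
  ultimately show "consecutive (T n) (lT n) (k2 n)" "lT n < k2 n"
    using \<open>k2 n \<in> T n\<close> unfolding consecutive_def by (force+)
qed

lemma rhat_eventually: "\<forall>\<^sub>F n in sequentially. rhat = enat (rT n - k1 n) \<or> rhat = \<infinity> \<and> K \<le> rT n - k1 n"
  unfolding rT_def using rhat_ex by (rule eventually_enat_of_tendsto)

lemma lhat_eventually: "\<forall>\<^sub>F n in sequentially. lhat = enat (k2 n - lT n) \<or> lhat = \<infinity> \<and> K \<le> k2 n - lT n"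
  unfolding lT_def using lhat_ex by (rule eventually_enat_of_tendsto)

lemma rhat_nonzero: "rhat \<noteq> 0"
proof -
  have "\<forall>\<^sub>F n in sequentially. rhat \<noteq> 0"
    using rhat_eventually[of 0] K_int
  proof eventually_elim
    case (elim n)
    then show ?case using rT_props(2)[of n] by (auto simp: zero_enat_def)
  qed
  then show ?thesis by simp
qed

lemma lhat_nonzero: "lhat \<noteq> 0"
proof -
  have "\<forall>\<^sub>F n in sequentially. lhat \<noteq> 0"
    using lhat_eventually[of 0] K_int
  proof eventually_elim
    case (elim n)
    then show ?case using lT_props(2)[of n] by (auto simp: zero_enat_def)
  qed
  then show ?thesis by simp
qed

lemma b_attained:
  assumes "x \<in> {0..1}"
  obtains q1 q2 where "adm_pair k1 k2 T x q1 q2"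
    "\<forall>\<^sub>F n in sequentially. b x = enat (q2 n - q1 n) \<or> b x = \<infinity>"
proof -
  obtain q1 q2 where q: "adm_pair k1 k2 T x q1 q2" "(\<lambda>n. ereal (real (q2 n - q1 n))) \<longlonglongrightarrow> ereal_of_enat (b x)"
    using b_ex assms unfolding is_b_def by blast
  have "\<forall>\<^sub>F n in sequentially. b x = enat (q2 n - q1 n) \<or> b x = \<infinity>"
    using eventually_enat_of_tendsto[OF q(2), of 0] by eventually_elim auto
  then show thesis using that q(1) by blast
qed

text \<open>The defining property of \<open>b x\<close> speaks about sequences; the lower bound
  needs a neighbourhood of \<open>x\<close> and all large \<open>n\<close> at once. If no
  neighbourhood worked, pairs at distance less than \<open>K\<close> could be chosen with indices
  \<open>g j\<close> increasing and radii \<open>1 / (j + 1)\<close>, giving an admissible sequence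
  of too small distance.\<close>

lemma b_lower:
  assumes x: "x \<in> {0..1}" and K: "enat K \<le> b x"
  obtains \<epsilon> where "0 < \<epsilon>" "\<forall>\<^sub>F n in sequentially. \<forall>q1\<in>T n. \<forall>q2\<in>T n. k1 n < q1 \<longrightarrow> q1 < q2 \<longrightarrow> q2 < k2 n \<longrightarrow>
      \<bar>real q1 / real n - x\<bar> < \<epsilon> \<longrightarrow> \<bar>real q2 / real n - x\<bar> < \<epsilon> \<longrightarrow> K \<le> q2 - q1"
proof (rule ccontr)
  assume neg: "\<not> thesis"
  note witness = that
  define \<Phi> where "\<Phi> \<epsilon> n q \<longleftrightarrow> (fst q \<in> T n \<and> snd q \<in> T n \<and> k1 n < fst q \<and> fst q < snd q \<and> snd q < k2 n \<and>
      \<bar>real (fst q) / real n - x\<bar> < \<epsilon> \<and> \<bar>real (snd q) / real n - x\<bar> < \<epsilon>)" for \<epsilon> n and q :: "nat \<times> nat"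
  have freq: "\<exists>n>N. \<exists>q. \<Phi> \<epsilon> n q \<and> snd q - fst q < K" if "0 < \<epsilon>" for \<epsilon> N
  proof (rule ccontr)
    assume n: "\<not> ?thesis"
    have "\<forall>\<^sub>F n in sequentially. \<forall>q1\<in>T n. \<forall>q2\<in>T n. k1 n < q1 \<longrightarrow> q1 < q2 \<longrightarrow> q2 < k2 n \<longrightarrow>
      \<bar>real q1 / real n - x\<bar> < \<epsilon> \<longrightarrow> \<bar>real q2 / real n - x\<bar> < \<epsilon> \<longrightarrow> K \<le> q2 - q1"
      using eventually_gt_at_top[of N]
    proof eventually_elim
      case (elim i)
      show ?case
      proof (intro ballI impI)
        fix q1 q2 assume "q1 \<in> T i" "q2 \<in> T i" "k1 i < q1" "q1 < q2" "q2 < k2 i"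
          "\<bar>real q1 / real i - x\<bar> < \<epsilon>" "\<bar>real q2 / real i - x\<bar> < \<epsilon>"
        then have "\<Phi> \<epsilon> i (q1, q2)" by (simp add: \<Phi>_def)
        then show "K \<le> q2 - q1" using n elim by force
      qed
    qed
    from witness[OF that this] neg show False by blast
  qed
  have "\<exists>g. \<forall>j. (\<exists>q. \<Phi> (1 / real (Suc j)) (g j) q \<and> snd q - fst q < K) \<and> g j < (g (Suc j) :: nat)"
  proof (rule dependent_nat_choice)
    show "\<exists>n. \<exists>q. \<Phi> (1 / real (Suc 0)) n q \<and> snd q - fst q < K" using freq[of 1 0] by auto
    show "\<exists>n'. (\<exists>q. \<Phi> (1 / real (Suc (Suc j))) n' q \<and> snd q - fst q < K) \<and> n < n'" for n j
      using freq[of "1 / real (Suc (Suc j))" n] by auto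
  qed
  then obtain g where g: "\<And>j. \<exists>q. \<Phi> (1 / real (Suc j)) (g j) q \<and> snd q - fst q < K" "\<And>j. g j < g (Suc j)" by blast
  then obtain q where q: "\<And>j. \<Phi> (1 / real (Suc j)) (g j) (q j)" "\<And>j. snd (q j) - fst (q j) < K" by metis
  have gm: "strict_mono g" using g(2) by (simp add: strict_mono_Suc_iff)
  obtain p1 p2 where p: "adm_pair k1 k2 T x p1 p2" using b_ex x unfolding is_b_def by blast
  \<comment> \<open>Outside the indices \<open>g j\<close> the bad pairs are completed by an
    arbitrary admissible pair \<open>p1\<close>, \<open>p2\<close>.\<close>
  define Q where "Q n = (if n \<in> range g then q (inv_into UNIV g n) else (p1 n, p2 n))" for n
  have merge: "eventually (\<lambda>n. P n (Q n)) sequentially"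
    if "eventually (\<lambda>k. P (g k) (q k)) sequentially" "eventually (\<lambda>n. P n (p1 n, p2 n)) sequentially" for P
    unfolding Q_def using eventually_merge[where P = P and r = g and q = q and p = "\<lambda>n. (p1 n, p2 n)"] gm that by blast
  have qlim: "eventually (\<lambda>k. \<Phi> e (g k) (q k)) sequentially" if "0 < e" for e
  proof -
    have "eventually (\<lambda>k. 1 / real (Suc k) < e) sequentially"
      using order_tendstoD(2)[OF LIMSEQ_Suc[OF lim_1_over_n]] that by simp
    then show ?thesis
    proof eventually_elim
      case (elim k)
      show ?case using q(1)[of k] less_trans[OF _ elim] unfolding \<Phi>_def by blast
    qed
  qed
  have plim: "eventually (\<lambda>n. \<Phi> e n (p1 n, p2 n)) sequentially" if "0 < e" for e
  proof -
    have "eventually (\<lambda>n. \<bar>real (p1 n) / real n - x\<bar> < e) sequentially" "eventually (\<lambda>n. \<bar>real (p2 n) / real n - x\<bar> < e) sequentially"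
      using p that by (auto simp: adm_pair_def tendsto_iff dist_real_def)
    moreover have "eventually (\<lambda>n. k1 n < p1 n \<and> p1 n < p2 n \<and> p2 n < k2 n \<and> p1 n \<in> T n \<and> p2 n \<in> T n) sequentially"
      using p by (simp add: adm_pair_def)
    ultimately show ?thesis by eventually_elim (simp add: \<Phi>_def)
  qed
  have Qlim: "eventually (\<lambda>n. \<Phi> e n (Q n)) sequentially" if "0 < e" for e
    by (rule merge[OF qlim plim]) (rule that)+
  have "adm_pair k1 k2 T x (\<lambda>n. fst (Q n)) (\<lambda>n. snd (Q n))"
    unfolding adm_pair_def tendsto_iff dist_real_def
  proof (intro conjI allI impI)
    show "\<forall>\<^sub>F n in sequentially. k1 n < fst (Q n) \<and> fst (Q n) < snd (Q n) \<and> snd (Q n) < k2 n \<and> fst (Q n) \<in> T n \<and> snd (Q n) \<in> T n"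
      by (rule eventually_mono[OF Qlim[of 1]]) (auto simp: \<Phi>_def)
    show "\<forall>\<^sub>F n in sequentially. \<bar>real (fst (Q n)) / real n - x\<bar> < e"
      "\<forall>\<^sub>F n in sequentially. \<bar>real (snd (Q n)) / real n - x\<bar> < e" if "0 < e" for e
      by (rule eventually_mono[OF Qlim[OF that]]; simp add: \<Phi>_def)+
  qed
  then have "ereal_of_enat (b x) \<le> liminf (\<lambda>n. ereal (real (snd (Q n) - fst (Q n))))"
    using b_ex x unfolding is_b_def by blast
  moreover have "ereal (real K) \<le> ereal_of_enat (b x)" using K by (metis ereal_of_enat_le_iff ereal_of_enat_simps(1))
  \<comment> \<open>A bound strictly below the lower limit holds eventually. For integers, exceeding
    \<open>K - 1/2\<close> means at least \<open>K\<close>.\<close>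
  moreover have "ereal (real K - 1/2) < ereal (real K)" by simp
  ultimately have "ereal (real K - 1/2) < liminf (\<lambda>n. ereal (real (snd (Q n) - fst (Q n))))" by (metis less_le_trans)
  then have "eventually (\<lambda>n. ereal (real K - 1/2) < ereal (real (snd (Q n) - fst (Q n)))) sequentially"
    by (rule less_LiminfD)
  from eventually_subseq[OF gm this]
  have "eventually (\<lambda>k. K \<le> snd (Q (g k)) - fst (Q (g k))) sequentially"
    by eventually_elim simp
  then obtain k where "K \<le> snd (Q (g k)) - fst (Q (g k))" using eventually_happens by fastforce
  moreover have "Q (g k) = q k" using gm by (simp add: Q_def strict_mono_imp_inj_on)
  ultimately show False using q(2)[of k] by simp
qed

end

section \<open>Structure of limits of bounded energy\<close>

lemma AE_eq_of_L1_limit: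
  fixes u :: "real \<Rightarrow> real" and r :: "nat \<Rightarrow> nat"
  assumes L1: "L1_conv us u" and r: "strict_mono r"
    and ae: "\<And>k. AE x in lborel. x \<in> {0..1} \<longrightarrow> us (r k) x = v k x"
    and lim: "\<And>t. 0 < t \<Longrightarrow> t < 1 \<Longrightarrow> t \<notin> X \<Longrightarrow> (\<lambda>k. v k t) \<longlonglongrightarrow> f t" and X: "finite X"
  shows "AE x in lborel. x \<in> {0..1} \<longrightarrow> u x = f x"
proof -
  let ?M = "lebesgue_on {0..1::real}"
  have us: "us n absolutely_integrable_on {0..1}" "u absolutely_integrable_on {0..1}" for n
    using L1 by (auto simp: L1_conv_def)
  define w where "w k x = us (r k) x - u x" for k x
  have wa: "w k absolutely_integrable_on {0..1}" for k
    unfolding w_def by (rule set_integral_diff(1)[OF us(1) us(2)])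
  then have wi: "integrable ?M (w k)" for k by (simp add: integrable_restrict_space set_integrable_def)
  have "(\<lambda>n. integral {0..1} (\<lambda>x. \<bar>us n x - u x\<bar>)) \<longlonglongrightarrow> 0" using L1 by (simp add: L1_conv_def)
  from LIMSEQ_subseq_LIMSEQ[OF this r]
  have "(\<lambda>k. integral {0..1} (\<lambda>x. \<bar>w k x\<bar>)) \<longlonglongrightarrow> 0" by (simp add: o_def w_def)
  moreover have "integral {0..1} (\<lambda>x. \<bar>w k x\<bar>) = (\<integral>x. norm (w k x) \<partial>?M)" for k
  proof -
    have "integrable ?M (\<lambda>x. norm (w k x))" using wi by (rule integrable_norm)
    then have "(\<integral>x. norm (w k x) \<partial>?M) = integral {0..1} (\<lambda>x. norm (w k x))" by (rule lebesgue_integral_eq_integral) simp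
    then show ?thesis by simp
  qed
  ultimately have "(\<lambda>k. \<integral>x. norm (w k x) \<partial>?M) \<longlonglongrightarrow> 0" by simp
  \<comment> \<open>Convergence in \<open>L1\<close> gives convergence almost everywhere along a
    further subsequence, which is enough to identify \<open>u\<close> with the pointwise
    limit.\<close>
  from tendsto_L1_AE_subseq[OF wi this]
  obtain \<rho> where \<rho>: "strict_mono \<rho>" "AE x in ?M. (\<lambda>n. w (\<rho> n) x) \<longlonglongrightarrow> 0" by blast
  have "AE x in lebesgue. x \<in> {0..1} \<longrightarrow> (\<lambda>n. w (\<rho> n) x) \<longlonglongrightarrow> 0"
    using \<rho>(2) by (subst (asm) AE_restrict_space_iff) auto
  then have 1: "AE x in lborel. x \<in> {0..1} \<longrightarrow> (\<lambda>n. w (\<rho> n) x) \<longlonglongrightarrow> 0"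
    by (simp add: AE_completion_iff)
  have 2: "AE x in lborel. \<forall>k. x \<in> {0..1} \<longrightarrow> us (r k) x = v k x"
    unfolding AE_all_countable using ae by blast
  have "AE x in lborel. x \<notin> insert 0 (insert 1 X)"
    by (rule AE_not_in, rule finite_imp_null_set_lborel) (use X in simp)
  with 1 2 show ?thesis
  proof eventually_elim
    case (elim x)
    show ?case
    proof
      assume x: "x \<in> {0..1}"
      have "(\<lambda>n. v (\<rho> n) x - u x) \<longlonglongrightarrow> 0" using elim(1,2) x by (simp add: w_def)
      then have "(\<lambda>n. v (\<rho> n) x) \<longlonglongrightarrow> u x" by (simp add: LIM_zero_cancel)
      moreover have "(\<lambda>n. v (\<rho> n) x) \<longlonglongrightarrow> f x"
        using LIMSEQ_subseq_LIMSEQ[OF lim[of x] \<rho>(1)] x elim(3) by (simp add: o_def)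
      ultimately show "u x = f x" by (rule LIMSEQ_unique)
    qed
  qed
qed

text \<open>Several steep bonds may converge to the same point. Their amplitudes are added, and
  points of total weight zero are no jumps and are removed.\<close>

lemma step_sum_group:
  fixes a :: "'j \<Rightarrow> real" and x :: "'j \<Rightarrow> real"
  assumes "finite J" "\<And>j. j \<in> J \<Longrightarrow> 0 \<le> a j"
  defines "w \<equiv> \<lambda>y. \<Sum>j\<in>{j\<in>J. x j = y}. a j" and "S \<equiv> {y\<in>x ` J. 0 < (\<Sum>j\<in>{j\<in>J. x j = y}. a j)}"
  shows "step_sum J a x t = (\<Sum>y\<in>{y\<in>S. y < t}. w y)" "(\<Sum>j\<in>J. a j) = (\<Sum>y\<in>S. w y)"
proof -
  have w0: "w y = 0" if "y \<in> x ` J - S" for y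
  proof -
    have "0 \<le> w y" unfolding w_def by (rule sum_nonneg) (use assms in auto)
    then show ?thesis using that by (auto simp: S_def w_def)
  qed
  have fin: "finite (x ` J)" using assms(1) by simp
  have "(\<Sum>j\<in>J. a j) = (\<Sum>y\<in>x ` J. w y)" unfolding w_def by (rule sum.image_gen[OF assms(1)])
  also have "\<dots> = (\<Sum>y\<in>S. w y)"
    by (rule sum.mono_neutral_right[OF fin]) (use w0 in \<open>auto simp: S_def\<close>)
  finally show "(\<Sum>j\<in>J. a j) = (\<Sum>y\<in>S. w y)" .
  have "step_sum J a x t = (\<Sum>y\<in>x ` {j\<in>J. x j < t}. \<Sum>j\<in>{j\<in>{j\<in>J. x j < t}. x j = y}. a j)"
    unfolding step_sum_def by (rule sum.image_gen) (use assms(1) in simp)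
  also have "\<dots> = (\<Sum>y\<in>{y\<in>x ` J. y < t}. w y)"
  proof (rule sum.cong)
    fix y assume "y \<in> {y\<in>x ` J. y < t}"
    then have "{j\<in>{j\<in>J. x j < t}. x j = y} = {j\<in>J. x j = y}" by auto
    then show "(\<Sum>j\<in>{j\<in>{j\<in>J. x j < t}. x j = y}. a j) = w y" by (simp add: w_def)
  qed auto
  also have "\<dots> = (\<Sum>y\<in>{y\<in>S. y < t}. w y)"
    by (rule sum.mono_neutral_right) (use w0 fin in \<open>auto simp: S_def\<close>)
  finally show "step_sum J a x t = (\<Sum>y\<in>{y\<in>S. y < t}. w y)" .
qed

context qc_setting
begin

definition admissible :: "nat \<Rightarrow> (nat \<Rightarrow> real) \<Rightarrow> bool" where
  "admissible n s \<longleftrightarrow> (\<forall>i<n. s i \<in> D) \<and> elem_const (T n) s \<and> s 0 = u0 \<and> s (n - 1) = u1 \<and> (\<Sum>i<n. s i) = real n * l"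

definition good_n :: "nat \<Rightarrow> bool" where
  "good_n n \<longleftrightarrow> 0 < k1 n \<and> k1 n + 1 < k2 n \<and> k2 n + 2 < n"

text \<open>The hypothesis orders only \<open>k1 n < k2 n\<close>. The extra unit comes from
  \<open>k1 n / n\<close> tending to 0 and \<open>k2 n / n\<close> to 1, with
  \<open>n \<ge> 10\<close> to turn the gap into an integer one.\<close>

lemma eventually_good: "eventually good_n sequentially"
proof -
  have "eventually (\<lambda>n. real (k1 n) / real n < 1/4) sequentially" using order_tendstoD(2)[OF K3, of "1/4"] by simp
  moreover have "eventually (\<lambda>n. real (n - k2 n) / real n < 1/4) sequentially" using order_tendstoD(2)[OF K4, of "1/4"] by simp
  ultimately show ?thesis using K_int eventually_ge_at_top[of 10]
  proof eventually_elim
    case (elim n)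
    then have "real (k1 n) < real n / 4" "real (n - k2 n) < real n / 4" by (simp_all add: pos_divide_less_eq)
    then show ?case using elim by (simp add: good_n_def of_nat_diff)
  qed
qed

lemma H1n_less_imp:
  assumes n: "good_n n" and lt: "H1n J1 J2 l u0 u1 n (k1 n) (k2 n) (T n) u < ereal c"
  obtains v where "bond_affine n v" "AE x in lborel. x \<in> {0..1} \<longrightarrow> u x = v x" "v 0 = 0"
    "admissible n (slopes n v)" "qc_E n (k1 n) (k2 n) (slopes n v) < c"
proof -
  have n0: "0 < n" using n by (simp add: good_n_def)
  obtain v where v: "in_A_T n (T n) v" "BC n l u0 u1 v" "AE x in lborel. x \<in> {0..1} \<longrightarrow> u x = v x"
    "ereal (real n) * (qc_energy J1 J2 n (k1 n) (k2 n) (\<lambda>i. v (real i / real n)) - ereal m) < ereal c"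
    using lt unfolding H1n_def Inf_less_iff biconj_l by blast
  have sD: "slopes n v i \<in> D" if "i < n" for i
    using qc_energy_finite_imp[OF n0 less_trans[OF v(4)] that] by simp
  have T: "T n \<subseteq> {0..n}" "0 \<in> T n" "n \<in> T n" using T_sub by auto
  have "slopes n v 0 = u0" using v(2) n0 by (simp add: slopes_def BC_def)
  moreover have "slopes n v (n - 1) = u1"
  proof -
    have "real (n - 1 + 1) / real n = 1" "real (n - 1) / real n = (real n - 1) / real n" using n0 by (simp_all add: of_nat_diff)
    then show ?thesis using v(2) n0 by (simp add: slopes_def BC_def)
  qed
  moreover have "(\<Sum>i<n. slopes n v i) = real n * l"
    using slopes_sum[OF n0, of v n] v(2) n0 by (simp add: BC_def)
  ultimately have "admissible n (slopes n v)"
    unfolding admissible_def using sD in_A_T_affine(2)[OF v(1) T n0] by simp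
  moreover have "qc_E n (k1 n) (k2 n) (slopes n v) < c"
  proof -
    have "ereal (real n) * (qc_energy J1 J2 n (k1 n) (k2 n) (\<lambda>i. v (real i / real n)) - ereal m)
        = ereal (qc_E n (k1 n) (k2 n) (slopes n v))"
      by (rule qc_energy_real) (use n sD in \<open>auto simp: good_n_def\<close>)
    then show ?thesis using v(4) by simp
  qed
  ultimately show thesis using that v(2,3) in_A_T_affine(1)[OF v(1) T n0] by (simp add: BC_def)
qed

text \<open>The energy bound permits \<open>steep_bonds_compactness\<close>, and the
  \<open>L1\<close> limit is identified with the pointwise limit of the interpolations. The jump set
  is nonempty because \<open>l > \<gamma>\<close>. Besides the form of \<open>u\<close>, each jump
  point gets a sequence of bonds that converges to it and whose slopes tend to infinity; the energy
  estimate needs this.\<close>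

lemma limit_structure:
  fixes r0 :: "nat \<Rightarrow> nat"
  assumes L1: "L1_conv us u" and r0: "strict_mono r0"
    and good: "\<And>k. good_n (r0 k)"
    and lt: "\<And>k. H1n J1 J2 l u0 u1 (r0 k) (k1 (r0 k)) (k2 (r0 k)) (T (r0 k)) (us (r0 k)) < ereal c"
  obtains r s S a where "strict_mono r" "\<And>k. good_n (r k)" "\<And>k. admissible (r k) (s k)"
    "\<And>k. qc_E (r k) (k1 (r k)) (k2 (r k)) (s k) < c"
    "sbvc_rep l \<gamma> S a" "AE x in lborel. x \<in> {0..1} \<longrightarrow> u x = sbvc_fun \<gamma> S a x"
    "\<And>y. y \<in> S \<Longrightarrow> \<exists>p. (\<forall>k. p k < r k) \<and> (\<lambda>k. real (p k) / real (r k)) \<longlonglongrightarrow> y \<and> (\<forall>M. eventually (\<lambda>k. M \<le> s k (p k)) sequentially)"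
proof -
  define P where "P k v \<longleftrightarrow> bond_affine (r0 k) v \<and> (AE x in lborel. x \<in> {0..1} \<longrightarrow> us (r0 k) x = v x) \<and> v 0 = 0 \<and>
      admissible (r0 k) (slopes (r0 k) v) \<and> qc_E (r0 k) (k1 (r0 k)) (k2 (r0 k)) (slopes (r0 k) v) < c" for k v
  have "\<exists>v. P k v" for k
    unfolding P_def by (rule H1n_less_imp[OF good lt]) (intro exI conjI)
  then obtain v where Pv: "\<And>k. P k (v k)" by metis
  have v: "\<And>k. bond_affine (r0 k) (v k)" "\<And>k. AE x in lborel. x \<in> {0..1} \<longrightarrow> us (r0 k) x = v k x"
    "\<And>k. v k 0 = 0" "\<And>k. admissible (r0 k) (slopes (r0 k) (v k))"
    "\<And>k. qc_E (r0 k) (k1 (r0 k)) (k2 (r0 k)) (slopes (r0 k) (v k)) < c"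
    using Pv unfolding P_def by blast+
  define s where "s k = slopes (r0 k) (v k)" for k
  have pos0: "0 < r0 k" for k using good[of k] unfolding good_n_def by linarith
  have r0top: "filterlim r0 at_top sequentially" using r0 by (rule filterlim_subseq)
  have good': "0 < k1 (r0 k)" "k1 (r0 k) + 1 < k2 (r0 k)" "k2 (r0 k) + 2 < r0 k" for k
    using good by (simp_all add: good_n_def)
  have sD: "s k i \<in> D" if "i < r0 k" for k i using v(4) that by (simp add: s_def admissible_def)
  have E: "qc_E (r0 k) (k1 (r0 k)) (k2 (r0 k)) (s k) \<le> c" for k using v(5)[of k] by (simp add: s_def)
  obtain K where K: "\<And>n a b s. 0 < a \<Longrightarrow> a + 1 < b \<Longrightarrow> b + 2 < n \<Longrightarrow> (\<And>i. i < n \<Longrightarrow> s i \<in> D) \<Longrightarrow>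
      qc_E n a b s \<le> c \<Longrightarrow> (\<forall>i<n. - K \<le> s i)"
    and cnt: "\<And>\<delta>. 0 < \<delta> \<Longrightarrow> \<exists>c'. \<forall>n a b s. 0 < a \<longrightarrow> a + 1 < b \<longrightarrow> b + 2 < n \<longrightarrow> (\<forall>i<n. s i \<in> D) \<longrightarrow>
      qc_E n a b s \<le> c \<longrightarrow> card {i. i < n \<and> \<delta> \<le> \<bar>s i - \<gamma>\<bar>} \<le> c'"
    using energy_bound_consequences[of c] by blast
  have Kk: "- K \<le> s k i" if "i < r0 k" for k i
    by (rule K[OF good' _ E, rule_format, OF _ that]) (rule sD)
  have cntk: "\<exists>c'. \<forall>k. card {i. i < r0 k \<and> \<delta> \<le> \<bar>s k i - \<gamma>\<bar>} \<le> c'" if d: "0 < \<delta>" for \<delta>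
  proof -
    obtain c' where c': "\<forall>n a b s. 0 < a \<longrightarrow> a + 1 < b \<longrightarrow> b + 2 < n \<longrightarrow> (\<forall>i<n. s i \<in> D) \<longrightarrow>
      qc_E n a b s \<le> c \<longrightarrow> card {i. i < n \<and> \<delta> \<le> \<bar>s i - \<gamma>\<bar>} \<le> c'" using cnt[OF d] by blast
    have "card {i. i < r0 k \<and> \<delta> \<le> \<bar>s k i - \<gamma>\<bar>} \<le> c'" for k
      by (rule c'[rule_format, OF good' _ E]) (rule sD)
    then show ?thesis by blast
  qed
  have tot: "(\<Sum>i<r0 k. s k i) = real (r0 k) * l" for k using v(4) by (simp add: s_def admissible_def)
  obtain \<rho> :: "nat \<Rightarrow> nat" and J :: nat and pos :: "nat \<Rightarrow> nat \<Rightarrow> nat" and A :: "nat \<Rightarrow> nat \<Rightarrow> real"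
    and err :: "nat \<Rightarrow> real" and x a :: "nat \<Rightarrow> real" where \<rho>: "strict_mono \<rho>" and err: "err \<longlonglongrightarrow> 0"
    and node: "\<And>k i. i \<le> r0 (\<rho> k) \<Longrightarrow> \<bar>(\<Sum>j<i. s (\<rho> k) j) / real (r0 (\<rho> k)) - \<gamma> * (real i / real (r0 (\<rho> k)))
        - (\<Sum>j\<in>{j\<in>{..<J}. pos k j < i}. A k j)\<bar> \<le> err k"
    and poslim: "\<And>j. j < J \<Longrightarrow> (\<lambda>k. real (pos k j) / real (r0 (\<rho> k))) \<longlonglongrightarrow> x j"
    and Alim: "\<And>j. j < J \<Longrightarrow> (\<lambda>k. A k j) \<longlonglongrightarrow> a j"
    and pos: "\<And>k j. pos k j < r0 (\<rho> k)" and Ann: "\<And>k j. 0 \<le> A k j"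
    and As: "\<And>k j. 0 < A k j \<Longrightarrow> s (\<rho> k) (pos k j) = \<gamma> + real (r0 (\<rho> k)) * A k j"
  proof (rule steep_bonds_compactness[of r0 K s \<gamma> l, OF r0top pos0])
    show "- K \<le> s k i" if "i < r0 k" for k i using that by (rule Kk)
    show "\<exists>c'. \<forall>k. card {i. i < r0 k \<and> \<delta> \<le> \<bar>s k i - \<gamma>\<bar>} \<le> c'" if "0 < \<delta>" for \<delta> using that by (rule cntk)
    show "(\<Sum>i<r0 k. s k i) = real (r0 k) * l" for k by (rule tot)
  qed (rule that)
  define r where "r = r0 \<circ> \<rho>"
  have r: "strict_mono r" unfolding r_def by (rule strict_mono_o[OF r0 \<rho>])
  have rtop: "filterlim r at_top sequentially" using r by (rule filterlim_subseq)
  have ann: "0 \<le> a j" if "j < J" for j by (rule LIMSEQ_le_const[OF Alim[OF that]]) (use Ann in auto)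
  have x01: "x j \<in> {0..1}" if "j < J" for j
  proof -
    have "0 \<le> x j" by (rule LIMSEQ_le_const[OF poslim[OF that]]) auto
    moreover have "x j \<le> 1"
      by (rule LIMSEQ_le_const2[OF poslim[OF that]]) (use pos in \<open>auto intro!: exI[of _ 0] simp: divide_le_eq less_imp_le\<close>)
    ultimately show ?thesis by simp
  qed
  define w where "w y = (\<Sum>j\<in>{j\<in>{..<J}. x j = y}. a j)" for y
  define S where "S = {y\<in>x ` {..<J}. 0 < (\<Sum>j\<in>{j\<in>{..<J}. x j = y}. a j)}"
  note grp = step_sum_group[of "{..<J}" a x, folded w_def[abs_def] S_def]
  have lim: "(\<lambda>k. v (\<rho> k) t) \<longlonglongrightarrow> sbvc_fun \<gamma> S w t" if "0 < t" "t < 1" "t \<notin> x ` {..<J}" for t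
  proof -
    have "(\<lambda>k. v (\<rho> k) t) \<longlonglongrightarrow> \<gamma> * t + step_sum {..<J} a x t"
    proof (rule interp_limit[where N = r and pos = pos and A = A and err = err])
      show "\<bar>v (\<rho> k) (real i / real (r k)) - \<gamma> * (real i / real (r k)) - (\<Sum>j\<in>{j\<in>{..<J}. pos k j < i}. A k j)\<bar> \<le> err k"
        if "i \<le> r k" for k i
        using node[of i k] that slopes_sum[OF pos0, of "\<rho> k" "v (\<rho> k)" i] pos0[of "\<rho> k"] v(3)
        by (simp add: r_def s_def)
    qed (use rtop v(1) err poslim Alim that in \<open>auto simp: r_def\<close>)
    then show ?thesis using grp(1)[of t] ann by (simp add: sbvc_fun_def)
  qed
  have "AE x in lborel. x \<in> {0..1} \<longrightarrow> u x = sbvc_fun \<gamma> S w x"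
    by (rule AE_eq_of_L1_limit[OF L1 r, where v = "\<lambda>k. v (\<rho> k)" and X = "x ` {..<J}"])
       (use v(2) lim in \<open>auto simp: r_def\<close>)
  moreover have "sbvc_rep l \<gamma> S w"
  proof -
    have "\<bar>l - \<gamma> - (\<Sum>j<J. A k j)\<bar> \<le> err k" for k
    proof -
      have "{j\<in>{..<J}. pos k j < r0 (\<rho> k)} = {..<J}" using pos by auto
      then show ?thesis using node[of "r0 (\<rho> k)" k] tot[of "\<rho> k"] pos0[of "\<rho> k"] by simp
    qed
    then have "(\<lambda>k. l - \<gamma> - (\<Sum>j<J. A k j)) \<longlonglongrightarrow> 0"
      by (intro Lim_null_comparison[OF _ err]) auto
    moreover have "(\<lambda>k. l - \<gamma> - (\<Sum>j<J. A k j)) \<longlonglongrightarrow> l - \<gamma> - (\<Sum>j<J. a j)"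
      by (intro tendsto_intros Alim) auto
    ultimately have "l - \<gamma> - (\<Sum>j<J. a j) = 0" by (metis LIMSEQ_unique)
    then have sum: "\<gamma> + (\<Sum>y\<in>S. w y) = l" using grp(2) ann by simp
    have "finite S" "S \<subseteq> {0..1}" "\<forall>y\<in>S. 0 < w y" using x01 by (auto simp: S_def w_def)
    moreover have "S \<noteq> {}" using sum l_gt by auto
    ultimately show ?thesis using sum by (simp add: sbvc_rep_def)
  qed
  moreover have "\<exists>p. (\<forall>k. p k < r k) \<and> (\<lambda>k. real (p k) / real (r k)) \<longlonglongrightarrow> y \<and>
      (\<forall>M. eventually (\<lambda>k. M \<le> s (\<rho> k) (p k)) sequentially)" if y: "y \<in> S" for y
  proof -
    have "\<exists>j<J. x j = y \<and> 0 < a j"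
    proof (rule ccontr)
      assume "\<not> ?thesis"
      then have "(\<Sum>j\<in>{j\<in>{..<J}. x j = y}. a j) \<le> 0" by (intro sum_nonpos) force
      then show False using y by (simp add: S_def)
    qed
    then obtain j where j: "j < J" "x j = y" "0 < a j" by blast
    \<comment> \<open>The slope is \<gamma> plus \<open>r k\<close> times an amplitude that
      eventually exceeds \<open>a j / 2\<close>.\<close>
    have "eventually (\<lambda>k. M \<le> s (\<rho> k) (pos k j)) sequentially" for M
    proof -
      have "eventually (\<lambda>k. A k j > a j / 2) sequentially" using order_tendstoD(1)[OF Alim[OF j(1)], of "a j / 2"] j by simp
      moreover have "eventually (\<lambda>k. real (r k) \<ge> \<bar>M\<bar> / (a j / 2)) sequentially"
        using filterlim_compose[OF filterlim_real_sequentially rtop] unfolding filterlim_at_top by blast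
      ultimately show ?thesis
      proof eventually_elim
        case (elim k)
        have "\<bar>M\<bar> \<le> real (r k) * (a j / 2)" using elim(2) j(3) by (simp add: field_simps)
        also have "\<dots> \<le> real (r k) * A k j" using elim(1) by (intro mult_left_mono) auto
        finally have "\<bar>M\<bar> \<le> real (r k) * A k j" .
        then show ?case using As[of k j] elim(1) j(3) gamma_pos by (simp add: r_def)
      qed
    qed
    then show ?thesis using pos poslim[OF j(1)] j(2) by (intro exI[of _ "\<lambda>k. pos k j"]) (auto simp: r_def)
  qed
  ultimately show thesis
    using that[of r "\<lambda>k. s (\<rho> k)" S w] r good v(4,5) by (simp add: r_def s_def)
qed

end

section \<open>The liminf inequality\<close>

lemma ratio_eventually_less:
  fixes f g N :: "nat \<Rightarrow> nat"
  assumes "(\<lambda>k. real (f k) / real (N k)) \<longlonglongrightarrow> a" "(\<lambda>k. real (g k) / real (N k)) \<longlonglongrightarrow> c" "a < c"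
  shows "eventually (\<lambda>k. f k < g k) sequentially"
proof -
  have "(\<lambda>k. real (g k) / real (N k) - real (f k) / real (N k)) \<longlonglongrightarrow> c - a" by (intro tendsto_diff assms)
  then have "eventually (\<lambda>k. 0 < real (g k) / real (N k) - real (f k) / real (N k)) sequentially"
    by (rule order_tendstoD(1)) (use assms in simp)
  then show ?thesis by eventually_elim (simp add: divide_less_cancel)
qed

lemma ratio_complement:
  fixes f N :: "nat \<Rightarrow> nat"
  assumes "(\<lambda>k. real (f k) / real (N k)) \<longlonglongrightarrow> a" "\<And>k. f k \<le> N k" "\<And>k. 0 < N k"
  shows "(\<lambda>k. real (N k - f k) / real (N k)) \<longlonglongrightarrow> 1 - a"
proof -
  have "real (N k - f k) / real (N k) = 1 - real (f k) / real (N k)" for k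
    using assms(2,3)[of k] by (simp add: of_nat_diff diff_divide_distrib)
  then show ?thesis using tendsto_diff[OF tendsto_const assms(1), of 1] by simp
qed

context lj_potentials
begin

lemma B_IFJ_not_MInf:
  assumes "0 < \<theta>" "rh \<noteq> 0"
  shows "B_IFJ J1 J2 \<gamma> rh bb \<theta> \<noteq> -\<infinity>"
proof -
  have "B_IFJ_tilde J1 J2 \<gamma> rh bb \<noteq> -\<infinity>"
    unfolding tilde_terms[OF assms(2)] by (auto simp: min_def split: enat.split)
  then have "B_IFJ_tilde J1 J2 \<gamma> rh bb + B_theta J1 J2 \<gamma> \<theta> \<noteq> -\<infinity>"
    by (subst B_theta_real[OF assms(1)]) simp
  then show ?thesis unfolding B_IFJ_def B_BJ_real[OF assms(1)] by (simp add: min_def)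
qed

text \<open>Stated for an abstract end with interface \<open>kk\<close> and end \<open>rr\<close> of
  the first element, so that it applies to the left end and to the reflected right end. The window
  \<open>W\<close> grows more slowly than \<open>N\<close>, which keeps it disjoint from interior
  jumps and from the other end.\<close>

lemma end_lower:
  fixes N kk rr p q1 q2 :: "nat \<Rightarrow> nat" and s :: "nat \<Rightarrow> nat \<Rightarrow> real"
  assumes \<theta>: "0 < \<theta>" and rh: "rh \<noteq> 0"
    and A: "ereal A < (if jump then B_IFJ J1 J2 \<gamma> rh bb \<theta> else B_theta J1 J2 \<gamma> \<theta>)"
    and N: "\<And>k. 0 < N k"
    and kk: "filterlim kk at_top sequentially" "(\<lambda>k. real (kk k) / real (N k)) \<longlonglongrightarrow> 0"
    and rr: "\<And>k. kk k < rr k" "(\<lambda>k. real (rr k) / real (N k)) \<longlonglongrightarrow> 0"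
    and rrh: "\<And>K. \<forall>\<^sub>F k in sequentially. rh = enat (rr k - kk k) \<or> rh = \<infinity> \<and> K \<le> rr k - kk k"
    and s: "\<And>k. s k 0 = \<theta>" "\<And>k i. i < N k \<Longrightarrow> s k i \<in> D" "\<And>k i. kk k \<le> i \<Longrightarrow> i < rr k \<Longrightarrow> s k i = s k (kk k)"
    and kN: "(\<lambda>k. real (kk k + 1) / real (N k)) \<longlonglongrightarrow> 0"
    and p: "jump \<Longrightarrow> (\<forall>M. \<forall>\<^sub>F k in sequentially. M \<le> s k (p k)) \<and> (\<lambda>k. real (q2 k) / real (N k)) \<longlonglongrightarrow> 0 \<and>
       (\<forall>k. q1 k \<le> p k \<and> p k < q2 k \<and> (\<forall>i\<in>{q1 k..<q2 k}. s k i = s k (p k)) \<and> (rr k \<le> p k \<longrightarrow> rr k \<le> q1 k)) \<and>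
       (\<forall>K. enat K \<le> bb \<longrightarrow> (\<forall>\<^sub>F k in sequentially. rr k \<le> p k \<longrightarrow> K \<le> q2 k - q1 k))"
  obtains W :: "nat \<Rightarrow> nat" where "(\<lambda>k. real (W k) / real (N k)) \<longlonglongrightarrow> 0" "\<And>k. kk k < W k"
    "\<forall>\<^sub>F k in sequentially. A \<le> left_energy (s k) (kk k) (W k)"
proof (cases jump)
  case False
  then have "ereal A < B_theta J1 J2 \<gamma> \<theta>" using A by simp
  note ltn = this
  obtain k0 where k0: "\<And>k W s. k0 \<le> k \<Longrightarrow> k < W \<Longrightarrow> s 0 = \<theta> \<Longrightarrow> (\<And>i. i < W \<Longrightarrow> s i \<in> D) \<Longrightarrow>
      A \<le> left_energy s k W" using left_lower_nojump[OF \<theta> ltn] by blast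
  have "\<forall>\<^sub>F k in sequentially. kk k + 1 < N k"
    by (rule ratio_eventually_less[OF kN, of N 1]) (use N in \<open>simp_all add: less_imp_neq[symmetric]\<close>)
  moreover have "\<forall>\<^sub>F k in sequentially. k0 \<le> kk k" using kk(1) by (simp add: filterlim_at_top)
  ultimately have "\<forall>\<^sub>F k in sequentially. A \<le> left_energy (s k) (kk k) (kk k + 1)"
  proof eventually_elim
    case (elim k)
    show ?case by (rule k0) (use elim s in auto)
  qed
  then show thesis using that[of "\<lambda>k. kk k + 1"] kN by simp
next
  case True
  note p = p[OF True]
  have "ereal A < B_IFJ J1 J2 \<gamma> rh bb \<theta>" using A True by simp
  note ltJ = this
  show thesis
  proof (rule left_lower_jump[OF \<theta> rh ltJ])
  fix M :: real and k0 :: nat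
  assume lower: "\<And>k r q1 q2 W s j. k0 \<le> k \<Longrightarrow> k < r \<Longrightarrow> r \<le> W \<Longrightarrow>
      rh = enat (r - k) \<or> rh = \<infinity> \<and> k0 \<le> r - k \<Longrightarrow> s 0 = \<theta> \<Longrightarrow> (\<And>i. i < W \<Longrightarrow> s i \<in> D) \<Longrightarrow>
      (\<And>i. k \<le> i \<Longrightarrow> i < r \<Longrightarrow> s i = s k) \<Longrightarrow> j < W \<Longrightarrow> M \<le> s j \<Longrightarrow>
      (r \<le> j \<Longrightarrow> r \<le> q1 \<and> q1 \<le> j \<and> j < q2 \<and> q2 \<le> W \<and> (\<forall>i\<in>{q1..<q2}. s i = s j) \<and>
          min (enat k0) bb \<le> enat (q2 - q1)) \<Longrightarrow>
      A \<le> left_energy s k W"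
  \<comment> \<open>Large enough to contain both the first continuum element and the element of the
    steep bond.\<close>
  define W where "W k = max (rr k) (q2 k)" for k
  have Wlim: "(\<lambda>k. real (W k) / real (N k)) \<longlonglongrightarrow> 0"
  proof -
    have "(\<lambda>k. max (real (rr k) / real (N k)) (real (q2 k) / real (N k))) \<longlonglongrightarrow> max 0 0"
      by (intro tendsto_max rr(2)) (use p in blast)
    moreover have "max (real (rr k) / real (N k)) (real (q2 k) / real (N k)) = real (W k) / real (N k)" for k
      by (cases "rr k \<le> q2 k") (simp_all add: W_def max_def divide_right_mono divide_le_cancel)
    ultimately show ?thesis by simp
  qed
  have "min (enat k0) bb \<noteq> \<infinity>" by (cases bb) (auto simp: min_def)
  \<comment> \<open>The minimum is finite even if the count is infinite, so the assumption on finite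
    \<open>K\<close> applies to it.\<close>
  then obtain K where K: "enat K = min (enat k0) bb" by (metis not_infinity_eq)
  have "enat K \<le> bb" unfolding K by simp
  have "\<forall>\<^sub>F k in sequentially. W k < N k"
    by (rule ratio_eventually_less[OF Wlim, of N 1]) (use N in \<open>simp_all add: less_imp_neq[symmetric]\<close>)
  moreover have "\<forall>\<^sub>F k in sequentially. k0 \<le> kk k" using kk(1) by (simp add: filterlim_at_top)
  moreover have "\<forall>\<^sub>F k in sequentially. M \<le> s k (p k)" using p by blast
  moreover have "\<forall>\<^sub>F k in sequentially. rr k \<le> p k \<longrightarrow> K \<le> q2 k - q1 k" using p \<open>enat K \<le> bb\<close> by blast
  ultimately have "\<forall>\<^sub>F k in sequentially. A \<le> left_energy (s k) (kk k) (W k)"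
    using rrh[of k0]
  proof eventually_elim
    case (elim k)
    have pk: "q1 k \<le> p k" "p k < q2 k" "\<forall>i\<in>{q1 k..<q2 k}. s k i = s k (p k)" "rr k \<le> p k \<Longrightarrow> rr k \<le> q1 k"
      using p by blast+
    show ?case
    proof (rule lower[of "kk k" "rr k" "W k" "s k" "p k" "q1 k" "q2 k"])
      show "s k i \<in> D" if "i < W k" for i using s(2) that elim(1) by simp
      show "s k i = s k (kk k)" if "kk k \<le> i" "i < rr k" for i using s(3) that by blast
      show "p k < W k" using pk(2) by (simp add: W_def)
      show "rr k \<le> q1 k \<and> q1 k \<le> p k \<and> p k < q2 k \<and> q2 k \<le> W k \<and> (\<forall>i\<in>{q1 k..<q2 k}. s k i = s k (p k)) \<and>
          min (enat k0) bb \<le> enat (q2 k - q1 k)" if "rr k \<le> p k"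
      proof -
        have "min (enat k0) bb \<le> enat (q2 k - q1 k)" unfolding K[symmetric] using elim(4) that by simp
        moreover have "q2 k \<le> W k" by (simp add: W_def)
        ultimately show ?thesis using pk that by blast
      qed
    qed (use elim rr(1) s(1) in \<open>auto simp: W_def\<close>)
  qed
  then show thesis using that[of W] Wlim rr(1) by (simp add: W_def less_max_iff_disj)
  qed
qed

end

context qc_setting
begin

text \<open>Elements have length of smaller order than \<open>n\<close>, so both their ends have the
  macroscopic limit of any point in between.\<close>

lemma gap_ratio:
  assumes r: "strict_mono (r :: nat \<Rightarrow> nat)" and pos: "\<And>k. 0 < r k"
    and el: "\<And>k. consecutive (T (r k)) (q1 k) (q2 k)" and pq: "\<And>k. q1 k \<le> p k" "\<And>k. p k \<le> q2 k"
    and lim: "(\<lambda>k. real (p k) / real (r k)) \<longlonglongrightarrow> y"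
  shows "(\<lambda>k. real (q1 k) / real (r k)) \<longlonglongrightarrow> y" "(\<lambda>k. real (q2 k) / real (r k)) \<longlonglongrightarrow> y"
proof -
  obtain g :: "nat \<Rightarrow> nat" where g: "(\<lambda>n. real (g n) / real n) \<longlonglongrightarrow> 0" "\<And>n a c. consecutive (T n) a c \<Longrightarrow> c - a \<le> g n"
    using T_gap by blast
  have gl: "(\<lambda>k. real (g (r k)) / real (r k)) \<longlonglongrightarrow> 0" using LIMSEQ_subseq_LIMSEQ[OF g(1) r] by (simp add: o_def)
  have gap: "q2 k \<le> q1 k + g (r k)" for k using g(2)[OF el[of k]] by simp
  show "(\<lambda>k. real (q1 k) / real (r k)) \<longlonglongrightarrow> y"
  proof (rule tendsto_sandwich[OF _ _ _ lim])
    show "\<forall>\<^sub>F k in sequentially. real (p k) / real (r k) - real (g (r k)) / real (r k) \<le> real (q1 k) / real (r k)"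
    proof (intro always_eventually allI)
      fix k
      have "real (p k) - real (g (r k)) \<le> real (q1 k)" using gap[of k] pq(2)[of k] by linarith
      then show "real (p k) / real (r k) - real (g (r k)) / real (r k) \<le> real (q1 k) / real (r k)"
        by (simp add: diff_divide_distrib[symmetric] divide_right_mono)
    qed
    show "(\<lambda>k. real (p k) / real (r k) - real (g (r k)) / real (r k)) \<longlonglongrightarrow> y" using tendsto_diff[OF lim gl] by simp
    show "\<forall>\<^sub>F k in sequentially. real (q1 k) / real (r k) \<le> real (p k) / real (r k)"
      using pq(1) by (simp add: divide_right_mono)
  qed
  show "(\<lambda>k. real (q2 k) / real (r k)) \<longlonglongrightarrow> y"
  proof (rule tendsto_sandwich[OF _ _ lim])
    show "\<forall>\<^sub>F k in sequentially. real (q2 k) / real (r k) \<le> real (p k) / real (r k) + real (g (r k)) / real (r k)"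
    proof (intro always_eventually allI)
      fix k
      have "real (q2 k) \<le> real (p k) + real (g (r k))" using gap[of k] pq(1)[of k] by linarith
      then show "real (q2 k) / real (r k) \<le> real (p k) / real (r k) + real (g (r k)) / real (r k)"
        by (simp add: add_divide_distrib[symmetric] divide_right_mono)
    qed
    show "(\<lambda>k. real (p k) / real (r k) + real (g (r k)) / real (r k)) \<longlonglongrightarrow> y" using tendsto_add[OF lim gl] by simp
    show "\<forall>\<^sub>F k in sequentially. real (p k) / real (r k) \<le> real (q2 k) / real (r k)"
      using pq(2) by (simp add: divide_right_mono)
  qed
qed

lemma element_count_lower:
  assumes r: "strict_mono (r :: nat \<Rightarrow> nat)" and y: "y \<in> {0..1}" and K: "enat K \<le> b y"
    and el: "\<And>k. consecutive (T (r k)) (q1 k) (q2 k)"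
    and lim: "(\<lambda>k. real (q1 k) / real (r k)) \<longlonglongrightarrow> y" "(\<lambda>k. real (q2 k) / real (r k)) \<longlonglongrightarrow> y"
  shows "\<forall>\<^sub>F k in sequentially. k1 (r k) < q1 k \<longrightarrow> q2 k < k2 (r k) \<longrightarrow> K \<le> q2 k - q1 k"
proof -
  obtain \<epsilon> where \<epsilon>: "0 < \<epsilon>" "\<forall>\<^sub>F n in sequentially. \<forall>q1\<in>T n. \<forall>q2\<in>T n. k1 n < q1 \<longrightarrow> q1 < q2 \<longrightarrow> q2 < k2 n \<longrightarrow>
      \<bar>real q1 / real n - y\<bar> < \<epsilon> \<longrightarrow> \<bar>real q2 / real n - y\<bar> < \<epsilon> \<longrightarrow> K \<le> q2 - q1"
    using b_lower[OF y K] by blast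
  have "\<forall>\<^sub>F k in sequentially. \<bar>real (q1 k) / real (r k) - y\<bar> < \<epsilon>" "\<forall>\<^sub>F k in sequentially. \<bar>real (q2 k) / real (r k) - y\<bar> < \<epsilon>"
    using lim \<epsilon>(1) by (auto simp: tendsto_iff dist_real_def)
  with eventually_subseq[OF r \<epsilon>(2)] show ?thesis
  proof eventually_elim
    case (elim k)
    have "q1 k \<in> T (r k)" "q2 k \<in> T (r k)" "q1 k < q2 k" using el[of k] by (auto simp: consecutive_def)
    then show ?case using elim by blast
  qed
qed

lemma end_value_not_MInf:
  "(if 0 \<in> S then B_IFJ J1 J2 \<gamma> rhat (b 0) u0 else B_theta J1 J2 \<gamma> u0) \<noteq> -\<infinity>"
  "(if 1 \<in> S then B_IFJ J1 J2 \<gamma> lhat (b 1) u1 else B_theta J1 J2 \<gamma> u1) \<noteq> -\<infinity>"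
  using B_IFJ_not_MInf[OF u0_pos rhat_nonzero] B_theta_real[OF u0_pos]
    B_IFJ_not_MInf[OF u1_pos lhat_nonzero] B_theta_real[OF u1_pos] by auto

lemma count_m_ne_PInf: "ereal_of_enat k * J0 J1 J2 \<gamma> \<noteq> \<infinity>"
  unfolding enat_mult_m by (simp split: enat.split)

text \<open>The subtractions become additions of terms none of which is minus infinity, the form
  required for splitting a bound.\<close>

lemma H1_value_eq:
  assumes "finite S"
  shows "H1_value J1 J2 \<gamma> u0 u1 b rhat lhat S =
      ((if 0 \<in> S then B_IFJ J1 J2 \<gamma> rhat (b 0) u0 else B_theta J1 J2 \<gamma> u0)
     + (if 1 \<in> S then B_IFJ J1 J2 \<gamma> lhat (b 1) u1 else B_theta J1 J2 \<gamma> u1)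
     + (\<Sum>x\<in>S \<inter> {0<..<1}. - (ereal_of_enat (b x) * J0 J1 J2 \<gamma>))) + ereal (- m)"
proof -
  have "finite (S \<inter> {0<..<1})" using assms by simp
  from uminus_sum_ereal[OF this, of "\<lambda>x. ereal_of_enat (b x) * J0 J1 J2 \<gamma>"] count_m_ne_PInf
  show ?thesis unfolding H1_value_def minus_ereal_def by (simp add: J0_gamma)
qed

text \<open>The bound \<open>A\<close> is split into shares \<open>A0\<close>, \<open>A1\<close> for
  the ends and \<open>a y\<close> for the interior jumps. The two windows and the elements that
  contain the steep bonds are disjoint for large \<open>k\<close>, because their macroscopic limits
  differ; all other bonds have nonnegative energy.\<close>

lemma energy_lower:
  fixes r :: "nat \<Rightarrow> nat" and s :: "nat \<Rightarrow> nat \<Rightarrow> real"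
  assumes r: "strict_mono r" and good: "\<And>k. good_n (r k)" and adm: "\<And>k. admissible (r k) (s k)"
    and S: "finite S" "S \<subseteq> {0..1}"
    and jumps: "\<And>y. y \<in> S \<Longrightarrow> \<exists>p. (\<forall>k. p k < r k) \<and> (\<lambda>k. real (p k) / real (r k)) \<longlonglongrightarrow> y \<and>
        (\<forall>M. eventually (\<lambda>k. M \<le> s k (p k)) sequentially)"
    and A: "ereal A < H1_value J1 J2 \<gamma> u0 u1 b rhat lhat S"
  shows "\<forall>\<^sub>F k in sequentially. A \<le> qc_E (r k) (k1 (r k)) (k2 (r k)) (s k)"
proof -
  define I where "I = S \<inter> {0<..<1}"
  define X0 where "X0 = (if 0 \<in> S then B_IFJ J1 J2 \<gamma> rhat (b 0) u0 else B_theta J1 J2 \<gamma> u0)"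
  define X1 where "X1 = (if 1 \<in> S then B_IFJ J1 J2 \<gamma> lhat (b 1) u1 else B_theta J1 J2 \<gamma> u1)"
  define f where "f x = ereal_of_enat (b x) * J0 J1 J2 \<gamma>" for x
  have finI: "finite I" using S by (simp add: I_def)
  have f_ne: "f x \<noteq> \<infinity>" for x unfolding f_def by (rule count_m_ne_PInf)
  have X0n: "X0 \<noteq> -\<infinity>" and X1n: "X1 \<noteq> -\<infinity>" unfolding X0_def X1_def by (rule end_value_not_MInf)+
  have sumn: "(\<Sum>x\<in>I. - f x) \<noteq> -\<infinity>" by (rule sum_ereal_not_MInf) (use f_ne in \<open>simp add: ereal_uminus_eq_reorder\<close>)
  have "H1_value J1 J2 \<gamma> u0 u1 b rhat lhat S = (X0 + X1 + (\<Sum>x\<in>I. - f x)) + ereal (- m)"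
    unfolding X0_def X1_def I_def f_def by (rule H1_value_eq[OF S(1)])
  then have lt: "ereal (A + m) < X0 + X1 + (\<Sum>x\<in>I. - f x)"
    using A less_plus_ereal_iff[of A "X0 + X1 + (\<Sum>x\<in>I. - f x)" "- m"] by simp
  have X01n: "X0 + X1 \<noteq> -\<infinity>" using X0n X1n by simp
  obtain A01 A2 where A01: "ereal A01 < X0 + X1" "ereal A2 < (\<Sum>x\<in>I. - f x)" "A + m < A01 + A2"
    using ereal_less_add_split[OF lt X01n sumn] by blast
  obtain A0 A1 where A0: "ereal A0 < X0" "ereal A1 < X1" "A01 < A0 + A1"
    using ereal_less_add_split[OF A01(1) X0n X1n] by blast
  obtain a where a: "\<And>x. x \<in> I \<Longrightarrow> ereal (a x) < - f x" "A2 < (\<Sum>x\<in>I. a x)"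
    using ereal_less_sum_split[OF finI A01(2)] f_ne by (auto simp: ereal_uminus_eq_reorder)
  have pos: "0 < r k" for k using good[of k] unfolding good_n_def by linarith
  have g: "0 < k1 (r k)" "k1 (r k) + 1 < k2 (r k)" "k2 (r k) + 2 < r k" for k
    using good[of k] by (simp_all add: good_n_def)
  have k1k2: "k1 (r k) < k2 (r k)" "k2 (r k) < r k" for k using g[of k] by linarith+
  have rtop: "filterlim r at_top sequentially" using r by (rule filterlim_subseq)
  have T: "T n \<subseteq> {0..n}" "0 \<in> T n" "n \<in> T n" for n using T_sub by auto
  have sD: "s k i \<in> D" if "i < r k" for k i using adm[of k] that by (simp add: admissible_def)
  have const: "s k i = s k a" if "consecutive (T (r k)) a c" "a \<le> i" "i < c" for k a c i
  proof -
    have "elem_const (T (r k)) (s k)" using adm[of k] by (simp add: admissible_def)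
    from this[unfolded elem_const_def, rule_format, OF that(1)]
    show ?thesis using that(2,3) by (metis atLeastLessThan_iff)
  qed
  obtain p where p: "\<And>y k. y \<in> S \<Longrightarrow> p y k < r k" "\<And>y. y \<in> S \<Longrightarrow> (\<lambda>k. real (p y k) / real (r k)) \<longlonglongrightarrow> y"
    "\<And>y M. y \<in> S \<Longrightarrow> eventually (\<lambda>k. M \<le> s k (p y k)) sequentially"
    using jumps by metis
  have "\<exists>q. consecutive (T (r k)) (fst q) (snd q) \<and> fst q \<le> p y k \<and> p y k < snd q \<and> snd q \<le> r k" if "y \<in> S" for y k
    using consecutive_cover[OF T p(1)[OF that]] by (metis fst_conv snd_conv)
  then obtain q where q: "\<And>y k. y \<in> S \<Longrightarrow> consecutive (T (r k)) (fst (q y k)) (snd (q y k))"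
    "\<And>y k. y \<in> S \<Longrightarrow> fst (q y k) \<le> p y k" "\<And>y k. y \<in> S \<Longrightarrow> p y k < snd (q y k)" "\<And>y k. y \<in> S \<Longrightarrow> snd (q y k) \<le> r k"
    by metis
  define q1 where "q1 y k = fst (q y k)" for y k
  define q2 where "q2 y k = snd (q y k)" for y k
  note q = q[folded q1_def q2_def]
  have qlim: "(\<lambda>k. real (q1 y k) / real (r k)) \<longlonglongrightarrow> y" "(\<lambda>k. real (q2 y k) / real (r k)) \<longlonglongrightarrow> y" if "y \<in> S" for y
    using gap_ratio[OF r pos q(1)[OF that] q(2)[OF that] less_imp_le[OF q(3)[OF that]] p(2)[OF that]] by auto
  have qconst: "\<forall>i\<in>{q1 y k..<q2 y k}. s k i = s k (p y k)" if "y \<in> S" for y k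
  proof
    fix i assume "i \<in> {q1 y k..<q2 y k}"
    then have "s k i = s k (q1 y k)" by (intro const[OF q(1)[OF that]]) auto
    moreover have "s k (p y k) = s k (q1 y k)" by (intro const[OF q(1)[OF that]] q(2,3)[OF that])
    ultimately show "s k i = s k (p y k)" by simp
  qed
  have k1lim: "(\<lambda>k. real (k1 (r k)) / real (r k)) \<longlonglongrightarrow> 0" using LIMSEQ_subseq_LIMSEQ[OF K3 r] by (simp add: o_def)
  have k2lim: "(\<lambda>k. real (r k - k2 (r k)) / real (r k)) \<longlonglongrightarrow> 0" using LIMSEQ_subseq_LIMSEQ[OF K4 r] by (simp add: o_def)
  have k2lim1: "(\<lambda>k. real (k2 (r k)) / real (r k)) \<longlonglongrightarrow> 1"
  proof -
    have "(\<lambda>k. real (r k - (r k - k2 (r k))) / real (r k)) \<longlonglongrightarrow> 1 - 0"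
      by (rule ratio_complement[OF k2lim]) (use pos in auto)
    then show ?thesis using k1k2(2) by (simp add: less_imp_le)
  qed
  have inv: "(\<lambda>k. 1 / real (r k)) \<longlonglongrightarrow> 0" using filterlim_compose[OF lim_1_over_n rtop] by simp
  have plus1: "(\<lambda>k. real (h k + 1) / real (r k)) \<longlonglongrightarrow> 0" if "(\<lambda>k. real (h k) / real (r k)) \<longlonglongrightarrow> 0" for h :: "nat \<Rightarrow> nat"
    using tendsto_add[OF that inv] by (simp add: add_divide_distrib add.commute)
  have rTl: "(\<lambda>k. real (rT (r k)) / real (r k)) \<longlonglongrightarrow> 0"
    by (rule gap_ratio(2)[OF r pos, of "\<lambda>k. k1 (r k)" _ "\<lambda>k. k1 (r k)"]) (use rT_props k1k2 k1lim in \<open>auto simp: less_imp_le\<close>)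
  have lTl: "(\<lambda>k. real (lT (r k)) / real (r k)) \<longlonglongrightarrow> 1"
    by (rule gap_ratio(1)[OF r pos, of _ "\<lambda>k. k2 (r k)" "\<lambda>k. k2 (r k)"]) (use lT_props k1k2 k2lim1 in \<open>auto simp: less_imp_le\<close>)
  have zero01: "(0::real) \<in> {0..1}" and one01: "(1::real) \<in> {0..1}" by auto
  obtain W0 :: "nat \<Rightarrow> nat" where W0: "(\<lambda>k. real (W0 k) / real (r k)) \<longlonglongrightarrow> 0" "\<And>k. k1 (r k) < W0 k"
    "\<forall>\<^sub>F k in sequentially. A0 \<le> left_energy (s k) (k1 (r k)) (W0 k)"
  proof (rule end_lower[where N = r and kk = "\<lambda>k. k1 (r k)" and rr = "\<lambda>k. rT (r k)" and s = s and jump = "0 \<in> S"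
        and p = "p 0" and ?q1.0 = "q1 0" and ?q2.0 = "q2 0" and A = A0 and bb = "b 0", OF u0_pos rhat_nonzero _ pos])
    show "ereal A0 < (if 0 \<in> S then B_IFJ J1 J2 \<gamma> rhat (b 0) u0 else B_theta J1 J2 \<gamma> u0)"
      using A0(1) by (simp add: X0_def)
    show "filterlim (\<lambda>k. k1 (r k)) at_top sequentially" by (rule filterlim_compose[OF K1 rtop])
    show "\<forall>\<^sub>F k in sequentially. rhat = enat (rT (r k) - k1 (r k)) \<or> rhat = \<infinity> \<and> K \<le> rT (r k) - k1 (r k)" for K
      by (rule eventually_subseq[OF r rhat_eventually])
    show "s k 0 = u0" for k using adm[of k] by (simp add: admissible_def)
    show "s k i = s k (k1 (r k))" if "k1 (r k) \<le> i" "i < rT (r k)" for k i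
      using const[OF rT_props(1)[OF k1k2] that] .
    show "(\<forall>M. \<forall>\<^sub>F k in sequentially. M \<le> s k (p 0 k)) \<and> (\<lambda>k. real (q2 0 k) / real (r k)) \<longlonglongrightarrow> 0 \<and>
       (\<forall>k. q1 0 k \<le> p 0 k \<and> p 0 k < q2 0 k \<and> (\<forall>i\<in>{q1 0 k..<q2 0 k}. s k i = s k (p 0 k)) \<and> (rT (r k) \<le> p 0 k \<longrightarrow> rT (r k) \<le> q1 0 k)) \<and>
       (\<forall>K. enat K \<le> b 0 \<longrightarrow> (\<forall>\<^sub>F k in sequentially. rT (r k) \<le> p 0 k \<longrightarrow> K \<le> q2 0 k - q1 0 k))" if z: "0 \<in> S"
    proof (intro conjI allI impI)
      \<comment> \<open>The end \<open>rT\<close> of the first element is a representative atom, so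
        an element with a bond beyond it cannot start before it.\<close>
      show rq: "rT (r k) \<le> q1 0 k" if "rT (r k) \<le> p 0 k" for k
        using q(1)[OF z, of k] q(3)[OF z, of k] that rT_props(1)[OF k1k2] unfolding consecutive_def by (metis le_less_trans not_le)
      show "\<forall>\<^sub>F k in sequentially. rT (r k) \<le> p 0 k \<longrightarrow> K \<le> q2 0 k - q1 0 k" if "enat K \<le> b 0" for K
        using element_count_lower[OF r zero01 that q(1)[OF z] qlim[OF z]] ratio_eventually_less[OF qlim(2)[OF z] k2lim1 zero_less_one]
      proof eventually_elim
        case (elim k)
        then show ?case using rq[of k] rT_props(2)[OF k1k2, of k] by auto
      qed
      show "\<forall>\<^sub>F k in sequentially. M \<le> s k (p 0 k)" for M by (rule p(3)[OF z])
      show "(\<lambda>k. real (q2 0 k) / real (r k)) \<longlonglongrightarrow> 0" by (rule qlim(2)[OF z])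
      show "q1 0 k \<le> p 0 k" "p 0 k < q2 0 k" for k by (rule q(2)[OF z], rule q(3)[OF z])
      show "\<forall>i\<in>{q1 0 k..<q2 0 k}. s k i = s k (p 0 k)" for k by (rule qconst[OF z])
    qed
    show "(\<lambda>k. real (k1 (r k)) / real (r k)) \<longlonglongrightarrow> 0" by (rule k1lim)
    show "k1 (r k) < rT (r k)" for k by (rule rT_props(2)[OF k1k2])
    show "(\<lambda>k. real (rT (r k)) / real (r k)) \<longlonglongrightarrow> 0" by (rule rTl)
    show "s k i \<in> D" if "i < r k" for k i by (rule sD[OF that])
    show "(\<lambda>k. real (k1 (r k) + 1) / real (r k)) \<longlonglongrightarrow> 0" by (rule plus1[OF k1lim])
  qed (rule that)
  obtain W1 :: "nat \<Rightarrow> nat" where W1: "(\<lambda>k. real (W1 k) / real (r k)) \<longlonglongrightarrow> 0" "\<And>k. r k - k2 (r k) < W1 k"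
    "\<forall>\<^sub>F k in sequentially. A1 \<le> left_energy (\<lambda>i. s k (r k - 1 - i)) (r k - k2 (r k)) (W1 k)"
  \<comment> \<open>Reflection of bonds: bond \<open>p\<close> becomes \<open>r k - 1 - p\<close>,
    the element \<open>[q1, q2)\<close> becomes \<open>[r k - q2, r k - q1)\<close>, and the
    interface is bond \<open>r k - k2 (r k)\<close>.\<close>
  proof (rule end_lower[where N = r and kk = "\<lambda>k. r k - k2 (r k)" and rr = "\<lambda>k. r k - lT (r k)" and s = "\<lambda>k i. s k (r k - 1 - i)"
        and jump = "1 \<in> S" and p = "\<lambda>k. r k - 1 - p 1 k" and ?q1.0 = "\<lambda>k. r k - q2 1 k" and ?q2.0 = "\<lambda>k. r k - q1 1 k"
        and A = A1 and bb = "b 1", OF u1_pos lhat_nonzero _ pos])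
    show "ereal A1 < (if 1 \<in> S then B_IFJ J1 J2 \<gamma> lhat (b 1) u1 else B_theta J1 J2 \<gamma> u1)"
      using A0(2) by (simp add: X1_def)
    show "filterlim (\<lambda>k. r k - k2 (r k)) at_top sequentially" using filterlim_compose[OF K2 rtop] by simp
    have lk: "lT (r k) < k2 (r k)" for k using lT_props(2)[OF k1k2] .
    show "r k - k2 (r k) < r k - lT (r k)" for k using lk[of k] k1k2(2)[of k] by linarith
    have e: "r k - lT (r k) - (r k - k2 (r k)) = k2 (r k) - lT (r k)" for k using lk[of k] k1k2(2)[of k] by linarith
    show "\<forall>\<^sub>F k in sequentially. lhat = enat (r k - lT (r k) - (r k - k2 (r k))) \<or> lhat = \<infinity> \<and> K \<le> r k - lT (r k) - (r k - k2 (r k))" for K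
      unfolding e by (rule eventually_subseq[OF r lhat_eventually])
    have "lT (r k) \<le> r k" for k using lk[of k] k1k2(2)[of k] by linarith
    then show "(\<lambda>k. real (r k - lT (r k)) / real (r k)) \<longlonglongrightarrow> 0" using ratio_complement[OF lTl] pos by simp
    show "s k (r k - 1 - 0) = u1" for k using adm[of k] by (simp add: admissible_def)
    show "s k (r k - 1 - i) \<in> D" if "i < r k" for k i using sD[of "r k - 1 - i" k] that by simp
    show "s k (r k - 1 - i) = s k (r k - 1 - (r k - k2 (r k)))" if "r k - k2 (r k) \<le> i" "i < r k - lT (r k)" for k i
    proof -
      have "s k (r k - 1 - i) = s k (lT (r k))" "s k (r k - 1 - (r k - k2 (r k))) = s k (lT (r k))"
        by (rule const[OF lT_props(1)[OF k1k2]]; use that lk[of k] k1k2(2)[of k] in linarith)+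
      then show ?thesis by simp
    qed
    show "(\<forall>M. \<forall>\<^sub>F k in sequentially. M \<le> s k (r k - 1 - (r k - 1 - p 1 k))) \<and> (\<lambda>k. real (r k - q1 1 k) / real (r k)) \<longlonglongrightarrow> 0 \<and>
       (\<forall>k. r k - q2 1 k \<le> r k - 1 - p 1 k \<and> r k - 1 - p 1 k < r k - q1 1 k \<and>
          (\<forall>i\<in>{r k - q2 1 k..<r k - q1 1 k}. s k (r k - 1 - i) = s k (r k - 1 - (r k - 1 - p 1 k))) \<and>
          (r k - lT (r k) \<le> r k - 1 - p 1 k \<longrightarrow> r k - lT (r k) \<le> r k - q2 1 k)) \<and>
       (\<forall>K. enat K \<le> b 1 \<longrightarrow> (\<forall>\<^sub>F k in sequentially. r k - lT (r k) \<le> r k - 1 - p 1 k \<longrightarrow> K \<le> r k - q1 1 k - (r k - q2 1 k)))" if z: "1 \<in> S"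
    proof (intro conjI allI impI)
      have pp: "r k - 1 - (r k - 1 - p 1 k) = p 1 k" for k using p(1)[OF z, of k] by linarith
      show "\<forall>\<^sub>F k in sequentially. M \<le> s k (r k - 1 - (r k - 1 - p 1 k))" for M unfolding pp by (rule p(3)[OF z])
      have q1r: "q1 1 k \<le> r k" for k using q(2)[OF z, of k] p(1)[OF z, of k] by linarith
      then show "(\<lambda>k. real (r k - q1 1 k) / real (r k)) \<longlonglongrightarrow> 0" using ratio_complement[OF qlim(1)[OF z]] pos by simp
      show "r k - q2 1 k \<le> r k - 1 - p 1 k" "r k - 1 - p 1 k < r k - q1 1 k" for k
        using q(2,3)[OF z, of k] p(1)[OF z, of k] by linarith+
      show "\<forall>i\<in>{r k - q2 1 k..<r k - q1 1 k}. s k (r k - 1 - i) = s k (r k - 1 - (r k - 1 - p 1 k))" for k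
      proof
        fix i assume "i \<in> {r k - q2 1 k..<r k - q1 1 k}"
        then have "r k - 1 - i \<in> {q1 1 k..<q2 1 k}" using q(4)[OF z, of k] by auto
        then show "s k (r k - 1 - i) = s k (r k - 1 - (r k - 1 - p 1 k))" unfolding pp using qconst[OF z, of k] by blast
      qed
      have ql: "q2 1 k \<le> lT (r k)" if "r k - lT (r k) \<le> r k - 1 - p 1 k" for k
      proof -
        have "p 1 k < lT (r k)" using that p(1)[OF z, of k] lk[of k] k1k2(2)[of k] by linarith
        then show ?thesis using q(1)[OF z, of k] q(2)[OF z, of k] lT_props(1)[OF k1k2, of k]
          unfolding consecutive_def by (metis le_less_trans not_le)
      qed
      show "r k - lT (r k) \<le> r k - q2 1 k" if "r k - lT (r k) \<le> r k - 1 - p 1 k" for k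
        using ql[OF that] by linarith
      show "\<forall>\<^sub>F k in sequentially. r k - lT (r k) \<le> r k - 1 - p 1 k \<longrightarrow> K \<le> r k - q1 1 k - (r k - q2 1 k)" if "enat K \<le> b 1" for K
        using element_count_lower[OF r one01 that q(1)[OF z] qlim[OF z]] ratio_eventually_less[OF k1lim qlim(1)[OF z] zero_less_one]
      proof eventually_elim
        case (elim k)
        have "r k - q1 1 k - (r k - q2 1 k) = q2 1 k - q1 1 k" using q(4)[OF z, of k] by linarith
        then show ?case using elim ql[of k] lk[of k] by auto
      qed
    qed
    show "(\<lambda>k. real (r k - k2 (r k)) / real (r k)) \<longlonglongrightarrow> 0" by (rule k2lim)
    show "(\<lambda>k. real (r k - k2 (r k) + 1) / real (r k)) \<longlonglongrightarrow> 0" by (rule plus1[OF k2lim])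
  qed (rule that)
  have W1c: "(\<lambda>k. real (r k - W1 k) / real (r k)) \<longlonglongrightarrow> 1"
  proof -
    have "\<forall>\<^sub>F k in sequentially. W1 k < r k"
      by (rule ratio_eventually_less[OF W1(1), of r 1]) (use pos in \<open>simp_all add: less_imp_neq[symmetric]\<close>)
    then have "\<forall>\<^sub>F k in sequentially. 1 - real (W1 k) / real (r k) = real (r k - W1 k) / real (r k)"
      by eventually_elim (use pos in \<open>simp add: of_nat_diff diff_divide_distrib less_imp_neq[symmetric]\<close>)
    moreover have "(\<lambda>k. 1 - real (W1 k) / real (r k)) \<longlonglongrightarrow> 1 - 0" by (intro tendsto_intros W1(1))
    ultimately show ?thesis using tendsto_cong by fastforce
  qed
  have wins: "\<forall>\<^sub>F k in sequentially. W0 k < r k - W1 k" by (rule ratio_eventually_less[OF W0(1) W1c _]) simp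
  have IS: "y \<in> S" "0 < y" "y < 1" if "y \<in> I" for y using that by (auto simp: I_def)
  have mid: "\<forall>\<^sub>F k in sequentially. \<forall>y\<in>I. a y \<le> (\<Sum>i\<in>{q1 y k..<q2 y k}. G (s k i))"
  proof (rule eventually_ball_finite[OF finI], rule ballI)
    fix y assume y: "y \<in> I"
    have lt: "a y < - (real n * m)" if "b y = enat n" for n
      using a(1)[OF y] that by (simp add: f_def J0_gamma)
    obtain M :: real and k0 :: nat
      where Mk: "\<And>q1 q2 s h. (\<And>i. i \<in> {q1..<q2} \<Longrightarrow> s i = h) \<Longrightarrow> M \<le> h \<Longrightarrow> min (enat k0) (b y) \<le> enat (q2 - q1) \<Longrightarrow>
      a y \<le> (\<Sum>i\<in>{q1..<q2}. G (s i))"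
      by (rule interior_lower_jump[of "b y" "a y"]) (use lt in blast)+
    have "min (enat k0) (b y) \<noteq> \<infinity>" by (cases "b y") (auto simp: min_def)
    then obtain K where K: "enat K = min (enat k0) (b y)" by (metis not_infinity_eq)
    have "enat K \<le> b y" unfolding K by simp
    have "\<forall>\<^sub>F k in sequentially. k1 (r k) < q1 y k \<longrightarrow> q2 y k < k2 (r k) \<longrightarrow> K \<le> q2 y k - q1 y k"
      by (rule element_count_lower[OF r _ \<open>enat K \<le> b y\<close>]) (use IS[OF y] S q qlim in auto)
    moreover have "\<forall>\<^sub>F k in sequentially. k1 (r k) < q1 y k"
      by (rule ratio_eventually_less[OF k1lim qlim(1) _]) (use IS[OF y] in auto)
    moreover have "\<forall>\<^sub>F k in sequentially. q2 y k < k2 (r k)"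
      by (rule ratio_eventually_less[OF qlim(2) k2lim1 _]) (use IS[OF y] in auto)
    moreover have "\<forall>\<^sub>F k in sequentially. M \<le> s k (p y k)" by (rule p(3)) (use IS[OF y] in auto)
    ultimately show "\<forall>\<^sub>F k in sequentially. a y \<le> (\<Sum>i\<in>{q1 y k..<q2 y k}. G (s k i))"
    proof eventually_elim
      case (elim k)
      show ?case
      proof (rule Mk[of _ _ _ "s k (p y k)"])
        show "s k i = s k (p y k)" if "i \<in> {q1 y k..<q2 y k}" for i using qconst[OF IS(1)[OF y]] that by blast
        show "min (enat k0) (b y) \<le> enat (q2 y k - q1 y k)" unfolding K[symmetric] using elim by simp
      qed (rule elim)
    qed
  qed
  have sepL: "\<forall>\<^sub>F k in sequentially. \<forall>y\<in>I. W0 k < q1 y k"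
    by (rule eventually_ball_finite[OF finI], rule ballI, rule ratio_eventually_less[OF W0(1) qlim(1) _]) (use IS in auto)
  have sepR: "\<forall>\<^sub>F k in sequentially. \<forall>y\<in>I. q2 y k < r k - W1 k"
    by (rule eventually_ball_finite[OF finI], rule ballI, rule ratio_eventually_less[OF qlim(2) W1c _]) (use IS in auto)
  have sep: "\<forall>\<^sub>F k in sequentially. \<forall>y\<in>I. \<forall>z\<in>I. y < z \<longrightarrow> q2 y k < q1 z k"
  proof (rule eventually_ball_finite[OF finI], rule ballI, rule eventually_ball_finite[OF finI], rule ballI)
    fix y z assume y: "y \<in> I" and z: "z \<in> I"
    show "\<forall>\<^sub>F k in sequentially. y < z \<longrightarrow> q2 y k < q1 z k"
    proof (cases "y < z")
      case True
      have "\<forall>\<^sub>F k in sequentially. q2 y k < q1 z k"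
        by (rule ratio_eventually_less[OF qlim(2)[OF IS(1)[OF y]] qlim(1)[OF IS(1)[OF z]] True])
      then show ?thesis by eventually_elim simp
    qed simp
  qed
  show ?thesis
    using wins mid sepL sepR sep W0(3) W1(3)
  proof eventually_elim
    case (elim k)
    have k2r: "k2 (r k) \<le> r k" using k1k2(2)[of k] by simp
    have "qc_E (r k) (k1 (r k)) (k2 (r k)) (s k) = left_energy (s k) (k1 (r k)) (W0 k)
       + left_energy (\<lambda>i. s k (r k - 1 - i)) (r k - k2 (r k)) (W1 k) + (\<Sum>i\<in>{W0 k..<r k - W1 k}. G (s k i)) - m"
      by (rule qc_E_windows) (use pos W0(2) W1(2) elim(1) k2r in auto)
    moreover have "(\<Sum>y\<in>I. a y) \<le> (\<Sum>i\<in>{W0 k..<r k - W1 k}. G (s k i))"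
    proof -
      have "(\<Sum>y\<in>I. a y) \<le> (\<Sum>y\<in>I. \<Sum>i\<in>{q1 y k..<q2 y k}. G (s k i))" by (rule sum_mono) (use elim(2) in auto)
      also have "\<dots> = (\<Sum>i\<in>(\<Union>y\<in>I. {q1 y k..<q2 y k}). G (s k i))"
      proof (rule sum.UNION_disjoint[symmetric, OF finI])
        show "\<forall>y\<in>I. \<forall>z\<in>I. y \<noteq> z \<longrightarrow> {q1 y k..<q2 y k} \<inter> {q1 z k..<q2 z k} = {}"
        proof (intro ballI impI)
          fix y z assume yz: "y \<in> I" "z \<in> I" "y \<noteq> z"
          then have "q2 y k < q1 z k \<or> q2 z k < q1 y k" using elim(5) by (metis linorder_neqE)
          then show "{q1 y k..<q2 y k} \<inter> {q1 z k..<q2 z k} = {}" by auto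
        qed
      qed simp
      also have "\<dots> \<le> (\<Sum>i\<in>{W0 k..<r k - W1 k}. G (s k i))"
      proof (rule sum_mono2)
        show "(\<Union>y\<in>I. {q1 y k..<q2 y k}) \<subseteq> {W0 k..<r k - W1 k}" using elim(3,4) by fastforce
        show "0 \<le> G (s k i)" if "i \<in> {W0 k..<r k - W1 k} - (\<Union>y\<in>I. {q1 y k..<q2 y k})" for i
          using that by (intro G_nonneg sD) auto
      qed simp
      finally show ?thesis .
    qed
    ultimately show ?case using elim(6,7) A01(3) A0(3) a(2) by linarith
  qed
qed

text \<open>If it failed, some \<open>c\<close> between the two sides would bound the energies along
  a subsequence. The jump set found there is one representation of \<open>u\<close>, so its value is
  at least the infimum \<open>H1_lim\<close>, and \<open>energy_lower\<close> contradicts the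
  bound.\<close>

lemma liminf_inequality:
  assumes L1: "L1_conv us u"
  shows "H1_lim J1 J2 \<gamma> l u0 u1 b rhat lhat u \<le> liminf (\<lambda>n. H1n J1 J2 l u0 u1 n (k1 n) (k2 n) (T n) (us n))"
proof (rule ccontr)
  let ?f = "\<lambda>n. H1n J1 J2 l u0 u1 n (k1 n) (k2 n) (T n) (us n)"
  assume "\<not> ?thesis"
  then have "liminf ?f < H1_lim J1 J2 \<gamma> l u0 u1 b rhat lhat u" by simp
  from ereal_dense2[OF this]
  obtain c where c: "liminf ?f < ereal c" "ereal c < H1_lim J1 J2 \<gamma> l u0 u1 b rhat lhat u" by blast
  have "\<not> eventually (\<lambda>n. \<not> good_n n \<or> ereal c \<le> ?f n) sequentially"
  proof
    assume "eventually (\<lambda>n. \<not> good_n n \<or> ereal c \<le> ?f n) sequentially"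
    with eventually_good have "eventually (\<lambda>n. ereal c \<le> ?f n) sequentially" by eventually_elim auto
    then have "ereal c \<le> liminf ?f" by (rule Liminf_bounded)
    then show False using c(1) by simp
  qed
  then obtain r0 :: "nat \<Rightarrow> nat" where r0: "strict_mono r0" "\<And>k. \<not> (\<not> good_n (r0 k) \<or> ereal c \<le> ?f (r0 k))"
    using not_eventually_sequentiallyD by blast
  then have good0: "\<And>k. good_n (r0 k)" and lt0: "\<And>k. ?f (r0 k) < ereal c" by (auto simp: not_le)
  obtain r s S a where r: "strict_mono r" "\<And>k. good_n (r k)" "\<And>k. admissible (r k) (s k)"
    "\<And>k. qc_E (r k) (k1 (r k)) (k2 (r k)) (s k) < c"
    "sbvc_rep l \<gamma> S a" "AE x in lborel. x \<in> {0..1} \<longrightarrow> u x = sbvc_fun \<gamma> S a x"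
    "\<And>y. y \<in> S \<Longrightarrow> \<exists>p. (\<forall>k. p k < r k) \<and> (\<lambda>k. real (p k) / real (r k)) \<longlonglongrightarrow> y \<and> (\<forall>M. eventually (\<lambda>k. M \<le> s k (p k)) sequentially)"
    by (rule limit_structure[OF L1 r0(1) good0 lt0]) (rule that)
  have "H1_lim J1 J2 \<gamma> l u0 u1 b rhat lhat u \<le> H1_value J1 J2 \<gamma> u0 u1 b rhat lhat S"
    unfolding H1_lim_def by (rule Inf_lower) (use r(5,6) in blast)
  then have "ereal c < H1_value J1 J2 \<gamma> u0 u1 b rhat lhat S" using c(2) by simp
  then have "\<forall>\<^sub>F k in sequentially. c \<le> qc_E (r k) (k1 (r k)) (k2 (r k)) (s k)"
    by (intro energy_lower[OF r(1-3) _ _ r(7)]) (use r(5) in \<open>auto simp: sbvc_rep_def\<close>)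
  then obtain k where "c \<le> qc_E (r k) (k1 (r k)) (k2 (r k)) (s k)" using eventually_happens by fastforce
  then show False using r(4)[of k] by simp
qed

end

section \<open>Construction of recovery slopes for fixed n\<close>

lemma sum_interval_indicator:
  fixes c :: real and p w n :: nat
  assumes "p + w \<le> n"
  shows "(\<Sum>i<n. if p \<le> i \<and> i < p + w then c else 0) = real w * c"
proof -
  have "(\<Sum>i<n. if p \<le> i \<and> i < p + w then c else 0) = (\<Sum>i\<in>{i\<in>{..<n}. p \<le> i \<and> i < p + w}. c)"
    by (rule sum.inter_filter[symmetric]) simp
  also have "{i\<in>{..<n}. p \<le> i \<and> i < p + w} = {p..<p+w}" using assms by auto
  finally show ?thesis by simp
qed

text \<open>An interval bounded by representative atoms contains an element entirely or not at all.
  This is why steep blocks may be added without violating the mesh constraint.\<close>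

lemma consecutive_inside_or_outside:
  assumes "consecutive T a c" "p \<in> T" "p' \<in> T" "i \<in> {a..<c}"
  shows "(p \<le> i \<and> i < p') = (p \<le> a \<and> a < p')"
  using assms unfolding consecutive_def by (meson atLeastLessThan_iff le_less_trans less_le_trans not_le order_trans)

context lj_potentials
begin

lemma left_energy_cong:
  assumes "k < W" "\<And>i. i < W \<Longrightarrow> s i = t i"
  shows "left_energy s k W = left_energy t k W"
proof -
  have "path s 0 (0 + k) = path t 0 k" by (rule path_shift) (use assms in simp)
  moreover have "(\<Sum>i\<in>{k<..<W}. G (s i)) = (\<Sum>i\<in>{k<..<W}. G (t i))" by (rule sum.cong) (use assms(2) in auto)
  ultimately show ?thesis using assms by (simp add: left_energy_def)
qed

lemma end_upper:
  assumes \<theta>: "0 < \<theta>" and rh: "rh \<noteq> 0"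
    and A: "(if jump then B_IFJ J1 J2 \<gamma> rh bb \<theta> else B_theta J1 J2 \<gamma> \<theta>) < ereal A"
  obtains cnt k0 :: nat and C H :: real where "0 < cnt"
    "\<And>k r q1 q2. k0 \<le> k \<Longrightarrow> k < r \<Longrightarrow> r \<le> q1 \<Longrightarrow> q1 < q2 \<Longrightarrow> rh = enat (r - k) \<or> rh = \<infinity> \<Longrightarrow>
       bb = enat (q2 - q1) \<or> bb = \<infinity> \<Longrightarrow>
       \<exists>e p. left_block \<theta> k r q1 q2 cnt C e p \<and> (\<forall>h\<ge>H. left_energy (if jump then bump p cnt h e else e) k q2 \<le> A)"
proof (cases jump)
  case True
  then have "B_IFJ J1 J2 \<gamma> rh bb \<theta> < ereal A" using A by simp
  note ltA = this
  show thesis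
  proof (rule left_upper_jump[OF \<theta> rh ltA])
    fix cnt k0 :: nat and C H :: real
    assume "0 < cnt" "\<And>k r q1 q2. k0 \<le> k \<Longrightarrow> k < r \<Longrightarrow> r \<le> q1 \<Longrightarrow> q1 < q2 \<Longrightarrow> rh = enat (r - k) \<or> rh = \<infinity> \<Longrightarrow>
       bb = enat (q2 - q1) \<or> bb = \<infinity> \<Longrightarrow>
       \<exists>e p. left_block \<theta> k r q1 q2 cnt C e p \<and> (\<forall>h\<ge>H. left_energy (bump p cnt h e) k q2 \<le> A)"
    then show thesis using that[of cnt k0 C H] True by simp
  qed
next
  case False
  then have "B_theta J1 J2 \<gamma> \<theta> < ereal A" using A by simp
  from left_upper_nojump[OF \<theta> this]
  obtain e N where e: "e 0 = \<theta>" "\<And>i. e i \<in> D" "\<And>i. N \<le> i \<Longrightarrow> e i = \<gamma>" "\<And>k W. N \<le> k \<Longrightarrow> left_energy e k W \<le> A"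
    by blast
  define C where "C = (\<Sum>i<N. \<bar>e i - \<gamma>\<bar>)"
  show thesis
  \<comment> \<open>Without a jump nothing is raised: the count 1, the height 0 and the block at
    \<open>N + 1\<close> are placeholders of the common format.\<close>
  proof (rule that[of 1 "N + 2" C 0])
    fix k r q1 q2 :: nat
    assume h: "N + 2 \<le> k" "k < r" "r \<le> q1" "q1 < q2"
    have "(\<Sum>i<q2. \<bar>e i - \<gamma>\<bar>) = C" unfolding C_def
      by (rule sum.mono_neutral_right) (use h e in auto)
    then have "left_block \<theta> k r q1 q2 1 C e (N + 1)"
      unfolding left_block_def using h e by auto
    then show "\<exists>e p. left_block \<theta> k r q1 q2 1 C e p \<and> (\<forall>h\<ge>0. left_energy (if jump then bump p 1 h e else e) k q2 \<le> A)"
      using False e(4)[of k q2] h(1) by auto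
  qed simp
qed

end

text \<open>All data of one recovery chain. The points 0 and 1 receive an element even if they are
  no jumps, since \<open>q2 0\<close> and \<open>q1 1\<close> also delimit the windows of the two
  ends. The right profile \<open>eR\<close> and its block are numbered from the right
  boundary.\<close>

locale recovery_config = qc_setting +
  fixes n :: nat and S :: "real set" and q1 q2 :: "real \<Rightarrow> nat" and cL cR :: nat and CL CR :: real
    and eL eR :: "nat \<Rightarrow> real" and pL pR :: nat and amp :: "real \<Rightarrow> real"
  assumes good: "good_n n" and finS: "finite S" and S01: "S \<subseteq> {0..1}"
    and q: "\<And>y. y \<in> insert 0 (insert 1 S) \<Longrightarrow> q1 y \<in> T n \<and> q2 y \<in> T n \<and> k1 n < q1 y \<and> q1 y < q2 y \<and> q2 y < k2 n"
    and blockL: "left_block u0 (k1 n) (rT n) (q1 0) (q2 0) cL CL eL pL"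
    and blockR: "left_block u1 (n - k2 n) (n - lT n) (n - q2 1) (n - q1 1) cR CR eR pR"
    and sep01: "q2 0 < q1 1"
    and sep: "\<And>y. y \<in> S \<inter> {0<..<1} \<Longrightarrow> q2 0 < q1 y \<and> q2 y < q1 1"
    and sepI: "\<And>y z. y \<in> S \<inter> {0<..<1} \<Longrightarrow> z \<in> S \<inter> {0<..<1} \<Longrightarrow> y < z \<Longrightarrow> q2 y < q1 z"
    and amp_pos: "\<And>y. y \<in> S \<Longrightarrow> 0 < \<gamma> + amp y"
begin

text \<open>First steep bond of the jump at \<open>y\<close>. For \<open>y = 1\<close> the block
  \<open>[pR, pR + cR)\<close> is reflected back to the numbering of the chain.\<close>

definition ps :: "real \<Rightarrow> nat" where
  "ps y = (if y = 0 then pL else if y = 1 then n - (pR + cR) else q1 y)"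

definition ct :: "real \<Rightarrow> nat" where
  "ct y = (if y = 0 then cL else if y = 1 then cR else q2 y - q1 y)"

definition ind :: "real \<Rightarrow> nat \<Rightarrow> real" where
  "ind y i = (if ps y \<le> i \<and> i < ps y + ct y then amp y else 0)"

text \<open>Written as \<gamma> plus deviations, so that lengths and nodal values are computed
  termwise. The supports of the parts are separated in such a way that in each window only one
  profile and its own block survive.\<close>

definition slp :: "nat \<Rightarrow> real" where
  "slp i = \<gamma> + (eL i - \<gamma>) + (eR (n - 1 - i) - \<gamma>) + (\<Sum>y\<in>S. ind y i)"

lemma k12: "k1 n < k2 n" "k2 n < n" "0 < n"
  using good by (auto simp: good_n_def)

lemma rT_le: "rT n \<le> q1 0"
  using rT_props(1)[OF k12(1,2)] q[of 0] unfolding consecutive_def by (metis insertI1 not_le)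

lemma lT_ge: "q2 1 \<le> lT n"
  using lT_props(1)[OF k12(1,2)] q[of 1] unfolding consecutive_def by (metis insertI1 insertI2 not_le)

lemma ends: "pL + cL \<le> q2 0" "pR + cR \<le> n - q1 1" "q1 1 < n" "q2 0 < n" "1 \<le> pL" "1 \<le> pR"
  using blockL blockR q[of 1] q[of 0] k12 unfolding left_block_def by auto

lemma eL_gamma: "q1 0 \<le> i \<Longrightarrow> eL i = \<gamma>"
  using blockL rT_le unfolding left_block_def by auto

lemma eR_gamma: "i < lT n \<Longrightarrow> eR (n - 1 - i) = \<gamma>"
  using blockR k12 lT_props(2)[OF k12(1,2)] unfolding left_block_def by auto

lemma ind_left: "y \<in> S \<Longrightarrow> y \<noteq> 0 \<Longrightarrow> i < q2 0 \<Longrightarrow> ind y i = 0"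
  using sep[of y] sep01 ends S01 by (cases "y = 1") (auto simp: ind_def ps_def)

lemma ind_right: "y \<in> S \<Longrightarrow> y \<noteq> 1 \<Longrightarrow> q1 1 \<le> i \<Longrightarrow> ind y i = 0"
  using sep[of y] sep01 ends S01 q[of y] by (cases "y = 0") (auto simp: ind_def ps_def ct_def)

lemma ind_end0: "q2 0 \<le> i \<Longrightarrow> ind 0 i = 0"
  using ends by (auto simp: ind_def ps_def ct_def)

lemma ind_end1: "i < q1 1 \<Longrightarrow> ind 1 i = 0"
  using ends by (auto simp: ind_def ps_def ct_def)

lemma slp_left:
  assumes "i < q2 0"
  shows "slp i = (if 0 \<in> S then bump pL cL (\<gamma> + amp 0) eL i else eL i)"
proof -
  have "(\<Sum>y\<in>S. ind y i) = (\<Sum>y\<in>S. if y = 0 then ind 0 i else 0)"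
    by (rule sum.cong) (use ind_left assms in auto)
  also have "\<dots> = (if 0 \<in> S then ind 0 i else 0)" using finS by simp
  finally have 1: "(\<Sum>y\<in>S. ind y i) = (if 0 \<in> S then ind 0 i else 0)" .
  have "eR (n - 1 - i) = \<gamma>"
    by (rule eR_gamma) (use assms sep01 lT_ge q[of 1] in auto)
  moreover have "eL j = \<gamma>" if "pL \<le> j" "j < pL + cL" for j
    using blockL that unfolding left_block_def by auto
  ultimately show ?thesis unfolding slp_def 1 by (auto simp: ind_def ps_def ct_def bump_def)
qed

lemma slp_right:
  assumes "i < n - q1 1"
  shows "slp (n - 1 - i) = (if 1 \<in> S then bump pR cR (\<gamma> + amp 1) eR i else eR i)"
proof -
  have i: "q1 1 \<le> n - 1 - i" "n - 1 - (n - 1 - i) = i" using assms by auto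
  have "(\<Sum>y\<in>S. ind y (n - 1 - i)) = (\<Sum>y\<in>S. if y = 1 then ind 1 (n - 1 - i) else 0)"
    by (rule sum.cong) (use ind_right i in auto)
  also have "\<dots> = (if 1 \<in> S then ind 1 (n - 1 - i) else 0)" using finS by simp
  finally have 1: "(\<Sum>y\<in>S. ind y (n - 1 - i)) = (if 1 \<in> S then ind 1 (n - 1 - i) else 0)" .
  have "eL (n - 1 - i) = \<gamma>"
    by (rule eL_gamma) (use i sep01 q[of 0] in auto)
  moreover have "eR j = \<gamma>" if "pR \<le> j" "j < pR + cR" for j
    using blockR that unfolding left_block_def by auto
  moreover have "ind 1 (n - 1 - i) = (if pR \<le> i \<and> i < pR + cR then amp 1 else 0)"
  proof -
    have "(n - (pR + cR) \<le> n - 1 - i \<and> n - 1 - i < n - (pR + cR) + cR) = (pR \<le> i \<and> i < pR + cR)"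
      using ends(2,3) assms by linarith
    then show ?thesis by (simp add: ind_def ps_def ct_def)
  qed
  ultimately show ?thesis unfolding slp_def 1 i(2) by (auto simp: bump_def)
qed

lemma slp_mid:
  assumes "q2 0 \<le> i" "i < q1 1"
  shows "slp i = \<gamma> + (\<Sum>y\<in>S \<inter> {0<..<1}. ind y i)"
proof -
  have "(\<Sum>y\<in>S. ind y i) = (\<Sum>y\<in>S \<inter> {0<..<1}. ind y i)"
  proof (rule sum.mono_neutral_right[OF finS])
    show "\<forall>y\<in>S - S \<inter> {0<..<1}. ind y i = 0"
    proof
      fix y assume "y \<in> S - S \<inter> {0<..<1}"
      then have "y = 0 \<or> y = 1" using S01 by force
      then show "ind y i = 0" using ind_end0[OF assms(1)] ind_end1[OF assms(2)] by auto
    qed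
  qed simp
  moreover have "eL i = \<gamma>" by (rule eL_gamma) (use assms q[of 0] in auto)
  moreover have "eR (n - 1 - i) = \<gamma>" by (rule eR_gamma) (use assms lT_ge q[of 1] in auto)
  ultimately show ?thesis by (simp add: slp_def)
qed

lemma ind_interior: "y \<in> S \<inter> {0<..<1} \<Longrightarrow> ind y i = (if q1 y \<le> i \<and> i < q2 y then amp y else 0)"
  using q[of y] by (auto simp: ind_def ps_def ct_def)

lemma slp_mid_in:
  assumes "z \<in> S \<inter> {0<..<1}" "i \<in> {q1 z..<q2 z}"
  shows "slp i = \<gamma> + amp z"
proof -
  have "(\<Sum>y\<in>S \<inter> {0<..<1}. ind y i) = (\<Sum>y\<in>S \<inter> {0<..<1}. if y = z then amp z else 0)"
  proof (rule sum.cong[OF refl])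
    fix y assume y: "y \<in> S \<inter> {0<..<1}"
    show "ind y i = (if y = z then amp z else 0)"
      unfolding ind_interior[OF y] using sepI[OF y assms(1)] sepI[OF assms(1) y] assms(2)
      by (cases y z rule: linorder_cases) auto
  qed
  also have "\<dots> = amp z" using finS assms(1) by simp
  finally show ?thesis using slp_mid[of i] sep[OF assms(1)] assms(2) by simp
qed

lemma slp_mid_out:
  assumes "q2 0 \<le> i" "i < q1 1" "\<And>y. y \<in> S \<inter> {0<..<1} \<Longrightarrow> i \<notin> {q1 y..<q2 y}"
  shows "slp i = \<gamma>"
proof -
  have "(\<Sum>y\<in>S \<inter> {0<..<1}. ind y i) = 0"
    by (rule sum.neutral) (use assms(3) ind_interior in auto)
  then show ?thesis using slp_mid[OF assms(1,2)] by simp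
qed

lemma mid_energy: "(\<Sum>i\<in>{q2 0..<q1 1}. G (slp i)) = (\<Sum>y\<in>S \<inter> {0<..<1}. real (q2 y - q1 y) * G (\<gamma> + amp y))"
proof -
  let ?I = "S \<inter> {0<..<1}"
  have "(\<Sum>i\<in>{q2 0..<q1 1}. G (slp i)) = (\<Sum>i\<in>(\<Union>y\<in>?I. {q1 y..<q2 y}). G (slp i))"
  proof (rule sum.mono_neutral_right)
    show "(\<Union>y\<in>?I. {q1 y..<q2 y}) \<subseteq> {q2 0..<q1 1}" using sep by fastforce
    show "\<forall>i\<in>{q2 0..<q1 1} - (\<Union>y\<in>?I. {q1 y..<q2 y}). G (slp i) = 0"
    proof
      fix i assume "i \<in> {q2 0..<q1 1} - (\<Union>y\<in>?I. {q1 y..<q2 y})"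
      then have "slp i = \<gamma>" by (intro slp_mid_out) auto
      then show "G (slp i) = 0" by simp
    qed
  qed simp
  also have "\<dots> = (\<Sum>y\<in>?I. \<Sum>i\<in>{q1 y..<q2 y}. G (slp i))"
  proof (rule sum.UNION_disjoint)
    show "\<forall>y\<in>?I. \<forall>z\<in>?I. y \<noteq> z \<longrightarrow> {q1 y..<q2 y} \<inter> {q1 z..<q2 z} = {}"
    proof (intro ballI impI)
      fix y z assume "y \<in> ?I" "z \<in> ?I" "y \<noteq> z"
      then have "q2 y < q1 z \<or> q2 z < q1 y" using sepI by (metis linorder_neqE)
      then show "{q1 y..<q2 y} \<inter> {q1 z..<q2 z} = {}" by auto
    qed
  qed (use finS in auto)
  also have "\<dots> = (\<Sum>y\<in>?I. \<Sum>i\<in>{q1 y..<q2 y}. G (\<gamma> + amp y))"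
    by (intro sum.cong refl arg_cong[where f = G] slp_mid_in)
  finally show ?thesis by simp
qed

lemma slp_D: "i < n \<Longrightarrow> slp i \<in> D"
proof -
  assume i: "i < n"
  have eD: "eL j \<in> D" "eR j \<in> D" for j using blockL blockR unfolding left_block_def by auto
  have aD: "\<gamma> + amp y \<in> D" if "y \<in> S" for y using amp_pos[OF that] pos_in by blast
  consider "i < q2 0" | "q1 1 \<le> i" | "q2 0 \<le> i" "i < q1 1" by linarith
  then show "slp i \<in> D"
  proof cases
    case 1
    then show ?thesis using slp_left[OF 1] eD aD by (auto simp: bump_def)
  next
    case 2
    then have "n - 1 - i < n - q1 1" "n - 1 - (n - 1 - i) = i" using i by auto
    then show ?thesis using slp_right[of "n - 1 - i"] eD aD by (auto simp: bump_def)
  next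
    case 3
    show ?thesis
    proof (cases "\<exists>y\<in>S \<inter> {0<..<1}. i \<in> {q1 y..<q2 y}")
      case True
      then show ?thesis using slp_mid_in aD by fastforce
    next
      case False
      then have "slp i = \<gamma>" using 3 by (intro slp_mid_out) auto
      then show ?thesis using gamma_in by simp
    qed
  qed
qed

lemma T_mem: "i \<le> k1 n \<Longrightarrow> i \<in> T n" "k2 n \<le> i \<Longrightarrow> i \<le> n \<Longrightarrow> i \<in> T n"
  using T_atom[rule_format, of n] by auto

lemma ps_in_T:
  assumes "y \<in> S"
  shows "ps y \<in> T n" "ps y + ct y \<in> T n"
proof -
  have "ps y \<in> T n \<and> ps y + ct y \<in> T n"
  proof -
    consider "y = 0" | "y = 1" | "y \<noteq> 0" "y \<noteq> 1" by blast
    then show ?thesis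
    proof cases
      case 1
      have "cL = 1 \<and> pL < k1 n \<or> pL = k1 n \<and> cL = rT n - k1 n \<or> pL = q1 0 \<and> cL = q2 0 - q1 0"
        using blockL by (simp add: left_block_def)
      then show ?thesis
        using 1 T_mem(1) q[of 0] rT_props[OF k12(1,2)] by (auto simp: ps_def ct_def consecutive_def)
    next
      case 2
      have lk: "lT n < k2 n" "lT n \<in> T n" "k2 n \<in> T n"
        using lT_props[OF k12(1,2)] by (auto simp: consecutive_def)
      have "cR = 1 \<and> pR < n - k2 n \<or> pR = n - k2 n \<and> cR = (n - lT n) - (n - k2 n) \<or>
          pR = n - q2 1 \<and> cR = (n - q1 1) - (n - q2 1)"
        using blockR by (simp add: left_block_def)
      moreover have "q1 1 < q2 1" "q2 1 < k2 n" "q1 1 \<in> T n" "q2 1 \<in> T n" using q[of 1] by auto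
      ultimately have "n - (pR + cR) \<in> T n \<and> n - (pR + cR) + cR \<in> T n"
      proof (elim disjE conjE)
        assume "cR = 1" "pR < n - k2 n"
        then show ?thesis by (intro conjI T_mem(2)) linarith+
      next
        assume h: "pR = n - k2 n" "cR = n - lT n - (n - k2 n)"
        have "n - (pR + cR) = lT n" "n - (pR + cR) + cR = k2 n" using h lk k12 by linarith+
        then show ?thesis using lk by simp
      next
        assume h: "pR = n - q2 1" "cR = n - q1 1 - (n - q2 1)" "q1 1 < q2 1" "q2 1 < k2 n" "q1 1 \<in> T n" "q2 1 \<in> T n"
        have "n - (pR + cR) = q1 1" "n - (pR + cR) + cR = q2 1" using h k12 by linarith+
        then show ?thesis using h by simp
      qed
      then show ?thesis using 2 by (simp add: ps_def ct_def)
    next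
      case 3
      then show ?thesis using q[of y] assms by (auto simp: ps_def ct_def)
    qed
  qed
  then show "ps y \<in> T n" "ps y + ct y \<in> T n" by auto
qed

text \<open>Each summand is constant on elements: the steep blocks have representative atoms as
  ends, and the profiles vary only in the atomistic region, where elements are single bonds, take
  one value on the first element and equal \<gamma> beyond.\<close>

lemma slp_elem_const: "elem_const (T n) slp"
  unfolding elem_const_def
proof (intro allI impI ballI)
  fix a c i assume ac: "consecutive (T n) a c" and i: "i \<in> {a..<c}"
  have acT: "a \<in> T n" "c \<in> T n" "a < c" "c \<le> n" using ac T_sub[rule_format, of n] by (auto simp: consecutive_def)
  have noT: "\<not> (a < z \<and> z < c)" if "z \<in> T n" for z using ac that by (auto simp: consecutive_def)
  have rTT: "rT n \<in> T n" "k1 n < rT n" and k1T: "k1 n \<in> T n"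
    using rT_props[OF k12(1,2)] by (auto simp: consecutive_def)
  have lTT: "lT n \<in> T n" "lT n < k2 n" and k2T: "k2 n \<in> T n"
    using lT_props[OF k12(1,2)] by (auto simp: consecutive_def)
  have "(\<Sum>y\<in>S. ind y i) = (\<Sum>y\<in>S. ind y a)"
  proof (rule sum.cong[OF refl])
    fix y assume "y \<in> S"
    from consecutive_inside_or_outside[OF ac ps_in_T[OF this] i]
    show "ind y i = ind y a" by (simp add: ind_def)
  qed
  moreover have "eL i = eL a"
  proof -
    consider "a < k1 n" | "k1 n \<le> a" "a < rT n" | "rT n \<le> a" by linarith
    then show ?thesis
    proof cases
      case 1
      then have "a + 1 \<in> T n" by (intro T_mem(1)) simp
      then have "i = a" using noT[of "a + 1"] i by auto
      then show ?thesis by simp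
    next
      case 2
      then have "c \<le> rT n" using noT[OF rTT(1)] by simp
      then have "eL i = eL (k1 n)" "eL a = eL (k1 n)"
        using blockL 2 i unfolding left_block_def by (metis atLeastLessThan_iff le_trans less_le_trans)+
      then show ?thesis by simp
    next
      case 3
      then show ?thesis using blockL i unfolding left_block_def by auto
    qed
  qed
  moreover have "eR (n - 1 - i) = eR (n - 1 - a)"
  proof -
    consider "k2 n \<le> a" | "lT n \<le> a" "a < k2 n" | "a < lT n" by linarith
    then show ?thesis
    proof cases
      case 1
      then have "a + 1 \<in> T n" using acT by (intro T_mem(2)) auto
      then have "i = a" using noT[of "a + 1"] i by auto
      then show ?thesis by simp
    next
      case 2
      then have "c \<le> k2 n" using noT[OF k2T] by simp
      then have "n - 1 - i \<in> {n - k2 n..<n - lT n}" "n - 1 - a \<in> {n - k2 n..<n - lT n}"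
        using 2 i k12 acT by auto
      then have "eR (n - 1 - i) = eR (n - k2 n)" "eR (n - 1 - a) = eR (n - k2 n)"
        using blockR unfolding left_block_def by blast+
      then show ?thesis by simp
    next
      case 3
      then have "c \<le> lT n" using noT[OF lTT(1)] by simp
      then show ?thesis using eR_gamma[of i] eR_gamma[of a] 3 i by simp
    qed
  qed
  ultimately show "slp i = slp a" by (simp add: slp_def)
qed

lemma slp_ends: "slp 0 = u0" "slp (n - 1) = u1"
proof -
  have "eL 0 = u0" "eR 0 = u1" using blockL blockR by (auto simp: left_block_def)
  moreover have "0 < q2 0" "0 < n - q1 1" using q[of 0] ends by auto
  ultimately show "slp 0 = u0" "slp (n - 1) = u1"
    using slp_left[of 0] slp_right[of 0] ends(5,6) by (auto simp: bump_def)
qed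

lemma ps_le: "y \<in> S \<Longrightarrow> ps y + ct y \<le> n"
  using ps_in_T(2)[of y] T_sub[rule_format, of n] by auto

definition dev :: "nat \<Rightarrow> real" where
  "dev j = (eL j - \<gamma>) + (eR (n - 1 - j) - \<gamma>)"

lemma dev_abs: "(\<Sum>j<n. \<bar>dev j\<bar>) \<le> CL + CR"
proof -
  have "(\<Sum>j<n. \<bar>dev j\<bar>) \<le> (\<Sum>j<n. \<bar>eL j - \<gamma>\<bar>) + (\<Sum>j<n. \<bar>eR (n - 1 - j) - \<gamma>\<bar>)"
    unfolding dev_def sum.distrib[symmetric] by (rule sum_mono) (rule abs_triangle_ineq)
  also have "(\<Sum>j<n. \<bar>eR (n - 1 - j) - \<gamma>\<bar>) = (\<Sum>j<n. \<bar>eR j - \<gamma>\<bar>)"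
    using sum.nat_diff_reindex[of "\<lambda>j. \<bar>eR j - \<gamma>\<bar>" n] by simp
  also have "(\<Sum>j<n. \<bar>eR j - \<gamma>\<bar>) = (\<Sum>j<n - q1 1. \<bar>eR j - \<gamma>\<bar>)"
  proof (rule sum.mono_neutral_right)
    show "\<forall>i\<in>{..<n} - {..<n - q1 1}. \<bar>eR i - \<gamma>\<bar> = 0"
    proof
      fix i assume "i \<in> {..<n} - {..<n - q1 1}"
      then have "n - lT n \<le> i" using lT_ge q[of 1] by auto
      then show "\<bar>eR i - \<gamma>\<bar> = 0" using blockR unfolding left_block_def by auto
    qed
  qed auto
  also have "(\<Sum>j<n. \<bar>eL j - \<gamma>\<bar>) = (\<Sum>j<q2 0. \<bar>eL j - \<gamma>\<bar>)"
  proof (rule sum.mono_neutral_right)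
    show "{..<q2 0} \<subseteq> {..<n}" using ends by auto
    show "\<forall>i\<in>{..<n} - {..<q2 0}. \<bar>eL i - \<gamma>\<bar> = 0"
    proof
      fix i assume "i \<in> {..<n} - {..<q2 0}"
      then have "q1 0 \<le> i" using q[of 0] by auto
      then show "\<bar>eL i - \<gamma>\<bar> = 0" using eL_gamma by simp
    qed
  qed simp
  finally have "(\<Sum>j<n. \<bar>dev j\<bar>) \<le> (\<Sum>j<q2 0. \<bar>eL j - \<gamma>\<bar>) + (\<Sum>j<n - q1 1. \<bar>eR j - \<gamma>\<bar>)" .
  moreover have "(\<Sum>j<q2 0. \<bar>eL j - \<gamma>\<bar>) \<le> CL" using blockL unfolding left_block_def by blast
  moreover have "(\<Sum>j<n - q1 1. \<bar>eR j - \<gamma>\<bar>) \<le> CR" using blockR unfolding left_block_def by blast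
  ultimately show ?thesis by linarith
qed

lemma slp_dev: "slp j = \<gamma> + dev j + (\<Sum>y\<in>S. ind y j)"
  by (simp add: slp_def dev_def)

lemma slp_sum: "(\<Sum>j<n. slp j) = real n * \<gamma> + (\<Sum>j<n. dev j) + (\<Sum>y\<in>S. real (ct y) * amp y)"
proof -
  have "(\<Sum>j<n. \<Sum>y\<in>S. ind y j) = (\<Sum>y\<in>S. \<Sum>j<n. ind y j)" by (rule sum.swap)
  also have "\<dots> = (\<Sum>y\<in>S. real (ct y) * amp y)"
    unfolding ind_def by (intro sum.cong refl sum_interval_indicator ps_le)
  finally show ?thesis by (simp add: slp_dev sum.distrib)
qed

text \<open>Nodal values in the form used by \<open>interp_limit\<close>: the pairs
  \<open>(y, r)\<close> enumerate the steep bonds one by one, and the error comes from the layers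
  alone.\<close>

lemma slp_node:
  assumes "i \<le> n"
  shows "\<bar>(\<Sum>j<i. slp j) / real n - \<gamma> * (real i / real n)
     - (\<Sum>z\<in>{z\<in>Sigma S (\<lambda>y. {..<ct y}). ps (fst z) + snd z < i}. amp (fst z) / real n)\<bar> \<le> (CL + CR) / real n"
proof -
  let ?J = "Sigma S (\<lambda>y. {..<ct y})"
  have cnt: "(\<Sum>j<i. ind y j) = (\<Sum>r<ct y. if ps y + r < i then amp y else 0)" for y
  proof -
    have "(\<Sum>j<i. ind y j) = (\<Sum>j\<in>{j\<in>{..<i}. ps y \<le> j \<and> j < ps y + ct y}. amp y)"
      unfolding ind_def by (rule sum.inter_filter[symmetric]) simp
    also have "\<dots> = (\<Sum>r\<in>{r\<in>{..<ct y}. ps y + r < i}. amp y)"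
      by (rule sum.reindex_bij_witness[of _ "\<lambda>r. ps y + r" "\<lambda>j. j - ps y"]) auto
    also have "\<dots> = (\<Sum>r<ct y. if ps y + r < i then amp y else 0)" by (rule sum.inter_filter) simp
    finally show ?thesis .
  qed
  have "(\<Sum>z\<in>{z\<in>?J. ps (fst z) + snd z < i}. amp (fst z) / real n) = (\<Sum>z\<in>?J. if ps (fst z) + snd z < i then amp (fst z) / real n else 0)"
    by (rule sum.inter_filter) (use finS in auto)
  also have "\<dots> = (\<Sum>y\<in>S. \<Sum>r<ct y. if ps y + r < i then amp y / real n else 0)"
    by (subst sum.Sigma) (use finS in \<open>auto simp: case_prod_beta\<close>)
  also have "\<dots> = (\<Sum>y\<in>S. \<Sum>j<i. ind y j) / real n"
    unfolding cnt sum_divide_distrib by (intro sum.cong refl) auto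
  also have "\<dots> = (\<Sum>j<i. \<Sum>y\<in>S. ind y j) / real n" by (subst sum.swap) simp
  finally have J: "(\<Sum>z\<in>{z\<in>?J. ps (fst z) + snd z < i}. amp (fst z) / real n) = (\<Sum>j<i. \<Sum>y\<in>S. ind y j) / real n" .
  have "(\<Sum>j<i. slp j) = real i * \<gamma> + (\<Sum>j<i. dev j) + (\<Sum>j<i. \<Sum>y\<in>S. ind y j)"
    by (simp add: slp_dev sum.distrib)
  then have "(\<Sum>j<i. slp j) / real n - \<gamma> * (real i / real n) - (\<Sum>j<i. \<Sum>y\<in>S. ind y j) / real n = (\<Sum>j<i. dev j) / real n"
    by (simp add: add_divide_distrib)
  moreover have "\<bar>\<Sum>j<i. dev j\<bar> \<le> CL + CR"
  proof -
    have "\<bar>\<Sum>j<i. dev j\<bar> \<le> (\<Sum>j<i. \<bar>dev j\<bar>)" by (rule sum_abs)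
    also have "\<dots> \<le> (\<Sum>j<n. \<bar>dev j\<bar>)" by (rule sum_mono2) (use assms in auto)
    finally show ?thesis using dev_abs by simp
  qed
  ultimately show ?thesis unfolding J by (simp add: divide_right_mono)
qed

lemma slp_energy:
  assumes "left_energy (if 0 \<in> S then bump pL cL (\<gamma> + amp 0) eL else eL) (k1 n) (q2 0) \<le> A0"
    "left_energy (if 1 \<in> S then bump pR cR (\<gamma> + amp 1) eR else eR) (n - k2 n) (n - q1 1) \<le> A1"
    "\<And>y. y \<in> S \<inter> {0<..<1} \<Longrightarrow> real (q2 y - q1 y) * G (\<gamma> + amp y) \<le> a y"
  shows "qc_E n (k1 n) (k2 n) slp \<le> A0 + A1 + (\<Sum>y\<in>S \<inter> {0<..<1}. a y) - m"
proof -
  have w: "n - (n - q1 1) = q1 1" using ends by simp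
  have "qc_E n (k1 n) (k2 n) slp = left_energy slp (k1 n) (q2 0) + left_energy (\<lambda>i. slp (n - 1 - i)) (n - k2 n) (n - q1 1)
     + (\<Sum>i\<in>{q2 0..<n - (n - q1 1)}. G (slp i)) - m"
    by (rule qc_E_windows) (use k12 q[of 0] q[of 1] sep01 ends in auto)
  also have "left_energy slp (k1 n) (q2 0) = left_energy (if 0 \<in> S then bump pL cL (\<gamma> + amp 0) eL else eL) (k1 n) (q2 0)"
    by (rule left_energy_cong) (use q[of 0] slp_left in auto)
  also have "left_energy (\<lambda>i. slp (n - 1 - i)) (n - k2 n) (n - q1 1) =
      left_energy (if 1 \<in> S then bump pR cR (\<gamma> + amp 1) eR else eR) (n - k2 n) (n - q1 1)"
    by (rule left_energy_cong) (use q[of 1] k12 slp_right in auto)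
  finally have "qc_E n (k1 n) (k2 n) slp \<le> A0 + A1 + (\<Sum>y\<in>S \<inter> {0<..<1}. real (q2 y - q1 y) * G (\<gamma> + amp y)) - m"
    using assms(1,2) unfolding w mid_energy by linarith
  moreover have "(\<Sum>y\<in>S \<inter> {0<..<1}. real (q2 y - q1 y) * G (\<gamma> + amp y)) \<le> (\<Sum>y\<in>S \<inter> {0<..<1}. a y)"
    by (rule sum_mono) (rule assms(3))
  ultimately show ?thesis by linarith
qed

end

section \<open>The limsup inequality\<close>

lemma ereal_add_less_split:
  assumes "X + Y < ereal A" "X \<noteq> -\<infinity>" "Y \<noteq> -\<infinity>"
  obtains x y where "X < ereal x" "Y < ereal y" "x + y < A"
proof -
  obtain x y where xy: "X = ereal x" "Y = ereal y" using assms by (cases X; cases Y) auto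
  define d where "d = (A - x - y) / 3"
  have "d > 0" using assms(1) xy by (simp add: d_def)
  then show thesis using that[of "x + d" "y + d"] xy by (simp add: d_def field_simps)
qed

lemma ereal_sum_less_split:
  assumes "finite I" "sum f I < ereal A" "\<And>i. i \<in> I \<Longrightarrow> f i \<noteq> -\<infinity>"
  shows "\<exists>a. (\<forall>i\<in>I. f i < ereal (a i)) \<and> (\<Sum>i\<in>I. a i) < A"
  using assms
proof (induction I arbitrary: A rule: finite_induct)
  case empty
  then show ?case by simp
next
  case (insert i I)
  have nm: "sum f I \<noteq> -\<infinity>" using insert.prems(2) insert.hyps by (intro sum_ereal_not_MInf) auto
  obtain x y where xy: "f i < ereal x" "sum f I < ereal y" "x + y < A"
    using ereal_add_less_split[of "f i" "sum f I" A] insert.prems insert.hyps nm by auto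
  obtain a where a: "\<forall>i\<in>I. f i < ereal (a i)" "(\<Sum>i\<in>I. a i) < y"
    using insert.IH[OF xy(2)] insert.prems(2) by auto
  have "(\<Sum>j\<in>insert i I. (a(i := x)) j) = x + (\<Sum>j\<in>I. a j)"
    using insert.hyps by (simp add: sum.insert) (rule sum.cong, auto)
  then show ?case using xy a by (intro exI[of _ "a(i := x)"]) auto
qed

text \<open>Dominated convergence. The integrand is set to 0 on a null set that contains the jump
  points and the points where \<open>u\<close> differs from \<open>f\<close>, so that convergence
  holds everywhere.\<close>

lemma L1_limit_of_pointwise:
  fixes v :: "nat \<Rightarrow> real \<Rightarrow> real"
  assumes u: "u absolutely_integrable_on {0..1}" and vc: "\<And>k. continuous_on {0..1} (v k)"
    and bd: "\<And>k t. t \<in> {0..1} \<Longrightarrow> \<bar>v k t\<bar> \<le> C"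
    and lim: "\<And>t. 0 < t \<Longrightarrow> t < 1 \<Longrightarrow> t \<notin> X \<Longrightarrow> (\<lambda>k. v k t) \<longlonglongrightarrow> f t" and X: "finite X"
    and ae: "AE x in lborel. x \<in> {0..1} \<longrightarrow> u x = f x"
  shows "(\<lambda>k. integral {0..1} (\<lambda>x. \<bar>v k x - u x\<bar>)) \<longlonglongrightarrow> 0"
proof -
  have "AE x in lebesgue. x \<in> {0..1} \<longrightarrow> u x = f x" using ae by (simp add: AE_completion_iff)
  then obtain N where N: "negligible N" "{x. \<not> (x \<in> {0..1} \<longrightarrow> u x = f x)} \<subseteq> N"
    unfolding eventually_ae_filter_negligible by blast
  define Z where "Z = N \<union> insert 0 (insert 1 X)"
  have Z: "negligible Z" unfolding Z_def by (rule negligible_Un[OF N(1)], rule negligible_finite) (use X in simp)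
  define w where "w k x = (if x \<in> Z then 0 else \<bar>v k x - u x\<bar>)" for k x
  have wu: "(\<lambda>x. \<bar>v k x - u x\<bar>) absolutely_integrable_on {0..1}" for k
  proof -
    have "v k absolutely_integrable_on {0..1}" using vc by (intro absolutely_integrable_continuous_real)
    then have "(\<lambda>x. v k x - u x) absolutely_integrable_on {0..1}" using u by (rule set_integral_diff(1))
    then show ?thesis by (rule set_integrable_abs)
  qed
  have wi: "w k integrable_on {0..1}" for k
  proof (rule integrable_spike[OF _ Z])
    show "(\<lambda>x. \<bar>v k x - u x\<bar>) integrable_on {0..1}" using wu set_lebesgue_integral_eq_integral(1) by blast
  qed (simp add: w_def)
  have we: "integral {0..1} (w k) = integral {0..1} (\<lambda>x. \<bar>v k x - u x\<bar>)" for k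
    by (rule integral_spike[OF Z]) (simp add: w_def)
  have "(\<lambda>k. integral {0..1} (w k)) \<longlonglongrightarrow> integral {0..1} (\<lambda>x :: real. 0 :: real)"
  proof (rule dominated_convergence(2)[where h = "\<lambda>x. \<bar>C\<bar> + \<bar>u x\<bar>"])
    show "w k integrable_on {0..1}" for k by (rule wi)
    have "(\<lambda>x. \<bar>u x\<bar>) integrable_on {0..1}"
      using set_integrable_abs[OF u] set_lebesgue_integral_eq_integral(1) by blast
    then show "(\<lambda>x. \<bar>C\<bar> + \<bar>u x\<bar>) integrable_on {0..1}" by (intro integrable_add) auto
    show "norm (w k x) \<le> \<bar>C\<bar> + \<bar>u x\<bar>" if "x \<in> {0..1}" for k x
      using bd[OF that, of k] by (auto simp: w_def)
    show "(\<lambda>k. w k x) \<longlonglongrightarrow> 0" if x: "x \<in> {0..1}" for x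
    proof (cases "x \<in> Z")
      case True
      then show ?thesis by (simp add: w_def)
    next
      case False
      then have "(\<lambda>k. v k x) \<longlonglongrightarrow> f x" using x lim[of x] by (auto simp: Z_def)
      moreover have "u x = f x" using False N(2) x by (auto simp: Z_def)
      ultimately have "(\<lambda>k. \<bar>v k x - u x\<bar>) \<longlonglongrightarrow> \<bar>u x - u x\<bar>" by (intro tendsto_intros) simp
      then show ?thesis using False by (simp add: w_def)
    qed
  qed
  then show ?thesis by (simp add: we)
qed

text \<open>It suffices to come within any \<open>c > G\<close>. For each \<open>n\<close> one uses
  the best level that is already reached at \<open>n\<close>, and this level improves without
  bound.\<close>

lemma Gamma_limsup_diagonal:
  assumes u: "u absolutely_integrable_on {0..1}"
    and rec: "\<And>c. G < ereal c \<Longrightarrow> \<exists>us. L1_conv us u \<and> (\<forall>\<^sub>F n in sequentially. H n (us n) \<le> ereal c)"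
  shows "\<exists>us. L1_conv us u \<and> limsup (\<lambda>n. H n (us n)) \<le> (G :: ereal)"
proof (cases "G = \<infinity>")
  case True
  have "L1_conv (\<lambda>_. u) u" using u by (simp add: L1_conv_def)
  then show ?thesis using True by auto
next
  case False
  \<comment> \<open>Levels that decrease to \<open>G\<close>, with a separate formula for
    \<open>G\<close> equal to minus infinity.\<close>
  define c where "c j = (if G = -\<infinity> then - real j else real_of_ereal G + 1 / real (Suc j))" for j
  have Gc: "G < ereal (c j)" for j using False by (cases G) (auto simp: c_def)
  have cdec: "c j' \<le> c j" if "j \<le> j'" for j j'
    using that by (auto simp: c_def frac_le)
  have clim: "\<exists>j. ereal (c j) \<le> y" if Gy: "G < y" for y
  proof (cases G)
    case (real g)
    obtain x where x: "g < x" "ereal x \<le> y"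
    proof (cases y)
      case (real x)
      then show ?thesis using that[of x] \<open>G < y\<close> \<open>G = ereal g\<close> by simp
    next
      case PInf
      then show ?thesis using that[of "g + 1"] by simp
    qed (use \<open>G < y\<close> in simp)
    then obtain j where "1 / real (Suc j) < x - g" using reals_Archimedean[of "x - g"] by (auto simp: inverse_eq_divide)
    then have "ereal (c j) \<le> ereal x" using real by (simp add: c_def)
    then show ?thesis using x(2) order_trans by blast
  next
    case MInf
    obtain x where x: "ereal x \<le> y" using Gy by (metis MInf ereal_dense2 less_imp_le)
    obtain j :: nat where "- x \<le> real j" using real_arch_simple by blast
    then have "ereal (c j) \<le> ereal x" using MInf by (simp add: c_def)
    then show ?thesis using x order_trans by blast
  qed (use False in simp)
  obtain V where V: "\<And>j. L1_conv (V j) u" "\<And>j. \<forall>\<^sub>F n in sequentially. H n (V j n) \<le> ereal (c j)"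
    using rec[OF Gc] by metis
  define Q where "Q j n \<longleftrightarrow> integral {0..1} (\<lambda>x. \<bar>V j n x - u x\<bar>) < 1 / real (Suc j) \<and> H n (V j n) \<le> ereal (c j)" for j n
  have "\<forall>\<^sub>F n in sequentially. Q j n" for j
  proof -
    have "(\<lambda>n. integral {0..1} (\<lambda>x. \<bar>V j n x - u x\<bar>)) \<longlonglongrightarrow> 0" using V(1) by (simp add: L1_conv_def)
    then have "\<forall>\<^sub>F n in sequentially. integral {0..1} (\<lambda>x. \<bar>V j n x - u x\<bar>) < 1 / real (Suc j)"
      by (rule order_tendstoD) simp
    with V(2)[of j] show ?thesis unfolding Q_def by eventually_elim simp
  qed
  then have "\<forall>j. \<exists>N. \<forall>n\<ge>N. Q j n" by (simp add: eventually_at_top_linorder)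
  then obtain N where N: "\<And>j n. N j \<le> n \<Longrightarrow> Q j n" by metis
  \<comment> \<open>The levels available at \<open>n\<close>; the bound \<open>j \<le> n\<close>
    keeps the set finite, so that a largest one exists.\<close>
  define A where "A n = {j. j \<le> n \<and> N j \<le> n}" for n
  define j where "j n = (if A n = {} then 0 else Max (A n))" for n
  have fin: "finite (A n)" for n by (simp add: A_def)
  have jQ: "i \<le> j n \<and> Q (j n) n" if "max i (N i) \<le> n" for i n
  proof -
    have i: "i \<in> A n" using that by (simp add: A_def)
    then have jn: "j n = Max (A n)" by (auto simp: j_def)
    have "j n \<in> A n" unfolding jn by (rule Max_in[OF fin]) (use i in auto)
    moreover have "i \<le> j n" unfolding jn by (rule Max_ge[OF fin i])
    ultimately show ?thesis using N by (simp add: A_def)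
  qed
  define us where "us n = V (j n) n" for n
  have "L1_conv us u"
    unfolding L1_conv_def
  proof (intro conjI allI)
    show "us n absolutely_integrable_on {0..1}" for n using V(1) by (simp add: us_def L1_conv_def)
    show "u absolutely_integrable_on {0..1}" by (rule u)
    show "(\<lambda>n. integral {0..1} (\<lambda>x. \<bar>us n x - u x\<bar>)) \<longlonglongrightarrow> 0"
    proof (rule LIMSEQ_I)
      fix e :: real assume "0 < e"
      then obtain i where i: "1 / real (Suc i) < e" using reals_Archimedean[of e] by (auto simp: inverse_eq_divide)
      have "norm (integral {0..1} (\<lambda>x. \<bar>us n x - u x\<bar>) - 0) < e" if "max i (N i) \<le> n" for n
      proof -
        have jn: "i \<le> j n" "Q (j n) n" using jQ[OF that] by auto
        have "integral {0..1} (\<lambda>x. \<bar>us n x - u x\<bar>) < 1 / real (Suc (j n))" using jn(2) by (simp add: Q_def us_def)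
        also have "\<dots> \<le> 1 / real (Suc i)" using jn(1) by (intro frac_le) auto
        finally have "integral {0..1} (\<lambda>x. \<bar>us n x - u x\<bar>) < e" using i by simp
        moreover have "0 \<le> integral {0..1} (\<lambda>x. \<bar>us n x - u x\<bar>)" 
          by (cases "(\<lambda>x. \<bar>us n x - u x\<bar>) integrable_on {0..1}") (auto intro: integral_nonneg simp: not_integrable_integral)
        ultimately show ?thesis by simp
      qed
      then show "\<exists>no. \<forall>n\<ge>no. norm (integral {0..1} (\<lambda>x. \<bar>us n x - u x\<bar>) - 0) < e" by blast
    qed
  qed
  moreover have "limsup (\<lambda>n. H n (us n)) \<le> G"
  proof (rule dense_ge)
    fix y assume "G < y"
    then obtain i where i: "ereal (c i) \<le> y" using clim by blast
    have "H n (us n) \<le> y" if "max i (N i) \<le> n" for n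
    proof -
      have "i \<le> j n" "Q (j n) n" using jQ[OF that] by auto
      then have "H n (us n) \<le> ereal (c (j n))" "c (j n) \<le> c i" using cdec by (auto simp: Q_def us_def)
      then show ?thesis using i by (meson ereal_less_eq(3) order_trans)
    qed
    then show "limsup (\<lambda>n. H n (us n)) \<le> y"
      by (intro Limsup_bounded) (unfold eventually_at_top_linorder, blast)
  qed
  ultimately show ?thesis by blast
qed

context lj_potentials
begin

lemma qc_E_cong:
  assumes "0 < a" "a + 1 < b" "b + 2 < n" "\<And>i. i < n \<Longrightarrow> s i = t i"
  shows "qc_E n a b s = qc_E n a b t"
proof -
  have "left_energy s a (b - 1) = left_energy t a (b - 1)"
    by (rule left_energy_cong) (use assms in auto)
  moreover have "left_energy (\<lambda>i. s (n - 1 - i)) (n - b) (Suc (n - b)) = left_energy (\<lambda>i. t (n - 1 - i)) (n - b) (Suc (n - b))"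
    by (rule left_energy_cong) (use assms in auto)
  ultimately show ?thesis by (simp add: qc_E_def)
qed

end

context qc_setting
begin

lemma H1n_interp_le:
  assumes n: "good_n n" and s: "admissible n s"
  shows "H1n J1 J2 l u0 u1 n (k1 n) (k2 n) (T n) (interp n s) \<le> ereal (qc_E n (k1 n) (k2 n) s)"
proof -
  have n0: "0 < n" and g: "0 < k1 n" "k1 n + 1 < k2 n" "k2 n + 2 < n" using n by (auto simp: good_n_def)
  have T: "T n \<subseteq> {0..n}" using T_sub by auto
  have sl: "slopes n (interp n s) i = s i" if "i < n" for i by (rule slopes_interp[OF that])
  have "ereal (real n) * (qc_energy J1 J2 n (k1 n) (k2 n) (\<lambda>i. interp n s (real i / real n)) - ereal m)
      = ereal (qc_E n (k1 n) (k2 n) (slopes n (interp n s)))"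
    by (rule qc_energy_real[OF g]) (use s sl in \<open>simp add: admissible_def\<close>)
  also have "qc_E n (k1 n) (k2 n) (slopes n (interp n s)) = qc_E n (k1 n) (k2 n) s"
    by (rule qc_E_cong[OF g sl])
  finally have E: "ereal (real n) * (qc_energy J1 J2 n (k1 n) (k2 n) (\<lambda>i. interp n s (real i / real n)) - ereal m)
      = ereal (qc_E n (k1 n) (k2 n) s)" .
  have "in_A_T n (T n) (interp n s)" by (rule interp_in_A_T[OF T n0]) (use s in \<open>simp add: admissible_def\<close>)
  moreover have "BC n l u0 u1 (interp n s)"
  proof -
    have tot: "(\<Sum>j<n. s j) = real n * l" and e: "s 0 = u0" "s (n - 1) = u1" using s by (auto simp: admissible_def)
    have "(\<Sum>j<n. s j) = (\<Sum>j<n - 1. s j) + s (n - 1)" using n0 by (cases n) auto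
    then have t1: "(\<Sum>j<n - 1. s j) = real n * l - u1" using tot e by simp
    have r: "(real n - 1) / real n = real (n - 1) / real n" using n0 by (simp add: of_nat_diff)
    have "interp n s (real 0 / real n) = 0" using interp_node[OF n0, of 0 s] by simp
    moreover have "interp n s (real 1 / real n) = u0 / real n" using interp_node[OF n0, of 1 s] n0 e by simp
    moreover have "interp n s ((real n - 1) / real n) = l - u1 / real n"
      unfolding r using interp_node[OF n0, of "n - 1" s] n0 t1 by (simp add: diff_divide_distrib)
    moreover have "interp n s (real n / real n) = l" using interp_node[OF n0, of n s] n0 tot by simp
    ultimately show ?thesis using n0 by (simp add: BC_def)
  qed
  ultimately show ?thesis
    unfolding H1n_def E[symmetric] biconj_l by (intro Inf_lower) blast
qed

text \<open>What the convergence proof needs of a chain. The positions \<open>pos\<close> are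
  recorded only as precisely as needed for their macroscopic limits: within the end windows for 0
  and 1, exactly for interior jumps.\<close>

definition recovery_slopes :: "nat \<Rightarrow> real set \<Rightarrow> (real \<Rightarrow> nat) \<Rightarrow> (real \<Rightarrow> nat) \<Rightarrow> (real \<Rightarrow> nat) \<Rightarrow> (real \<Rightarrow> real)
    \<Rightarrow> real \<Rightarrow> real \<Rightarrow> (nat \<Rightarrow> real) \<Rightarrow> (real \<Rightarrow> nat) \<Rightarrow> bool" where
  "recovery_slopes n S q1 q2 ct amp C c s pos \<longleftrightarrow> admissible n s \<and> qc_E n (k1 n) (k2 n) s \<le> c \<and>
     (\<forall>y\<in>S. (y = 0 \<longrightarrow> pos y \<le> q2 0) \<and> (y = 1 \<longrightarrow> q1 1 \<le> pos y \<and> pos y \<le> n) \<and> (y \<noteq> 0 \<and> y \<noteq> 1 \<longrightarrow> pos y = q1 y)) \<and>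
     (\<forall>i\<le>n. \<bar>(\<Sum>j<i. s j) / real n - \<gamma> * (real i / real n)
     - (\<Sum>z\<in>{z\<in>Sigma S (\<lambda>y. {..<ct y}). pos (fst z) + snd z < i}. amp (fst z) / real n)\<bar> \<le> C / real n)"

text \<open>The layers change the total length by a bounded amount \<open>Dn\<close>. It is taken
  from the jump at one point \<open>y0\<close>, so that the length is exactly \<open>l\<close>; the
  slopes there are of order \<open>n\<close>, so they stay steep.\<close>

lemma recovery_slopes_exist:
  assumes rep: "sbvc_rep l \<gamma> S a" and y0: "y0 \<in> S"
    and good: "good_n n"
    and q: "\<And>y. y \<in> insert 0 (insert 1 S) \<Longrightarrow> q1 y \<in> T n \<and> q2 y \<in> T n \<and> k1 n < q1 y \<and> q1 y < q2 y \<and> q2 y < k2 n"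
    and blockL: "left_block u0 (k1 n) (rT n) (q1 0) (q2 0) cL CL eL pL"
    and blockR: "left_block u1 (n - k2 n) (n - lT n) (n - q2 1) (n - q1 1) cR CR eR pR"
    and sep01: "q2 0 < q1 1"
    and sep: "\<And>y. y \<in> S \<inter> {0<..<1} \<Longrightarrow> q2 0 < q1 y \<and> q2 y < q1 1"
    and sepI: "\<And>y z. y \<in> S \<inter> {0<..<1} \<Longrightarrow> z \<in> S \<inter> {0<..<1} \<Longrightarrow> y < z \<Longrightarrow> q2 y < q1 z"
    and ct: "\<And>y. ct y = (if y = 0 then cL else if y = 1 then cR else bn y)" "0 < cL" "0 < cR"
      "\<And>y. y \<in> S \<inter> {0<..<1} \<Longrightarrow> q2 y - q1 y = bn y"
    and large: "\<And>y. y \<in> S \<Longrightarrow> H \<le> (real n * a y - (CL + CR)) / real (ct y)" and H: "0 \<le> H"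
    and A0: "\<And>h. H \<le> h \<Longrightarrow> left_energy (if 0 \<in> S then bump pL cL h eL else eL) (k1 n) (q2 0) \<le> A0"
    and A1: "\<And>h. H \<le> h \<Longrightarrow> left_energy (if 1 \<in> S then bump pR cR h eR else eR) (n - k2 n) (n - q1 1) \<le> A1"
    and Ay: "\<And>y h. y \<in> S \<inter> {0<..<1} \<Longrightarrow> H \<le> h \<Longrightarrow> real (bn y) * G h \<le> ay y"
    and c: "A0 + A1 + (\<Sum>y\<in>S \<inter> {0<..<1}. ay y) - m \<le> c"
  shows "\<exists>Dn s pos. \<bar>Dn\<bar> \<le> CL + CR \<and>
    recovery_slopes n S q1 q2 ct (\<lambda>y. (real n * a y - (if y = y0 then Dn else 0)) / real (ct y)) (CL + CR) c s pos"
proof -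
  define Dn where "Dn = (\<Sum>j<n. (eL j - \<gamma>) + (eR (n - 1 - j) - \<gamma>))"
  have S: "finite S" "S \<subseteq> {0..1}" using rep by (auto simp: sbvc_rep_def)
  have S3: "y = 0 \<or> y = 1 \<or> y \<in> S \<inter> {0<..<1}" if "y \<in> S" for y using that S(2) by fastforce
  have Dn: "\<bar>Dn\<bar> \<le> CL + CR"
  proof -
    \<comment> \<open>The amplitudes depend on \<open>Dn\<close>, whose bound is therefore needed
      first. The deviation of the layers does not involve amplitudes, so any positive choice, here
      1, provides the bound.\<close>
    interpret triv: recovery_config J1 J2 D \<gamma> m j1 j2 l u0 u1 k1 k2 T b rhat lhat n S q1 q2 cL cR CL CR eL eR pL pR "\<lambda>_. 1"
      by unfold_locales (use good S q blockL blockR sep01 sep sepI gamma_pos in auto)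
    have "\<bar>Dn\<bar> \<le> (\<Sum>j<n. \<bar>triv.dev j\<bar>)" unfolding Dn_def triv.dev_def by (rule sum_abs)
    then show ?thesis using triv.dev_abs by simp
  qed
  \<comment> \<open>The jump \<open>a y\<close> is shared by \<open>ct y\<close> steep bonds of
    length \<open>1 / n\<close>.\<close>
  define amp where "amp y = (real n * a y - (if y = y0 then Dn else 0)) / real (ct y)" for y
  have ctp: "0 < ct y" if "y \<in> S" for y using S3[OF that] ct q[of y] that by force
  have ampH: "H \<le> amp y" if "y \<in> S" for y
  proof -
    have "(real n * a y - (CL + CR)) / real (ct y) \<le> amp y"
      unfolding amp_def using Dn by (intro divide_right_mono) auto
    then show ?thesis using large[OF that] by simp
  qed
  interpret rc: recovery_config J1 J2 D \<gamma> m j1 j2 l u0 u1 k1 k2 T b rhat lhat n S q1 q2 cL cR CL CR eL eR pL pR amp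
  proof (unfold_locales)
    show "0 < \<gamma> + amp y" if "y \<in> S" for y using ampH[OF that] H gamma_pos by simp
  qed (use good S q blockL blockR sep01 sep sepI in auto)
  have cteq: "rc.ct y = ct y" if "y \<in> S" for y using S3[OF that] ct by (auto simp: rc.ct_def)
  have "recovery_slopes n S q1 q2 ct amp (CL + CR) c rc.slp rc.ps"
    unfolding recovery_slopes_def
  proof (intro conjI)
    have "(\<Sum>y\<in>S. real (rc.ct y) * amp y) = (\<Sum>y\<in>S. real n * a y - (if y = y0 then Dn else 0))"
      by (rule sum.cong) (use cteq ctp in \<open>auto simp: amp_def\<close>)
    also have "\<dots> = real n * (\<Sum>y\<in>S. a y) - Dn"
      using S(1) y0 by (simp add: sum_subtractf sum_distrib_left)
    also have "(\<Sum>y\<in>S. a y) = l - \<gamma>" using rep by (simp add: sbvc_rep_def)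
    finally have "(\<Sum>i<n. rc.slp i) = real n * l"
      unfolding rc.slp_sum by (simp add: Dn_def rc.dev_def algebra_simps)
    then show "admissible n rc.slp"
      unfolding admissible_def using rc.slp_D rc.slp_elem_const rc.slp_ends by blast
    have "qc_E n (k1 n) (k2 n) rc.slp \<le> A0 + A1 + (\<Sum>y\<in>S \<inter> {0<..<1}. ay y) - m"
    proof (rule rc.slp_energy)
      show "left_energy (if 0 \<in> S then bump pL cL (\<gamma> + amp 0) eL else eL) (k1 n) (q2 0) \<le> A0"
        using A0[of "\<gamma> + amp 0"] A0[of H] ampH[of 0] gamma_pos by (cases "0 \<in> S") auto
      show "left_energy (if 1 \<in> S then bump pR cR (\<gamma> + amp 1) eR else eR) (n - k2 n) (n - q1 1) \<le> A1"
        using A1[of "\<gamma> + amp 1"] A1[of H] ampH[of 1] gamma_pos by (cases "1 \<in> S") auto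
      show "real (q2 y - q1 y) * G (\<gamma> + amp y) \<le> ay y" if "y \<in> S \<inter> {0<..<1}" for y
        using Ay[OF that, of "\<gamma> + amp y"] ampH[of y] gamma_pos that ct(4)[OF that] by simp
    qed
    then show "qc_E n (k1 n) (k2 n) rc.slp \<le> c" using c by simp
    show "\<forall>y\<in>S. (y = 0 \<longrightarrow> rc.ps y \<le> q2 0) \<and> (y = 1 \<longrightarrow> q1 1 \<le> rc.ps y \<and> rc.ps y \<le> n) \<and> (y \<noteq> 0 \<and> y \<noteq> 1 \<longrightarrow> rc.ps y = q1 y)"
      using rc.ends by (auto simp: rc.ps_def)
    have Sg: "Sigma S (\<lambda>y. {..<rc.ct y}) = Sigma S (\<lambda>y. {..<ct y})" by (rule Sigma_cong) (use cteq in auto)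
    show "\<forall>i\<le>n. \<bar>(\<Sum>j<i. rc.slp j) / real n - \<gamma> * (real i / real n)
     - (\<Sum>z\<in>{z\<in>Sigma S (\<lambda>y. {..<ct y}). rc.ps (fst z) + snd z < i}. amp (fst z) / real n)\<bar> \<le> (CL + CR) / real n"
      using rc.slp_node unfolding Sg by blast
  qed
  then show ?thesis unfolding amp_def[abs_def] using Dn by blast
qed

end

context lj_potentials
begin

lemma end_upper_ex:
  assumes "0 < \<theta>" "rh \<noteq> 0" "(if jump then B_IFJ J1 J2 \<gamma> rh bb \<theta> else B_theta J1 J2 \<gamma> \<theta>) < ereal A"
  shows "\<exists>cnt k0 C H. 0 < cnt \<and> (\<forall>k r q1 q2. k0 \<le> k \<longrightarrow> k < r \<longrightarrow> r \<le> q1 \<longrightarrow> q1 < q2 \<longrightarrow>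
       rh = enat (r - k) \<or> rh = \<infinity> \<longrightarrow> bb = enat (q2 - q1) \<or> bb = \<infinity> \<longrightarrow>
       (\<exists>e p. left_block \<theta> k r q1 q2 cnt C e p \<and> (\<forall>h\<ge>H. left_energy (if jump then bump p cnt h e else e) k q2 \<le> A)))"
  by (rule end_upper[OF assms]) blast

lemma steep_element_energy:
  assumes "- (real k * m) < A"
  shows "\<exists>H. \<forall>h\<ge>H. real k * G h \<le> A"
proof -
  define x where "x = (A + real k * m) / (real k + 1)"
  have x: "0 < x" using assms by (simp add: x_def)
  have xA: "(real k + 1) * x = A + real k * m" by (simp add: x_def)
  obtain H where H: "\<And>h. H \<le> h \<Longrightarrow> G h \<le> - m + x" using jump_upper[OF x] by metis
  have "real k * G h \<le> A" if "H \<le> h" for h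
  proof -
    have "real k * G h \<le> real k * (- m + x)" using H[OF that] by (intro mult_left_mono) auto
    also have "\<dots> \<le> A" using xA x by (simp add: algebra_simps)
    finally show ?thesis .
  qed
  then show ?thesis by blast
qed

end

context qc_setting
begin

text \<open>The level \<open>c\<close> is split as in the lower bound, now from above, and pairs of
  atoms attaining the distances \<open>b y\<close> provide the elements to be made steep. All
  thresholds are independent of \<open>n\<close>, so the single-chain construction applies for large
  \<open>n\<close>.\<close>

lemma recovery_slopes_eventually:
  assumes rep: "sbvc_rep l \<gamma> S a" and lt: "H1_value J1 J2 \<gamma> u0 u1 b rhat lhat S < ereal c"
  obtains Q1 Q2 :: "real \<Rightarrow> nat \<Rightarrow> nat" and ct :: "real \<Rightarrow> nat" and C :: real and y0 :: real
    where "\<And>y. y \<in> insert 0 (insert 1 S) \<Longrightarrow> (\<lambda>n. real (Q1 y n) / real n) \<longlonglongrightarrow> y \<and> (\<lambda>n. real (Q2 y n) / real n) \<longlonglongrightarrow> y"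
    "\<And>y. y \<in> S \<Longrightarrow> 0 < ct y"
    "\<forall>\<^sub>F n in sequentially. good_n n \<and> (\<exists>Dn s pos. \<bar>Dn\<bar> \<le> C \<and>
        recovery_slopes n S (\<lambda>y. Q1 y n) (\<lambda>y. Q2 y n) ct (\<lambda>y. (real n * a y - (if y = y0 then Dn else 0)) / real (ct y)) C c s pos)"
proof -
  define I where "I = S \<inter> {0<..<1}"
  define X0 where "X0 = (if 0 \<in> S then B_IFJ J1 J2 \<gamma> rhat (b 0) u0 else B_theta J1 J2 \<gamma> u0)"
  define X1 where "X1 = (if 1 \<in> S then B_IFJ J1 J2 \<gamma> lhat (b 1) u1 else B_theta J1 J2 \<gamma> u1)"
  define f where "f x = ereal_of_enat (b x) * J0 J1 J2 \<gamma>" for x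
  have S: "finite S" "S \<subseteq> {0..1}" "S \<noteq> {}" "\<And>y. y \<in> S \<Longrightarrow> 0 < a y" using rep by (auto simp: sbvc_rep_def)
  have finI: "finite I" using S by (simp add: I_def)
  have f_ne: "f x \<noteq> \<infinity>" for x unfolding f_def by (rule count_m_ne_PInf)
  have X0n: "X0 \<noteq> -\<infinity>" and X1n: "X1 \<noteq> -\<infinity>" unfolding X0_def X1_def by (rule end_value_not_MInf)+
  have sumn: "(\<Sum>x\<in>I. - f x) \<noteq> -\<infinity>" by (rule sum_ereal_not_MInf) (use f_ne in \<open>simp add: ereal_uminus_eq_reorder\<close>)
  have "H1_value J1 J2 \<gamma> u0 u1 b rhat lhat S = (X0 + X1 + (\<Sum>x\<in>I. - f x)) + ereal (- m)"
    unfolding X0_def X1_def I_def f_def by (rule H1_value_eq[OF S(1)])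
  then have lt': "X0 + X1 + (\<Sum>x\<in>I. - f x) < ereal (c + m)"
    using lt plus_ereal_less_iff[of "X0 + X1 + (\<Sum>x\<in>I. - f x)" "- m" c] by simp
  have X01n: "X0 + X1 \<noteq> -\<infinity>" using X0n X1n by simp
  obtain A01 A2 where A01: "X0 + X1 < ereal A01" "(\<Sum>x\<in>I. - f x) < ereal A2" "A01 + A2 < c + m"
    using ereal_add_less_split[OF lt' X01n sumn] by blast
  obtain A0 A1 where A0: "X0 < ereal A0" "X1 < ereal A1" "A0 + A1 < A01"
    using ereal_add_less_split[OF A01(1) X0n X1n] by blast
  obtain ay where ay: "\<And>x. x \<in> I \<Longrightarrow> - f x < ereal (ay x)" "(\<Sum>x\<in>I. ay x) < A2"
    using ereal_sum_less_split[OF finI A01(2)] f_ne by (auto simp: ereal_uminus_eq_reorder)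
  \<comment> \<open>A jump set of finite energy can contain only interior points with finite
    \<open>b y\<close>, because an infinite count costs plus infinity.\<close>
  have "\<exists>k. b y = enat k \<and> - (real k * m) < ay y" if "y \<in> I" for y
    using ay(1)[OF that] unfolding f_def enat_mult_m by (cases "b y") auto
  then obtain bn where bn: "\<And>y. y \<in> I \<Longrightarrow> b y = enat (bn y)" "\<And>y. y \<in> I \<Longrightarrow> - (real (bn y) * m) < ay y" by metis
  obtain Hy where Hy: "\<And>y h. y \<in> I \<Longrightarrow> Hy y \<le> h \<Longrightarrow> real (bn y) * G h \<le> ay y"
    using steep_element_energy[OF bn(2)] by metis
  obtain cL kL CL HL where cL: "0 < cL" and eL: "\<forall>k r q1 q2. kL \<le> k \<longrightarrow> k < r \<longrightarrow> r \<le> q1 \<longrightarrow> q1 < q2 \<longrightarrow>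
       rhat = enat (r - k) \<or> rhat = \<infinity> \<longrightarrow> b 0 = enat (q2 - q1) \<or> b 0 = \<infinity> \<longrightarrow>
       (\<exists>e p. left_block u0 k r q1 q2 cL CL e p \<and> (\<forall>h\<ge>HL. left_energy (if 0 \<in> S then bump p cL h e else e) k q2 \<le> A0))"
    using end_upper_ex[OF u0_pos rhat_nonzero A0(1)[unfolded X0_def]] by (elim exE conjE) (rule that)
  obtain cR kR CR HR where cR: "0 < cR" and eR: "\<forall>k r q1 q2. kR \<le> k \<longrightarrow> k < r \<longrightarrow> r \<le> q1 \<longrightarrow> q1 < q2 \<longrightarrow>
       lhat = enat (r - k) \<or> lhat = \<infinity> \<longrightarrow> b 1 = enat (q2 - q1) \<or> b 1 = \<infinity> \<longrightarrow>
       (\<exists>e p. left_block u1 k r q1 q2 cR CR e p \<and> (\<forall>h\<ge>HR. left_energy (if 1 \<in> S then bump p cR h e else e) k q2 \<le> A1))"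
    using end_upper_ex[OF u1_pos lhat_nonzero A0(2)[unfolded X1_def]] by (elim exE conjE) (rule that)
  let ?Y = "insert 0 (insert 1 S)"
  have Y01: "y \<in> {0..1}" if "y \<in> ?Y" for y using that S(2) by auto
  have finY: "finite ?Y" using S(1) by simp
  have "\<exists>q1 q2. adm_pair k1 k2 T y q1 q2 \<and> (\<forall>\<^sub>F n in sequentially. b y = enat (q2 n - q1 n) \<or> b y = \<infinity>)" if "y \<in> ?Y" for y
    using b_attained[OF Y01[OF that]] by metis
  then obtain Q1 Q2 where Q: "\<And>y. y \<in> ?Y \<Longrightarrow> adm_pair k1 k2 T y (Q1 y) (Q2 y)"
    "\<And>y. y \<in> ?Y \<Longrightarrow> \<forall>\<^sub>F n in sequentially. b y = enat (Q2 y n - Q1 y n) \<or> b y = \<infinity>" by metis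
  have Qlim: "(\<lambda>n. real (Q1 y n) / real n) \<longlonglongrightarrow> y" "(\<lambda>n. real (Q2 y n) / real n) \<longlonglongrightarrow> y" if "y \<in> ?Y" for y
    using Q(1)[OF that] by (auto simp: adm_pair_def)
  have IS: "y \<in> ?Y" "0 < y" "y < 1" if "y \<in> I" for y using that by (auto simp: I_def)
  have ev_q: "\<forall>\<^sub>F n in sequentially. \<forall>y\<in>?Y. (k1 n < Q1 y n \<and> Q1 y n < Q2 y n \<and> Q2 y n < k2 n \<and> Q1 y n \<in> T n \<and> Q2 y n \<in> T n) \<and>
      (b y = enat (Q2 y n - Q1 y n) \<or> b y = \<infinity>)"
  proof (rule eventually_ball_finite[OF finY], rule ballI)
    fix y assume y: "y \<in> ?Y"
    show "\<forall>\<^sub>F n in sequentially. (k1 n < Q1 y n \<and> Q1 y n < Q2 y n \<and> Q2 y n < k2 n \<and> Q1 y n \<in> T n \<and> Q2 y n \<in> T n) \<and>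
      (b y = enat (Q2 y n - Q1 y n) \<or> b y = \<infinity>)"
      using Q(1)[OF y] Q(2)[OF y] by (simp add: adm_pair_def eventually_conj_iff)
  qed
  have ev_01: "\<forall>\<^sub>F n in sequentially. Q2 0 n < Q1 1 n"
    by (rule ratio_eventually_less[OF Qlim(2) Qlim(1)]) auto
  have ev_sep: "\<forall>\<^sub>F n in sequentially. \<forall>y\<in>I. Q2 0 n < Q1 y n \<and> Q2 y n < Q1 1 n"
  proof (rule eventually_ball_finite[OF finI], rule ballI)
    fix y assume y: "y \<in> I"
    have "\<forall>\<^sub>F n in sequentially. Q2 0 n < Q1 y n" "\<forall>\<^sub>F n in sequentially. Q2 y n < Q1 1 n"
      by (rule ratio_eventually_less[OF Qlim(2) Qlim(1)]; use IS[OF y] in auto)+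
    then show "\<forall>\<^sub>F n in sequentially. Q2 0 n < Q1 y n \<and> Q2 y n < Q1 1 n" by (rule eventually_conj)
  qed
  have ev_I: "\<forall>\<^sub>F n in sequentially. \<forall>y\<in>I. \<forall>z\<in>I. y < z \<longrightarrow> Q2 y n < Q1 z n"
  proof (rule eventually_ball_finite[OF finI], rule ballI, rule eventually_ball_finite[OF finI], rule ballI)
    fix y z assume y: "y \<in> I" and z: "z \<in> I"
    show "\<forall>\<^sub>F n in sequentially. y < z \<longrightarrow> Q2 y n < Q1 z n"
    proof (cases "y < z")
      case True
      have "\<forall>\<^sub>F n in sequentially. Q2 y n < Q1 z n"
        by (rule ratio_eventually_less[OF Qlim(2)[OF IS(1)[OF y]] Qlim(1)[OF IS(1)[OF z]] True])
      then show ?thesis by eventually_elim simp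
    qed simp
  qed
  define ct where "ct y = (if y = 0 then cL else if y = 1 then cR else bn y)" for y
  have bn_pos: "0 < bn y" if "y \<in> I" for y
  proof -
    have "\<forall>\<^sub>F n in sequentially. 0 < bn y"
      using ev_q
    proof eventually_elim
      case (elim n)
      then have "Q1 y n < Q2 y n" "enat (bn y) = enat (Q2 y n - Q1 y n)" using IS(1)[OF that] bn(1)[OF that] by auto
      then show ?case by simp
    qed
    then show ?thesis by simp
  qed
  have ctp: "0 < ct y" if "y \<in> S" for y
  proof (cases "y \<in> I")
    case True
    then show ?thesis using bn_pos cL cR by (simp add: ct_def)
  next
    case False
    then have "y = 0 \<or> y = 1" using that S(2) by (force simp: I_def)
    then show ?thesis using cL cR by (auto simp: ct_def)
  qed
  \<comment> \<open>A common height beyond which all energy estimates hold; 0 is included so that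
    \<gamma> plus an amplitude is positive and lies in the domain.\<close>
  define H where "H = Max (insert 0 (insert HL (insert HR (Hy ` I))))"
  have H: "0 \<le> H" "HL \<le> H" "HR \<le> H" "\<And>y. y \<in> I \<Longrightarrow> Hy y \<le> H"
    unfolding H_def using finI by (auto intro!: Max_ge simp del: Max_insert)
  have ev_large: "\<forall>\<^sub>F n in sequentially. \<forall>y\<in>S. H \<le> (real n * a y - (CL + CR)) / real (ct y)"
  proof (rule eventually_ball_finite[OF S(1)], rule ballI)
    fix y assume y: "y \<in> S"
    have "\<forall>\<^sub>F n in sequentially. (H * real (ct y) + (CL + CR)) / a y \<le> real n"
      using filterlim_real_sequentially unfolding filterlim_at_top by blast
    then show "\<forall>\<^sub>F n in sequentially. H \<le> (real n * a y - (CL + CR)) / real (ct y)"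
      by eventually_elim (use S(4)[OF y] ctp[OF y] in \<open>simp add: pos_le_divide_eq pos_divide_le_eq\<close>)
  qed
  obtain y0 where y0: "y0 \<in> S" using S(3) by blast
  have ev_k: "\<forall>\<^sub>F n in sequentially. kL \<le> k1 n" "\<forall>\<^sub>F n in sequentially. kR \<le> n - k2 n"
    using K1 K2 by (auto simp: filterlim_at_top)
  have "\<forall>\<^sub>F n in sequentially. good_n n \<and> (\<exists>Dn s pos. \<bar>Dn\<bar> \<le> CL + CR \<and>
        recovery_slopes n S (\<lambda>y. Q1 y n) (\<lambda>y. Q2 y n) ct (\<lambda>y. (real n * a y - (if y = y0 then Dn else 0)) / real (ct y)) (CL + CR) c s pos)"
    using eventually_good ev_k ev_q ev_01 ev_sep ev_I ev_large rhat_eventually[of 0] lhat_eventually[of 0]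
  proof eventually_elim
    case (elim n)
    have k12: "k1 n < k2 n" "k2 n < n" using elim(1) by (auto simp: good_n_def)
    have q: "Q1 y n \<in> T n \<and> Q2 y n \<in> T n \<and> k1 n < Q1 y n \<and> Q1 y n < Q2 y n \<and> Q2 y n < k2 n"
      and bq: "b y = enat (Q2 y n - Q1 y n) \<or> b y = \<infinity>" if "y \<in> ?Y" for y
      using bspec[OF elim(4) that] by simp_all
    have r: "consecutive (T n) (k1 n) (rT n)" "k1 n < rT n" and ll: "consecutive (T n) (lT n) (k2 n)" "lT n < k2 n"
      using rT_props[OF k12] lT_props[OF k12] by auto
    have r0: "rT n \<le> Q1 0 n" using r(1) q[of 0] unfolding consecutive_def by (metis insertI1 not_le)
    have l1: "Q2 1 n \<le> lT n" using ll(1) q[of 1] unfolding consecutive_def by (metis insertI1 insertI2 not_le)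
    have "rhat = enat (rT n - k1 n) \<or> rhat = \<infinity>" using elim(9) by blast
    then obtain el pl where L: "left_block u0 (k1 n) (rT n) (Q1 0 n) (Q2 0 n) cL CL el pl"
      "\<forall>h\<ge>HL. left_energy (if 0 \<in> S then bump pl cL h el else el) (k1 n) (Q2 0 n) \<le> A0"
      using eL[rule_format, OF elim(2) r(2) r0 _ _ bq] q[of 0] by auto
    have e1: "n - lT n - (n - k2 n) = k2 n - lT n" "n - Q1 1 n - (n - Q2 1 n) = Q2 1 n - Q1 1 n"
      "n - k2 n < n - lT n" "n - lT n \<le> n - Q2 1 n" "n - Q2 1 n < n - Q1 1 n"
      using k12 ll(2) l1 q[of 1] by auto
    have "lhat = enat (n - lT n - (n - k2 n)) \<or> lhat = \<infinity>" unfolding e1(1) using elim(10) by blast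
    moreover have "b 1 = enat (n - Q1 1 n - (n - Q2 1 n)) \<or> b 1 = \<infinity>" unfolding e1(2) by (rule bq) simp
    ultimately obtain er pr where R: "left_block u1 (n - k2 n) (n - lT n) (n - Q2 1 n) (n - Q1 1 n) cR CR er pr"
      "\<forall>h\<ge>HR. left_energy (if 1 \<in> S then bump pr cR h er else er) (n - k2 n) (n - Q1 1 n) \<le> A1"
      using eR[rule_format, OF elim(3) e1(3,4,5)] by blast
    have "\<exists>Dn s pos. \<bar>Dn\<bar> \<le> CL + CR \<and>
        recovery_slopes n S (\<lambda>y. Q1 y n) (\<lambda>y. Q2 y n) ct (\<lambda>y. (real n * a y - (if y = y0 then Dn else 0)) / real (ct y)) (CL + CR) c s pos"
    proof (rule recovery_slopes_exist[OF rep y0 elim(1) _ L(1) R(1), where bn = bn and H = H and ?A0.0 = A0 and ?A1.0 = A1 and ay = ay])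
      show "Q1 y n \<in> T n \<and> Q2 y n \<in> T n \<and> k1 n < Q1 y n \<and> Q1 y n < Q2 y n \<and> Q2 y n < k2 n" if "y \<in> ?Y" for y
        by (rule q[OF that])
      show "Q2 0 n < Q1 1 n" by (rule elim(5))
      show "Q2 0 n < Q1 y n \<and> Q2 y n < Q1 1 n" if "y \<in> S \<inter> {0<..<1}" for y using elim(6) that unfolding I_def by blast
      show "Q2 y n < Q1 z n" if "y \<in> S \<inter> {0<..<1}" "z \<in> S \<inter> {0<..<1}" "y < z" for y z using elim(7) that unfolding I_def by blast
      show "ct y = (if y = 0 then cL else if y = 1 then cR else bn y)" for y by (rule ct_def)
      show "Q2 y n - Q1 y n = bn y" if "y \<in> S \<inter> {0<..<1}" for y
        using bq[of y] bn(1)[of y] that by (auto simp: I_def)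
      show "H \<le> (real n * a y - (CL + CR)) / real (ct y)" if "y \<in> S" for y using elim(8) that by blast
      show "left_energy (if 0 \<in> S then bump pl cL h el else el) (k1 n) (Q2 0 n) \<le> A0" if "H \<le> h" for h
        using L(2)[rule_format, of h] H(2) that by simp
      show "left_energy (if 1 \<in> S then bump pr cR h er else er) (n - k2 n) (n - Q1 1 n) \<le> A1" if "H \<le> h" for h
        using R(2)[rule_format, of h] H(3) that by simp
      show "real (bn y) * G h \<le> ay y" if "y \<in> S \<inter> {0<..<1}" "H \<le> h" for y h
        using Hy[of y h] H(4)[of y] that by (simp add: I_def)
      show "A0 + A1 + (\<Sum>y\<in>S \<inter> {0<..<1}. ay y) - m \<le> c" using A0(3) A01(3) ay(2) unfolding I_def by linarith
    qed (use cL cR H(1) in auto)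
    then show ?case using elim(1) by blast
  qed
  then show thesis using that[of Q1 Q2 ct "CL + CR" y0] Qlim ctp by blast
qed

text \<open>Interpolating the recovery slopes gives functions that are uniformly bounded and
  converge pointwise off the jump set, hence in \<open>L1\<close>. The bounded correction
  \<open>Dn\<close> disappears after division by \<open>n\<close>.\<close>

lemma recovery:
  assumes u: "u absolutely_integrable_on {0..1}" and rep: "sbvc_rep l \<gamma> S a"
    and ae: "AE x in lborel. x \<in> {0..1} \<longrightarrow> u x = sbvc_fun \<gamma> S a x"
    and lt: "H1_value J1 J2 \<gamma> u0 u1 b rhat lhat S < ereal c"
  shows "\<exists>us. L1_conv us u \<and> (\<forall>\<^sub>F n in sequentially. H1n J1 J2 l u0 u1 n (k1 n) (k2 n) (T n) (us n) \<le> ereal c)"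
proof -
  obtain Q1 Q2 :: "real \<Rightarrow> nat \<Rightarrow> nat" and ct :: "real \<Rightarrow> nat" and C :: real and y0 :: real
    where Qlim: "\<And>y. y \<in> insert 0 (insert 1 S) \<Longrightarrow> (\<lambda>n. real (Q1 y n) / real n) \<longlonglongrightarrow> y \<and> (\<lambda>n. real (Q2 y n) / real n) \<longlonglongrightarrow> y"
    and ctp: "\<And>y. y \<in> S \<Longrightarrow> 0 < ct y"
    and ev: "\<forall>\<^sub>F n in sequentially. good_n n \<and> (\<exists>Dn s pos. \<bar>Dn\<bar> \<le> C \<and>
        recovery_slopes n S (\<lambda>y. Q1 y n) (\<lambda>y. Q2 y n) ct (\<lambda>y. (real n * a y - (if y = y0 then Dn else 0)) / real (ct y)) C c s pos)"
    by (rule recovery_slopes_eventually[OF rep lt]) (rule that)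
  obtain n0' where n0': "\<And>n. n0' \<le> n \<Longrightarrow> good_n n \<and> (\<exists>Dn s pos. \<bar>Dn\<bar> \<le> C \<and>
        recovery_slopes n S (\<lambda>y. Q1 y n) (\<lambda>y. Q2 y n) ct (\<lambda>y. (real n * a y - (if y = y0 then Dn else 0)) / real (ct y)) C c s pos)"
    using ev unfolding eventually_at_top_linorder by blast
  \<comment> \<open>Shifting the index by \<open>n0\<close> makes the construction available for
    every \<open>k\<close>; the successor ensures \<open>0 < N k\<close>.\<close>
  define n0 where "n0 = Suc n0'"
  have S: "finite S" "S \<subseteq> {0..1}" "\<And>y. y \<in> S \<Longrightarrow> 0 < a y" using rep by (auto simp: sbvc_rep_def)
  define RS where "RS k d s pos \<longleftrightarrow> \<bar>d\<bar> \<le> C \<and> recovery_slopes (k + n0) S (\<lambda>y. Q1 y (k + n0)) (\<lambda>y. Q2 y (k + n0)) ct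
      (\<lambda>y. (real (k + n0) * a y - (if y = y0 then d else 0)) / real (ct y)) C c s pos" for k d s pos
  have "\<exists>d s pos. RS k d s pos" for k
  proof -
    have "n0' \<le> k + n0" by (simp add: n0_def)
    from n0'[OF this] show ?thesis unfolding RS_def by blast
  qed
  then obtain Dn s pos where "\<And>k. RS k (Dn k) (s k) (pos k)" by metis
  then have rs: "\<And>k. \<bar>Dn k\<bar> \<le> C" "\<And>k. recovery_slopes (k + n0) S (\<lambda>y. Q1 y (k + n0)) (\<lambda>y. Q2 y (k + n0)) ct
      (\<lambda>y. (real (k + n0) * a y - (if y = y0 then Dn k else 0)) / real (ct y)) C c (s k) (pos k)"
    unfolding RS_def by blast+
  define N where "N k = k + n0" for k
  define amp where "amp k y = (real (N k) * a y - (if y = y0 then Dn k else 0)) / real (ct y)" for k y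
  \<comment> \<open>One index for each steep bond. The \<open>ct y\<close> bonds of a jump converge
    to the same point \<open>y\<close> and carry \<open>a y / ct y\<close> each in the
    limit.\<close>
  define J where "J = Sigma S (\<lambda>y. {..<ct y})"
  have good: "good_n (N k)" for k using n0'[of "N k"] by (simp add: N_def n0_def)
  have Npos: "0 < N k" for k by (simp add: N_def n0_def)
  have Ntop: "filterlim N at_top sequentially" unfolding N_def[abs_def] by (rule filterlim_add_const_nat_at_top)
  have adm: "admissible (N k) (s k)" and E: "qc_E (N k) (k1 (N k)) (k2 (N k)) (s k) \<le> c"
    and posy: "\<And>y. y \<in> S \<Longrightarrow> (y = 0 \<longrightarrow> pos k y \<le> Q2 0 (N k)) \<and> (y = 1 \<longrightarrow> Q1 1 (N k) \<le> pos k y \<and> pos k y \<le> N k) \<and>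
        (y \<noteq> 0 \<and> y \<noteq> 1 \<longrightarrow> pos k y = Q1 y (N k))"
    and node: "\<And>i. i \<le> N k \<Longrightarrow> \<bar>(\<Sum>j<i. s k j) / real (N k) - \<gamma> * (real i / real (N k))
     - (\<Sum>z\<in>{z\<in>J. pos k (fst z) + snd z < i}. amp k (fst z) / real (N k))\<bar> \<le> C / real (N k)" for k
    using rs(2)[of k] unfolding recovery_slopes_def N_def[symmetric] amp_def[symmetric] J_def[symmetric] by blast+
  have finJ: "finite J" using S(1) by (simp add: J_def)
  have JS: "fst z \<in> S" if "z \<in> J" for z using that by (auto simp: J_def)
  have inv: "(\<lambda>k. 1 / real (N k)) \<longlonglongrightarrow> 0" using filterlim_compose[OF lim_1_over_n Ntop] by simp
  have inv': "(\<lambda>k. X / real (N k)) \<longlonglongrightarrow> 0" for X using tendsto_mult[OF tendsto_const inv, of X] by simp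
  have sub: "(\<lambda>k. h (N k)) \<longlonglongrightarrow> L" if "h \<longlonglongrightarrow> L" for h and L :: real using filterlim_compose[OF that Ntop] .
  have C0: "0 \<le> C" using rs(1)[of 0] by simp
  have poslim: "(\<lambda>k. real (pos k y) / real (N k)) \<longlonglongrightarrow> y" if y: "y \<in> S" for y
  proof -
    have Q: "(\<lambda>k. real (Q1 y (N k)) / real (N k)) \<longlonglongrightarrow> y" "(\<lambda>k. real (Q2 y (N k)) / real (N k)) \<longlonglongrightarrow> y"
      using sub[of "\<lambda>n. real (Q1 y n) / real n" y] sub[of "\<lambda>n. real (Q2 y n) / real n" y] Qlim[of y] y by auto
    consider "y = 0" | "y = 1" | "y \<noteq> 0" "y \<noteq> 1" by blast
    then show ?thesis
    proof cases
      case 1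
      show ?thesis
      proof (rule tendsto_sandwich[OF _ _ _ Q(2)])
        show "\<forall>\<^sub>F k in sequentially. real (pos k y) / real (N k) \<le> real (Q2 y (N k)) / real (N k)"
          using posy[OF y] 1 by (intro always_eventually allI divide_right_mono) auto
        show "(\<lambda>_. 0) \<longlonglongrightarrow> y" using 1 by simp
      qed simp
    next
      case 2
      show ?thesis
      proof (rule tendsto_sandwich[OF _ _ Q(1)])
        show "\<forall>\<^sub>F k in sequentially. real (Q1 y (N k)) / real (N k) \<le> real (pos k y) / real (N k)"
          using posy[OF y] 2 by (intro always_eventually allI divide_right_mono) auto
        show "\<forall>\<^sub>F k in sequentially. real (pos k y) / real (N k) \<le> 1"
          using posy[OF y] 2 Npos by (intro always_eventually allI) (simp add: divide_le_eq)
        show "(\<lambda>_. 1) \<longlonglongrightarrow> y" using 2 by simp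
      qed
    next
      case 3
      then have "pos k y = Q1 y (N k)" for k using posy[OF y] by blast
      then show ?thesis using Q(1) by simp
    qed
  qed
  define v where "v k = interp (N k) (s k)" for k
  have vA: "in_A_T (N k) (T (N k)) (v k)" for k
    unfolding v_def using T_sub adm[of k] Npos by (intro interp_in_A_T) (auto simp: admissible_def)
  have vb: "bond_affine (N k) (v k)" for k
    by (rule in_A_T_affine(1)[OF vA]) (use T_sub Npos in auto)
  have vnode: "v k (real i / real (N k)) = (\<Sum>j<i. s k j) / real (N k)" if "i \<le> N k" for k i
    unfolding v_def by (rule interp_node[OF Npos that])
  have amplim: "(\<lambda>k. amp k y / real (N k)) \<longlonglongrightarrow> a y / real (ct y)" for y
  proof -
    have "(\<lambda>k. (if y = y0 then Dn k else 0) / real (N k)) \<longlonglongrightarrow> 0"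
      by (rule Lim_null_comparison[OF _ inv'[of C]]) (use rs(1) C0 in \<open>auto intro!: always_eventually divide_right_mono\<close>)
    then have "(\<lambda>k. (a y - (if y = y0 then Dn k else 0) / real (N k)) / real (ct y)) \<longlonglongrightarrow> (a y - 0) / real (ct y)"
      by (cases "ct y = 0") (simp, intro tendsto_intros, auto)
    moreover have "(a y - (if y = y0 then Dn k else 0) / real (N k)) / real (ct y) = amp k y / real (N k)" for k
    proof -
      have "a y - (if y = y0 then Dn k else 0) / real (N k) = (real (N k) * a y - (if y = y0 then Dn k else 0)) / real (N k)"
        using Npos[of k] by (simp add: diff_divide_distrib)
      then show ?thesis by (simp add: amp_def)
    qed
    ultimately show ?thesis by simp
  qed
  have lim: "(\<lambda>k. v k t) \<longlonglongrightarrow> sbvc_fun \<gamma> S a t" if t: "0 < t" "t < 1" "t \<notin> S" for t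
  proof -
    have "(\<lambda>k. v k t) \<longlonglongrightarrow> \<gamma> * t + step_sum J (\<lambda>z. a (fst z) / real (ct (fst z))) fst t"
    proof (rule interp_limit[OF Ntop finJ vb, where pos = "\<lambda>k z. pos k (fst z) + snd z" and A = "\<lambda>k z. amp k (fst z) / real (N k)"
          and err = "\<lambda>k. C / real (N k)"])
      show "\<bar>v k (real i / real (N k)) - \<gamma> * (real i / real (N k)) - (\<Sum>z\<in>{z\<in>J. pos k (fst z) + snd z < i}. amp k (fst z) / real (N k))\<bar>
          \<le> C / real (N k)" if "i \<le> N k" for k i
        unfolding vnode[OF that] by (rule node[OF that])
      show "(\<lambda>k. C / real (N k)) \<longlonglongrightarrow> 0" by (rule inv')
      show "(\<lambda>k. real (pos k (fst z) + snd z) / real (N k)) \<longlonglongrightarrow> fst z" if "z \<in> J" for z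
        using tendsto_add[OF poslim[OF JS[OF that]] inv'[of "real (snd z)"]] by (simp add: add_divide_distrib)
      show "(\<lambda>k. amp k (fst z) / real (N k)) \<longlonglongrightarrow> a (fst z) / real (ct (fst z))" if "z \<in> J" for z by (rule amplim)
      show "t \<notin> fst ` J" using t(3) JS by auto
    qed (use t in auto)
    also have "step_sum J (\<lambda>z. a (fst z) / real (ct (fst z))) fst t = (\<Sum>y\<in>{y\<in>S. y < t}. a y)"
    proof -
      have "{z\<in>J. fst z < t} = Sigma {y\<in>S. y < t} (\<lambda>y. {..<ct y})" by (auto simp: J_def)
      then have "step_sum J (\<lambda>z. a (fst z) / real (ct (fst z))) fst t = (\<Sum>y\<in>{y\<in>S. y < t}. \<Sum>r<ct y. a y / real (ct y))"
        unfolding step_sum_def by (subst sum.Sigma) (use S(1) in \<open>auto simp: case_prod_beta\<close>)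
      also have "\<dots> = (\<Sum>y\<in>{y\<in>S. y < t}. a y)" by (rule sum.cong) (use ctp in fastforce)+
      finally show ?thesis .
    qed
    finally show ?thesis by (simp add: sbvc_fun_def)
  qed
  \<comment> \<open>The affine part is at most \<gamma>, each steep bond contributes at most
    \<open>\<bar>a (fst z)\<bar> + C\<close> since \<open>ct\<close> and \<open>N k\<close> are at
    least 1, and the nodal error is at most \<open>C\<close>.\<close>
  define B where "B = \<gamma> + (\<Sum>z\<in>J. \<bar>a (fst z)\<bar> + C) + C"
  have nb: "\<bar>v k (real i / real (N k))\<bar> \<le> B" if i: "i \<le> N k" for k i
  proof -
    have N1: "1 \<le> real (N k)" using Npos[of k] by simp
    have "\<bar>amp k (fst z) / real (N k)\<bar> \<le> \<bar>a (fst z)\<bar> + C" if "z \<in> J" for z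
    proof -
      have c1: "1 \<le> real (ct (fst z))" using ctp[OF JS[OF that]] by simp
      have "\<bar>amp k (fst z)\<bar> \<le> \<bar>real (N k) * a (fst z) - (if fst z = y0 then Dn k else 0)\<bar>"
        unfolding amp_def using c1 by (simp add: abs_divide divide_le_eq mult_left_mono[of 1, simplified] mult_le_cancel_left1)
      also have "\<dots> \<le> real (N k) * \<bar>a (fst z)\<bar> + C"
        using rs(1)[of k] C0 abs_triangle_ineq4[of "real (N k) * a (fst z)" "if fst z = y0 then Dn k else 0"]
        by (auto simp: abs_mult split: if_splits)
      also have "\<dots> \<le> real (N k) * (\<bar>a (fst z)\<bar> + C)" using C0 N1 by (simp add: distrib_left mult_left_le_one_le mult_le_cancel_right1)
      finally have "\<bar>amp k (fst z)\<bar> / real (N k) \<le> \<bar>a (fst z)\<bar> + C" using N1 by (simp add: divide_le_eq mult.commute)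
      then show ?thesis by (simp add: abs_divide)
    qed
    then have "(\<Sum>z\<in>{z\<in>J. pos k (fst z) + snd z < i}. \<bar>amp k (fst z) / real (N k)\<bar>) \<le> (\<Sum>z\<in>{z\<in>J. pos k (fst z) + snd z < i}. \<bar>a (fst z)\<bar> + C)"
      by (intro sum_mono) auto
    also have "\<dots> \<le> (\<Sum>z\<in>J. \<bar>a (fst z)\<bar> + C)" by (rule sum_mono2[OF finJ]) (use C0 in auto)
    finally have s1: "\<bar>\<Sum>z\<in>{z\<in>J. pos k (fst z) + snd z < i}. amp k (fst z) / real (N k)\<bar> \<le> (\<Sum>z\<in>J. \<bar>a (fst z)\<bar> + C)"
      by (rule order_trans[OF sum_abs])
    have "\<gamma> * (real i / real (N k)) \<le> \<gamma> * 1" using i Npos[of k] gamma_pos by (intro mult_left_mono) (auto simp: divide_le_eq)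
    moreover have "0 \<le> \<gamma> * (real i / real (N k))" using gamma_pos by simp
    moreover have "C / real (N k) \<le> C" using C0 N1 by (simp add: divide_le_eq mult_le_cancel_left1)
    ultimately show ?thesis using node[OF i] s1 unfolding vnode[OF i] B_def by linarith
  qed
  have vbd: "\<bar>v k t\<bar> \<le> 2 * B" if t: "t \<in> {0..1}" for k t
  proof -
    \<comment> \<open>At \<open>t = 1\<close> the floor would give a bond beyond the chain, so the
      last bond is used.\<close>
    define i where "i = (if t = 1 then N k - 1 else nat \<lfloor>real (N k) * t\<rfloor>)"
    have N1: "0 < real (N k)" using Npos by simp
    have i: "i < N k" "real i \<le> real (N k) * t" "real (N k) * t \<le> real (i + 1)"
    proof -
      have *: "i < N k \<and> real i \<le> real (N k) * t \<and> real (N k) * t \<le> real (i + 1)"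
      proof (cases "t = 1")
        case True
        then show ?thesis using Npos[of k] by (simp add: i_def of_nat_diff)
      next
        case False
        then have tl: "t < 1" using t by simp
        have fl: "real i = of_int \<lfloor>real (N k) * t\<rfloor>" using False t by (simp add: i_def)
        have "real i \<le> real (N k) * t" "real (N k) * t \<le> real (i + 1)" using fl by linarith+
        moreover have "real (N k) * t < real (N k)" using tl N1 by simp
        ultimately show ?thesis by linarith
      qed
      then show "i < N k" "real i \<le> real (N k) * t" "real (N k) * t \<le> real (i + 1)" by auto
    qed
    obtain p q where pq: "\<forall>x\<in>{real i / real (N k)..real (i+1) / real (N k)}. v k x = p * x + q"
      using vb[of k] i(1) unfolding bond_affine_def by blast
    have "t \<in> {real i / real (N k)..real (i+1) / real (N k)}"
      using i N1 by (simp add: divide_le_eq le_divide_eq mult.commute)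
    from affine_between[OF pq this, of 0] show ?thesis
      using nb[of i k] nb[of "i + 1" k] i(1) by simp
  qed
  have "(\<lambda>k. integral {0..1} (\<lambda>x. \<bar>v k x - u x\<bar>)) \<longlonglongrightarrow> 0"
    by (rule L1_limit_of_pointwise[OF u _ vbd lim S(1) ae]) (auto simp: v_def interp_continuous)
  \<comment> \<open>For the finitely many small indices any integrable function will do; the choice
    is \<open>u\<close> itself.\<close>
  define us where "us n = (if n0 \<le> n then v (n - n0) else u)" for n
  have "L1_conv us u"
    unfolding L1_conv_def
  proof (intro conjI allI u)
    show "us n absolutely_integrable_on {0..1}" for n
      using u by (auto simp: us_def v_def intro!: absolutely_integrable_continuous_real interp_continuous)
    have "(\<lambda>k. integral {0..1} (\<lambda>x. \<bar>us (k + n0) x - u x\<bar>)) \<longlonglongrightarrow> 0"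
      using \<open>(\<lambda>k. integral {0..1} (\<lambda>x. \<bar>v k x - u x\<bar>)) \<longlonglongrightarrow> 0\<close> by (simp add: us_def)
    then show "(\<lambda>n. integral {0..1} (\<lambda>x. \<bar>us n x - u x\<bar>)) \<longlonglongrightarrow> 0" by (rule LIMSEQ_offset)
  qed
  moreover have "\<forall>\<^sub>F n in sequentially. H1n J1 J2 l u0 u1 n (k1 n) (k2 n) (T n) (us n) \<le> ereal c"
    using eventually_ge_at_top[of n0]
  proof eventually_elim
    case (elim n)
    then have n: "N (n - n0) = n" by (simp add: N_def)
    have "H1n J1 J2 l u0 u1 n (k1 n) (k2 n) (T n) (us n) \<le> ereal (qc_E n (k1 n) (k2 n) (s (n - n0)))"
      using H1n_interp_le[OF good adm, of "n - n0"] elim unfolding n by (simp add: us_def v_def n)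
    also have "\<dots> \<le> ereal c" using E[of "n - n0"] unfolding n by simp
    finally show ?case .
  qed
  ultimately show ?thesis by blast
qed

lemma limsup_inequality:
  assumes u: "u absolutely_integrable_on {0..1}"
  shows "\<exists>us. L1_conv us u \<and> limsup (\<lambda>n. H1n J1 J2 l u0 u1 n (k1 n) (k2 n) (T n) (us n)) \<le> H1_lim J1 J2 \<gamma> l u0 u1 b rhat lhat u"
proof (rule Gamma_limsup_diagonal[OF u])
  fix c assume "H1_lim J1 J2 \<gamma> l u0 u1 b rhat lhat u < ereal c"
  then obtain S a where "sbvc_rep l \<gamma> S a" "AE x in lborel. x \<in> {0..1} \<longrightarrow> u x = sbvc_fun \<gamma> S a x"
    "H1_value J1 J2 \<gamma> u0 u1 b rhat lhat S < ereal c"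
    unfolding H1_lim_def Inf_less_iff by blast
  then show "\<exists>us. L1_conv us u \<and> (\<forall>\<^sub>F n in sequentially. H1n J1 J2 l u0 u1 n (k1 n) (k2 n) (T n) (us n) \<le> ereal c)"
    using recovery[OF u] by blast
qed

end

theorem theorem4p8:
  fixes J1 J2 :: "real \<Rightarrow> ereal"
    and \<alpha> J0inf \<gamma> l u0 u1 :: real
    and k1 k2 :: "nat \<Rightarrow> nat"
    and T :: "nat \<Rightarrow> nat set"
    and b :: "real \<Rightarrow> enat"
    and rhat lhat :: enat
  assumes J1_proper: "\<forall>z. J1 z \<noteq> -\<infinity>"
    and J2_proper: "\<forall>z. J2 z \<noteq> -\<infinity>"
    and LJ1: "LJ1 J1 J2"
    and LJ2: "LJ2 J1 J2"
    and LJ3: "LJ3 J1 J2 \<alpha> J0inf"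
    and LJ4: "LJ4 J1 J2 \<gamma> J0inf"
    and l_gt: "l > \<gamma>"
    and u0_pos: "u0 > 0" and u1_pos: "u1 > 0"
    and K_int: "\<forall>\<^sub>F n in sequentially. 0 < k1 n \<and> k1 n < k2 n \<and> k2 n + 2 < n"
    and K1: "filterlim k1 at_top sequentially"
    and K2: "filterlim (\<lambda>n. n - k2 n) at_top sequentially"
    and K3: "(\<lambda>n. real (k1 n) / real n) \<longlonglongrightarrow> 0"
    and K4: "(\<lambda>n. real (n - k2 n) / real n) \<longlonglongrightarrow> 0"
    and T_sub: "\<forall>n. T n \<subseteq> {0..n} \<and> 0 \<in> T n \<and> n \<in> T n"
    and T_gap: "\<exists>p :: nat \<Rightarrow> nat. ((\<lambda>n. real (p n) / real n) \<longlonglongrightarrow> 0) \<and>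
                  (\<forall>n a c. consecutive (T n) a c \<longrightarrow> c - a \<le> p n)"
    and T_atom: "\<forall>n. {0..k1 n} \<union> {k2 n..n} \<subseteq> T n"
    and b_ex: "\<forall>x\<in>{0..1}. is_b k1 k2 T x (b x)"
    and rhat_ex: "(\<lambda>n. ereal (real (r_T (T n) (k1 n) - k1 n))) \<longlonglongrightarrow> ereal_of_enat rhat"
    and lhat_ex: "(\<lambda>n. ereal (real (k2 n - l_T (T n) (k2 n)))) \<longlonglongrightarrow> ereal_of_enat lhat"
  shows "Gamma_conv_L1 (\<lambda>n u. H1n J1 J2 l u0 u1 n (k1 n) (k2 n) (T n) u)
                       (H1_lim J1 J2 \<gamma> l u0 u1 b rhat lhat)"
proof -
  let ?m = "real_of_ereal (J0 J1 J2 \<gamma>)"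
  let ?j1 = "\<lambda>z. real_of_ereal (J1 z)"
  let ?j2 = "\<lambda>z. real_of_ereal (J2 z)"
  note pot = lj_potentials_of_LJ[OF J1_proper J2_proper LJ2 LJ3 LJ4]
  interpret lj: lj_potentials J1 J2 "dom_pot J1" \<gamma> ?m ?j1 ?j2
    by (rule pot(1))
  have biconj_l: "biconj (J0 J1 J2) l = ereal ?m"
    using pot(2)[of l] l_gt lj.J0_gamma by simp
  interpret qc: qc_setting J1 J2 "dom_pot J1" \<gamma> ?m ?j1 ?j2 l u0 u1 k1 k2 T b rhat lhat
    by unfold_locales
      (fact l_gt u0_pos u1_pos K_int K1 K2 K3 K4 T_sub T_gap T_atom b_ex rhat_ex lhat_ex biconj_l)+
  show ?thesis
    unfolding Gamma_conv_L1_def using qc.liminf_inequality qc.limsup_inequality by blast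
qed

end
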